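(* Let $\mathcal{A}$ be an affine hyperplane arrangement in $\mathbb{C}^n$ of rank $l$, and let $\mathcal{U}$ be an open cover of $\mathbb{C}^n$ by small convex sets. Suppose that $L$ is a generic flat line bundle over $M(\mathcal{A})$. Then $H^*(M(\mathcal{A});L)$ vanishes except in dimension $l$, and $\dim_{\mathbb{C}} H^l(M(\mathcal{A});L)=\beta(\mathcal{A})$.
   Context: A hyperplane arrangement $\mathcal{A}$ is a finite collection of affine hyperplanes in $\mathbb{C}^n$. Its singular set $\Sigma(\mathcal{A})$ is the union of the hyperplanes in $\mathcal{A}$, and $M(\mathcal{A}):=\mathbb{C}^n-\Sigma(\mathcal{A})$. $L(\mathcal{A})$ is the poset of nonempty intersections of hyperplanes in $\mathcal{A}$, ordered by inclusion, and $\overline{L}(\mathcal{A}):=L(\mathcal{A})\cup\{\mathbb{C}^n\}$. The rank of $\mathcal{A}$ is the maximum codimension $l$ of any nonempty intersection of hyperplanes in $\mathcal{A}$. $\beta(\mathcal{A})$ is the rank of the reduced homology group $\overline{H}_{l-1}(\Sigma(\mathcal{A}))$; equivalently, the rank of $H_l(\mathbb{C}^n,\Sigma(\mathcal{A}))$. Small sets: an open convex subset $U\subset\mathbb{C}^n$ is small (with respect to $\mathcal{A}$) if (i) $\{G\in\overline{L}(\mathcal{A})\mid G\cap U\neq\emptyset\}$ has a unique minimum element, denoted $\mathrm{Min}(U)$, and (ii) a hyperplane $H\in\mathcal{A}$ has nonempty intersection with $U$ if and only if $\mathrm{Min}(U)\subset H$. Let $\mathcal{U}=\{U_i\}_{i\in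 I}$ be an open cover of $\mathbb{C}^n$ by small convex sets. For $\sigma\subset I$ write $U_\sigma=\bigcap_{i\in\sigma}U_i$. The paper asserts that the intersection of two small convex open sets is also small, hence that the same is true for any finite intersection of such sets; on this basis it uses $\mathrm{Min}(U_\sigma)$ for every simplex $\sigma$ of the nerve. The nerve $N(\mathcal{U})$ is the simplicial complex with vertex set $I$ whose simplices are the finite nonempty $\sigma\subset I$ with $U_\sigma\neq\emptyset$. Let $\mathcal{U}_{\mathrm{sing}}:=\{U\in\mathcal{U}\mid U\cap\Sigma(\mathcal{A})\neq\emptyset\}$; its nerve $N(\mathcal{U}_{\mathrm{sing}})$ is a subcomplex of $N(\mathcal{U})$. For a simplex $\sigma$ put $\mathcal{A}_\sigma:=\{H\in\mathcal{A}\mid \mathrm{Min}(U_\sigma)\subset H\}$. Generic line bundles: $H_1(M(\mathcal{A}))$ is free abelian with basis $\{\alpha_H\}_{H\in\mathcal{A}}$, where $\alpha_H$ is the class of a loop going once around $H$ in the positive direction. A flat line bundle $L$ over $M(\mathcal{A})$, i.e. a $1$-dimensional complex local coefficient system, is determined by a tuple $\Lambda=(\lambda_H)_{H\in\mathcal{A}}\in(\mathbb{C}^* )^{\mathcal{A}}$, where $\pi_1(M(\mathcal{A}))$ acts through the composition of the abelianization map $\pi_1(M(\mathcal{A}))\to H_1(M(\mathcal{A}))$ with the homomorphism $H_1(M(\mathcal{A}))\to\mathbb{C}^*$ sending $\alpha_H$ to $\lambda_H$. For a simplex $\sigma$ put $\lambda_\sigma:=\prod_{H\in\mathcal{A}_\sigma}\lambda_H$.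 The tuple $\Lambda$, and the bundle $L$, is generic if $\lambda_\sigma\neq1$ for all $\sigma\in N(\mathcal{U}_{\mathrm{sing}})$. $H^*(M(\mathcal{A});L)$ is cohomology with local coefficients in $L$.
   Formalization: Genericity here also requires U_σ to be small, i.e. Min(U_σ) to exist, for each σ in N(U_sing); intersections of small convex sets need not be small (e.g. in C^3 with x=0, y=0), so λ_σ may otherwise be undefined. Also n ≥ 1. *)

theory Defs
  imports
    "HOL-Analysis.Analysis"
    "HOL-Homology.Homology"
    "HOL-Library.Extended_Nat"
    "Jordan_Normal_Form.Missing_VectorSpace"
begin

text \<open>The library's inner product on \<^typ>\<open>complex ^ 'n\<close> is the real one, so complex
  hyperplanes are written out as solution sets of one complex affine equation.\<close>

definition complex_hyperplane :: "(complex ^ 'n) set \<Rightarrow> bool" where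
  "complex_hyperplane H \<longleftrightarrow> (\<exists>a b. a \<noteq> 0 \<and> H = {x. (\<Sum>i\<in>UNIV. a $ i * x $ i) = b})"

definition hyperplane_arrangement :: "(complex ^ 'n) set set \<Rightarrow> bool" where
  "hyperplane_arrangement A \<longleftrightarrow> finite A \<and> (\<forall>H\<in>A. complex_hyperplane H)"

definition singular_set :: "(complex ^ 'n) set set \<Rightarrow> (complex ^ 'n) set" where
  "singular_set A = \<Union>A"

definition arr_complement :: "(complex ^ 'n) set set \<Rightarrow> (complex ^ 'n) set" where
  "arr_complement A = UNIV - singular_set A"

definition flats :: "(complex ^ 'n) set set \<Rightarrow> (complex ^ 'n) set set" where
  "flats A = {\<Inter>B | B. B \<subseteq> A \<and> B \<noteq> {} \<and> \<Inter>B \<noteq> {}}"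

definition flats_bar :: "(complex ^ 'n) set set \<Rightarrow> (complex ^ 'n) set set" where
  "flats_bar A = insert UNIV (flats A)"

text \<open>For a nonempty affine subspace \<open>G\<close>, the differences of points of \<open>G\<close> form its direction
  space; \<^const>\<open>vec.dim\<close> is the dimension over the field of entries, here \<open>\<complex>\<close>
  (whereas \<^const>\<open>aff_dim\<close> would be the real dimension).\<close>

definition complex_codim :: "(complex ^ 'n) set \<Rightarrow> nat" where
  "complex_codim G = CARD('n) - vec.dim {x - y | x y. x \<in> G \<and> y \<in> G}"

text \<open>Including the whole space, of codimension 0, only matters for the empty arrangement,
  which thereby has rank 0.\<close>

definition arr_rank :: "(complex ^ 'n) set set \<Rightarrow> nat" where
  "arr_rank A = Max (complex_codim ` flats_bar A)"

text \<open>The groups are written multiplicatively, as in the library.\<close>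

definition Z_independent :: "('g, 'm) monoid_scheme \<Rightarrow> 'g set \<Rightarrow> bool" where
  "Z_independent G S \<longleftrightarrow>
     (\<forall>k :: 'g \<Rightarrow> int. finprod G (\<lambda>s. s [^]\<^bsub>G\<^esub> k s) S = \<one>\<^bsub>G\<^esub> \<longrightarrow> (\<forall>s\<in>S. k s = 0))"

definition abelian_rank :: "('g, 'm) monoid_scheme \<Rightarrow> enat" where
  "abelian_rank G =
     (SUP S \<in> {S. finite S \<and> S \<subseteq> carrier G \<and> Z_independent G S}. enat (card S))"

text \<open>The relative group is used rather than the reduced homology of the singular set in degree
  \<open>l - 1\<close>: the two agree, except that the library's reduced homology of the empty space vanishes
  in degree \<open>-1\<close>, where the usual convention makes it infinite cyclic (empty arrangement).\<close>

definition beta :: "(complex ^ 'n) set set \<Rightarrow> enat" where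
  "beta A =
     abelian_rank (relative_homology_group (int (arr_rank A)) euclidean (singular_set A))"

definition is_Min :: "(complex ^ 'n) set set \<Rightarrow> (complex ^ 'n) set \<Rightarrow> (complex ^ 'n) set \<Rightarrow> bool" where
  "is_Min A U G \<longleftrightarrow>
     G \<in> flats_bar A \<and> G \<inter> U \<noteq> {} \<and> (\<forall>G'\<in>flats_bar A. G' \<inter> U \<noteq> {} \<longrightarrow> G \<subseteq> G')"

definition Min_flat :: "(complex ^ 'n) set set \<Rightarrow> (complex ^ 'n) set \<Rightarrow> (complex ^ 'n) set" where
  "Min_flat A U = (THE G. is_Min A U G)"

definition small :: "(complex ^ 'n) set set \<Rightarrow> (complex ^ 'n) set \<Rightarrow> bool" where
  "small A U \<longleftrightarrow> open U \<and> convex U \<and> (\<exists>!G. is_Min A U G) \<and>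
     (\<forall>H\<in>A. H \<inter> U \<noteq> {} \<longleftrightarrow> Min_flat A U \<subseteq> H)"

definition nerve :: "'i set \<Rightarrow> ('i \<Rightarrow> 'a set) \<Rightarrow> 'i set set" where
  "nerve I U = {s. finite s \<and> s \<noteq> {} \<and> s \<subseteq> I \<and> (\<Inter>i\<in>s. U i) \<noteq> {}}"

definition sing_index :: "(complex ^ 'n) set set \<Rightarrow> 'i set \<Rightarrow> ('i \<Rightarrow> (complex ^ 'n) set) \<Rightarrow> 'i set" where
  "sing_index A I U = {i \<in> I. U i \<inter> singular_set A \<noteq> {}}"

definition arr_at :: "(complex ^ 'n) set set \<Rightarrow> (complex ^ 'n) set \<Rightarrow> (complex ^ 'n) set set" where
  "arr_at A V = {H \<in> A. Min_flat A V \<subseteq> H}"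

text \<open>The product \<open>\<Prod>H\<in>arr_at A V. \<Lambda> H\<close> refers to the minimum flat of \<open>V = U\<^sub>\<sigma>\<close>, which is a finite
  intersection of small sets.  Such an intersection need not be small: in \<open>\<complex>\<^sup>3\<close> with the arrangement
  \<open>x = 0\<close>, \<open>y = 0\<close>, thin convex neighbourhoods of the triangles with vertices
  \<open>(0,0,1), (1,0,0), (0,1,0)\<close> and \<open>(0,0,-1), (1,0,0), (0,1,0)\<close> are small, but their intersection
  meets both hyperplanes and misses the line where they meet.  For such a simplex
  \<open>\<lambda>\<^sub>\<sigma>\<close> is undefined, so asserting \<open>\<lambda>\<^sub>\<sigma> \<noteq> 1\<close> includes asserting that \<open>U\<^sub>\<sigma>\<close> is small.\<close>

definition generic ::
  "(complex ^ 'n) set set \<Rightarrow> 'i set \<Rightarrow> ('i \<Rightarrow> (complex ^ 'n) set) \<Rightarrow> ((complex ^ 'n) set \<Rightarrow> complex) \<Rightarrow> bool" where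
  "generic A I U \<Lambda> \<longleftrightarrow>
     (\<forall>s\<in>nerve (sing_index A I U) U.
        small A (\<Inter>i\<in>s. U i) \<and> (\<Prod>H\<in>arr_at A (\<Inter>i\<in>s. U i). \<Lambda> H) \<noteq> 1)"

text \<open>A local coefficient system is a functor from the fundamental groupoid to complex vector
  spaces.  The fibres are subspaces of one ambient complex vector space, with scalar multiplication
  \<open>cscale\<close>.  Only paths with image in \<open>X\<close>, and vectors in the fibre over their starting point, matter
  for \<open>transport\<close>.\<close>

record ('a, 'v) local_system =
  fibre :: "'a \<Rightarrow> 'v set"
  transport :: "(real \<Rightarrow> 'a) \<Rightarrow> 'v \<Rightarrow> 'v"

locale flat_line_bundle = vector_space cscale
  for cscale :: "complex \<Rightarrow> 'v::ab_group_add \<Rightarrow> 'v" +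
  fixes X :: "'a::topological_space set"
    and L :: "('a, 'v) local_system"
  assumes fibre_subspace: "x \<in> X \<Longrightarrow> module.subspace cscale (fibre L x)"
    and fibre_dim: "x \<in> X \<Longrightarrow> vector_space.dim cscale (fibre L x) = 1"
    and transport_bij:
      "\<lbrakk>path g; path_image g \<subseteq> X\<rbrakk> \<Longrightarrow>
        bij_betw (transport L g) (fibre L (pathstart g)) (fibre L (pathfinish g))"
    and transport_add:
      "\<lbrakk>path g; path_image g \<subseteq> X; u \<in> fibre L (pathstart g); v \<in> fibre L (pathstart g)\<rbrakk> \<Longrightarrow>
        transport L g (u + v) = transport L g u + transport L g v"
    and transport_scale:
      "\<lbrakk>path g; path_image g \<subseteq> X; v \<in> fibre L (pathstart g)\<rbrakk> \<Longrightarrow>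
        transport L g (cscale a v) = cscale a (transport L g v)"
    and transport_homotopic:
      "\<lbrakk>homotopic_paths X g h; v \<in> fibre L (pathstart g)\<rbrakk> \<Longrightarrow>
        transport L g v = transport L h v"
    and transport_join:
      "\<lbrakk>path g; path_image g \<subseteq> X; path h; path_image h \<subseteq> X; pathfinish g = pathstart h;
        v \<in> fibre L (pathstart g)\<rbrakk> \<Longrightarrow>
        transport L (g +++ h) v = transport L h (transport L g v)"

text \<open>A loop going once around \<open>H\<close> in the positive direction: the boundary circle, with its complex
  orientation, of a disc in a complex line which meets the singular set only in the centre,
  the centre lying on \<open>H\<close> and on no other hyperplane.  Taking \<open>z = 1\<close> shows \<open>v\<close> is not
  parallel to \<open>H\<close>.\<close>

definition positive_meridian ::
  "(complex ^ 'n) set set \<Rightarrow> (complex ^ 'n) set \<Rightarrow> (real \<Rightarrow> complex ^ 'n) \<Rightarrow> bool" where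
  "positive_meridian A H g \<longleftrightarrow>
     (\<exists>p v. p \<in> H \<and> (\<forall>H'\<in>A - {H}. p \<notin> H') \<and>
        (\<forall>z. 0 < cmod z \<and> cmod z \<le> 1 \<longrightarrow> p + z *s v \<notin> singular_set A) \<and>
        g = (\<lambda>t. p + cis (2 * pi * t) *s v))"

text \<open>Since a one-dimensional representation of the fundamental group factors through the first
  homology group, the bundle is determined by these scalars up to isomorphism.\<close>

definition has_monodromy ::
  "(complex \<Rightarrow> 'v \<Rightarrow> 'v) \<Rightarrow> (complex ^ 'n) set set \<Rightarrow> (complex ^ 'n, 'v) local_system \<Rightarrow>
     ((complex ^ 'n) set \<Rightarrow> complex) \<Rightarrow> bool" where
  "has_monodromy cscale A L \<Lambda> \<longleftrightarrow>
     (\<forall>H\<in>A. \<forall>g. positive_meridian A H g \<longrightarrow>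
        (\<forall>w\<in>fibre L (pathstart g). transport L g w = cscale (\<Lambda> H) w))"

definition complex_ring :: "complex ring" where
  "complex_ring = \<lparr>carrier = UNIV, mult = (*), one = 1, zero = 0, add = (+)\<rparr>"

definition initial_vertex :: "nat \<Rightarrow> real" where
  "initial_vertex = (\<lambda>j. if j = 0 then 1 else 0)"

text \<open>The path in the standard simplex from vertex 1 to vertex 0.\<close>

definition first_edge :: "real \<Rightarrow> nat \<Rightarrow> real" where
  "first_edge t = (\<lambda>j. if j = 0 then t else if j = 1 then 1 - t else 0)"

text \<open>A cochain assigns to each singular simplex an element of the fibre over the image of the
  initial vertex; the value 0 on all other functions makes equality of cochains extensional.
  The ring multiplication of the underlying record is not used.\<close>

definition cochain_space ::
  "(complex \<Rightarrow> 'v \<Rightarrow> 'v) \<Rightarrow> 'a::topological_space set \<Rightarrow> ('a, 'v::ab_group_add) local_system \<Rightarrow> nat \<Rightarrow>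
     (complex, ((nat \<Rightarrow> real) \<Rightarrow> 'a) \<Rightarrow> 'v) module" where
  "cochain_space cscale X L p =
     \<lparr>carrier = {c. \<forall>f. if singular_simplex p (top_of_set X) f
                         then c f \<in> fibre L (f initial_vertex) else c f = 0},
      mult = undefined, one = undefined,
      zero = (\<lambda>f. 0), add = (\<lambda>c d f. c f + d f), smult = (\<lambda>a c f. cscale a (c f))\<rparr>"

text \<open>Every face but the 0-th has the same initial vertex as the simplex; the value on the 0-th face
  has to be transported along the edge.\<close>

definition coboundary ::
  "(complex \<Rightarrow> 'v \<Rightarrow> 'v) \<Rightarrow> 'a::topological_space set \<Rightarrow> ('a, 'v::ab_group_add) local_system \<Rightarrow> nat \<Rightarrow>
     (((nat \<Rightarrow> real) \<Rightarrow> 'a) \<Rightarrow> 'v) \<Rightarrow> ((nat \<Rightarrow> real) \<Rightarrow> 'a) \<Rightarrow> 'v" where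
  "coboundary cscale X L p c = (\<lambda>f.
     if singular_simplex (Suc p) (top_of_set X) f
     then transport L (f \<circ> first_edge) (c (singular_face (Suc p) 0 f)) +
          (\<Sum>k = 1..Suc p. cscale ((-1) ^ k) (c (singular_face (Suc p) k f)))
     else 0)"

definition cocycles ::
  "(complex \<Rightarrow> 'v \<Rightarrow> 'v) \<Rightarrow> 'a::topological_space set \<Rightarrow> ('a, 'v::ab_group_add) local_system \<Rightarrow> nat \<Rightarrow>
     (((nat \<Rightarrow> real) \<Rightarrow> 'a) \<Rightarrow> 'v) set" where
  "cocycles cscale X L p =
     {c \<in> carrier (cochain_space cscale X L p). coboundary cscale X L p c = (\<lambda>f. 0)}"

definition coboundaries ::
  "(complex \<Rightarrow> 'v \<Rightarrow> 'v) \<Rightarrow> 'a::topological_space set \<Rightarrow> ('a, 'v::ab_group_add) local_system \<Rightarrow> nat \<Rightarrow>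
     (((nat \<Rightarrow> real) \<Rightarrow> 'a) \<Rightarrow> 'v) set" where
  "coboundaries cscale X L p =
     (case p of 0 \<Rightarrow> {\<lambda>f. 0}
      | Suc q \<Rightarrow> coboundary cscale X L q ` carrier (cochain_space cscale X L q))"

definition quotient_module :: "('r, 'm, 'z) module_scheme \<Rightarrow> 'm set \<Rightarrow> ('r, 'm set) module" where
  "quotient_module M N =
     \<lparr>carrier = a_rcosets\<^bsub>M\<^esub> N, mult = undefined, one = undefined,
      zero = N, add = set_add M,
      smult = (\<lambda>a S. \<Union>s\<in>S. N +>\<^bsub>M\<^esub> (a \<odot>\<^bsub>M\<^esub> s))\<rparr>"

definition local_cohomology ::
  "(complex \<Rightarrow> 'v \<Rightarrow> 'v) \<Rightarrow> 'a::topological_space set \<Rightarrow> ('a, 'v::ab_group_add) local_system \<Rightarrow> nat \<Rightarrow>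
     (complex, (((nat \<Rightarrow> real) \<Rightarrow> 'a) \<Rightarrow> 'v) set) module" where
  "local_cohomology cscale X L p =
     quotient_module ((cochain_space cscale X L p)\<lparr>carrier := cocycles cscale X L p\<rparr>)
       (coboundaries cscale X L p)"

end

theory Submission
  imports Defs "HOL-Complex_Analysis.Complex_Analysis"
begin

text \<open>Write \<open>M\<close> for the complement, \<open>T\<close> for the union of the open \<open>\<epsilon>\<close>-tubes around the hyperplanes and
  consider homology with coefficients in an arbitrary rank one local system on \<open>M\<close>. For small \<open>\<epsilon>\<close> the pair
  \<open>(M, M \<inter> T)\<close> has homology only in degree \<open>l\<close>, and its dimension \<open>b\<close> there is the same for all local
  systems. This is a Morse argument: one sweeps through the real part of a generic multiple of one of the
  functionals, away from its finitely many critical values the pair is carried along by the flow of a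
  vector field tangent to the hyperplanes, and a critical value contributes the pair of a smaller box
  around it, in which the arrangement has one functional less to be swept or is central; a central
  arrangement is reduced to a slice, an arrangement of smaller rank.

  For the trivial local system \<open>M \<inter> T\<close> may be replaced by \<open>T\<close> and \<open>M\<close> by the whole space (excision), and \<open>T\<close>
  retracts to \<open>\<Sigma>\<close>; hence \<open>b = \<beta>\<close>. For a generic one \<open>M \<inter> T\<close> is acyclic: it is covered by
  intersections of the small sets with \<open>M \<inter> T\<close>, each of which contracts to a neighbourhood of a point
  of \<open>Min(U_\<sigma>)\<close>, where the circle action \<open>p + e^(i t) (x - p)\<close> is a homotopy from the identity to itself
  which acts on chains by \<open>\<lambda>_\<sigma> \<noteq> 1\<close>. So \<open>H(M) = H(M, M \<inter> T)\<close>, and cohomology is dual to homology.\<close>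

text \<open>A non-zero vector chosen in each fibre turns parallel transport into a number
  \<open>hol g\<close> for every path. Chains are then finitely supported complex functions on
  singular simplices, the same for all local systems; only the boundary operator is twisted. So
  \<open>LL\<close> can fix the dimension before it quantifies over the holonomy, and one integer
  serves both the constant system, which computes \<open>beta\<close>, and the given one. Flows
  appear without integral curves: a straight step \<open>x + t V(x)\<close> is iterated. Chains have
  compact carriers, so finitely many steps suffice, and a short step only has to respect finitely
  many thresholds. The field exists at \<open>x\<close> when the swept functional is linearly
  independent of those that must stand still there; this can fail only near finitely many values,
  the critical ones. The obstacle is that the sides of the boxes around critical points interfere
  with each other. It is met by widely separated scales \<open>e 0\<close>, \<open>e 1\<close>, ...,
  \<open>1\<close>: whatever depends on functionals that are small at one scale is negligible at the
  next. Concentration in a single degree makes the connecting maps vanish, so dimensions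
  add.\<close>

abbreviation "iv == initial_vertex"
abbreviation "spx p == top_of_set (standard_simplex p)"
abbreviation "supp == Poly_Mapping.keys"
abbreviation "coe == Poly_Mapping.lookup"

section \<open>Twisted singular chains\<close>

definition sc :: "complex => ('s \<Rightarrow>\<^sub>0 complex) => ('s \<Rightarrow>\<^sub>0 complex)" where
 "sc a c = Poly_Mapping.map ((*) a) c"

abbreviation gen :: "'s => ('s \<Rightarrow>\<^sub>0 complex)" where "gen s == Poly_Mapping.single s 1"

definition lext :: "('s => ('t \<Rightarrow>\<^sub>0 complex)) => ('s \<Rightarrow>\<^sub>0 complex) => ('t \<Rightarrow>\<^sub>0 complex)" where
 "lext g c = (SUM s:supp c. sc (coe c s) (g s))"

definition cx :: "('s \<Rightarrow>\<^sub>0 int) => ('s \<Rightarrow>\<^sub>0 complex)" where "cx c = Poly_Mapping.map of_int c"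

lemma lookup_sc [simp]: "coe (sc a c) s = a * coe c s"
 by (simp add: sc_def Poly_Mapping.map.rep_eq when_def)

lemma lookup_cx [simp]: "coe (cx c) s = of_int (coe c s)"
 by (simp add: cx_def Poly_Mapping.map.rep_eq when_def)

interpretation tc: vector_space sc
 by unfold_locales (auto intro!: poly_mapping_eqI simp: lookup_add algebra_simps)

lemma keys_sc: "supp (sc a c) <= supp c" by (auto simp: in_keys_iff)

lemma keys_cx: "supp (cx c) = supp c" by (auto simp: in_keys_iff)

lemma cx_add: "cx (a + b) = cx a + cx b" by (auto intro!: poly_mapping_eqI simp: lookup_add)

lemma cx_diff: "cx (a - b) = cx a - cx b" by (auto intro!: poly_mapping_eqI simp: lookup_minus)

lemma cx_0 [simp]: "cx 0 = 0" by (auto intro!: poly_mapping_eqI)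

lemma cx_gen [simp]: "cx (frag_of s) = gen s"
 by (auto intro!: poly_mapping_eqI simp: lookup_single when_def)

lemma lext_superset:
 assumes "finite S" "supp c <= S"
 shows "lext g c = (SUM s:S. sc (coe c s) (g s))" unfolding lext_def using assms
 by (intro sum.mono_neutral_left) (auto simp: in_keys_iff)

lemma lext_add: "lext g (a + b) = lext g a + lext g b"
proof -
 let ?S = "supp a Un supp b"
 have "supp (a + b) <= ?S" by (rule keys_add)
 thus ?thesis by (simp add: lext_superset[of ?S] lookup_add tc.scale_left_distrib sum.distrib)
qed

lemma lext_sc: "lext g (sc k a) = sc k (lext g a)" using keys_sc[of k a]
 by (simp add: lext_superset[of "supp a"] tc.scale_sum_right)

lemma lext_0 [simp]: "lext g 0 = 0" by (simp add: lext_def)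

lemma lext_gen [simp]: "lext g (gen s) = g s" by (simp add: lext_def)

lemma lext_minus: "lext g (- a) = - lext g a" using lext_sc[of g "-1" a] by simp

lemma lext_diff: "lext g (a - b) = lext g a - lext g b"
 using lext_add[of g a "-b"] by (simp add: lext_minus)

lemma lext_sum: "lext g (SUM i:I. f i) = (SUM i:I. lext g (f i))"
 by (induction I rule: infinite_finite_induct) (auto simp: lext_add)

lemma lext_cong: "(!!s. s : supp c ==> g s = h s) ==> lext g c = lext h c" by (simp add: lext_def)

lemma lext_id: "lext gen c = c"
proof (rule poly_mapping_eqI)
 fix s
 show "coe (lext gen c) s = coe c s"
  by (simp add: lext_def lookup_sum lookup_single when_def if_distrib[of "%x. _ * x"]
    sum.delta in_keys_iff cong: if_cong)
qed

lemma chain_induct [consumes 1, case_names zero gen add scale]: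
 assumes supp: "supp c <= S" and "P 0" "!!x. x : S ==> P (gen x)" "!!a b. P a ==> P b ==> P (a + b)"
  "!!k a. P a ==> P (sc k a)"
 shows "P c"
proof -
 have "P (SUM s:F. sc (coe c s) (gen s))" if "finite F" "F <= S" for F
  using that by (induction F rule: finite_induct) (auto intro: assms)
 from this[of "supp c"] supp have "P (lext gen c)" by (simp add: lext_def)
 thus ?thesis by (simp add: lext_id)
qed

subsection \<open>Paths in convex sets of barycentric coordinates\<close>

definition seg :: "(nat => real) => (nat => real) => real => nat => real" where
 "seg a b = (%t i. (1 - t) * a i + t * b i)"

definition fconvex :: "(nat => real) set => bool" where
 "fconvex K \<longleftrightarrow> (ALL a:K. ALL b:K. ALL t:{0..1}. seg a b t : K)"

lemma seg_simps [simp]: "seg a b 0 = a" "seg a b 1 = b" by (auto simp: seg_def)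

lemma path_seg: "path (seg a b)" unfolding path_def seg_def
 by (intro continuous_on_coordinatewise_then_product continuous_intros)

lemma fconvex_simplex: "fconvex (standard_simplex p)" unfolding fconvex_def seg_def
 by (metis (full_types) add_0 atLeastAtMost_iff convex_standard_simplex)

lemma homotopic_paths_fconvex:
 assumes K: "fconvex K" and P: "path P" "path_image P <= K" and Q: "path Q" "path_image Q <= K"
  and "pathstart P = pathstart Q" "pathfinish P = pathfinish Q"
 shows "homotopic_paths K P Q"
proof -
 define h where "h = (%z::real \<times> real. seg (P (snd z)) (Q (snd z)) (fst z))"
 have cP: "continuous_on ({0..1} \<times> {0..1}) (%z::real\<times>real. R (snd z) i)"
  if "path R" for R :: "real => nat => real" and i
 proof -
  have "continuous_on {0..1} (%t. R t i)"
   using that unfolding path_def by (rule continuous_on_product_then_coordinatewise)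
  thus ?thesis by (rule continuous_on_compose2) (auto intro: continuous_intros)
 qed
 have "continuous_on ({0..1} \<times> {0..1}) h" unfolding h_def seg_def
  by (intro continuous_on_coordinatewise_then_product continuous_intros cP P Q)
 moreover have "h : ({0..1} \<times> {0..1}) \<rightarrow> K"
  using K P Q unfolding h_def fconvex_def path_image_def by (auto simp: image_subset_iff)
 ultimately show ?thesis unfolding homotopic_paths by (intro exI[of _ h])
   (use assms in \<open>auto simp: h_def seg_def pathstart_def pathfinish_def fun_eq_iff algebra_simps\<close>)
qed

text \<open>Parallel transport of a rank one local system, relative to a non-zero vector chosen in
  each fibre. It is recorded on all paths rather than on loops, so that neither a base point nor
  connectedness of \<open>X\<close> enters.\<close>

locale holonomy =
 fixes X :: "'a::real_normed_vector set" and hol :: "(real => 'a) => complex"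
 assumes hol_nz: "[|path g; path_image g <= X|] ==> hol g ~= 0"
  and hol_join: "[|path g; path_image g <= X; path h; path_image h <= X; pathfinish g = pathstart h|]
   ==> hol (g +++ h) = hol g * hol h" and hol_homotopic: "homotopic_paths X g h ==> hol g = hol h"
begin

lemma hol_const: "x : X ==> hol (%t. x) = 1"
proof -
 assume x: "x : X"
 \<comment> \<open>The constant path is its own join, so its holonomy equals its own square and is
   not 0.\<close>
 show ?thesis using x using hol_join[of "%t. x" "%t. x"] hol_nz[of "%t. x"]
  by (simp add: joinpaths_def path_def path_image_def pathstart_def pathfinish_def)
qed

lemma hol_reverse:
 assumes "path g" "path_image g <= X"
 shows "hol (reversepath g) = inverse (hol g)"
proof -
 have "homotopic_paths X (g +++ reversepath g) (linepath (pathstart g) (pathstart g))"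
  by (rule homotopic_paths_rinv) (use assms in auto)
 hence "hol (g +++ reversepath g) = hol (linepath (pathstart g) (pathstart g))"
  by (rule hol_homotopic)
 also have "... = 1" using hol_const[of "pathstart g"] assms pathstart_in_path_image[of g]
  by (auto simp: linepath_refl)
 finally show ?thesis
  using assms hol_nz[OF assms] hol_join[of g "reversepath g"] by (auto simp: field_simps)
qed

definition wt :: "((nat => real) => 'a) => (nat => real) => (nat => real) => complex" where
 "wt F a b = hol (F o seg a b)"

lemma path_seg_in: "fconvex K ==> a : K ==> b : K ==> path_image (seg a b) <= K"
 by (auto simp: path_image_def fconvex_def)

text \<open>Paths in the convex set \<open>K\<close> with the same ends are homotopic: over a convex
  parameter set \<open>wt\<close> trivialises the system.\<close>

lemma wt_path:
 assumes K: "fconvex K" and F: "continuous_on K F" "F ` K <= X" and P: "path P" "path_image P <= K"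
 shows "hol (F o P) = wt F (P 0) (P 1)"
proof -
 have "homotopic_paths K P (seg (P 0) (P 1))" using P by (intro homotopic_paths_fconvex K P path_seg path_seg_in) (auto simp: pathstart_def pathfinish_def)
 hence "homotopic_paths X (F o P) (F o seg (P 0) (P 1))"
  by (rule homotopic_paths_continuous_image) (use F in auto)
 thus ?thesis unfolding wt_def by (rule hol_homotopic)
qed

lemma
 assumes K: "fconvex K" and F: "continuous_on K F" "F ` K <= X" and abc: "a : K" "b : K" "c : K"
 shows wt_trans: "wt F a b * wt F b c = wt F a c"
  and wt_nz: "wt F a b ~= 0" and wt_refl: "wt F a a = 1"
proof -
 have p: "path (F o seg u v)" "path_image (F o seg u v) <= X" if "u : K" "v : K" for u v
  using that F path_seg_in[OF K that] path_seg
  by (auto intro!: path_continuous_image continuous_on_subset[OF F(1)] simp: path_image_compose)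
 have "wt F a b * wt F b c = hol ((F o seg a b) +++ (F o seg b c))" unfolding wt_def using abc
  by (subst hol_join) (auto simp: p[unfolded o_def] p pathstart_def pathfinish_def)
 also have "(F o seg a b) +++ (F o seg b c) = F o (seg a b +++ seg b c)"
  by (auto simp: joinpaths_def)
 also have "hol ... = wt F a c"
 proof (subst wt_path[OF K F])
  show "path (seg a b +++ seg b c)"
   by (intro path_join_imp path_seg) (auto simp: pathstart_def pathfinish_def)
  show "path_image (seg a b +++ seg b c) <= K" by (intro subset_path_image_join path_seg_in K abc)
 qed (auto simp: joinpaths_def)
 finally show "wt F a b * wt F b c = wt F a c" .
 show "wt F a b ~= 0" unfolding wt_def using p abc by (intro hol_nz)
 show "wt F a a = 1" unfolding wt_def using hol_const abc F by (auto simp: seg_def fun_eq_iff algebra_simps)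
qed

end

section \<open>Singular simplices and the twisted boundary operator\<close>

abbreviation idp :: "nat => (nat => real) => nat => real" where
 "idp p == restrict id (standard_simplex p)"

abbreviation "bdi p == chain_boundary p (frag_of (idp p))"

lemma powertop_euclidean: "powertop_real (UNIV::nat set) = euclidean"
 by (rule euclidean_product_topology)

lemma simplex_iff: "singular_simplex p (top_of_set S) f \<longleftrightarrow>
   continuous_on (standard_simplex p) f & f ` standard_simplex p <= S & f : extensional (standard_simplex p)"
 by (auto simp: singular_simplex_def powertop_euclidean)

lemma initial_vertex_simplex [simp]: "iv : standard_simplex p" unfolding initial_vertex_def by simp

definition tchain :: "nat => 'a::topological_space set => (((nat => real) => 'a) \<Rightarrow>\<^sub>0 complex) set" where
 "tchain p S = {c. supp c <= {f. singular_simplex p (top_of_set S) f}}"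

abbreviation tch :: "'a::topological_space set => nat => (((nat => real) => 'a) \<Rightarrow>\<^sub>0 complex) set" where
 "tch A == %p. tchain p A"

lemma tchain_subspace: "tc.subspace (tchain p S)" unfolding tc.subspace_def tchain_def
 using keys_add keys_sc by (fastforce simp: subset_iff)

lemmas tchain_0 = tc.subspace_0[OF tchain_subspace]
 and tchain_add = tc.subspace_add[OF tchain_subspace]
 and tchain_diff = tc.subspace_diff[OF tchain_subspace]
 and tchain_sc = tc.subspace_scale[OF tchain_subspace]
 and tchain_sum = tc.subspace_sum[OF tchain_subspace]

lemma tchain_gen: "gen f : tchain p S \<longleftrightarrow> singular_simplex p (top_of_set S) f"
 by (simp add: tchain_def)

lemma tchain_mono: "S <= T ==> tchain p S <= tchain p T"
 unfolding tchain_def by (auto simp: simplex_iff subset_iff)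

lemma tchain_lext: "(!!f. f : supp c ==> g f : tchain q T) ==> lext g c : tchain q T"
 unfolding lext_def by (intro tchain_sum tchain_sc)

lemma tchain_Int: "tchain p S Int tchain p T = tchain p (S Int T)"
 unfolding tchain_def by (fastforce simp: simplex_iff subset_iff)

lemma tchain_carrier_compact:
 assumes "c : tchain p (S::'a::t2_space set)" obtains K where "compact K" "K <= S" "c : tchain p K"
proof
 let ?K = "UN f:supp c. f ` standard_simplex p"
 have comp: "compact (standard_simplex p)"
  using compactin_standard_simplex[of p] by (simp add: powertop_euclidean)
 show "compact ?K" using assms unfolding tchain_def
  by (intro compact_UN) (auto simp: simplex_iff intro!: compact_continuous_image comp)
 show "?K <= S" "c : tchain p ?K"
  using assms unfolding tchain_def by (fastforce simp: simplex_iff subset_iff)+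
qed

lemma simplex_map_top:
 assumes "singular_simplex q (top_of_set K) ka" "continuous_on K F" "F ` K <= S"
 shows "singular_simplex q (top_of_set S) (simplex_map q F ka)" using assms
 by (intro singular_simplex_simplex_map[of q "top_of_set K"]) auto

context holonomy
begin

text \<open>Pushes an integral chain of the parameter set to a twisted chain. Coefficients sit over
  initial vertices; the weight compares the fibre over the initial vertex of each simplex with the
  fibre over \<open>F b\<close>.\<close>

definition Tw where "Tw q F b s = lext (%ka. sc (wt F (ka iv) b) (gen (simplex_map q F ka))) (cx s)"

text \<open>A face is weighted by the transport from its own initial vertex to that of the simplex.
  With this direction the dual complex is the cochain complex of the line bundle, where the value on
  the 0-th face is transported along \<open>first_edge\<close>.\<close>

definition bd where "bd p c = lext (%f. Tw (p - 1) f iv (bdi p)) c"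

lemma Tw_of: "Tw q F b (frag_of ka) = sc (wt F (ka iv) b) (gen (simplex_map q F ka))"
 by (simp add: Tw_def)

lemma Tw_0 [simp]: "Tw q F b 0 = 0" by (simp add: Tw_def)

lemma Tw_diff: "Tw q F b (s - t) = Tw q F b s - Tw q F b t" by (simp add: Tw_def cx_diff lext_diff)

lemma Tw_in:
 assumes "singular_chain q (top_of_set K) s" "continuous_on K F"
  "!!ka. ka : supp s ==> F ` ka ` standard_simplex q <= S"
 shows "Tw q F b s : tchain q S" unfolding Tw_def
proof (intro tchain_lext tchain_sc)
 fix ka assume "ka : supp (cx s)"
 hence k: "ka : supp s" by (simp add: keys_cx)
 with assms have "singular_simplex q (top_of_set K) ka" by (auto simp: singular_chain_def)
 hence "singular_simplex q (top_of_set (F ` K)) (simplex_map q F ka)"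
  by (rule simplex_map_top) (use assms in auto)
 thus "gen (simplex_map q F ka) : tchain q S" using assms(3)[OF k] unfolding tchain_gen simplex_iff
  by (auto simp: simplex_map_def)
qed

lemma Tw_in':
 assumes "singular_chain q (top_of_set K) s" "continuous_on K F" "F ` K <= S"
 shows "Tw q F b s : tchain q S"
proof (rule Tw_in[OF assms(1,2)])
 show "F ` ka ` standard_simplex q <= S" if "ka : supp s" for ka
  using that assms by (fastforce simp: singular_chain_def simplex_iff)
qed

lemma wt_cong_path:
 assumes "fconvex K" "continuous_on K F" "F ` K <= X" "!!x. x : K ==> F x = G x" "a : K" "b : K"
 shows "wt F a b = wt G a b"
proof -
 have "homotopic_paths X (F o seg a b) (G o seg a b)"
 proof (rule homotopic_paths_eq)
  show "path (F o seg a b)" "path_image (F o seg a b) <= X"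
   using assms path_seg_in[of K a b] path_seg
   by (auto intro!: path_continuous_image continuous_on_subset[OF assms(2)] simp: path_image_compose)
  show "!!t. t : {0..1} ==> (F o seg a b) t = (G o seg a b) t"
   using assms by (auto simp: fconvex_def)
 qed
 thus ?thesis unfolding wt_def by (rule hol_homotopic)
qed

lemma Tw_cong:
 assumes "singular_chain q (top_of_set K) s" "fconvex K" "continuous_on K F" "F ` K <= X" "b : K"
  "!!x. x : K ==> F x = G x"
 shows "Tw q F b s = Tw q G b s" unfolding Tw_def
proof (rule lext_cong)
 fix ka assume "ka : supp (cx s)"
 hence k: "singular_simplex q (top_of_set K) ka"
  using assms by (auto simp: singular_chain_def keys_cx)
 hence "ka iv : K" by (auto simp: simplex_iff image_subset_iff)
 hence "wt F (ka iv) b = wt G (ka iv) b" by (intro wt_cong_path[of K]) (use assms in auto)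
 moreover have "simplex_map q F ka = simplex_map q G ka"
  using k assms(6) by (auto simp: simplex_map_def fun_eq_iff simplex_iff image_subset_iff)
 ultimately show "sc (wt F (ka iv) b) (gen (simplex_map q F ka)) =
       sc (wt G (ka iv) b) (gen (simplex_map q G ka))" by simp
qed

lemma wt_compose:
 assumes K: "fconvex K" and F: "continuous_on K F" "F ` K <= X"
  and K': "fconvex K'" "continuous_on K' j" "j ` K' <= K" and "a : K'" "b : K'"
 shows "wt (F o j) a b = wt F (j a) (j b)"
proof -
 have "hol (F o (j o seg a b)) = wt F ((j o seg a b) 0) ((j o seg a b) 1)"
 proof (rule wt_path[OF K F])
  show "path (j o seg a b)" using assms path_seg_in[of K' a b] path_seg
   by (auto intro!: path_continuous_image continuous_on_subset[OF K'(2)])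
  show "path_image (j o seg a b) <= K"
   using assms path_seg_in[of K' a b] by (auto simp: path_image_compose)
 qed
 thus ?thesis by (simp add: wt_def o_assoc)
qed

text \<open>By \<open>wt_trans\<close>, moving the base point from \<open>j b'\<close> to
  \<open>b\<close> multiplies all weights by one common factor.\<close>

lemma Tw_chain_map:
 assumes s: "singular_chain q (top_of_set K') s" and K: "fconvex K" and F: "continuous_on K F" "F ` K <= X"
  and K': "fconvex K'" "continuous_on K' j" "j ` K' <= K" and "b' : K'" "b : K"
 shows "Tw q F b (chain_map q j s) = sc (wt F (j b') b) (Tw q (F o j) b' s)"
 using s[unfolded singular_chain_def]
proof (induction s rule: frag_induction)
 case (one \<mu>)
 hence v: "\<mu> iv : K'"  by (auto simp: simplex_iff image_subset_iff)
 have "wt F (j (\<mu> iv)) b = wt F (j (\<mu> iv)) (j b') * wt F (j b') b"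
  by (subst wt_trans[OF K F]) (use v assms in auto)
 also have "wt F (j (\<mu> iv)) (j b') = wt (F o j) (\<mu> iv) b'"
  by (subst wt_compose[OF K F K']) (use v assms in auto)
 finally have "wt F (j (\<mu> iv)) b = wt (F o j) (\<mu> iv) b' * wt F (j b') b" .
 moreover have "simplex_map q F (simplex_map q j \<mu>) = simplex_map q (F o j) \<mu>"
  by (auto simp: simplex_map_def fun_eq_iff)
 ultimately show ?case  by (simp add: simplex_map_def Tw_of mult.commute o_def)
qed (auto simp: chain_map_diff Tw_diff tc.scale_right_diff_distrib)

lemma singular_chain_boundary_idp: "singular_chain (p - 1) (spx p) (bdi p)"
proof -
 show ?thesis using singular_chain_boundary[of p "spx p" "frag_of (idp p)"]
  by (simp add: simplex_iff singular_chain_of)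
qed

lemma chain_map_idp:
 assumes "singular_simplex q (top_of_set K) ka"
 shows "chain_map q ka (frag_of (idp q)) = frag_of ka"
 using singular_simplex_chain_map_id[OF assms] by simp

text \<open>The system is trivial over a convex parameter set, so \<open>Tw\<close> is a chain map
  from integral singular chains. Identities for the twisted boundary, \<open>bd_bd\<close> among
  them, are inherited from the untwisted one in this way.\<close>

lemma bd_Tw:
 assumes s: "singular_chain q (top_of_set K) s" and K: "fconvex K" and F: "continuous_on K F" "F ` K <= X"
  and b: "b : K"
 shows "bd q (Tw q F b s) = Tw (q - 1) F b (chain_boundary q s)"
 using s[unfolded singular_chain_def]
proof (induction s rule: frag_induction)
 case (one ka)
 hence k: "singular_simplex q (top_of_set K) ka" by simp
 have kc: "continuous_on (standard_simplex q) ka" "ka ` standard_simplex q <= K"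
  using k by (auto simp: simplex_iff)
 let ?d = "chain_boundary q (frag_of (idp q))"
 have "Tw (q - 1) F b (chain_boundary q (frag_of ka)) = Tw (q - 1) F b (chain_map (q - 1) ka ?d)"
  using chain_boundary_chain_map[of q "spx q" "frag_of (idp q)" ka] chain_map_idp[OF k]
  by (simp add: singular_chain_of simplex_iff)
 also have "... = sc (wt F (ka iv) b) (Tw (q - 1) (F o ka) iv ?d)"
  by (rule Tw_chain_map[OF singular_chain_boundary_idp K F fconvex_simplex kc _ b]) simp
 also have "Tw (q - 1) (F o ka) iv ?d = Tw (q - 1) (simplex_map q F ka) iv ?d"
  by (rule Tw_cong[OF singular_chain_boundary_idp fconvex_simplex])
   (use F kc in \<open>auto intro!: continuous_on_compose2[OF F(1) kc(1)] simp: simplex_map_def\<close>)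
 finally show ?case by (simp add: Tw_of bd_def lext_sc)
next
 case (diff a b)
 thus ?case by (simp add: Tw_diff chain_boundary_diff) (simp add: bd_def lext_diff)
qed (auto simp: bd_def)

lemma bd_gen: "bd p (gen f) = Tw (p - 1) f iv (bdi p)" by (simp add: bd_def)

lemma bd_add: "bd p (a + b) = bd p a + bd p b" and bd_sc: "bd p (sc k a) = sc k (bd p a)"
 and bd_diff: "bd p (a - b) = bd p a - bd p b" and bd_zero [simp]: "bd p 0 = 0"
 by (simp_all add: bd_def lext_add lext_sc lext_diff)

lemma bd_in:
 assumes "c : tchain p S"
 shows "bd p c : tchain (p - 1) S" unfolding bd_def
using assms by (fastforce simp: tchain_def simplex_iff intro: tchain_lext Tw_in' singular_chain_boundary_idp)

lemma bd_degree_0: "bd 0 c = 0" by (simp add: bd_def chain_boundary_def lext_def)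

lemma bd_bd:
 assumes "c : tchain p X"
 shows "bd (p - 1) (bd p c) = 0" using assms[unfolded tchain_def mem_Collect_eq]
proof (induction c rule: chain_induct)
 case (gen f)
 hence f: "continuous_on (standard_simplex p) f" "f ` standard_simplex p <= X"
  by (auto simp: simplex_iff)
 show ?case using chain_boundary_boundary[of p "spx p" "frag_of (idp p)"] using bd_Tw[OF singular_chain_boundary_idp fconvex_simplex f, of iv]
  by (simp add: simplex_iff singular_chain_of bd_gen)
qed (simp_all add: bd_add bd_sc)

end

subsection \<open>Natural chain homotopies from acyclic models\<close>

lemma fconvex_contract:
 assumes K: "fconvex K" and f: "continuous_on T f" "f ` T <= K" and g: "continuous_on T g" "g ` T <= K"
 shows "homotopic_with (%h. h : {} \<rightarrow> {}) (top_of_set T) (top_of_set K) f (g :: (nat => real) => nat => real)"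
proof -
 let ?h = "%z. seg (f (snd z)) (g (snd z)) (fst z)"
 have c: "continuous_on ({0..1} \<times> T) (%z. k (snd z) i)" if "continuous_on T k"
  for k :: "(nat => real) => nat => real" and i
 proof -
  have "continuous_on T (%t. k t i)" using that by (rule continuous_on_product_then_coordinatewise)
  thus ?thesis by (rule continuous_on_compose2) (auto intro: continuous_intros)
 qed
 have "continuous_on ({0..1} \<times> T) ?h"
  unfolding seg_def by (intro continuous_on_coordinatewise_then_product continuous_intros c f g)
 thus ?thesis using K f g unfolding homotopic_with_def by (auto simp: fconvex_def image_subset_iff)
qed

lemma homologous_fconvex:
 fixes T :: "(nat => real) set"
 assumes K: "fconvex K" and f: "continuous_on T f" "f ` T <= K" and g: "continuous_on T g" "g ` T <= (K :: (nat => real) set)"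
  and c: "singular_chain p (top_of_set T) c" "chain_boundary p c = 0"
 obtains t where "singular_chain (Suc p) (top_of_set K) t"
  "chain_boundary (Suc p) t = chain_map p f c - chain_map p g c"
proof -
 have "singular_relcycle p (top_of_set T) {} c" using c by (simp add: singular_cycle)
 from homotopic_imp_homologous_rel_chain_maps[OF fconvex_contract[OF K f g] this]
 show ?thesis using that by (auto simp: homologous_rel_def singular_boundary)
qed

lemma chain_map_const_boundary:
 assumes c: "singular_chain p (top_of_set K) c" "chain_boundary p c = 0" "p > 0" and a: "a : K"
 obtains t where "singular_chain (Suc p) (top_of_set K) t"
  "chain_boundary (Suc p) t = chain_map p (%x. a) c"
proof -
 have ch: "singular_chain p (top_of_set {a}) (chain_map p (%x. a) c)"
  by (rule singular_chain_chain_map[OF c(1)]) simp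
 have "singular_relcycle p (top_of_set {a}) {} (chain_map p (%x. a) c)" using chain_boundary_chain_map[OF c(1), of "%x. a"] c using ch
  by (simp add: singular_cycle)
 then obtain t where "singular_chain (Suc p) (top_of_set {a}) t"
  "chain_boundary (Suc p) t = chain_map p (%x. a) c" using singular_boundary_eq_cycle_singleton[of "top_of_set {a}" a p] \<open>p > 0\<close>
  by (auto simp: singular_boundary)
 thus ?thesis using that a singular_chain_mono[of "Suc p" euclidean "{a}" t K] by auto
qed

text \<open>The cycle is homologous to its image under the constant map to \<open>a\<close>, and
  that image bounds in positive degree.\<close>

lemma acyclic_fconvex:
 assumes K: "fconvex K" and c: "singular_chain p (top_of_set K) c" "chain_boundary p c = 0" "p > 0"
  and a: "a : K"
 obtains t where "singular_chain (Suc p) (top_of_set K) t" "chain_boundary (Suc p) t = c"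
proof -
 obtain t where t: "singular_chain (Suc p) (top_of_set K) t"
  "chain_boundary (Suc p) t = chain_map p id c - chain_map p (%x. a) c"
  by (rule homologous_fconvex[OF K _ _ _ _ c(1,2), of id "%x. a"]) (use a in auto)
 obtain u where u: "singular_chain (Suc p) (top_of_set K) u"
  "chain_boundary (Suc p) u = chain_map p (%x. a) c" by (rule chain_map_const_boundary[OF c a])
 show ?thesis by (rule that[of "t + u"])
   (use t u chain_map_ident[OF c(1)] in \<open>auto simp: chain_boundary_add singular_chain_add\<close>)
qed

text \<open>The natural operator on chains whose value on the model in degree \<open>q\<close> is
  \<open>T q\<close>; \<open>hat ka\<close> is the map of models induced by the singular simplex
  \<open>ka\<close>.\<close>

definition lft where
 "lft hat n q (T :: nat => (nat => real) chain) s = frag_extend (%ka. chain_map n (hat ka) (T q)) s"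

text \<open>The models are convex sets \<open>K p\<close> depending functorially, via \<open>hat\<close>, on singular simplices of
  standard simplices: the simplices themselves for subdivision, prisms for homotopies.\<close>

lemma acyclic_models:
 fixes A :: "nat => (nat => real) chain"
 assumes K: "!!p. fconvex (K p)" "!!p. K p ~= {}"
  and hat_cont: "!!p q ka. singular_simplex q (spx p) ka ==> continuous_on (K q) (hat ka)"
  and hat_in: "!!p q ka. singular_simplex q (spx p) ka ==> hat ka ` K q <= K p"
  and hat_comp: "!!p q r ka \<mu> x. singular_simplex q (spx p) ka ==>
    singular_simplex r (spx q) \<mu> ==> x : K r ==> hat (simplex_map r ka \<mu>) x = hat ka (hat \<mu> x)"
  and A: "!!p. singular_chain p (top_of_set (K p)) (A p)"
  and dA: "!!p. chain_boundary p (A p) = lft hat (p - 1) (p - 1) A (bdi p)"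
  and A0: "EX t. singular_chain 1 (top_of_set (K 0)) t & chain_boundary 1 t = A 0"
 shows "EX T. ALL p. singular_chain (Suc p) (top_of_set (K p)) (T p) &
   chain_boundary (Suc p) (T p) = A p - lft hat p (p - 1) T (bdi p)"
proof -
 define L where "L = (%q (t::(nat => real) chain) s. frag_extend (%ka. chain_map (Suc q) (hat ka) t) s)"
 have idp_chain: "singular_chain p (spx p) (frag_of (idp p))" for p
  by (simp add: singular_chain_of simplex_iff)
 have L_in: "singular_chain (Suc q) (top_of_set (K p)) (L q t s)"
  if "singular_chain (Suc q) (top_of_set (K q)) t" "singular_chain q (spx p) s" for q t s p
  unfolding L_def
 proof (rule singular_chain_extend)
  fix ka assume "ka : supp s"
  with that have "singular_simplex q (spx p) ka" by (auto simp: singular_chain_def)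
  thus "singular_chain (Suc q) (top_of_set (K p)) (chain_map (Suc q) (hat ka) t)"
   by (intro singular_chain_chain_map[OF that(1)]) (use hat_cont[of q p] hat_in[of q p] in auto)
 qed
 have L_nat: "chain_map (Suc r) (hat ka) (L r t s) = L r t (chain_map r ka s)"
  if t: "singular_chain (Suc r) (top_of_set (K r)) t" and k: "singular_simplex q (spx p) ka"
   and s: "singular_chain r (spx q) s" for r t s p q ka using s[unfolded singular_chain_def]
 proof (induction s rule: frag_induction)
  case (one \<mu>)
  hence m: "singular_simplex r (spx q) \<mu>" by simp
  have "chain_map (Suc r) (hat ka) (chain_map (Suc r) (hat \<mu>) t) = chain_map (Suc r) (hat ka o hat \<mu>) t"
   by (simp add: chain_map_compose)
  also have "... = chain_map (Suc r) (hat (simplex_map r ka \<mu>)) t"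
   by (rule chain_map_eq[OF t]) (use hat_comp[OF k m] in auto)
  finally show ?case by (simp add: L_def)
 qed (auto simp: L_def chain_map_diff frag_extend_diff)
 have L_0: "L q t 0 = 0" for q t by (simp add: L_def)
 \<comment> \<open>Choosing the next model chain requires the boundary of the present one, which
   refers to the one before. The existential \<open>t'\<close> keeps that predecessor out of sight,
   so that dependent choice carries a single chain at a time.\<close>
 define P where "P = (%p t. singular_chain (Suc p) (top_of_set (K p)) t &
   (EX t'. (p > 0 --> singular_chain p (top_of_set (K (p - 1))) t') &
    chain_boundary (Suc p) t = A p - L (p - 1) t' (bdi p)))"
 have bL: "chain_boundary (Suc p) (L p t s) = lft hat p p A s - L (p - 1) t' (chain_boundary p s)"
  if t: "singular_chain (Suc p) (top_of_set (K p)) t"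
   and t': "p > 0 --> singular_chain p (top_of_set (K (p - 1))) t'"
   and dt: "chain_boundary (Suc p) t = A p - L (p - 1) t' (bdi p)"
   and s: "singular_chain p (spx m) s" for p t t' s m using s[unfolded singular_chain_def]
 proof (induction s rule: frag_induction)
  case (one ka)
  hence k: "singular_simplex p (spx m) ka" by simp
  have "chain_boundary (Suc p) (L p t (frag_of ka)) = chain_map p (hat ka) (chain_boundary (Suc p) t)"
   using chain_boundary_chain_map[OF t, of "hat ka"] by (simp add: L_def)
  also have "... = chain_map p (hat ka) (A p) - chain_map p (hat ka) (L (p - 1) t' (bdi p))"
   by (simp add: dt chain_map_diff)
  also have "chain_map p (hat ka) (L (p - 1) t' (bdi p)) =
    L (p - 1) t' (chain_boundary p (frag_of ka))"
  proof (cases "p = 0")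
   case False
   hence "chain_map p (hat ka) (L (p - 1) t' (bdi p)) =
     L (p - 1) t' (chain_map (p - 1) ka (bdi p))" using L_nat[of "p - 1" t' p m ka "bdi p"] False t' k
     singular_chain_boundary[OF idp_chain[of p]] by simp
   also have "chain_map (p - 1) ka (bdi p) = chain_boundary p (frag_of ka)"
    using chain_boundary_chain_map[OF idp_chain[of p], of ka] singular_simplex_chain_map_id[OF k] by simp
   finally show ?thesis .
  qed (simp add: chain_boundary_def L_0)
  finally show ?case by (simp add: lft_def)
 qed (auto simp: L_def lft_def chain_boundary_diff frag_extend_diff)
 have "EX T. ALL p. P p (T p) & chain_boundary (Suc (Suc p)) (T (Suc p)) =
   A (Suc p) - L p (T p) (chain_boundary (Suc p) (frag_of (idp (Suc p))))"
 proof (rule dependent_nat_choice)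
  show "EX t. P 0 t" using A0 by (auto simp: P_def chain_boundary_def L_0)
 next
  fix t p assume "P p t"
  then obtain t' where t: "singular_chain (Suc p) (top_of_set (K p)) t"
   and t': "p > 0 --> singular_chain p (top_of_set (K (p - 1))) t'"
   and dt: "chain_boundary (Suc p) t = A p - L (p - 1) t' (bdi p)" unfolding P_def by blast
  let ?s = "chain_boundary (Suc p) (frag_of (idp (Suc p)))"
  have s: "singular_chain p (top_of_set (standard_simplex (Suc p))) ?s"
   using singular_chain_boundary[OF idp_chain[of "Suc p"]] by simp
  let ?R = "A (Suc p) - L p t ?s"
  \<comment> \<open>The right hand side is a cycle by \<open>bL\<close> applied to a boundary, and
    the model is acyclic in positive degree; degree 0 is the hypothesis \<open>A0\<close>.\<close>
  have "chain_boundary (Suc p) ?R = 0"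
   using bL[OF t t' dt s] dA[of "Suc p"] chain_boundary_boundary[OF idp_chain[of "Suc p"]]
   by (simp add: chain_boundary_diff L_0)
  moreover have "singular_chain (Suc p) (top_of_set (K (Suc p))) ?R"
   by (intro singular_chain_diff A L_in t s)
  moreover obtain a where "a : K (Suc p)" using K(2) by blast
  ultimately obtain u where u: "singular_chain (Suc (Suc p)) (top_of_set (K (Suc p))) u"
   "chain_boundary (Suc (Suc p)) u = ?R"
   using acyclic_fconvex[OF K(1), of "Suc p" "Suc p" ?R] by blast
  thus "EX u. P (Suc p) u & chain_boundary (Suc (Suc p)) u = A (Suc p) - L p t ?s"
   using t unfolding P_def by (intro exI[of _ u]) auto
 qed
 then obtain T where T: "!!p. P p (T p)" "!!p. chain_boundary (Suc (Suc p)) (T (Suc p)) =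
   A (Suc p) - L p (T p) (chain_boundary (Suc p) (frag_of (idp (Suc p))))" by blast
 have "chain_boundary (Suc p) (T p) = A p - lft hat p (p - 1) T (bdi p)" for p
  using T(1)[of 0] T(2)[of "p - 1"] by (cases p) (auto simp: P_def L_def lft_def chain_boundary_def)
 with T(1) show ?thesis unfolding P_def by blast
qed

section \<open>Operators on twisted chains induced by model chains\<close>

context holonomy
begin

definition nop where "nop F b n T p c = lext (%f. Tw n (F p f) (b p) (T p)) c" for F :: "nat => _"

lemma nop_gen: "nop F b n T p (gen f) = Tw n (F p f) (b p) (T p)"
 and nop_add: "nop F b n T p (x + y) = nop F b n T p x + nop F b n T p y"
 and nop_sc: "nop F b n T p (sc k x) = sc k (nop F b n T p x)"
 and nop_0 [simp]: "nop F b n T p 0 = 0" by (simp_all add: nop_def lext_add lext_sc)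

lemma nop_diff: "nop F b n T p (x - y) = nop F b n T p x - nop F b n T p y"
 by (simp add: nop_def lext_diff)

end

text \<open>\<open>F p f\<close> spreads the model \<open>K p\<close> over the simplex
  \<open>f\<close>, and \<open>b p\<close> is the base point of the model. \<open>F_wt\<close>
  demands that transport between the base points of the models of a face and of the simplex is the
  one between initial vertices; this makes the induced operators compatible with the twisted
  boundary.\<close>

locale natural_model = holonomy +
 fixes S :: "'a set" and K :: "nat => (nat => real) set" and hat F b
 assumes SX: "S <= X" and K: "!!p. fconvex (K p)" and bK: "!!p. b p : K p"
  and hat_cont: "!!p q ka. singular_simplex q (spx p) ka ==> continuous_on (K q) (hat ka)"
  and hat_in: "!!p q ka. singular_simplex q (spx p) ka ==> hat ka ` K q <= K p"
  and F_cont: "!!p f. singular_simplex p (top_of_set S) f ==> continuous_on (K p) (F p f)"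
  and F_in: "!!p f. singular_simplex p (top_of_set S) f ==> F p f ` K p <= X"
  and F_nat: "!!p q f ka x. singular_simplex p (top_of_set S) f ==>
    singular_simplex q (spx p) ka ==> x : K q ==> F q (simplex_map q f ka) x = F p f (hat ka x)"
  and F_wt: "!!p q f ka. singular_simplex p (top_of_set S) f ==> singular_simplex q (spx p) ka ==>
    wt (F p f) (hat ka (b q)) (b p) = wt f (ka iv) iv"
begin

lemma nop_Tw:
 assumes f: "singular_simplex p (top_of_set S) f" and s: "singular_chain q (spx p) s"
  and T: "singular_chain n (top_of_set (K q)) (T q)"
 shows "nop F b n T q (Tw q f iv s) = Tw n (F p f) (b p) (lft hat n q T s)"
 using s[unfolded singular_chain_def]
proof (induction s rule: frag_induction)
 case (one ka)
 hence k: "singular_simplex q (spx p) ka" by simp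
 have fk: "singular_simplex q (top_of_set S) (simplex_map q f ka)"
  using simplex_map_top[OF k] f by (auto simp: simplex_iff)
 have "Tw n (F p f) (b p) (chain_map n (hat ka) (T q)) =
   sc (wt (F p f) (hat ka (b q)) (b p)) (Tw n (F p f o hat ka) (b q) (T q))"
  by (rule Tw_chain_map[OF T K F_cont[OF f] F_in[OF f] K hat_cont[OF k] hat_in[OF k] bK bK])
 also have "Tw n (F p f o hat ka) (b q) (T q) = Tw n (F q (simplex_map q f ka)) (b q) (T q)"
  by (rule Tw_cong[OF T K, symmetric]) (use F_cont[OF fk] F_in[OF fk] F_nat[OF f k] bK in auto)
 finally show ?case by (simp add: lft_def Tw_of nop_sc nop_gen F_wt[OF f k])
qed (simp_all add: lft_def Tw_diff frag_extend_diff nop_diff)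

text \<open>\<open>Tw\<close> is a chain map, and \<open>nop_Tw\<close> turns naturality of the
  models in the faces into compatibility with \<open>bd\<close>; the identity between model chains
  carries over simplex by simplex.\<close>

lemma nop_homotopy:
 assumes T: "!!p. singular_chain (Suc p) (top_of_set (K p)) (T p)"
  and A: "!!p. singular_chain p (top_of_set (K p)) (A p)"
  and dT: "!!p. chain_boundary (Suc p) (T p) = A p - lft hat p (p - 1) T (bdi p)"
  and c: "c : tchain p S"
 shows "bd (Suc p) (nop F b (Suc p) T p c) + nop F b p T (p - 1) (bd p c) = nop F b p A p c"
 using c[unfolded tchain_def mem_Collect_eq]
proof (induction c rule: chain_induct)
 case (gen f)
 hence f: "singular_simplex p (top_of_set S) f" by simp
 have "bd (Suc p) (nop F b (Suc p) T p (gen f)) = Tw p (F p f) (b p) (chain_boundary (Suc p) (T p))"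
  using bd_Tw[OF T K F_cont[OF f] F_in[OF f] bK] by (simp add: nop_gen)
 moreover have "nop F b p T (p - 1) (bd p (gen f)) =
   Tw p (F p f) (b p) (lft hat p (p - 1) T (bdi p))"
 proof (cases p)
  case 0
  thus ?thesis by (simp add: bd_degree_0 chain_boundary_def lft_def)
 next
  case (Suc q)
  thus ?thesis using nop_Tw[OF f singular_chain_boundary_idp, of p T] T[of q] by (simp add: bd_gen)
 qed
 ultimately show ?case by (simp add: dT Tw_diff nop_gen)
next
 case (add x y)
 show ?case unfolding bd_add nop_add add.IH[symmetric] by (simp add: algebra_simps)
next
 case (scale k x)
 show ?case unfolding bd_sc nop_sc scale.IH[symmetric] tc.scale_right_distrib ..
qed (simp_all)

end

subsection \<open>Subdivision\<close>

definition sdchain :: "nat => nat => (nat => real) chain" where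
 "sdchain n p = (singular_subdivision p ^^ n) (frag_of (idp p))"

lemma singular_chain_sd_pow: "singular_chain p Y c ==> singular_chain p Y ((singular_subdivision p ^^ n) c)"
 by (induction n) (auto intro: singular_chain_singular_subdivision)

lemma chain_boundary_sd_pow: "singular_chain p Y c ==>
  chain_boundary p ((singular_subdivision p ^^ n) c) = (singular_subdivision (p - 1) ^^ n) (chain_boundary p c)"
proof (induction n)
 case (Suc n)
 thus ?case
  using chain_boundary_singular_subdivision[OF singular_chain_sd_pow[OF Suc.prems], of n] by simp
qed simp

lemma idp_chain: "singular_chain p (spx p) (frag_of (idp p))"
 by (simp add: singular_chain_of simplex_iff)

lemma sdchain_in: "singular_chain p (spx p) (sdchain n p)"
 unfolding sdchain_def by (rule singular_chain_sd_pow[OF idp_chain])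

lemma sd_pow_eq:
 assumes "singular_chain q (spx p) s"
 shows "(singular_subdivision q ^^ n) s = frag_extend (%ka. chain_map q ka (sdchain n q)) s"
proof -
 let ?t = "(simplicial_subdivision q ^^ n) (frag_of (idp q))"
 have "simplicial_chain q (standard_simplex q) (frag_of (idp q))"
  by (metis order_refl simplicial_chain_of simplicial_simplex_id)
 hence "simplicial_chain q (standard_simplex q) ?t"
  by (induction n) (auto simp only: funpow.simps o_apply id_apply simplicial_chain_simplicial_subdivision)
 hence "singular_chain q (spx q) ?t"
  using simplicial_imp_singular_chain by (metis powertop_euclidean)
 hence "chain_map q (idp q) ?t = ?t" by (rule chain_map_id_gen) auto
 thus ?thesis using iterated_singular_subdivision[OF idp_chain, of n q] using iterated_singular_subdivision[OF assms, of n]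
  by (simp add: sdchain_def)
qed

text \<open>Iterated subdivision commutes with boundaries and is the identity in degree 0, so
  acyclic models yields a homotopy to the identity, given by chains inside the model simplices and
  hence ready to be twisted.\<close>

lemma sd_homotopy_exists: "EX T. ALL p. singular_chain (Suc p) (spx p) (T p) &
   chain_boundary (Suc p) (T p) = sdchain n p - frag_of (idp p) - lft (%ka. ka) p (p - 1) T (bdi p)"
proof (rule acyclic_models[where A = "%p. sdchain n p - frag_of (idp p)" and K = standard_simplex and hat = "%ka. ka"])
 fix p
 show "singular_chain p (spx p) (sdchain n p - frag_of (idp p))"
  by (intro singular_chain_diff sdchain_in idp_chain)
 have s: "singular_chain (p - 1) (spx p) (bdi p)"
  using singular_chain_boundary[OF idp_chain] by simp
 have "lft (%ka. ka) (p - 1) (p - 1) (%p. sdchain n p - frag_of (idp p)) s =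
   (singular_subdivision (p - 1) ^^ n) s - s" if "singular_chain (p - 1) (spx p) s" for s
 proof -
  have "lft (%ka. ka) (p - 1) (p - 1) (%p. sdchain n p - frag_of (idp p)) s =
   frag_extend (%ka. chain_map (p - 1) ka (sdchain n (p - 1))) s - s"
   using that[unfolded singular_chain_def]
  proof (induction s rule: frag_induction)
   case (one ka)
   thus ?case using singular_simplex_chain_map_id[of "p - 1" "spx p" ka] unfolding lft_def frag_extend_of chain_map_diff
    by simp
  qed (simp_all add: lft_def frag_extend_diff)
  thus ?thesis using sd_pow_eq[OF that] by simp
 qed
 from this[OF s] show "chain_boundary p (sdchain n p - frag_of (idp p)) =
   lft (%ka. ka) (p - 1) (p - 1) (%p. sdchain n p - frag_of (idp p)) (bdi p)"
  using chain_boundary_sd_pow[OF idp_chain, of p n] by (simp add: chain_boundary_diff sdchain_def)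
next
 show "EX t. singular_chain 1 (spx 0) t & chain_boundary 1 t = sdchain n 0 - frag_of (idp 0)"
 proof (intro exI conjI)
  have "(singular_subdivision 0 ^^ n) c = c" if "singular_chain 0 Y c" for c :: "(nat => real) chain" and Y
   by (induction n) (use singular_subdivision_zero[OF that] in auto)
  from this[OF idp_chain[of 0]] show "chain_boundary 1 0 = sdchain n 0 - frag_of (idp 0)"
   by (simp add: sdchain_def)
 qed auto
qed (auto simp: simplex_iff fconvex_simplex nonempty_standard_simplex simplex_map_def)

lemma (in holonomy) natural_model_sd:
 assumes "S <= X"
 shows "natural_model X hol S standard_simplex (%ka. ka) (%p f. f) (%p. iv)"
proof unfold_locales
 fix p q :: nat and f ka and x :: "nat => real"
 assume "singular_simplex p (top_of_set S) f" "singular_simplex q (spx p) ka"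
  "x : standard_simplex q"
 thus "simplex_map q f ka x = f (ka x)" by (simp add: simplex_map_def)
qed (use assms in \<open>auto simp: simplex_iff fconvex_simplex\<close>)

text \<open>The homotopy consists of chains inside each simplex, so it maps the chains of every
  subset to chains of that subset; excision uses this besides the decomposition itself.
  \<open>D\<close> depends on \<open>c\<close> through the number of subdivisions.\<close>

lemma (in holonomy) small_chains:
 assumes AB: "openin (top_of_set (A Un B)) A" "openin (top_of_set (A Un B)) B" "A Un B <= X"
  and c: "c : tchain p (A Un B)" obtains D a b where "!!q x y. D q (x + y) = D q x + D q y"
  "!!q S x. S <= X ==> x : tchain q S ==> D q x : tchain (Suc q) S"
  "a : tchain p A" "b : tchain p B" "bd (Suc p) (D p c) + D (p - 1) (bd p c) = a + b - c"
proof -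
 let ?F = "%p f. f" and ?b = "%p::nat. iv"
 have "EX n. ALL m>=n. ALL ka:supp (sdchain m p).
   f ` ka ` standard_simplex p <= A \<or> f ` ka ` standard_simplex p <= B" if f: "f : supp c" for f
 proof -
  have f: "continuous_on (standard_simplex p) f" "f ` standard_simplex p <= A Un B"
   using c f by (auto simp: tchain_def simplex_iff)
  let ?pre = "%V. {x : standard_simplex p. f x : V}"
  have "openin (spx p) (?pre V)" if "openin (top_of_set (A Un B)) V" for V
  proof -
   have "openin (spx p) (standard_simplex p Int f -` V)"
    by (rule continuous_openin_preimage[OF f(1) _ that]) (use f(2) in auto)
   thus ?thesis by (simp add: vimage_def Int_def)
  qed
  hence op: "!!U. U : {?pre A, ?pre B} ==> openin (spx p) U" using AB by blast
  have cov: "topspace (spx p) <= \<Union>{?pre A, ?pre B}" using f by auto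
  obtain n where n: "!!m ka. n <= m ==> ka : supp ((singular_subdivision p ^^ m) (frag_of (idp p))) ==>
    EX V:{?pre A, ?pre B}. ka : standard_simplex p \<rightarrow> V"
  by (smt (verit) sufficient_iterated_singular_subdivision_exists op cov idp_chain)
  show ?thesis using n by (auto simp: sdchain_def intro!: ballI)
 qed
 then obtain N where N: "!!f m ka. f : supp c ==> N f <= m ==> ka : supp (sdchain m p) ==>
   f ` ka ` standard_simplex p <= A \<or> f ` ka ` standard_simplex p <= B" by metis
 \<comment> \<open>Smallness persists under further subdivision, so one number serves the finitely
   many simplices of \<open>c\<close>.\<close>
 define n where "n = Max (insert 0 (N ` supp c))"
 have nN: "N f <= n" if "f : supp c" for f unfolding n_def using that by (intro Max_ge) auto
 obtain T where T: "!!p. singular_chain (Suc p) (spx p) (T p)" "!!p. chain_boundary (Suc p) (T p) =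
    sdchain n p - frag_of (idp p) - lft (%ka. ka) p (p - 1) T (bdi p)"
  using sd_homotopy_exists[of n] by blast
 define D where "D = (%q x. nop ?F ?b (Suc q) T q x)"
 have Dadd: "D q (x + y) = D q x + D q y" for q x y by (simp add: D_def nop_add)
 have Din: "D q x : tchain (Suc q) S" if "S <= X" "x : tchain q S" for q S x unfolding D_def nop_def
 proof (rule tchain_lext)
  fix f assume "f : supp x"
  with that show "Tw (Suc q) f iv (T q) : tchain (Suc q) S"
   by (intro Tw_in'[OF T(1)]) (auto simp: tchain_def simplex_iff)
 qed
 interpret natural_model X hol "A Un B" standard_simplex "%ka. ka" "%p f. f" "%p. iv"
  by (rule natural_model_sd[OF AB(3)])
 have ac: "singular_chain p (spx p) (sdchain n p - frag_of (idp p))" for p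
  by (intro singular_chain_diff sdchain_in idp_chain)
 have "nop ?F ?b p (%p. sdchain n p - frag_of (idp p)) p c = nop ?F ?b p (sdchain n) p c - lext gen c"
 proof -
  have "Tw p f iv (frag_of (idp p)) = gen f" if "f : supp c" for f
  proof -
   have f: "singular_simplex p (top_of_set (A Un B)) f" using c that by (auto simp: tchain_def)
   hence cf: "continuous_on (standard_simplex p) f" "f ` standard_simplex p <= X"
    using AB by (auto simp: simplex_iff)
   have "simplex_map p f (idp p) = f"
    using f by (auto simp: simplex_map_def simplex_iff extensional_def fun_eq_iff)
   moreover have "wt f iv iv = 1" by (rule wt_refl[OF fconvex_simplex[of p] cf, of _ iv iv]) auto
   ultimately show ?thesis unfolding Tw_of by simp
  qed
  thus ?thesis  by (simp add: nop_def Tw_diff) (simp add: lext_def tc.scale_right_diff_distrib sum_subtractf)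
 qed
 moreover have "nop ?F ?b p (sdchain n) p c : {a + b |a b. a : tchain p A & b : tchain p B}"
 proof -
  have sub: "tc.subspace {a + b |a b. a : tchain p A & b : tchain p B}"
   by (intro tc.subspace_sums tchain_subspace)
  show ?thesis unfolding nop_def lext_def Tw_def
  proof (intro tc.subspace_sum[OF sub] tc.subspace_scale[OF sub])
   fix f ka assume f: "f : supp c" and "ka : supp (cx (sdchain n p))"
   hence k: "ka : supp (sdchain n p)" by (simp add: keys_cx)
   hence "singular_simplex p (spx p) ka" using sdchain_in[of p n] by (auto simp: singular_chain_def)
   hence s: "singular_simplex p (top_of_set (A Un B)) (simplex_map p f ka)"
    by (rule simplex_map_top) (use c f in \<open>auto simp: tchain_def simplex_iff\<close>)
   have "gen (simplex_map p f ka) : tchain p A \<or> gen (simplex_map p f ka) : tchain p B"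
    using N[OF f nN[OF f] k] s unfolding tchain_gen simplex_iff by (auto simp: simplex_map_def)
   thus "gen (simplex_map p f ka) : {a + b |a b. a : tchain p A & b : tchain p B}"
    using tchain_0[of p A] tchain_0[of p B] by force
  qed
 qed
 ultimately obtain a b where ab: "a : tchain p A" "b : tchain p B"
  "nop ?F ?b p (%p. sdchain n p - frag_of (idp p)) p c = a + b - c" by (auto simp: lext_id)
 show ?thesis using that[OF Dadd Din ab(1,2)] nop_homotopy[OF T(1) ac T(2) c] ab(3) unfolding D_def
  by (cases p) (auto simp: bd_degree_0)
qed

subsection \<open>Homotopies\<close>

text \<open>Coordinate 0 is the time and the shifted sequence a point of the simplex. Prisms are
  thus again convex sets of real sequences and can serve as models.\<close>

definition prism :: "nat => (nat => real) set" where
 "prism p = {z. z 0 : {0..1} & (%i. z (Suc i)) : standard_simplex p}"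

definition timed :: "real => (nat => real) => nat => real" where "timed t x = case_nat t x"

lemma timed_simps [simp]: "timed t x 0 = t" "timed t x (Suc i) = x i" "(%i. timed t x (Suc i)) = x"
 by (auto simp: timed_def)

lemma timed_in_prism [simp]: "timed t x : prism p \<longleftrightarrow> 0 <= t & t <= 1 & x : standard_simplex p"
 by (auto simp: prism_def)

lemma continuous_on_timed:
 assumes "continuous_on S t" "continuous_on S x"
 shows "continuous_on S (%z. timed (t z) (x z))"
proof (rule continuous_on_coordinatewise_then_product)
 fix i
 show "continuous_on S (%z. timed (t z) (x z) i)"
  using assms by (cases i) (auto intro: continuous_on_product_then_coordinatewise)
qed

lemma continuous_on_shift: "continuous_on S (%z::nat => real. %i. z (Suc i))"
by (fastforce intro: continuous_on_coordinatewise_then_product continuous_on_subset continuous_on_product_coordinates)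

lemma fconvex_prism: "fconvex (prism p)" unfolding fconvex_def
proof (intro ballI)
 fix a b and t :: real assume ab: "a : prism p" "b : prism p" and t: "t : {0..1}"
 have "seg (%i. a (Suc i)) (%i. b (Suc i)) t : standard_simplex p"
  using fconvex_simplex[of p] ab t by (auto simp: fconvex_def prism_def)
 moreover have "(1 - t) * a 0 + t * b 0 <= (1 - t) * 1 + t * 1"
  using ab t by (intro add_mono mult_left_mono) (auto simp: prism_def)
 ultimately show "seg a b t : prism p" using ab t by (auto simp: prism_def seg_def)
qed

definition phat :: "((nat => real) => nat => real) => (nat => real) => nat => real" where
 "phat ka z = timed (z 0) (ka (%i. z (Suc i)))"

text \<open>The top of the prism minus its bottom.\<close>

definition pends :: "nat => (nat => real) chain" where
 "pends p = chain_map p (timed 1) (frag_of (idp p)) - chain_map p (timed 0) (frag_of (idp p))"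

lemma phat_cont:
 assumes "singular_simplex q (spx p) ka"
 shows "continuous_on (prism q) (phat ka)" unfolding phat_def
proof (rule continuous_on_timed)
 show "continuous_on (prism q) (%z. z 0)"
  by (rule continuous_on_subset[OF continuous_on_product_coordinates]) simp
 show "continuous_on (prism q) (%z. ka (%i. z (Suc i)))"
  by (rule continuous_on_compose2[of "standard_simplex q" ka, OF _ continuous_on_shift])
   (use assms in \<open>auto simp: simplex_iff prism_def\<close>)
qed

lemma phat_in: "singular_simplex q (spx p) ka ==> phat ka ` prism q <= prism p"
 by (auto simp: phat_def prism_def simplex_iff)

lemma timed_chain:
 assumes "singular_chain q (spx p) s" "t : {0..1}"
 shows "singular_chain q (top_of_set (prism p)) (chain_map q (timed t) s)"
 by (rule singular_chain_chain_map[OF assms(1)])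
  (use assms(2) in \<open>auto intro!: continuous_on_timed continuous_on_const continuous_on_id\<close>)

lemma pends_in: "singular_chain p (top_of_set (prism p)) (pends p)"
 unfolding pends_def by (intro singular_chain_diff timed_chain idp_chain) auto

lemma lft_pends:
 assumes "singular_chain q (spx p) s"
 shows "lft phat q q pends s = chain_map q (timed 1) s - chain_map q (timed 0) s"
 using assms[unfolded singular_chain_def]
proof (induction s rule: frag_induction)
 case (one ka)
 have "restrict (phat ka o restrict (timed t o idp q) (standard_simplex q)) (standard_simplex q) =
   restrict (timed t o ka) (standard_simplex q)" for t by (auto simp: phat_def)
 hence "chain_map q (phat ka) (chain_map q (timed t) (frag_of (idp q))) = chain_map q (timed t) (frag_of ka)" for t
  by (simp only: chain_map_of simplex_map_def)
 thus ?case by (simp only: lft_def pends_def frag_extend_of chain_map_diff)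
qed (simp_all add: lft_def chain_map_diff frag_extend_diff)

lemma prism_homotopy_exists: "EX T. ALL p. singular_chain (Suc p) (top_of_set (prism p)) (T p) &
   chain_boundary (Suc p) (T p) = pends p - lft phat p (p - 1) T (bdi p)"
proof (rule acyclic_models[OF fconvex_prism _ phat_cont phat_in _ pends_in])
 show "prism p ~= {}" for p
  using timed_in_prism[of 0 iv p] by (metis empty_iff initial_vertex_simplex order_refl zero_le_one)
 show "phat (simplex_map r ka \<mu>) x = phat ka (phat \<mu> x)" if "x : prism r" for r ka \<mu> x
  using that by (simp add: phat_def simplex_map_def prism_def)
 show "chain_boundary p (pends p) = lft phat (p - 1) (p - 1) pends (bdi p)" for p
 proof -
  have "singular_chain (p - 1) (spx p) (bdi p)" using singular_chain_boundary[OF idp_chain] by simp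
  from lft_pends[OF this] show ?thesis unfolding pends_def chain_boundary_diff
   using chain_boundary_chain_map[OF idp_chain, of p "timed 1"] chain_boundary_chain_map[OF idp_chain, of p "timed 0"]
   by simp
 qed
 show "EX t. singular_chain 1 (top_of_set (prism 0)) t & chain_boundary 1 t = pends 0"
 proof (rule homologous_fconvex[OF fconvex_prism[of 0], of "standard_simplex 0" "timed 1" "timed 0" 0 "frag_of (idp 0)"])
  show "chain_boundary 0 (frag_of (idp 0)) = 0" by (simp add: chain_boundary_def)
  fix t assume "singular_chain (Suc 0) (top_of_set (prism 0)) t"
   "chain_boundary (Suc 0) t = chain_map 0 (timed 1) (frag_of (idp 0)) - chain_map 0 (timed 0) (frag_of (idp 0))"
  thus ?thesis by (auto simp only: One_nat_def pends_def)
 qed (auto intro!: continuous_on_timed continuous_on_const continuous_on_id idp_chain simp del: restrict_apply)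
qed auto

context holonomy
begin

lemma hol_cong:
 assumes "path g" "path_image g <= X" "!!t. t : {0..1} ==> g t = h t"
 shows "hol g = hol h" by (intro hol_homotopic homotopic_paths_eq) (use assms in auto)

definition htrack :: "('a => real => 'a) => nat => ((nat => real) => 'a) => (nat => real) => 'a" where
 "htrack h p f z = h (f (%i. z (Suc i))) (z 0)"

lemma htrack_cont:
 assumes cont: "continuous_on (S \<times> {0..1}) (%z. h (fst z) (snd z))"
  and f: "singular_simplex p (top_of_set S) f"
 shows "continuous_on (prism p) (htrack h p f)"
proof -
 have "continuous_on (prism p) (%z. f (%i. z (Suc i)))"
  by (rule continuous_on_compose2[of "standard_simplex p" f, OF _ continuous_on_shift])
   (use f in \<open>auto simp: simplex_iff prism_def\<close>)
 moreover have "continuous_on (prism p) (%z. z 0)"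
  by (rule continuous_on_subset[OF continuous_on_product_coordinates]) simp
 ultimately have "continuous_on (prism p) (%z. (f (%i. z (Suc i)), z 0))"
  by (rule continuous_on_Pair)
 from continuous_on_compose2[OF cont this] show ?thesis
  using f by (auto simp: htrack_def simplex_iff prism_def image_subset_iff)
qed

text \<open>The prism operator, twisted with base point at time 0. The bottom then acts as the
  identity, while the top picks up the holonomy of the track run backwards; for a circle action this
  is the factor by which chains are multiplied. Subsets are tracked so that the operators act on
  pairs.\<close>

lemma homotopy_operators:
 fixes h :: "'a => real => 'a"
 assumes SX: "S <= X" and cont: "continuous_on (S \<times> {0..1}) (%z. h (fst z) (snd z))"
  and h0: "!!x. x : S ==> h x 0 = x" and hX: "!!x t. x : S ==> 0 <= t ==> t <= 1 ==> h x t : X"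
 obtains G D where "!!q x y. D q (x + y) = D q x + D q y" "!!q k x. D q (sc k x) = sc k (D q x)"
  "!!q x y. G q (x + y) = G q x + G q y" "!!q k x. G q (sc k x) = sc k (G q x)"
  "!!q A B c. A <= S ==> c : tchain q A ==> (!!x t. x : A ==> 0 <= t ==> t <= 1 ==> h x t : B) ==>
    D q c : tchain (Suc q) B"
  "!!q A B c. A <= S ==> c : tchain q A ==> (!!x. x : A ==> h x 1 : B) ==> G q c : tchain q B"
  "!!q c. c : tchain q S ==> bd (Suc q) (D q c) + D (q - 1) (bd q c) = G q c - c"
  "!!q f. singular_simplex q (top_of_set S) f ==>
    G q (gen f) = sc (hol (%t. h (f iv) (1 - t))) (gen (simplex_map q (%x. h x 1) f))"
proof -
 let ?F = "htrack h" and ?b = "%p::nat. timed 0 iv"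
 have Fin: "?F p f ` prism p <= B"
  if "singular_simplex p (top_of_set A) f" "!!x t. x : A ==> 0 <= t ==> t <= 1 ==> h x t : B" for p f A B
  using that by (auto simp: htrack_def prism_def simplex_iff)
 interpret natural_model X hol S prism phat "htrack h" ?b
 proof unfold_locales
  fix p q f ka and x :: "nat => real"
  assume f: "singular_simplex p (top_of_set S) f"
  show "continuous_on (prism p) (?F p f)" by (rule htrack_cont[OF cont f])
  show "?F p f ` prism p <= X" by (rule Fin[OF f hX])
  assume k: "singular_simplex q (spx p) ka"
  show "?F q (simplex_map q f ka) x = ?F p f (phat ka x)" if "x : prism q"
   using that by (simp add: htrack_def phat_def simplex_map_def prism_def)
  have v: "ka iv : standard_simplex p" using k by (auto simp: simplex_iff)
  have s: "seg (ka iv) iv t : standard_simplex p" if "t : {0..1}" for t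
   using that v fconvex_simplex[of p] by (auto simp: fconvex_def)
  have fs: "f x : S" if "x : standard_simplex p" for x using that f by (auto simp: simplex_iff)
  \<comment> \<open>At time 0 the track of \<open>f\<close> is \<open>f\<close> itself, so the
    weights between base points of prisms are those between initial vertices.\<close>
  have e: "(f o seg (ka iv) iv) t =
    (?F p f o seg (timed 0 (ka iv)) (timed 0 iv)) t" if "t : {0..1}" for t
   using h0[OF fs[OF s[OF that]]] by (simp add: htrack_def seg_def)
  have "wt f (ka iv) iv = wt (?F p f) (timed 0 (ka iv)) (timed 0 iv)" unfolding wt_def
  proof (rule hol_cong[OF _ _ e])
   show "path (f o seg (ka iv) iv)" by (rule path_continuous_image[OF path_seg])
     (use s f in \<open>auto simp: path_image_def simplex_iff intro: continuous_on_subset\<close>)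
   show "path_image (f o seg (ka iv) iv) <= X" using s fs SX by (auto simp: path_image_def)
  qed auto
  thus "wt (?F p f) (phat ka (timed 0 iv)) (timed 0 iv) = wt f (ka iv) iv" by (simp add: phat_def)
 qed (use SX in \<open>auto simp: fconvex_prism intro: phat_cont dest: phat_in\<close>)
 obtain T where T: "!!p. singular_chain (Suc p) (top_of_set (prism p)) (T p)"
  "!!p. chain_boundary (Suc p) (T p) = pends p - lft phat p (p - 1) T (bdi p)"
  using prism_homotopy_exists by blast
 define D where "D = (%q x. nop ?F ?b (Suc q) T q x)"
 define G where "G = (%q x. nop ?F ?b q (%q. chain_map q (timed 1) (frag_of (idp q))) q x)"
 have TwT: "Tw q (?F q f) (timed 0 iv) (chain_map q (timed t) (frag_of (idp q))) =
   sc (wt (?F q f) (timed t iv) (timed 0 iv)) (gen (simplex_map q (%x. h x t) f))" for q f t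
 proof -
  have "simplex_map q (?F q f) (simplex_map q (timed t) (idp q)) = simplex_map q (%x. h x t) f"
   by (auto simp: simplex_map_def htrack_def fun_eq_iff)
  moreover have "simplex_map q (timed t) (idp q) iv = timed t iv" by (simp add: simplex_map_def)
  ultimately show ?thesis by (simp only: chain_map_of Tw_of)
 qed
 show ?thesis
 proof (rule that[of D G])
  show "D q (x + y) = D q x + D q y" "D q (sc k x) = sc k (D q x)"
   "G q (x + y) = G q x + G q y" "G q (sc k x) = sc k (G q x)" for q x y k
   by (simp_all add: D_def G_def nop_add nop_sc)
  show "D q c : tchain (Suc q) B"
   if "A <= S" "c : tchain q A" "!!x t. x : A ==> 0 <= t ==> t <= 1 ==> h x t : B" for q A B c
   unfolding D_def nop_def
  proof (rule tchain_lext)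
   fix f assume "f : supp c"
   with that have f: "singular_simplex q (top_of_set A) f" "singular_simplex q (top_of_set S) f"
    by (auto simp: tchain_def simplex_iff)
   show "Tw (Suc q) (?F q f) (timed 0 iv) (T q) : tchain (Suc q) B"
    by (rule Tw_in'[OF T(1) htrack_cont[OF cont f(2)] Fin[OF f(1) that(3)]])
  qed
  show "G q c : tchain q B" if "A <= S" "c : tchain q A" "!!x. x : A ==> h x 1 : B" for q A B c
   unfolding G_def nop_def TwT
  proof (intro tchain_lext tchain_sc)
   fix f assume "f : supp c"
   with that have f: "singular_simplex q (top_of_set A) f" by (auto simp: tchain_def)
   have "continuous_on A (%x. (%z. h (fst z) (snd z)) (x, 1))"
    by (rule continuous_on_compose2[OF cont]) (use that in \<open>auto intro!: continuous_intros\<close>)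
   hence "continuous_on A (%x. h x 1)" by simp
   thus "gen (simplex_map q (%x. h x 1) f) : tchain q B"
    unfolding tchain_gen by (rule simplex_map_top[OF f]) (use that in auto)
  qed
  show "G q (gen f) = sc (hol (%t. h (f iv) (1 - t))) (gen (simplex_map q (%x. h x 1) f))"
   if "singular_simplex q (top_of_set S) f" for q f
  proof -
   show ?thesis unfolding G_def nop_gen TwT by (simp add: wt_def htrack_def o_def seg_def algebra_simps)
  qed
  show "bd (Suc q) (D q c) + D (q - 1) (bd q c) = G q c - c" if c: "c : tchain q S" for q c
  proof -
   have "bd (Suc q) (D q c) + D (q - 1) (bd q c) = nop ?F ?b q pends q c"
    unfolding D_def using nop_homotopy[OF T(1) pends_in T(2) c]
    by (cases q) (auto simp: bd_degree_0)
   also have "... = G q c - lext (%f. Tw q (?F q f) (timed 0 iv) (chain_map q (timed 0) (frag_of (idp q)))) c"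
    by (simp add: nop_def pends_def Tw_diff G_def) (simp add: lext_def tc.scale_right_diff_distrib sum_subtractf)
   also have "lext (%f. Tw q (?F q f) (timed 0 iv) (chain_map q (timed 0) (frag_of (idp q)))) c = lext gen c"
   proof (rule lext_cong)
    fix f assume "f : supp c"
    with c have f: "singular_simplex q (top_of_set S) f" by (auto simp: tchain_def)
    hence "simplex_map q (%x. h x 0) f = f"
     using h0 by (auto simp: simplex_map_def simplex_iff fun_eq_iff extensional_def)
    moreover have "wt (?F q f) (timed 0 iv) (timed 0 iv) = 1"
     by (rule wt_refl[OF fconvex_prism htrack_cont[OF cont f] Fin[OF f hX], of _ "timed 0 iv" "timed 0 iv"])
      auto
    ultimately show "Tw q (?F q f) (timed 0 iv) (chain_map q (timed 0) (frag_of (idp q))) = gen f"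
     by (simp only: TwT tc.scale_one)
   qed
   finally show ?thesis by (simp add: lext_id)
  qed
 qed
qed

end

section \<open>Homology concentrated in one degree\<close>

lemma sum_lessThan_add_nat:
 fixes f :: "nat => 'b::comm_monoid_add"
 shows "(\<Sum>i<m + n. f i) = (\<Sum>i<m. f i) + (\<Sum>i<n. f (m + i))" by (induction n) (auto simp: add.assoc)

text \<open>All degrees share one vector space; \<open>d 0 = 0\<close> together with truncated
  subtraction in \<open>p - 1\<close> imitates a zero group in degree -1.\<close>

locale cplx = vector_space s for s :: "complex => 'v::ab_group_add => 'v" +
 fixes d :: "nat => 'v => 'v"
 assumes d_add: "d p (x + y) = d p x + d p y" and d_sc: "d p (s k x) = s k (d p x)" and d_0: "d 0 x = 0"
begin

lemma d_zero [simp]: "d p 0 = 0" using d_sc[of p 0 0] by simp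

lemma d_minus: "d p (- x) = - d p x" using d_sc[of p "-1" x] by simp

lemma d_diff: "d p (x - y) = d p x - d p y" using d_add[of p x "-y"] by (simp add: d_minus)

text \<open>That \<open>d\<close> squares to zero is part of the subcomplex: the twisted boundary
  has this property on chains in \<open>X\<close>, where the holonomy is meaningful.\<close>

definition subcx :: "(nat => 'v set) => bool" where
 "subcx A \<longleftrightarrow> (ALL p. subspace (A p)) & (ALL p. ALL x:A p. d p x : A (p - 1)) & (ALL p. ALL x:A p. d (p - 1) (d p x) = 0)"

definition rz where "rz A B p = {x : A p. d p x : B (p - 1)}" for A B :: "nat => 'v set"
definition rb where "rb A B p = {x : A p. EX e:A (Suc p). x - d (Suc p) e : B p}" for A B :: "nat => 'v set"

text \<open>The dimension of \<open>Z\<close> modulo \<open>B\<close>, expressed through a basis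
  \<open>v\<close> modulo \<open>B\<close> instead of a quotient space.\<close>

definition qd :: "'v set => 'v set => nat => bool" where
 "qd Z B b \<longleftrightarrow> (EX v. (ALL i<b. v i : Z) & (ALL z:Z. EX a. z - (\<Sum>i<b. s (a i) (v i)) : B) &
   (ALL a. (\<Sum>i<b. s (a i) (v i)) : B --> (ALL i<b. a i = 0)))"

text \<open>Relative homology concentrated in degree \<open>k\<close>, of dimension \<open>b\<close>
  there; \<open>hz\<close> is the case without homology.\<close>

definition hc where "hc A B k b \<longleftrightarrow> (ALL p. p ~= k --> rz A B p <= rb A B p) & qd (rz A B k) (rb A B k) b"
definition hz where "hz A B \<longleftrightarrow> (ALL p. rz A B p <= rb A B p)"

lemma qd_0: "qd Z B 0 \<longleftrightarrow> Z <= B" by (auto simp: qd_def)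

lemma qdE:
 assumes "qd Z B b"
 obtains v where "!!i. i < b ==> v i : Z" "!!z. z : Z ==> EX f. z - (\<Sum>i<b. s (f i) (v i)) : B"
  "!!f. (\<Sum>i<b. s (f i) (v i)) : B ==> (ALL i<b. f i = 0)" using assms by (auto simp: qd_def)

lemma hc_qd: "hc A B k b ==> qd (rz A B k) (rb A B k) b" by (simp add: hc_def)

lemma hcD: "hc A B k b ==> p ~= k ==> rz A B p <= rb A B p" by (simp add: hc_def)

lemma hz_hc: "hz A B \<longleftrightarrow> hc A B k 0" unfolding hz_def hc_def qd_0 by metis

lemma subcx_simps:
 assumes "subcx A"
 shows "0 : A p" "x : A p ==> y : A p ==> x + y : A p" "x : A p ==> y : A p ==> x - y : A p"
  "x : A p ==> s k x : A p" "x : A p ==> d p x : A (p - 1)" "x : A (Suc p) ==> d (Suc p) x : A p"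
  "x : A p ==> d (p - 1) (d p x) = 0" "x : A (Suc p) ==> d p (d (Suc p) x) = 0"
proof -
 have A: "subspace (A p)" and d: "!!p x. x : A p ==> d p x : A (p - 1)" and dd: "!!p x. x : A p ==> d (p - 1) (d p x) = 0"
  using assms unfolding subcx_def by blast+
 show "0 : A p" "x : A p ==> y : A p ==> x + y : A p" "x : A p ==> y : A p ==> x - y : A p"
  "x : A p ==> s k x : A p"
  using subspace_0[OF A] subspace_add[OF A] subspace_diff[OF A] subspace_scale[OF A] by blast+
 show "x : A p ==> d p x : A (p - 1)" "x : A p ==> d (p - 1) (d p x) = 0"
  by (rule d dd; assumption)+
 show "x : A (Suc p) ==> d (Suc p) x : A p" "x : A (Suc p) ==> d p (d (Suc p) x) = 0"
  using d[of x "Suc p"] dd[of x "Suc p"] by simp_all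
qed

lemma subcx_sum: "subcx A ==> (!!i. i : I ==> f i : A p) ==> (SUM i:I. f i) : A p"
 unfolding subcx_def by (auto intro: subspace_sum)

lemma rz_subspace: "subcx A ==> subcx B ==> subspace (rz A B p)"
 by (rule subspaceI) (auto simp: rz_def subcx_simps d_add d_sc)

lemma hzD:
 assumes "hz A B" "x : A p" "d p x : B (p - 1)"
 obtains e y where "e : A (Suc p)" "y : B p" "x = d (Suc p) e + y"
using assms by (fastforce simp: hz_def rz_def rb_def)

lemma rbI: "e : A (Suc p) ==> y : B p ==> x : A p ==> x = d (Suc p) e + y ==> x : rb A B p"
 by (auto simp: rb_def intro!: bexI[of _ e])

lemma rbE:
 assumes "x : rb A B p" obtains e y where "e : A (Suc p)" "y : B p" "x = d (Suc p) e + y"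
using assms by (auto simp: rb_def)

lemma rb_subspace: assumes A: "subcx A" and B: "subcx B" shows "subspace (rb A B p)"
proof (rule subspaceI)
 show "0 : rb A B p" using subcx_simps(1)[OF A] subcx_simps(1)[OF B] by (intro rbI[of 0 _ _ 0]) auto
 fix x y assume xy: "x : rb A B p" "y : rb A B p"
 hence "x : A p" "y : A p" by (auto simp: rb_def)
 moreover obtain e u where "e : A (Suc p)" "u : B p" "x = d (Suc p) e + u"
  using rbE[OF xy(1)] by blast
 moreover obtain f v where "f : A (Suc p)" "v : B p" "y = d (Suc p) f + v"
  using rbE[OF xy(2)] by blast
 ultimately show "x + y : rb A B p" using subcx_simps(2)[OF A] subcx_simps(2)[OF B]
  by (intro rbI[of "e + f" _ _ "u + v"]) (auto simp: d_add)
next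
 fix k x assume x: "x : rb A B p"
 hence "x : A p" by (auto simp: rb_def)
 moreover obtain e u where "e : A (Suc p)" "u : B p" "x = d (Suc p) e + u" using rbE[OF x] by blast
 moreover from calculation have "s k x : A p" using subcx_simps(4)[OF A] by blast
 ultimately show "s k x : rb A B p" using subcx_simps(4)[OF A] subcx_simps(4)[OF B]
  by (intro rbI[of "s k e" _ _ "s k u"]) (simp_all add: d_sc scale_right_distrib)
qed

lemma rz_subset: "rz A B p <= A p" by (auto simp: rz_def)

lemma hc_iff: "hc A B k b \<longleftrightarrow> (ALL p. qd (rz A B p) (rb A B p) (if p = k then b else 0))"
 by (auto simp: hc_def qd_0)

end

text \<open>An isomorphism of quotients is given by a relation between representatives that is
  linear, total on both sides and compatible with being zero. No map has to be chosen in the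
  direction where none is canonical.\<close>

lemma qd_transfer:
 assumes "cplx s d" "cplx s' d'" and R0: "R 0 0"
  and R: "!!x y x' y'. R x x' ==> R y y' ==> R (x + y) (x' + y')" "!!c x x'. R x x' ==> R (s c x) (s' c x')"
  and B: "!!x x'. R x x' ==> x' : B' \<longleftrightarrow> x : B"
  and Z: "!!x. x : Z ==> EX x':Z'. R x x'" "!!x'. x' : Z' ==> EX x:Z. R x x'"
  and qd: "cplx.qd s Z B b"
 shows "cplx.qd s' Z' B' b"
proof -
 interpret C: cplx s d by fact
 interpret D: cplx s' d' by fact
 obtain v where v: "!!i. i < b ==> v i : Z" "!!z. z : Z ==> EX f. z - (\<Sum>i<b. s (f i) (v i)) : B"
  "!!f. (\<Sum>i<b. s (f i) (v i)) : B ==> (ALL i<b. f i = 0)" by (rule C.qdE[OF qd]) (rule that)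
 have "ALL i. EX w. i < b --> w : Z' & R (v i) w" using Z(1) v(1) by metis
 then obtain w where w: "!!i. i < b ==> w i : Z'" "!!i. i < b ==> R (v i) (w i)" by metis
 have sum: "R (\<Sum>i<n. s (f i) (v i)) (\<Sum>i<n. s' (f i) (w i))" if "n <= b" for f n
  using that by (induction n) (auto intro!: R0 R w)
 have "EX f. z' - (\<Sum>i<b. s' (f i) (w i)) : B'" if z': "z' : Z'" for z'
 proof -
  obtain z f where z: "R z z'" "z - (\<Sum>i<b. s (f i) (v i)) : B" using Z(2)[OF z'] v(2) by blast
  show ?thesis using R(1)[OF z(1) R(2)[OF sum[OF order_refl, of f], of "-1"]] using B z(2) by auto
 qed
 thus ?thesis using w(1) v(3) B[OF sum[OF order_refl]] unfolding D.qd_def by blast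
qed

lemma hc_transfer:
 assumes "cplx s d" "cplx s' d'" and R0: "!!p. R p 0 0"
  and R: "!!p x y x' y'. R p x x' ==> R p y y' ==> R p (x + y) (x' + y')"
   "!!p c x x'. R p x x' ==> R p (s c x) (s' c x')"
  and B: "!!p x x'. R p x x' ==> x' : cplx.rb d' A' B' p \<longleftrightarrow> x : cplx.rb d A B p"
  and Z: "!!p x. x : cplx.rz d A B p ==> EX x':cplx.rz d' A' B' p. R p x x'"
   "!!p x'. x' : cplx.rz d' A' B' p ==> EX x:cplx.rz d A B p. R p x x'"
 shows "cplx.hc s d A B k b \<longleftrightarrow> cplx.hc s' d' A' B' k b"
 unfolding cplx.hc_iff[OF assms(1)] cplx.hc_iff[OF assms(2)]
proof (intro all_cong1 iffI)
 fix p b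
 show "cplx.qd s' (cplx.rz d' A' B' p) (cplx.rb d' A' B' p) b"
  if "cplx.qd s (cplx.rz d A B p) (cplx.rb d A B p) b"
  by (rule qd_transfer[OF assms(1,2) R0 R B Z that])
 show "cplx.qd s (cplx.rz d A B p) (cplx.rb d A B p) b"
  if "cplx.qd s' (cplx.rz d' A' B' p) (cplx.rb d' A' B' p) b"
  by (rule qd_transfer[OF assms(2,1) _ _ _ _ _ _ that, of "%x y. R p y x"]) (auto simp: R0 R B Z)
qed

context cplx
begin

text \<open>In the long exact sequence of the triple both outer pairs live in degree
  \<open>k\<close>, so the connecting maps vanish and a short exact sequence remains.\<close>

lemma hc_triple:
 assumes A: "subcx A" and B: "subcx B" and C: "subcx C" and CB: "!!p. C p <= B p" and BA: "!!p. B p <= A p"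
  and AB: "hc A B k b1" and BC: "hc B C k b2"
 shows "hc A C k (b1 + b2)"
proof -
 note a = subcx_simps[OF A] and bb = subcx_simps[OF B] and c = subcx_simps[OF C]
 have step: "z : rb A C p" if z: "z : rz A C p" and "z : rb A B p" and BC: "rz B C p <= rb B C p" for p z
 proof -
  obtain e y where e: "e : A (Suc p)" "y : B p" "z = d (Suc p) e + y"
   using rbE[OF \<open>z : rb A B p\<close>] by blast
  hence "y : rz B C p" using a(8)[OF e(1)] using e z by (simp add: d_add rz_def)
  then obtain e' y' where e': "e' : B (Suc p)" "y' : C p" "y = d (Suc p) e' + y'"
   using BC rbE by blast
  have "z = d (Suc p) (e + e') + y'" using e(3) e'(3) by (simp add: d_add)
  thus ?thesis using a(2)[OF e(1)] e'(1) BA using e'(2) z by (intro rbI[of "e + e'" _ _ y']) (auto simp: rz_def)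
 qed
 obtain u where u: "!!i. i < b1 ==> u i : rz A B k" "!!z. z : rz A B k ==> EX f. z - (\<Sum>i<b1. s (f i) (u i)) : rb A B k"
  "!!f. (\<Sum>i<b1. s (f i) (u i)) : rb A B k ==> (ALL i<b1. f i = 0)"
  by (rule qdE[OF hc_qd[OF AB]]) (rule that)
 obtain v where v: "!!i. i < b2 ==> v i : rz B C k" "!!z. z : rz B C k ==> EX f. z - (\<Sum>i<b2. s (f i) (v i)) : rb B C k"
  "!!f. (\<Sum>i<b2. s (f i) (v i)) : rb B C k ==> (ALL i<b2. f i = 0)"
  by (rule qdE[OF hc_qd[OF BC]]) (rule that)
 \<comment> \<open>A relative cycle of \<open>(A, B)\<close> lifts to one of \<open>(A, C)\<close>:
   its boundary is a relative cycle of \<open>(B, C)\<close> in degree \<open>k - 1\<close>, where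
   there is no homology. In degree 0 all boundaries are 0.\<close>
 have "EX y:B k. d k (x - y) : C (k - 1)" if "x : rz A B k" for x
 proof (cases k)
  case 0
  thus ?thesis using bb(1) c(1) by (auto simp: d_0)
 next
  case (Suc j)
  have "d k x : rb B C j" using that c(1) a(8) Suc using hcD[OF BC, of j] Suc by (auto simp: rz_def)
  then obtain e y where e: "e : B (Suc j)" "y : C j" "d k x = d (Suc j) e + y" using rbE by blast
  hence "d k (x - e) = y" using Suc by (simp add: d_diff)
  thus ?thesis using e Suc by (intro bexI[of _ e]) simp_all
 qed
 hence "ALL i. EX y. i < b1 --> y : B k & d k (u i - y) : C (k - 1)" using u(1) by blast
 then obtain y where y: "!!i. i < b1 ==> y i : B k" "!!i. i < b1 ==> d k (u i - y i) : C (k - 1)"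
  by metis
 let ?w = "%i. if i < b1 then u i - y i else v (i - b1)"
 have wsum: "(\<Sum>i<b1 + b2. s (f i) (?w i)) =
   (\<Sum>i<b1. s (f i) (u i)) - (\<Sum>i<b1. s (f i) (y i)) + (\<Sum>i<b2. s (f (b1 + i)) (v i))" for f
  by (simp add: sum_lessThan_add_nat scale_right_diff_distrib sum_subtractf)
 have ysum: "(\<Sum>i<b1. s (f i) (y i)) : B k" for f by (intro subcx_sum[OF B] bb(4)) (use y in auto)
 have vsum: "(\<Sum>i<b2. s (f i) (v i)) : rz B C k" for f
  using rz_subspace[OF B C, of k] v(1) by (intro subspace_sum subspace_scale) auto
 have "qd (rz A C k) (rb A C k) (b1 + b2)" unfolding qd_def
 proof (intro exI[of _ ?w] conjI allI impI ballI)
  show "?w i : rz A C k" if "i < b1 + b2" for i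
  proof (cases "i < b1")
   case True
   thus ?thesis using u(1)[of i] y[of i] BA[of k] using a(3) y(2)[OF True] True
    by (auto simp: rz_def)
  next
   case False
   thus ?thesis using that v(1)[of "i - b1"] BA[of k] by (auto simp: rz_def)
  qed
  fix z assume z: "z : rz A C k"
  then obtain f where f: "z - (\<Sum>i<b1. s (f i) (u i)) : rb A B k" using CB using u(2)
   by (fastforce simp: rz_def)
  let ?z = "z - (\<Sum>i<b1. s (f i) (u i - y i))"
  have yA: "y i : A k" if "i < b1" for i using y(1)[OF that] BA by blast
  have "u i - y i : rz A C k" if "i < b1" for i
   using u(1)[OF that] y(2)[OF that] yA[OF that] a(3) by (auto simp: rz_def)
  hence zz: "?z : rz A C k"
   by (intro subspace_diff[OF rz_subspace[OF A C] z] subspace_sum[OF rz_subspace[OF A C]]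
     subspace_scale[OF rz_subspace[OF A C]]) auto
  have B_rb: "x : rb A B k" if "x : B k" for x using that BA a(1) by (intro rbI[of 0 _ _ x]) auto
  have zeq: "?z = (z - (\<Sum>i<b1. s (f i) (u i))) + (\<Sum>i<b1. s (f i) (y i))"
   by (simp add: scale_right_diff_distrib sum_subtractf)
  have "?z : rb A B k" unfolding zeq using subspace_add[OF rb_subspace[OF A B] f B_rb[OF ysum]] .
  then obtain e y' where e: "e : A (Suc k)" "y' : B k" "?z = d (Suc k) e + y'" using rbE by blast
  have "d k y' = d k ?z" unfolding e(3) using a(8)[OF e(1)] by (simp add: d_add)
  then obtain g where "y' - (\<Sum>i<b2. s (g i) (v i)) : rb B C k" using zz e(2) using v(2)
   by (fastforce simp: rz_def)
  then obtain e' x where e': "e' : B (Suc k)" "x : C k" "y' - (\<Sum>i<b2. s (g i) (v i)) = d (Suc k) e' + x"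
   using rbE by blast
  let ?f = "%i. if i < b1 then f i else g (i - b1)"
  have "z - (\<Sum>i<b1 + b2. s (?f i) (?w i)) = ?z - (\<Sum>i<b2. s (g i) (v i))"
   unfolding wsum by (simp add: scale_right_diff_distrib sum_subtractf)
  also have "... = d (Suc k) (e + e') + x" using e(3) e'(3) by (simp add: d_add)
  finally have "z - (\<Sum>i<b1 + b2. s (?f i) (?w i)) = d (Suc k) (e + e') + x" .
  moreover have e'': "e + e' : A (Suc k)" and x: "x : A k"
   using a(2)[OF e(1)] e'(1,2) BA CB by blast+
  moreover have "d (Suc k) (e + e') + x : A k" using a(2)[OF a(6)[OF e''] x] .
  ultimately show "EX f. z - (\<Sum>i<b1 + b2. s (f i) (?w i)) : rb A C k" using e'(2) rbI[of "e + e'" A k x C]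
   by (auto intro: exI[of _ ?f])
 next
  fix f i assume *: "(\<Sum>i<b1 + b2. s (f i) (?w i)) : rb A C k" and i: "i < b1 + b2"
  let ?V = "\<Sum>i<b2. s (f (b1 + i)) (v i)" and ?Y = "\<Sum>i<b1. s (f i) (y i)" and ?U = "\<Sum>i<b1. s (f i) (u i)"
  obtain e x where e: "e : A (Suc k)" "x : C k" "?U - ?Y + ?V = d (Suc k) e + x"
   using * rbE unfolding wsum by blast
  have VB: "?V : B k" using vsum by (auto simp: rz_def)
  have "?U : rb A B k"
  proof (rule rbI)
   show "e : A (Suc k)" by (rule e(1))
   show "?Y - ?V + x : B k" by (rule bb(2)[OF bb(3)[OF ysum VB] subsetD[OF CB e(2)]])
   show "?U : A k" using u(1) by (intro subcx_sum[OF A] a(4)) (auto simp: rz_def)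
   show "?U = d (Suc k) e + (?Y - ?V + x)" using e(3) by (simp add: algebra_simps)
  qed
  hence f1: "ALL i<b1. f i = 0" by (rule u(3))
  hence V: "?V = d (Suc k) e + x" using e(3) by simp
  \<comment> \<open>The boundary of \<open>e\<close> lies in \<open>B\<close>, so \<open>e\<close>
    is a relative cycle of \<open>(A, B)\<close> in degree \<open>k + 1\<close>. As there is no
    homology there, \<open>e\<close> may be replaced by a chain of \<open>B\<close>.\<close>
  have "?V - x : B k" by (rule bb(3)[OF VB subsetD[OF CB e(2)]])
  hence "e : rb A B (Suc k)" using V using e(1) using hcD[OF AB, of "Suc k"] by (auto simp: rz_def)
  then obtain e2 y2 where e2: "e2 : A (Suc (Suc k))" "y2 : B (Suc k)" "e = d (Suc (Suc k)) e2 + y2"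
   using rbE by blast
  hence "d (Suc k) e = d (Suc k) y2" using a(8)[OF e2(1)] by (simp add: d_add)
  hence "?V : rb B C k" using V e2 e(2) VB by (intro rbI[of y2 _ _ x]) auto
  hence f2: "ALL i<b2. f (b1 + i) = 0" by (rule v(3)[of "%i. f (b1 + i)"])
  show "f i = 0" using f1 f2 i by (metis add_diff_inverse_nat nat_add_left_cancel_less)
 qed
 moreover have "rz A C p <= rb A C p" if "p ~= k" for p
 proof
  fix z assume z: "z : rz A C p"
  hence "z : rb A B p" "rz B C p <= rb B C p" using CB using hcD[OF AB that] hcD[OF BC that]
   by (auto simp: rz_def)
  with z show "z : rb A C p" using step by blast
 qed
 ultimately show ?thesis by (simp add: hc_def)
qed

text \<open>A relative cycle of \<open>(A, C)\<close> can be moved into \<open>B\<close> by a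
  boundary of \<open>A\<close>; the relation pairs it with the result.\<close>

lemma hz_top:
 assumes A: "subcx A" and B: "subcx B" and C: "subcx C" and CB: "!!p. C p <= B p" and BA: "!!p. B p <= A p"
  and AB: "hz A B"
 shows "hc A C k b \<longleftrightarrow> hc B C k b"
proof (rule hc_transfer[OF cplx_axioms cplx_axioms,
  of "%p z w. z : A p & w : B p & (EX e:A (Suc p). z = d (Suc p) e + w)"])
 note a = subcx_simps[OF A] and bb = subcx_simps[OF B] and c = subcx_simps[OF C]
 fix p c z w z' w' k
 let ?R = "%p z w. z : A p & w : B p & (EX e:A (Suc p). z = d (Suc p) e + w)"
 show "?R p 0 0" using a(1) bb(1) by (auto intro!: bexI[of _ 0])
 {
  assume "?R p z w" "?R p z' w'"
  then obtain e e' where "e : A (Suc p)" "e' : A (Suc p)" "z = d (Suc p) e + w" "z' = d (Suc p) e' + w'"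
   by blast
  thus "?R p (z + z') (w + w')"
   using \<open>?R p z w\<close> \<open>?R p z' w'\<close> a(2) bb(2) by (auto simp: d_add intro!: bexI[of _ "e + e'"])
 next
  assume "?R p z w"
  then obtain e where e: "e : A (Suc p)" "z = d (Suc p) e + w" "z : A p" "w : B p" by blast
  hence "s k z = d (Suc p) (s k e) + s k w" by (simp add: d_sc scale_right_distrib)
  thus "?R p (s k z) (s k w)" using e a(4) bb(4) by blast
  show "w : rb B C p \<longleftrightarrow> z : rb A C p"
  proof
   assume "w : rb B C p"
   then obtain f y where "f : B (Suc p)" "y : C p" "w = d (Suc p) f + y" by (rule rbE)
   thus "z : rb A C p"
    using e a(2)[of e "Suc p" f] BA by (intro rbI[of "e + f" _ _ y]) (auto simp: d_add)
  next
   assume "z : rb A C p"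
   then obtain f y where f: "f : A (Suc p)" "y : C p" "z = d (Suc p) f + y" by (rule rbE)
   hence w: "d (Suc p) (f - e) = w - y" and fe: "f - e : A (Suc p)"
    using e a(3) by (auto simp: d_diff algebra_simps)
   then obtain g h where g: "g : A (Suc (Suc p))" "h : B (Suc p)" "f - e = d (Suc (Suc p)) g + h" using bb(3)[OF e(4) subsetD[OF CB f(2)]] using hzD[OF AB fe]
    by auto
   hence "w - y = d (Suc p) h" using a(8)[OF g(1)] w by (simp add: d_add)
   thus "w : rb B C p" using g f(2) e(4) by (intro rbI[of h _ _ y]) (auto simp: algebra_simps)
  qed
 next
  assume z: "z : rz A C p"
  hence zA: "z : A p" "d p z : B (p - 1)" using CB by (auto simp: rz_def)
  obtain e y where e: "e : A (Suc p)" "y : B p" "z = d (Suc p) e + y" by (rule hzD[OF AB zA])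
  thus "EX w:rz B C p. ?R p z w"
   using z a(8)[OF e(1)] by (intro bexI[of _ y]) (auto simp: rz_def d_add)
 next
  assume "w : rz B C p"
  thus "EX z:rz A C p. ?R p z w"
   using BA a(1) by (intro bexI[of _ w]) (auto simp: rz_def intro!: bexI[of _ 0])
 }
qed

text \<open>The relation is congruence modulo \<open>B\<close>. A relative cycle of
  \<open>(A, B)\<close> is corrected by an element of \<open>B\<close> to one of
  \<open>(A, C)\<close>, since its boundary is trivial in the homology of
  \<open>(B, C)\<close>.\<close>

lemma hz_bot:
 assumes A: "subcx A" and B: "subcx B" and C: "subcx C" and CB: "!!p. C p <= B p" and BA: "!!p. B p <= A p"
  and BC: "hz B C"
 shows "hc A C k b \<longleftrightarrow> hc A B k b"
proof (rule hc_transfer[OF cplx_axioms cplx_axioms, of "%p z w. z : rz A C p & w : A p & w - z : B p"])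
 note a = subcx_simps[OF A] and bb = subcx_simps[OF B] and c = subcx_simps[OF C]
 fix p c z w z' w' k
 let ?R = "%p z w. z : rz A C p & w : A p & w - z : B p"
 show "?R p 0 0" using a(1) bb(1) subcx_simps(1)[OF C] by (auto simp: rz_def)
 {
  assume "?R p z w" "?R p z' w'"
  thus "?R p (z + z') (w + w')"
   using a(2) bb(2)[of "w - z" p "w' - z'"] subspace_add[OF rz_subspace[OF A C]] by (auto simp: algebra_simps)
 next
  assume R: "?R p z w"
  thus "?R p (s k z) (s k w)"
   using a(4) bb(4)[of "w - z" p k] subspace_scale[OF rz_subspace[OF A C]]
   by (auto simp: scale_right_diff_distrib)
  have zA: "z : A p" using R by (simp add: rz_def)
  show "w : rb A B p \<longleftrightarrow> z : rb A C p"
  proof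
   assume "w : rb A B p"
   then obtain f y where f: "f : A (Suc p)" "y : B p" "w = d (Suc p) f + y" by (rule rbE)
   have y': "z - d (Suc p) f : B p" using bb(3)[OF f(2), of "w - z"] R f(3) by simp
   obtain e' y' where "e' : B (Suc p)" "y' : C p" "z - d (Suc p) f = d (Suc p) e' + y'" using R a(8)[OF f(1)] using hzD[OF BC y']
    by (auto simp: rz_def d_diff)
   thus "z : rb A C p"
    using f(1) a(2)[of f "Suc p" e'] BA zA by (intro rbI[of "f + e'" _ _ y']) (auto simp: d_add algebra_simps)
  next
   assume "z : rb A C p"
   then obtain f y where f: "f : A (Suc p)" "y : C p" "z = d (Suc p) f + y" by (rule rbE)
   thus "w : rb A B p" using R bb(2)[of "w - z" p y] CB by (intro rbI[of f _ _ "w - z + y"]) auto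
  qed
 next
  assume z: "z : rz A C p"
  thus "EX w:rz A B p. ?R p z w" using CB bb(1) by (intro bexI[of _ z]) (auto simp: rz_def)
 next
  assume w: "w : rz A B p"
  show "EX z:rz A C p. ?R p z w"
  proof (cases p)
   case 0
   thus ?thesis using w subcx_simps(1)[OF C] by (auto simp: rz_def d_0 intro!: bexI[of _ w])
  next
   case (Suc j)
   obtain e y where "e : B (Suc j)" "y : C j" "d p w = d (Suc j) e + y" using w a(8)[of w j] Suc using hzD[OF BC, of "d p w" j] subcx_simps(1)[OF C]
    by (auto simp: rz_def)
   thus ?thesis
    using w Suc BA[of p] a(3)[of w p e] by (intro bexI[of _ "w - e"]) (auto simp: rz_def d_diff)
  qed
 }
qed

text \<open>The connecting map is an isomorphism when \<open>(A, C)\<close> has no homology. The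
  relation pairs \<open>w\<close> with the elements of \<open>B\<close> that equal its boundary
  modulo \<open>C\<close>; degree 0 has no predecessor and is treated apart.\<close>

lemma hc_shift:
 assumes A: "subcx A" and B: "subcx B" and C: "subcx C" and CB: "!!p. C p <= B p" and BA: "!!p. B p <= A p"
  and AC: "hz A C" and BC: "hc B C k b"
 shows "hc A B (Suc k) b" unfolding hc_iff
proof
 note a = subcx_simps[OF A] and bb = subcx_simps[OF B] and c = subcx_simps[OF C]
 fix p
 show "qd (rz A B p) (rb A B p) (if p = Suc k then b else 0)"
 proof (cases p)
  case 0
  have "z : rb A B 0" if z: "z : A 0" for z
  proof -
   obtain e y where "e : A (Suc 0)" "y : C 0" "z = d (Suc 0) e + y"
    using hzD[OF AC z] c(1) by (auto simp: d_0)
   thus ?thesis using CB z by (intro rbI[of e _ _ y]) auto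
  qed
  thus ?thesis using 0 by (auto simp: rz_def qd_0)
 next
  case (Suc j)
  let ?R = "%z w. z : B j & w : A (Suc j) & z - d (Suc j) w : C j"
  have "qd (rz A B (Suc j)) (rb A B (Suc j)) (if j = k then b else 0)"
  proof (rule qd_transfer[OF cplx_axioms cplx_axioms, of ?R])
   show "qd (rz B C j) (rb B C j) (if j = k then b else 0)" using BC by (simp add: hc_iff)
   fix z w z' w' k
   show "?R 0 0" using a(1) bb(1) c(1) by simp
   {
    assume "?R z w" "?R z' w'"
    thus "?R (z + z') (w + w')"
     using a(2) bb(2) c(2)[of "z - d (Suc j) w" j "z' - d (Suc j) w'"] by (auto simp: d_add algebra_simps)
   next
    assume R: "?R z w"
    thus "?R (s k z) (s k w)"
     using a(4) bb(4) c(4)[of "z - d (Suc j) w" j k] by (auto simp: d_sc scale_right_diff_distrib)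
    show "w : rb A B (Suc j) \<longleftrightarrow> z : rb B C j"
    proof
     assume "w : rb A B (Suc j)"
     then obtain e y where e: "e : A (Suc (Suc j))" "y : B (Suc j)" "w = d (Suc (Suc j)) e + y"
      by (rule rbE)
     thus "z : rb B C j"
      using R a(8)[OF e(1)] by (intro rbI[of y _ _ "z - d (Suc j) y"]) (auto simp: d_add)
    next
     assume "z : rb B C j"
     then obtain e y where e: "e : B (Suc j)" "y : C j" "z = d (Suc j) e + y" by (rule rbE)
     have we: "w - e : A (Suc j)" using R a(3) BA e(1) by blast
     obtain g x where "g : A (Suc (Suc j))" "x : C (Suc j)" "w - e = d (Suc (Suc j)) g + x" using c(3)[OF e(2), of "z - d (Suc j) w"] R e(3) by (auto simp: d_diff intro: hzD[OF AC we])
     thus "w : rb A B (Suc j)"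
      using R e(1) CB bb(2)[of x "Suc j" e] by (intro rbI[of g _ _ "x + e"]) (auto simp: algebra_simps)
    qed
   next
    assume z: "z : rz B C j"
    hence z': "z : A j" "d j z : C (j - 1)" using BA by (auto simp: rz_def)
    obtain w y where w: "w : A (Suc j)" "y : C j" "z = d (Suc j) w + y" by (rule hzD[OF AC z'])
    have "z - y : B j" using z CB w(2) by (intro bb(3)) (auto simp: rz_def)
    thus "EX w:rz A B (Suc j). ?R z w" using w z by (intro bexI[of _ w]) (auto simp: rz_def)
   next
    assume "w : rz A B (Suc j)"
    thus "EX z:rz B C j. ?R z w"
     using a(8) c(1) by (intro bexI[of _ "d (Suc j) w"]) (auto simp: rz_def)
   }
  qed
  thus ?thesis using Suc by simp
 qed
qed

text \<open>The second isomorphism theorem, \<open>(A + B) / B\<close> against \<open>A\<close>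
  modulo the intersection. Replacing the chains of a union by sums of chains is a separate matter,
  settled by subdivision.\<close>

lemma hc_excision:
 assumes A: "subcx A" and B: "subcx B"
  and S: "!!p. S p = {x + y |x y. x : A p & y : B p}" and I: "!!p. I p = A p Int B p"
 shows "hc S B k b \<longleftrightarrow> hc A I k b"
proof (rule sym, rule hc_transfer[OF cplx_axioms cplx_axioms, of "%p x z. x : A p & z - x : B p"])
 note a = subcx_simps[OF A] and bb = subcx_simps[OF B]
 have SI: "x : S p" if "y : A p" "x - y : B p" for x y p
  unfolding S using that by (intro CollectI exI[of _ y] exI[of _ "x - y"]) simp
 fix p c x z x' z' k
 let ?R = "%p x z. x : A p & z - x : B p"
 show "?R p 0 0" using a(1) bb(1) by simp
 have dR: "d p z : B (p - 1) \<longleftrightarrow> d p x : I (p - 1)" if "?R p x z" for x z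
 proof -
  show ?thesis using bb(5)[of "z - x" p] that using bb(3)[of "d p z" "p - 1" "d p z - d p x"] bb(2)[of "d p z - d p x" "p - 1" "d p x"] that a(5) I
   by (auto simp: d_diff)
 qed
 {
  assume "?R p x z" "?R p x' z'"
  thus "?R p (x + x') (z + z')"
   using a(2) bb(2)[of "z - x" p "z' - x'"] by (auto simp: algebra_simps)
 next
  assume R: "?R p x z"
  thus "?R p (s k x) (s k z)"
   using a(4) bb(4)[of "z - x" p k] by (auto simp: scale_right_diff_distrib)
  show "z : rb S B p \<longleftrightarrow> x : rb A I p"
  proof
   assume "z : rb S B p"
   then obtain g u where g: "g : S (Suc p)" "u : B p" "z = d (Suc p) g + u" by (rule rbE)
   then obtain e f where e: "e : A (Suc p)" "f : B (Suc p)" "g = e + f" by (auto simp: S)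
   have "x - d (Suc p) e : B p" using g(3) e(3) using bb(2)[OF bb(6)[OF e(2)] g(2)] bb(3) R
    by (fastforce simp: d_add)
   thus "x : rb A I p" using R I e(1) a(3)[OF _ a(6)[OF e(1)]] by (auto simp: rb_def)
  next
   assume "x : rb A I p"
   then obtain e u where "e : A (Suc p)" "u : I p" "x = d (Suc p) e + u" by (rule rbE)
   thus "z : rb S B p" using R I bb(1) bb(2)[of "z - x" p u] SI[of e "Suc p" e] SI[of x p z]
    by (intro rbI[of e _ _ "z - x + u"]) auto
  qed
 next
  assume "x : rz A I p"
  thus "EX z:rz S B p. ?R p x z"
   using I bb(1) SI[of x p x] by (intro bexI[of _ x]) (auto simp: rz_def)
 next
  assume z: "z : rz S B p"
  then obtain x y where "x : A p" "y : B p" "z = x + y" by (auto simp: rz_def S)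
  thus "EX x:rz A I p. ?R p x z" using z dR[of x z] by (intro bexI[of _ x]) (auto simp: rz_def)
 }
qed

end

section \<open>Twisted homology of pairs\<close>

lemma tchain_empty: "tchain p {} = {0}"
proof -
 have "c = 0" if "c : tchain p ({}::'a::topological_space set)" for c
 proof -
  have "~ singular_simplex p (top_of_set ({}::'a set)) f" for f
   using nonempty_standard_simplex[of p] by (auto simp: singular_simplex_def continuous_map_def)
  thus ?thesis using that by (auto simp: tchain_def)
 qed
 thus ?thesis by (auto simp: tchain_0)
qed

lemma add4_swap: "(x + y) + (u + v) = (x + u) + (y + v)" for x :: "'b::ab_semigroup_add"
 by (simp add: ac_simps)

lemma push_algebra: "a + y + w = (a - b) + (y - v) + (b + v + w)" for a :: "'b::ab_group_add"
 by (simp add: algebra_simps)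

sublocale holonomy < cplx sc bd by unfold_locales (auto simp: bd_add bd_sc bd_degree_0)

lemma gen_nz [simp]: "gen s ~= (0 :: _ \<Rightarrow>\<^sub>0 complex)"
 by (metis lookup_single_eq lookup_zero zero_neq_one)

lemma cx_cmul: "cx (frag_cmul k x) = sc (of_int k) (cx x)" by (rule poly_mapping_eqI) simp

context holonomy
begin

lemma Tw_add: "Tw q F b (s + t) = Tw q F b s + Tw q F b t" by (simp add: Tw_def cx_add lext_add)

lemma Tw_sum: "Tw q F b (SUM i:I. s i) = (SUM i:I. Tw q F b (s i))"
 by (induction I rule: infinite_finite_induct) (auto simp: Tw_add)

lemma Tw_cmul: "Tw q F b (frag_cmul k s) = sc (of_int k) (Tw q F b s)"
 by (simp add: Tw_def cx_cmul lext_sc)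

definition thc :: "'a set => 'a set => nat => nat => bool" where
 "thc A B k b \<longleftrightarrow> hc (tch A) (tch B) k b"

definition thz :: "'a set => 'a set => bool" where "thz A B \<longleftrightarrow> hz (tch A) (tch B)"

lemma subcx_tchain: "A <= X ==> subcx (tch A)"
 unfolding subcx_def using tchain_subspace bd_in bd_bd tchain_mono by blast

lemma thz_thc: "thz A B \<longleftrightarrow> thc A B k 0" unfolding thz_def thc_def by (rule hz_hc)

lemma thc_triple:
 "A <= X ==> B <= A ==> C <= B ==> thc A B k b1 ==> thc B C k b2 ==> thc A C k (b1 + b2)"
 unfolding thc_def by (rule hc_triple[of _ "%p. tchain p B"]) (auto intro!: subcx_tchain tchain_mono)

lemma thz_trans: "A <= X ==> B <= A ==> C <= B ==> thz A B ==> thz B C ==> thz A C"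
 using thc_triple[of A B C 0 0 0] thz_thc by simp

lemma thz_top: "A <= X ==> B <= A ==> C <= B ==> thz A B ==> thc A C k b \<longleftrightarrow> thc B C k b"
 unfolding thc_def thz_def by (rule hz_top) (auto intro!: subcx_tchain tchain_mono)

lemma thz_bot: "A <= X ==> B <= A ==> C <= B ==> thz B C ==> thc A C k b \<longleftrightarrow> thc A B k b"
 unfolding thc_def thz_def by (rule hz_bot) (auto intro!: subcx_tchain tchain_mono)

lemma thc_shift: "A <= X ==> B <= A ==> C <= B ==> thz A C ==> thc B C k b ==> thc A B (Suc k) b"
 unfolding thc_def thz_def
 by (rule hc_shift[of _ _ "%p. tchain p C"]) (auto intro!: subcx_tchain tchain_mono)

lemma thz_same: "A <= X ==> thz A A" unfolding thz_def hz_def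
proof (intro allI subsetI)
 fix p c assume A: "A <= X" and c: "c : rz (tch A) (tch A) p"
 show "c : rb (tch A) (tch A) p" using c subcx_simps(1)[OF subcx_tchain[OF A]]
  by (intro rbI[of 0]) (auto simp: rz_def)
qed

lemma thc_pair:
 assumes "A <= X" "B <= A" "B' <= B" "A' <= A" "B' <= A'" "thz A A'" "thz B B'"
 shows "thc A B k b \<longleftrightarrow> thc A' B' k b"
 using thz_top[of A A' B' k b] thz_bot[of A B B' k b] assms by auto

text \<open>By \<open>small_chains\<close> the chains of the union are acyclic modulo the sums
  \<open>?S\<close>, and algebraic excision applies to \<open>?S\<close>. The correction term
  \<open>D\<close> of the boundary is again a sum because \<open>D\<close> respects both
  parts.\<close>

lemma thc_excision:
 assumes A: "openin (top_of_set (A Un B)) A" and B: "openin (top_of_set (A Un B)) B" and X: "A Un B <= X"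
 shows "thc (A Un B) B k b \<longleftrightarrow> thc A (A Int B) k b"
proof -
 let ?S = "%p. {x + y |x y. x : tchain p A & y : tchain p B}"
 have AX: "A <= X" and BX: "B <= X" using X by auto
 note sA = subcx_simps[OF subcx_tchain[OF AX]] and sB = subcx_simps[OF subcx_tchain[OF BX]]
  and sU = subcx_simps[OF subcx_tchain[OF X]]
 have SU: "?S p <= tchain p (A Un B)" for p
 proof
  fix z assume "z : ?S p"
  then obtain x y where xy: "x : tchain p A" "y : tchain p B" and z: "z = x + y" by blast
  show "z : tchain p (A Un B)" using xy tchain_mono[of A "A Un B" p] tchain_mono[of B "A Un B" p] unfolding z
   by (auto intro: sU(2))
 qed
 have SI: "x + y : ?S p" if "x : tchain p A" "y : tchain p B" for x y p using that by blast
 have BS: "tchain p B <= ?S p" for p using SI[OF sA(1)] by force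
 have S: "subcx ?S" unfolding subcx_def
 proof (intro conjI allI ballI)
  show "tc.subspace (?S p)" for p
  proof (rule tc.subspaceI)
   show "0 : ?S p" using SI[OF sA(1) sB(1)] by simp
   fix z assume "z : ?S p"
   then obtain x y where xy: "x : tchain p A" "y : tchain p B" and z: "z = x + y" by blast
   show "sc k z : ?S p" for k
    unfolding z tc.scale_right_distrib by (rule SI[OF sA(4)[OF xy(1)] sB(4)[OF xy(2)]])
   fix z' assume "z' : ?S p"
   then obtain x' y' where xy': "x' : tchain p A" "y' : tchain p B" and z': "z' = x' + y'" by blast
   have "z + z' = (x + x') + (y + y')" unfolding z z' by (rule add4_swap)
   thus "z + z' : ?S p" using SI[OF sA(2)[OF xy(1) xy'(1)] sB(2)[OF xy(2) xy'(2)]] by simp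
  qed
  fix p z assume "z : ?S p"
  then obtain x y where xy: "x : tchain p A" "y : tchain p B" and z: "z = x + y" by blast
  show "bd p z : ?S (p - 1)" unfolding z bd_add by (rule SI[OF sA(5)[OF xy(1)] sB(5)[OF xy(2)]])
  show "bd (p - 1) (bd p z) = 0" unfolding z bd_add using sA(7)[OF xy(1)] sB(7)[OF xy(2)] by simp
 qed
 have "hz (tch (A Un B)) ?S" unfolding hz_def
 proof (intro allI subsetI)
  fix p z assume "z : rz (tch (A Un B)) ?S p"
  hence z: "z : tchain p (A Un B)" and "bd p z : ?S (p - 1)" by (auto simp: rz_def)
  then obtain a' b' where ab': "a' : tchain (p - 1) A" "b' : tchain (p - 1) B" and dz: "bd p z = a' + b'"
   by blast
  obtain D a b where Dadd: "!!q x y. D q (x + y) = D q x + D q y"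
   and Din: "!!q S x. S <= X ==> x : tchain q S ==> D q x : tchain (Suc q) S"
   and ab: "a : tchain p A" "b : tchain p B"
   and eq: "bd (Suc p) (D p z) + D (p - 1) (bd p z) = a + b - z"
   using small_chains[OF A B X z] by blast
  obtain x y where xy: "x : tchain p A" "y : tchain p B" and Dbd: "D (p - 1) (bd p z) = x + y"
  proof (cases p)
   case 0
   show ?thesis using Dadd[of 0 0 0] using that[of 0 0] sA(1) sB(1) 0 by (simp add: bd_degree_0)
  next
   case (Suc q)
   show ?thesis
    using that[of "D q a'" "D q b'"] Din[OF AX, of a' q] Din[OF BX, of b' q] ab' dz Dadd Suc by simp
  qed
  have Dz: "- D p z : tchain (Suc p) (A Un B)"
   using tc.subspace_neg[OF tchain_subspace Din[OF X z]] .
  have "bd (Suc p) (D p z) = a + b - z - (x + y)" using eq unfolding Dbd by (simp only: eq_diff_eq)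
  hence zeq: "z = bd (Suc p) (- D p z) + ((a - x) + (b - y))" by (simp add: d_minus)
  show "z : rb (tch (A Un B)) ?S p"
   by (rule rbI[OF Dz _ z zeq]) (rule SI[OF sA(3)[OF ab(1) xy(1)] sB(3)[OF ab(2) xy(2)]])
 qed
 hence "hc (tch (A Un B)) (tch B) k b \<longleftrightarrow> hc ?S (tch B) k b"
  by (intro hz_top subcx_tchain X BX S SU BS)
 also have "... \<longleftrightarrow> hc (tch A) (tch (A Int B)) k b"
  by (rule hc_excision[OF subcx_tchain[OF AX] subcx_tchain[OF BX]]) (auto simp: tchain_Int)
 finally show ?thesis by (simp add: thc_def)
qed

lemma thc_excision_open:
 "open A ==> open B ==> A Un B <= X ==> thc (A Un B) B k b \<longleftrightarrow> thc A (A Int B) k b"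
 by (rule thc_excision) (auto intro: open_subset)

text \<open>One step of \<open>h\<close> may leave points far from \<open>B\<close>. But a relative
  cycle has a compact carrier \<open>K\<close>, some iterate of the time-one map takes
  \<open>K\<close> into \<open>B\<close>, and each application changes the cycle by a boundary of
  \<open>A\<close> and a chain of \<open>B\<close>.\<close>

lemma thz_push:
 fixes h :: "'a => real => 'a"
 assumes AX: "A <= X" and BA: "B <= A"
  and cont: "continuous_on (A \<times> {0..1}) (%z. h (fst z) (snd z))" and h0: "!!x. x : A ==> h x 0 = x"
  and hA: "!!x t. x : A ==> 0 <= t ==> t <= 1 ==> h x t : A"
  and hB: "!!x t. x : B ==> 0 <= t ==> t <= 1 ==> h x t : B"
  and push: "!!K. compact K ==> K <= A ==> EX N. ALL x:K. ((%x. h x 1) ^^ N) x : B"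
 shows "thz A B" unfolding thz_def hz_def
proof (intro allI subsetI)
 fix p z assume "z : rz (tch A) (tch B) p"
 hence z: "z : tchain p A" and dz: "bd p z : tchain (p - 1) B" by (auto simp: rz_def)
 note a = subcx_simps[OF subcx_tchain[OF AX]] and b = subcx_simps[OF subcx_tchain[OF order_trans[OF BA AX]]]
 have BinA: "tchain q B <= tchain q A" for q by (rule tchain_mono[OF BA])
 have hAX: "h x t : X" if "x : A" "0 <= t" "t <= 1" for x t using hA[OF that] AX by blast
 obtain G D where Dadd: "!!q x y. D q (x + y) = D q x + D q y"
  and "!!q x y. G q (x + y) = G q x + G q y"
  and Din: "!!q U V c. U <= A ==> c : tchain q U ==> (!!x t. x : U ==> 0 <= t ==> t <= 1 ==> h x t : V) ==>
    D q c : tchain (Suc q) V"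
  and Gin: "!!q U V c. U <= A ==> c : tchain q U ==> (!!x. x : U ==> h x 1 : V) ==> G q c : tchain q V"
  and GD: "!!q c. c : tchain q A ==> bd (Suc q) (D q c) + D (q - 1) (bd q c) = G q c - c"
 proof (rule homotopy_operators[OF AX cont h0 hAX])
  fix G D
  assume a: "!!q x y. D q (x + y) = D q x + D q y" "!!q k x. D q (sc k x) = sc k (D q x)"
   "!!q x y. G q (x + y) = G q x + G q y" "!!q k x. G q (sc k x) = sc k (G q x)"
   "!!q U V c. U <= A ==> c : tchain q U ==> (!!x t. x : U ==> 0 <= t ==> t <= 1 ==> h x t : V) ==>
    D q c : tchain (Suc q) V"
   "!!q U V c. U <= A ==> c : tchain q U ==> (!!x. x : U ==> h x 1 : V) ==> G q c : tchain q V"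
   "!!q c. c : tchain q A ==> bd (Suc q) (D q c) + D (q - 1) (bd q c) = G q c - c"
  show thesis by (rule that[OF a(1,3,5,6,7)])
 qed
 have D0: "D q 0 = 0" for q using Dadd[of q 0 0] by simp
 obtain K where K: "compact K" "K <= A" "z : tchain p K" using tchain_carrier_compact[OF z] .
 let ?h = "%x. h x 1"
 have hK: "(?h ^^ n) ` K <= A" for n
 proof (induction n)
  case (Suc n)
  hence "h ((?h ^^ n) x) 1 : A" if "x : K" for x using that hA[of "(?h ^^ n) x" 1] by auto
  thus ?case by auto
 qed (use K(2) in simp)
 \<comment> \<open>The carrier is iterated along with the cycle: after \<open>n\<close> steps the
   remainder \<open>w\<close> lives on the \<open>n\<close>-th image of \<open>K\<close>.\<close>
 have step: "EX e:tchain (Suc p) A. EX y:tchain p B. EX w:tchain p ((?h ^^ n) ` K). z = bd (Suc p) e + y + w & bd p w : tchain (p - 1) B" for n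
 proof (induction n)
  case 0
  show ?case
   by (rule bexI[OF _ a(1)], rule bexI[OF _ b(1)], rule bexI[of _ z]) (use K(3) dz in auto)
 next
  case (Suc n)
  then obtain e y w where e: "e : tchain (Suc p) A" and y: "y : tchain p B" and w: "w : tchain p ((?h ^^ n) ` K)"
   and zeq: "z = bd (Suc p) e + y + w" and dw: "bd p w : tchain (p - 1) B" by blast
  define v where "v = D (p - 1) (bd p w)"
  have wA: "w : tchain p A" using w tchain_mono[OF hK] by blast
  have v: "v : tchain p B"
  proof (cases p)
   case 0
   thus ?thesis using b(1) by (simp add: v_def bd_degree_0 D0)
  next
   case (Suc q)
   thus ?thesis using Din[OF BA dw hB] by (simp add: v_def)
  qed
  have Dw: "D p w : tchain (Suc p) A" using Din[OF order_refl wA hA] .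
  have G: "bd (Suc p) (D p w) + v = G p w - w" using GD[OF wA] by (simp add: v_def)
  hence Gw: "G p w = bd (Suc p) (D p w) + v + w" by (simp only: eq_diff_eq)
  have "bd p (G p w) : tchain (p - 1) B" unfolding Gw using a(8)[OF Dw] using b(2)[OF b(5)[OF v] dw]
   by (simp add: bd_add)
  moreover have "z = bd (Suc p) (e - D p w) + (y - v) + G p w"
   unfolding zeq Gw bd_diff by (rule push_algebra)
  moreover have "G p w : tchain p ((?h ^^ Suc n) ` K)" by (rule Gin[OF hK w]) auto
  ultimately show ?case using a(3)[OF e Dw] b(3)[OF y v] by blast
 qed
 obtain N where N: "ALL x:K. (?h ^^ N) x : B" using push[OF K(1,2)] by blast
 obtain e y w where e: "e : tchain (Suc p) A" and y: "y : tchain p B" and w: "w : tchain p ((?h ^^ N) ` K)"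
   and zeq: "z = bd (Suc p) e + y + w" using step[of N] by blast
 have "w : tchain p B" using N using w tchain_mono by blast
 thus "z : rb (tch A) (tch B) p"
  using zeq rbI[OF e _ z, of "y + w" "%p. tchain p B"] b(2)[OF y] by (simp add: add.assoc)
qed

lemma thz_empty: "thz {} {}" by (rule thz_same) simp

text \<open>Mayer-Vietoris by excision: \<open>V j\<close> is acyclic relative to its intersection
  with the other sets, because that intersection is a union of sets whose finite intersections are
  among those assumed acyclic.\<close>

lemma thz_Union:
 assumes "finite C" "!!i. i : C ==> open (V i)" "!!i. i : C ==> V i <= X"
  "!!s. s <= C ==> s ~= {} ==> thz (INT i:s. V i) {}"
 shows "thz (UN i:C. V i) {}" using assms
proof (induction C arbitrary: V rule: finite_induct)
 case empty
 thus ?case by (simp add: thz_empty)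
next
 case (insert j C)
 let ?B = "UN i:C. V i"
 have B: "thz ?B {}"
  by (rule insert.IH) (use insert.prems(1,2) insert.prems(3)[OF order_trans[OF _ subset_insertI]] in auto)
 have "thz (UN i:C. V i Int V j) {}"
 proof (rule insert.IH)
  show "open (V i Int V j)" "V i Int V j <= X" if "i : C" for i
   using insert.prems(1,2) that by (auto intro!: open_Int)
  show "thz (INT i:s. V i Int V j) {}" if "s <= C" "s ~= {}" for s
  proof -
   have "(INT i:s. V i Int V j) = (INT i:insert j s. V i)" using that by auto
   thus ?thesis using insert.prems(3)[of "insert j s"] that by auto
  qed
 qed
 moreover have "(UN i:C. V i Int V j) = V j Int ?B" by auto
 ultimately have AB: "thz (V j Int ?B) {}" by simp
 have VX: "V j <= X" and BX: "?B <= X" using insert.prems(2) by auto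
 have "thz (V j) (V j Int ?B)"
  using thz_bot[of "V j" "V j Int ?B" "{}" 0 0] insert.prems(3)[of "{j}"] AB VX thz_thc by auto
 thus ?case using thc_excision_open[of "V j" ?B 0 0] insert.prems(1) VX BX thz_thc using thz_trans[of "V j Un ?B" ?B "{}"] B VX BX
  by auto
qed

section \<open>Homology of a point and of a convex set\<close>

definition cpt :: "nat => 'a => (nat => real) => 'a" where
 "cpt p a = restrict (%_. a) (standard_simplex p)"

lemma cpt_simplex: "singular_simplex p (top_of_set {a}) f \<longleftrightarrow> f = cpt p a"
by (auto simp: simplex_iff cpt_def extensional_def fun_eq_iff restrict_def)

lemma tchain_point: "c : tchain p {a} \<longleftrightarrow> (EX k. c = sc k (gen (cpt p a)))"
proof
 assume "c : tchain p {a}"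
 hence "supp c <= {cpt p a}" by (simp add: tchain_def cpt_simplex)
 thus "EX k. c = sc k (gen (cpt p a))"
 proof (induction rule: chain_induct)
  case zero
  show ?case by (rule exI[of _ 0]) simp
 next
  case (gen x)
  thus ?case by (intro exI[of _ 1]) simp
 next
  case (add a b)
  thus ?case by (metis tc.scale_left_distrib)
 next
  case (scale k a)
  thus ?case by (metis tc.scale_scale)
 qed
next
 assume "EX k. c = sc k (gen (cpt p a))"
 thus "c : tchain p {a}"
  by (auto intro!: tc.subspace_scale[OF tchain_subspace] simp: tchain_gen cpt_simplex)
qed

lemma Tw_cpt:
 assumes "a : X" "singular_simplex q (spx p) ka"
 shows "Tw q (cpt p a) iv (frag_of ka) = gen (cpt q a)"
proof -
 have k: "ka ` standard_simplex q <= standard_simplex p" using assms(2) by (simp add: simplex_iff)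
 hence v: "ka iv : standard_simplex p" by auto
 have "wt (%_. a) (ka iv) iv = wt (cpt p a) (ka iv) iv"
  by (rule wt_cong_path[OF fconvex_simplex[of p]]) (use v assms(1) in \<open>auto simp: cpt_def\<close>)
 moreover have "simplex_map q (cpt p a) ka = cpt q a"
  using k by (auto simp: simplex_map_def cpt_def restrict_def fun_eq_iff)
 ultimately show ?thesis using hol_const[OF assms(1)] by (simp add: wt_def o_def Tw_of)
qed

text \<open>All faces coincide and all weights are 1, so only an alternating sum of ones is
  left.\<close>

lemma bd_cpt:
 assumes "a : X"
 shows "bd (Suc p) (gen (cpt (Suc p) a)) = (if even (Suc p) then gen (cpt p a) else 0)"
proof -
 let ?f = "%k. singular_face (Suc p) k (idp (Suc p))"
 have idp: "singular_simplex (Suc p) (top_of_set (standard_simplex (Suc p))) (idp (Suc p))"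
  using idp_chain[of "Suc p"] by (simp only: singular_chain_of)
 have face: "singular_simplex p (top_of_set (standard_simplex (Suc p))) (?f k)" if "k <= Suc p" for k
  using singular_simplex_singular_face[OF idp, of k] that by simp
 have "bd (Suc p) (gen (cpt (Suc p) a)) = Tw p (cpt (Suc p) a) iv (\<Sum>k\<le>Suc p. frag_cmul ((-1) ^ k) (frag_of (?f k)))"
  by (simp add: bd_gen chain_boundary_def)
 also have "... = (\<Sum>k\<le>Suc p. sc ((-1) ^ k) (Tw p (cpt (Suc p) a) iv (frag_of (?f k))))"
  by (simp only: Tw_sum Tw_cmul of_int_power of_int_minus of_int_1)
 also have "... = (\<Sum>k\<le>Suc p. sc ((-1) ^ k) (gen (cpt p a)))"
  by (rule sum.cong) (simp_all only: Tw_cpt[OF assms face] atMost_iff)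
 also have "... = sc (\<Sum>k\<le>Suc p. (-1) ^ k) (gen (cpt p a))" by (rule tc.scale_sum_left[symmetric])
 also have "(\<Sum>k\<le>n. (-1) ^ k) = (if even n then 1 else (0::complex))" for n by (induction n) auto
 finally show ?thesis by simp
qed

lemma thc_point: assumes "a : X" shows "thc {a} {} 0 1" unfolding thc_def hc_def
proof (intro conjI allI impI)
 have g: "gen (cpt p a) : tchain p {a}" for p by (simp add: tchain_gen cpt_simplex)
 have gnz: "sc k (gen (cpt p a)) = 0 \<longleftrightarrow> k = 0" for k p by (simp add: gen_nz)
 show "rz (tch {a}) (tch {}) p <= rb (tch {a}) (tch {}) p" if p0: "p ~= 0" for p
 proof
  fix z assume "z : rz (tch {a}) (tch {}) p"
  hence z: "z : tchain p {a}" and dz: "bd p z = 0" by (auto simp: rz_def tchain_empty)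
  obtain k where k: "z = sc k (gen (cpt p a))" using z tchain_point by blast
  obtain q where q: "p = Suc q" using p0 by (cases p) auto
  show "z : rb (tch {a}) (tch {}) p"
  proof (cases "even p")
   case True
   hence "z = bd (Suc p) 0 + 0" using dz unfolding k q using k by (simp add: bd_sc bd_cpt[OF assms])
   thus ?thesis using z by (intro rbI[of 0 _ _ 0]) (auto simp: tchain_0)
  next
   case False
   hence "z = bd (Suc p) (sc k (gen (cpt (Suc p) a))) + 0"
    using k by (simp add: bd_sc bd_cpt[OF assms])
   thus ?thesis using z g by (intro rbI[of "sc k (gen (cpt (Suc p) a))" _ _ 0])
     (auto simp: tchain_0 intro!: tc.subspace_scale[OF tchain_subspace])
  qed
 qed
 show "qd (rz (tch {a}) (tch {}) 0) (rb (tch {a}) (tch {}) 0) 1" unfolding qd_def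
 proof (intro exI[of _ "%_. gen (cpt 0 a)"] conjI allI impI ballI)
  show "gen (cpt 0 a) : rz (tch {a}) (tch {}) 0" using g by (simp add: rz_def bd_degree_0 tchain_0)
  fix z assume "z : rz (tch {a}) (tch {}) 0"
  then obtain k where k: "z = sc k (gen (cpt 0 a))"
   using tchain_point[of z 0 a] by (auto simp: rz_def)
  have "z - (\<Sum>i<1::nat. sc ((%_. k) i) (gen (cpt 0 a))) : rb (tch {a}) (tch {}) 0" unfolding k
   by (intro rbI[of 0 _ _ 0]) (auto simp: tchain_0)
  from exI[where P = "%f. z - (\<Sum>i<1::nat. sc (f i) (gen (cpt 0 a))) : rb (tch {a}) (tch {}) 0", OF this] show "EX f. z - (\<Sum>i<1::nat. sc (f i) (gen (cpt 0 a))) : rb (tch {a}) (tch {}) 0"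
   .
 next
  fix f :: "nat => complex" and i :: nat
  assume *: "(\<Sum>i<1::nat. sc (f i) (gen (cpt 0 a))) : rb (tch {a}) (tch {}) 0" and i: "i < 1"
  then obtain e y where "e : tchain (Suc 0) {a}" "y : tchain 0 {}" and eq: "sc (f 0) (gen (cpt 0 a)) = bd (Suc 0) e + y" 
   by (auto simp: lessThan_Suc intro: rbE)
  hence y: "y = 0" and "EX k. e = sc k (gen (cpt (Suc 0) a))"
   using tchain_point by (auto simp: tchain_empty)
  then obtain k where "e = sc k (gen (cpt (Suc 0) a))" by blast
  thus "f i = 0" using eq y gnz i by (simp add: bd_sc bd_cpt[OF assms])
 qed
qed

lemma thc_convex:
 assumes "S <= X" "convex S" "S ~= {}"
 shows "thc S {} 0 1"
proof -
 obtain a where a: "a : S" using assms by auto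
 have "thz S {a}"
 proof (rule thz_push[where h = "%x t. (1 - t) *\<^sub>R x + t *\<^sub>R a"])
  show "continuous_on (S \<times> {0..1}) (%z. (1 - snd z) *\<^sub>R fst z + snd z *\<^sub>R a)"
   by (intro continuous_intros)
  show "(1 - t) *\<^sub>R x + t *\<^sub>R a : S" if "x : S" "0 <= t" "t <= 1" for x t
   using convexD_alt[OF assms(2) that(1) a that(2,3)] .
  show "EX N. ALL x:K. ((%x. (1 - 1) *\<^sub>R x + 1 *\<^sub>R a) ^^ N) x : {a}" for K
   by (rule exI[of _ 1]) simp
 qed (use assms a in \<open>auto simp: scaleR_left_distrib[symmetric]\<close>)
 thus ?thesis using thz_top[of S "{a}" "{}" 0 1] thc_point[of a] a assms(1) by auto
qed

end

section \<open>Change of space and of coefficients\<close>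

lemma hc_iso:
 assumes "cplx s d" "cplx s' d'" and A: "cplx.subcx s d A"
  and add: "!!p x y. F p (x + y) = F p x + F p y" and sc: "!!p k x. F p (s k x) = s' k (F p x)"
  and comm: "!!p x. x : A p ==> F (p - 1) (d p x) = d' p (F p x)"
  and in_A': "!!p x. x : A p ==> F p x : A' p" and onto: "!!p y. y : A' p ==> EX x:A p. y = F p x"
  and B: "!!p x. x : A p ==> F p x : B' p \<longleftrightarrow> x : B p" and hc: "cplx.hc s d A B k b"
 shows "cplx.hc s' d' A' B' k b"
proof -
 interpret C: cplx s d by fact
 interpret D: cplx s' d' by fact
 note a = C.subcx_simps[OF A]
 have diff: "F p (x - y) = F p x - F p y" for p x y
  using add[of p "x - y" y] by (simp add: eq_diff_eq)
 have F0: "F p 0 = 0" for p using diff[of p 0 0] by simp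
 have z: "F p x : D.rz A' B' p \<longleftrightarrow> x : C.rz A B p" if "x : A p" for p x
  using that in_A'[OF that] B[OF a(5)[OF that]] comm[OF that] by (simp add: C.rz_def D.rz_def)
 have r: "F p x : D.rb A' B' p \<longleftrightarrow> x : C.rb A B p" if x: "x : A p" for p x
 proof
  assume "F p x : D.rb A' B' p"
  then obtain e' where e': "e' : A' (Suc p)" "F p x - d' (Suc p) e' : B' p" by (auto simp: D.rb_def)
  then obtain e where e: "e : A (Suc p)" "e' = F (Suc p) e" using onto by blast
  show "x : C.rb A B p" using comm[OF e(1)] using B[OF a(3)[OF x a(6)[OF e(1)]]] e'(2) using x e(1) unfolding C.rb_def
   by (auto simp: diff e(2))
 next
  assume "x : C.rb A B p"
  then obtain e where e: "e : A (Suc p)" "x - d (Suc p) e : B p" by (auto simp: C.rb_def)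
  show "F p x : D.rb A' B' p" using comm[OF e(1)] using B[OF a(3)[OF x a(6)[OF e(1)]]] e(2) using in_A' x e(1) unfolding D.rb_def
   by (auto simp: diff)
 qed
 have "C.hc A B k b \<longleftrightarrow> D.hc A' B' k b"
 proof (rule hc_transfer[OF assms(1,2), of "%p x y. x : A p & y = F p x"])
  show "EX x:C.rz A B p. x : A p & y = F p x" if y: "y : D.rz A' B' p" for p y
  using y onto z by (fastforce simp: D.rz_def)
 qed (use a add sc F0 r z C.rz_def in auto)
 thus ?thesis using hc by simp
qed

text \<open>Pushforward combined with a gauge transformation: \<open>u x\<close> is the factor
  between the coefficients over \<open>x\<close> and over \<open>g x\<close>.\<close>

definition push_sx where "push_sx u g p = lext (%f. sc (u (f iv)) (gen (simplex_map p g f)))"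

lemma push_sx_gen: "push_sx u g p (gen f) = sc (u (f iv)) (gen (simplex_map p g f))"
 by (simp add: push_sx_def)

lemma push_sx_in:
 assumes "c : tchain p A" "continuous_on A g" "g ` A <= B"
 shows "push_sx u g p c : tchain p B" unfolding push_sx_def
proof (rule tchain_lext)
 fix f assume "f : supp c"
 hence "singular_simplex p (top_of_set A) f" using assms(1) by (auto simp: tchain_def)
 thus "sc (u (f iv)) (gen (simplex_map p g f)) : tchain p B"
  using simplex_map_top[OF _ assms(2,3)] by (intro tc.subspace_scale[OF tchain_subspace]) (simp add: tchain_gen)
qed

lemma push_sx_inv:
 assumes "c : tchain p A" "!!x. x : A ==> g' (g x) = x" "!!x. x : A ==> u' (g x) * u x = 1"
 shows "push_sx u' g' p (push_sx u g p c) = c"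
proof -
 have "supp c <= {f. singular_simplex p (top_of_set A) f}" using assms(1) by (simp add: tchain_def)
 thus ?thesis
 proof (induction rule: chain_induct)
  case (gen f)
  hence f: "f ` standard_simplex p <= A" "f : extensional (standard_simplex p)"
   by (auto simp: simplex_iff)
  have "simplex_map p g' (simplex_map p g f) = f"
   using f assms(2) by (auto simp: simplex_map_def restrict_def fun_eq_iff extensional_def)
  moreover have "f iv : A" using f(1) by auto
  ultimately show ?case using assms(3)[of "f iv"]
   by (simp add: simplex_map_def push_sx_def lext_sc mult.commute)
 qed (simp_all add: push_sx_def lext_add lext_sc)
qed

text \<open>Systems that correspond under \<open>g\<close> up to the gauge transformation
  \<open>u\<close> are isomorphic, and the rescaled pushforward is an isomorphism of twisted
  complexes. Only \<open>S\<close> is mapped, so systems on different ambient spaces can be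
  compared.\<close>

lemma thc_transport:
 fixes g :: "'a::real_normed_vector => 'b::real_normed_vector"
 assumes "holonomy X hol" "holonomy X' hol'"
  and S: "S <= X" "continuous_on S g" "g ` S <= X'" "continuous_on (g ` S) g'" "!!x. x : S ==> g' (g x) = x"
  and u: "!!x. x : S ==> u x ~= 0"
  and hol: "!!gam. path gam ==> path_image gam <= S ==> hol' (g o gam) = u (pathstart gam) * hol gam / u (pathfinish gam)"
  and AB: "A <= S" "B <= A" and hc: "holonomy.thc hol A B k b"
 shows "holonomy.thc hol' (g ` A) (g ` B) k b"
proof -
 interpret C: holonomy X hol by fact
 interpret D: holonomy X' hol' by fact
 define u' where "u' y = 1 / u (g' y)" for y
 have AX: "A <= X" and gA: "g ` A <= g ` S" using AB S by auto
 have contA: "continuous_on A g" "continuous_on B g"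
  using S(2) AB by (auto intro: continuous_on_subset)
 have contA': "continuous_on (g ` A) g'" "continuous_on (g ` B) g'"
  using S(4) AB by (auto intro!: continuous_on_subset[OF S(4)])
 have ginv: "g' ` g ` A <= A" "g' ` g ` B <= B" using S(5) AB by auto
 have inv1: "push_sx u' g' p (push_sx u g p c) = c" if "c : tchain p A" for p c
  using AB(1) S(5) u by (intro push_sx_inv[OF that]) (auto simp: u'_def subset_iff)
 have inv2: "push_sx u g p (push_sx u' g' p c) = c" if "c : tchain p (g ` A)" for p c
  using AB(1) S(5) u by (intro push_sx_inv[OF that]) (auto simp: u'_def subset_iff)
 have comm: "push_sx u g (p - 1) (C.bd p x) = D.bd p (push_sx u g p x)" if "x : tchain p A" for p x
 proof -
  have "supp x <= {f. singular_simplex p (top_of_set A) f}" using that by (simp add: tchain_def)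
  thus ?thesis
  proof (induction rule: chain_induct)
   case (gen f)
   hence f: "continuous_on (standard_simplex p) f" "f ` standard_simplex p <= A"
    by (auto simp: simplex_iff)
   let ?s = "bdi p"
   let ?gf = "simplex_map p g f"
   have gf: "?gf x = g (f x)" if "x : standard_simplex p" for x
    using that by (simp add: simplex_map_def)
   have gfc: "continuous_on (standard_simplex p) ?gf" "?gf ` standard_simplex p <= X'"
    using simplex_map_top[OF CollectD[OF gen] contA(1) order_trans[OF image_mono[OF AB(1)] S(3)]]
    by (auto simp: simplex_iff)
   have key: "C.wt f (ka iv) iv * u (f (ka iv)) = u (f iv) * D.wt ?gf (ka iv) iv"
    and key2: "simplex_map (p - 1) g (simplex_map (p - 1) f ka) = simplex_map (p - 1) ?gf ka"
    and key3: "simplex_map (p - 1) f ka iv = f (ka iv)" if "ka : supp ?s" for ka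
   proof -
    have ka: "ka ` standard_simplex (p - 1) <= standard_simplex p"
     using C.singular_chain_boundary_idp[of p] that
     unfolding singular_chain_def simplex_iff by blast
    hence k: "ka iv : standard_simplex p" by auto
    let ?c = "seg (ka iv) iv"
    have c: "path_image ?c <= standard_simplex p"
     by (rule C.path_seg_in[OF fconvex_simplex k initial_vertex_simplex])
    have fc: "path (f o ?c)" "path_image (f o ?c) <= A"
     using c f by (auto simp: path_image_compose intro!: path_continuous_image[OF path_seg] continuous_on_subset[OF f(1)])
    have "D.wt ?gf (ka iv) iv = hol' (g o (f o ?c))" unfolding D.wt_def
    proof (rule D.hol_cong)
     show "path (?gf o ?c)"
      using c gfc(1) by (intro path_continuous_image[OF path_seg] continuous_on_subset[OF gfc(1)])
     show "path_image (?gf o ?c) <= X'" using c gfc(2) by (auto simp: path_image_compose)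
     show "(?gf o ?c) t = (g o (f o ?c)) t" if "t : {0..1}" for t
     proof -
      show ?thesis using c that using gf by (fastforce simp: path_image_def)
     qed
    qed
    also have "... = u (f (ka iv)) * C.wt f (ka iv) iv / u (f iv)"
     using hol[OF fc(1) order_trans[OF fc(2) AB(1)]] by (simp add: C.wt_def pathstart_def pathfinish_def)
    finally show "C.wt f (ka iv) iv * u (f (ka iv)) = u (f iv) * D.wt ?gf (ka iv) iv"
     using u[of "f iv"] f(2) AB(1) by (auto simp: subset_iff field_simps)
    show "simplex_map (p - 1) g (simplex_map (p - 1) f ka) = simplex_map (p - 1) ?gf ka"
     using ka gf by (auto simp: simplex_map_def restrict_def fun_eq_iff)
    show "simplex_map (p - 1) f ka iv = f (ka iv)" by (simp add: simplex_map_def)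
   qed
   have keys: "supp (cx ?s) = supp ?s" by (rule keys_cx)
   have v0: "?gf iv = g (f iv)" by (simp add: simplex_map_def)
   have "push_sx u g (p - 1) (C.bd p (gen f)) = lext (%ka. sc (C.wt f (ka iv) iv) (push_sx u g (p - 1) (gen (simplex_map (p - 1) f ka)))) (cx ?s)"
    unfolding C.bd_gen C.Tw_def push_sx_def lext_def[of _ "cx ?s"] by (simp only: lext_sum lext_sc)
   also have "... = lext (%ka. sc (u (f iv)) (sc (D.wt ?gf (ka iv) iv) (gen (simplex_map (p - 1) ?gf ka)))) (cx ?s)"
    by (rule lext_cong) (simp only: keys push_sx_gen key2 key3 key tc.scale_scale)
   also have "... = sc (u (f iv)) (D.bd p (gen ?gf))"
    unfolding D.bd_gen D.Tw_def lext_def tc.scale_sum_right by (simp only: tc.scale_scale mult_ac)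
   also have "... = D.bd p (push_sx u g p (gen f))" by (simp add: push_sx_gen D.bd_sc)
   finally show ?case .
  qed (simp_all add: push_sx_def lext_add lext_sc C.bd_add C.bd_sc D.bd_add D.bd_sc)
 qed
 show ?thesis using hc unfolding C.thc_def D.thc_def
 proof (rule hc_iso[where F = "push_sx u g", OF C.cplx_axioms D.cplx_axioms C.subcx_tchain[OF AX], rotated -1])
  show "push_sx u g p x : tchain p (g ` A)" if "x : tchain p A" for p x
   by (rule push_sx_in[OF that contA(1)]) simp
  show "EX x:tchain p A. y = push_sx u g p x" if "y : tchain p (g ` A)" for p y
   by (rule bexI[OF _ push_sx_in[OF that contA'(1) ginv(1)]]) (rule inv2[OF that, symmetric])
  show "push_sx u g p x : tchain p (g ` B) \<longleftrightarrow> x : tchain p B" if "x : tchain p A" for p x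
   using push_sx_in[OF _ contA(2) order_refl, of x p u] push_sx_in[OF _ contA'(2) ginv(2), of "push_sx u g p x" p u'] inv1[OF that]
   by auto
  show "push_sx u g (p - 1) (C.bd p x) = D.bd p (push_sx u g p x)" if "x : tchain p A" for p x
   by (rule comm[OF that])
 qed (simp_all add: push_sx_def lext_add lext_sc)
qed

section \<open>Affine functionals\<close>

type_synonym 'n aff = "(complex ^ 'n) \<times> complex"

definition cdot :: "complex ^ 'n => complex ^ 'n => complex" where
 "cdot a x = (SUM i:UNIV. a $ i * x $ i)"

definition ev :: "'n aff => complex ^ 'n => complex" where "ev f x = cdot (fst f) x + snd f"

lemma cdot_simps [simp]:
 "cdot a (x + y) = cdot a x + cdot a y" "cdot a (x - y) = cdot a x - cdot a y" "cdot a (- x) = - cdot a x"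
 "cdot a 0 = 0" "cdot 0 x = 0" "cdot a (c *s x) = c * cdot a x"
 "cdot (a + b) x = cdot a x + cdot b x" "cdot (a - b) x = cdot a x - cdot b x" "cdot (c *s a) x = c * cdot a x"
 "cdot (- a) x = - cdot a x"
 by (simp_all add: cdot_def sum.distrib sum_subtractf sum_negf algebra_simps sum_distrib_left)

lemma scaleR_vec_eq: "r *\<^sub>R x = complex_of_real r *s (x :: complex ^ 'n)"
 unfolding vec_eq_iff vector_scaleR_component vector_smult_component by (simp add: scaleR_conv_of_real)

lemma cdot_scaleR [simp]: "cdot a (r *\<^sub>R x) = of_real r * cdot a x" by (simp add: scaleR_vec_eq)

lemma cdot_sum: "cdot a (SUM i:I. f i) = (SUM i:I. cdot a (f i))"
 by (induction I rule: infinite_finite_induct) auto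

lemma cdot_sum_left: "cdot (SUM i:I. f i) x = (SUM i:I. cdot (f i) x)"
 by (induction I rule: infinite_finite_induct) auto

lemma ev_add: "ev f (x + v) = ev f x + cdot (fst f) v" by (simp add: ev_def)

lemma continuous_on_cdot [continuous_intros]: "continuous_on S f ==> continuous_on S (%x. cdot a (f x))"
 unfolding cdot_def by (intro continuous_intros)

lemma continuous_on_ev [continuous_intros]: "continuous_on S f ==> continuous_on S (%x. ev a (f x))"
 unfolding ev_def by (intro continuous_intros)

lemma continuous_on_vec_scale [continuous_intros]:
 "continuous_on S c ==> continuous_on S f ==> continuous_on S (%x. c x *s (f x :: complex ^ 'n))"
 unfolding vector_scalar_mult_def by (intro continuous_intros)

lemma cdot_le: "cmod (cdot a x) <= (SUM i:UNIV. cmod (a $ i)) * norm x"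
proof -
 have "cmod (cdot a x) <= (SUM i:UNIV. cmod (a $ i * x $ i))" unfolding cdot_def by (rule norm_sum)
 also have "... <= (SUM i:UNIV. cmod (a $ i) * norm x)"
  unfolding norm_mult by (intro sum_mono mult_left_mono Finite_Cartesian_Product.norm_nth_le norm_ge_zero)
 finally show ?thesis by (simp add: sum_distrib_right)
qed

text \<open>A linear form that is 1 on \<open>a\<close> and 0 on a basis of the span of
  \<open>S\<close>, represented by its coordinate vector. Such vectors are the directions of the
  fields below: the functionals in \<open>S\<close> stand still while \<open>a\<close> moves at unit
  speed.\<close>

lemma cdot_annihilate:
 fixes a :: "complex ^ 'n"
 assumes "a ~: vec.span S" obtains w where "!!s. s : S ==> cdot s w = 0" "cdot a w = 1"
proof -
 interpret P: vector_space_pair "(*s) :: complex => complex ^ 'n => _" "(*) :: complex => complex => _"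
  by unfold_locales (auto simp: algebra_simps)
 obtain B where B: "B <= S" "vec.independent B" "S <= vec.span B"
  using vec.maximal_independent_subset[of S] by blast
 have ind: "vec.independent (insert a B)"
  using vec.independent_insertI[of a B] assms B(2) B vec.span_mono[of B S] vec.span_minimal[OF B(3)]
  by simp
 obtain g where g: "Vector_Spaces.linear (*s) (*) g" "ALL x:insert a B. g x = (if x = a then 1 else 0)"
  using P.linear_independent_extend[OF ind, of "%x. if x = a then 1 else 0"] by blast
 interpret g: Vector_Spaces.linear "(*s) :: complex => complex ^ 'n => _" "(*)" g by (rule g(1))
 define w where "w = (\<chi> i. g (axis i 1))"
 have gw: "g x = cdot x w" for x
 proof -
  have "g x = g (SUM i:UNIV. x $ i *s axis i 1)"  by (simp add: basis_expansion)
  also have "... = (SUM i:UNIV. g (x $ i *s axis i 1))" by (rule g.sum)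
  finally have "g x = (SUM i:UNIV. g (x $ i *s axis i 1))" .
  thus ?thesis by (simp add: cdot_def w_def g.scale)
 qed
 have "cdot s w = 0" if "s : S" for s
 proof -
  have "s : vec.span B" using B(3) that by auto
  thus ?thesis
  proof (induction rule: vec.span_induct_alt)
   case (step c x y)
   show ?case using step(1) assms B(1) vec.span_base using step g(2) gw by auto
  qed simp
 qed
 thus ?thesis using g(2) gw using that by auto
qed

text \<open>The quantitative form of \<open>h\<close> having the value \<open>v\<close> where all of
  \<open>G\<close> vanish; such a \<open>v\<close> is a candidate for a critical value.\<close>

abbreviation domi :: "('n::finite) aff set => 'n aff => complex => real => bool" where
 "domi G h v C == (ALL x m. 0 <= m --> (ALL g:G. cmod (ev g x) <= m) --> cmod (ev h x - v) <= C * m)"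

text \<open>The linear part of \<open>u\<close> is a combination of those of \<open>F\<close>, and
  \<open>v\<close> is the constant left over. If \<open>F\<close> has a common zero,
  \<open>v\<close> is the value of \<open>u\<close> there; otherwise it depends on the chosen
  combination.\<close>

lemma dependent_bound:
 assumes "finite F" "fst u : vec.span (fst ` F)"
 obtains v C where "C >= 0" "!!x m. (!!g. g : F ==> cmod (ev g x) <= m) ==> cmod (ev u x - v) <= C * m"
  "!!p. (!!g. g : F ==> ev g p = 0) ==> v = ev u p"
proof -
 have "fst u : vec.span (fst ` F) ==> EX c. fst u = (SUM g:F. c g *s fst g)" using assms(1)
 proof (induction F arbitrary: u rule: finite_induct)
  case (insert g F)
  then obtain k where k: "fst u - k *s fst g : vec.span (fst ` F)" by (auto simp: vec.span_insert)
  obtain c where c: "fst u - k *s fst g = (SUM g:F. c g *s fst g)"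
   using insert.IH[of "(fst u - k *s fst g, 0)"] k by auto
  have "fst u = (SUM h:insert g F. (c(g := k)) h *s fst h)"
  proof -
   have "(SUM h:F. (c(g := k)) h *s fst h) = (SUM h:F. c h *s fst h)"
    using insert.hyps by (intro sum.cong) auto
   thus ?thesis using insert.hyps c by (simp add: algebra_simps)
  qed
  thus ?case by blast
 qed simp
 then obtain c where c: "fst u = (SUM g:F. c g *s fst g)" using assms(2) by blast
 define v where "v = snd u - (SUM g:F. c g * snd g)"
 have eq: "ev u x - v = (SUM g:F. c g * ev g x)" for x
  by (simp add: v_def ev_def c cdot_sum_left sum.distrib algebra_simps)
 show ?thesis
 proof
  show "(SUM g:F. cmod (c g)) >= 0" by (simp add: sum_nonneg)
  show "cmod (ev u x - v) <= (SUM g:F. cmod (c g)) * m" if "!!g. g : F ==> cmod (ev g x) <= m" for x m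
  proof -
   have "cmod (ev u x - v) <= (SUM g:F. cmod (c g * ev g x))" unfolding eq by (rule norm_sum)
   also have "... <= (SUM g:F. cmod (c g) * m)"
    using that by (intro sum_mono) (simp add: norm_mult mult_left_mono)
   finally show ?thesis by (simp add: sum_distrib_right)
  qed
  show "v = ev u p" if "!!g. g : F ==> ev g p = 0" for p using eq[of p] that by simp
 qed
qed

section \<open>Vector fields adapted to finitely many functionals\<close>

lemma prod_plus_one_minus:
 assumes "finite G"
 shows "(SUM S:Pow G. (PROD g:S. a g) * (PROD g:G - S. 1 - a g)) = (1::real)"
 using prod_add[OF assms, of a "%g. 1 - a g"] by simp

text \<open>A partition of unity indexed by the subsets of \<open>G\<close>. \<open>q g x\<close>
  decides whether \<open>g\<close> must be respected at \<open>x\<close> (at most 1), must not be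
  (at least 2), or may be; inadmissible sets have weight 0. Conditions of the form
  \<open>cdot b w = k\<close> are affine in \<open>w\<close> and survive averaging.\<close>

lemma vector_field:
 fixes q :: "'g => complex ^ 'n => real" and P :: "'g set => complex ^ 'n => bool"
 assumes G: "finite G" and q: "!!g. g : G ==> continuous_on X (q g)"
  and ex: "!!S x. S <= G ==> x : X ==> (!!g. g : G ==> q g x <= 1 ==> g : S) ==>
   (!!g. g : S ==> q g x < 2) ==> EX w. P S w"
 obtains W C where "continuous_on X W" "C > 0" "!!x. x : X ==> norm (W x) <= C"
  "!!x b k. x : X ==> (!!S w. S <= G ==> (!!g. g : G ==> q g x <= 1 ==> g : S) ==> P S w ==> cdot b w = k) ==>
    cdot b (W x) = k"
proof -
 define s where "s g x = max 0 (min 1 (2 - q g x))" for g x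
 define ro where "ro S x = (PROD g:S. s g x) * (PROD g:G - S. 1 - s g x)" for S x
 define w where "w S = (SOME w. P S w)" for S
 define W where "W x = (SUM S:Pow G. ro S x *\<^sub>R w S)" for x
 have s01: "0 <= s g x" "s g x <= 1" for g x by (auto simp: s_def)
 have ro0: "0 <= ro S x" for S x
  unfolding ro_def using s01 by (intro mult_nonneg_nonneg prod_nonneg) auto
 have ro1: "(SUM S:Pow G. ro S x) = 1" for x unfolding ro_def by (rule prod_plus_one_minus[OF G])
 have adm: "(ALL g:G. q g x <= 1 --> g : S) & (ALL g:S. q g x < 2)" if "ro S x ~= 0" "S : Pow G" for S x
 proof (intro conjI ballI impI)
  have fin: "finite S" "finite (G - S)" using that(2) G finite_subset by auto
  fix g assume g: "g : G" "q g x <= 1"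
  show "g : S"
  proof (rule ccontr)
   assume "g ~: S"
   hence "(PROD g:G - S. 1 - s g x) = 0"
    using g fin by (intro prod_zero) (auto simp: s_def intro!: bexI[of _ g])
   thus False using that(1) by (simp add: ro_def)
  qed
 next
  have fin: "finite S" using that(2) G finite_subset by auto
  fix g assume g: "g : S"
  show "q g x < 2"
  proof (rule ccontr)
   assume "~ q g x < 2"
   hence "(PROD g:S. s g x) = 0"
    using g fin by (intro prod_zero) (auto simp: s_def intro!: bexI[of _ g])
   thus False using that(1) by (simp add: ro_def)
  qed
 qed
 show ?thesis
 proof
  show "continuous_on X W" unfolding W_def ro_def s_def
   by (intro continuous_intros continuous_on_sum continuous_on_prod q) auto
  show "(SUM S:Pow G. norm (w S)) + 1 > 0" by (simp add: add_nonneg_pos sum_nonneg)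
  show "norm (W x) <= (SUM S:Pow G. norm (w S)) + 1" if "x : X" for x
  proof -
   have "norm (W x) <= (SUM S:Pow G. norm (ro S x *\<^sub>R w S))" unfolding W_def by (rule norm_sum)
   also have "... <= (SUM S:Pow G. norm (w S))"
   proof (rule sum_mono)
    fix S assume "S : Pow G"
    show "norm (ro S x *\<^sub>R w S) <= norm (w S)" using member_le_sum[OF \<open>S : Pow G\<close>, of "%S. ro S x"] ro0 ro1 G using ro0[of S x]
     by (simp add: mult_left_le_one_le)
   qed
   finally show ?thesis by simp
  qed
  fix x b k assume x: "x : X" and k: "!!S w. S <= G ==> (!!g. g : G ==> q g x <= 1 ==> g : S) ==> P S w ==> cdot b w = k"
  have "of_real (ro S x) * cdot b (w S) = of_real (ro S x) * k" if "S : Pow G" for S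
  proof (cases "ro S x = 0")
   case False
   have a: "(ALL g:G. q g x <= 1 --> g : S) & (ALL g:S. q g x < 2)" by (rule adm[OF False that])
   have "EX w. P S w" by (rule ex[OF _ x]) (use a that in auto)
   hence "P S (w S)" unfolding w_def by (rule someI_ex)
   thus ?thesis using k[of S "w S"] a that by auto
  qed simp
  hence "cdot b (W x) = (SUM S:Pow G. of_real (ro S x) * k)"
   unfolding W_def cdot_sum cdot_scaleR by (intro sum.cong) auto
  also have "... = of_real (SUM S:Pow G. ro S x) * k" by (simp add: sum_distrib_right)
  finally show "cdot b (W x) = k" using ro1 by simp
 qed
qed

section \<open>Flows along vector fields\<close>

definition MM :: "'n aff set => (complex ^ 'n) set" where "MM J = {x. ALL h:J. ev h x ~= 0}"

definition TT :: "'n aff set => real => (complex ^ 'n) set" where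
 "TT J ep = {x. EX h:J. cmod (ev h x) < ep}"

text \<open>The possible effects of one time step: the functionals in \<open>K\<close> and the small ones in \<open>J\<close> are
  constant along the flow, those in \<open>L\<close> only where they are not small.\<close>

definition fstep where
 "fstep J ep K L u ze x x' \<longleftrightarrow> (ALL h:J. ev h x' = ev h x \<or> (ep < cmod (ev h x) & ep / 2 < cmod (ev h x'))) &
   (ALL g:K. ev g x' = ev g x) &
   (ALL (g, a):L. ev g x' = ev g x \<or> (cmod (ev g x) < a / 2 & cmod (ev g x') < a)) &
   (EX s:{0..1}. ev u x' = ev u x + of_real s * ze (ev u x))"

lemma fstep_MM:
 assumes "fstep J ep K L u ze x x'" "0 <= ep" "x : MM J"
 shows "x' : MM J" unfolding MM_def
using assms(3) assms(1) assms(2) by (auto simp: MM_def fstep_def intro!: CollectI ballI)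

lemma fstep_TT:
 assumes "fstep J ep K L u ze x x'" "x : TT J ep"
 shows "x' : TT J ep"
proof -
 obtain h where h: "h : J" "cmod (ev h x) < ep" using assms(2) by (auto simp: TT_def)
 have "cmod (ev h x') < ep" using assms(1) h(1) unfolding fstep_def using h by auto
 thus ?thesis using h(1) by (auto simp: TT_def)
qed

text \<open>The Morse step. The field is \<open>ze (ev u x)\<close> times a field \<open>W\<close>
  on which \<open>u\<close> has unit speed, so the motion of \<open>u\<close> is prescribed; the
  functionals in \<open>K\<close>, those of \<open>J\<close> near zero and those of \<open>L\<close>
  away from zero stand still. A step is short against all thresholds, so \<open>fstep\<close>
  describes it, and \<open>A\<close> and \<open>B\<close> only have to be stable under
  \<open>fstep\<close>. Outside \<open>B\<close> the function \<open>m\<close> of \<open>u\<close>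
  is bounded below and drops by a fixed amount per step.\<close>

lemma uflow_gen:
 fixes ze :: "real => complex => complex"
 assumes J: "finite J" and L: "finite L" "!!g a. (g, a) : L ==> 0 < a" and hol: "holonomy (MM J) ta" and eps: "0 < ep"
  and Z: "open Z" "closed Zc" "Zc <= Z" and ze: "!!etp. 0 < etp ==> continuous_on UNIV (ze etp)" "!!etp z. 0 < etp ==> cmod (ze etp z) <= 1"
   "!!etp z. 0 < etp ==> z ~: Zc ==> ze etp z = 0" and AM: "A <= MM J" and BA: "B <= A"
  and etp: "0 < etp0"
  and A: "!!x x' etp. 0 < etp ==> etp <= etp0 ==> x : A ==> fstep J ep K L u (%z. of_real etp * ze etp z) x x' ==> x' : A"
  and B: "!!x x' etp. 0 < etp ==> etp <= etp0 ==> x : B ==> fstep J ep K L u (%z. of_real etp * ze etp z) x x' ==> x' : B"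
  and nondep: "!!x S L'. x : A ==> ev u x : Z ==> S <= J ==> (!!h. h : S ==> cmod (ev h x) < 2 * ep) ==>
    L' <= L ==> (!!g a. (g, a) : L' ==> a / 4 < cmod (ev g x)) ==> fst u ~: vec.span (fst ` (S Un K Un fst ` L'))"
  and m: "continuous_on UNIV m" "!!x. x : A ==> x ~: B ==> m0 <= m (ev u x)"
   "!!etp. 0 < etp ==> etp <= etp0 ==> EX c>0. ALL x:A - B. ALL x':A. ev u x' = ev u x + of_real etp * ze etp (ev u x) --> x' : B \<or> m (ev u x') <= m (ev u x) - (c::real)"
 shows "holonomy.thz ta A B"
proof -
 interpret holonomy "MM J" ta by fact
 let ?G = "Inl ` J Un Inr ` L"
 \<comment> \<open>Normalised for \<open>vector_field\<close>: at most 1 means that the functional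
   has to stand still (\<open>cmod (ev h x) <= ep\<close>, respectively
   \<open>cmod (ev y x) >= a / 2\<close>), below 2 that \<open>nondep\<close> covers it (bounds
   \<open>2 * ep\<close> and \<open>a / 4\<close>).\<close>
 define q where "q g x = (case g of Inl h => cmod (ev h x) / ep | Inr (y, a) => 3 - 4 * cmod (ev y x) / a)"
  for g :: "'a aff + ('a aff \<times> real)" and x
 define P where "P S w \<longleftrightarrow> (ALL h. Inl h : S --> cdot (fst h) w = 0) & (ALL y a. Inr (y, a) : S --> cdot (fst y) w = 0) &
  (ALL g:K. cdot (fst g) w = 0) & cdot (fst u) w = 1" for S :: "('a aff + ('a aff \<times> real)) set" and w
 let ?X = "{x : A. ev u x : Z}"
 have "finite ?G" using J L by simp
 moreover have "continuous_on ?X (q g)" if "g : ?G" for g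
  using that eps L(2) by (cases g) (auto simp: q_def split: prod.splits intro!: continuous_intros)
 moreover have "EX w. P S w" if S: "S <= ?G" "x : ?X" "!!g. g : S ==> q g x < 2" for S x
 proof -
  have "fst u ~: vec.span (fst ` (Inl -` S Un K Un fst ` (Inr -` S)))"
  proof (rule nondep)
   show "x : A" "ev u x : Z" "Inl -` S <= J" "Inr -` S <= L" using S by auto
   show "cmod (ev h x) < 2 * ep" if "h : Inl -` S" for h
    using S(3)[of "Inl h"] that eps by (simp add: q_def field_simps)
   show "a / 4 < cmod (ev y x)" if "(y, a) : Inr -` S" for y a
    using S(3)[of "Inr (y, a)"] that L(2)[of y a] S(1) by (auto simp: q_def field_simps)
  qed
  from cdot_annihilate[OF this] obtain w where "!!s. s : fst ` (Inl -` S Un K Un fst ` (Inr -` S)) ==> cdot s w = 0" "cdot (fst u) w = 1"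
   by blast
  hence "P S w" unfolding P_def by force
  thus ?thesis ..
 qed
 ultimately obtain W C where W: "continuous_on ?X W" "C > 0" "!!x. x : ?X ==> norm (W x) <= C"
  and Wk: "!!x b k. x : ?X ==> (!!S w. S <= ?G ==> (!!g. g : ?G ==> q g x <= 1 ==> g : S) ==> P S w ==> cdot b w = k) ==>
    cdot b (W x) = k" by (rule vector_field[of ?G ?X q P]) blast+
 have Wu: "cdot (fst u) (W x) = 1" if "x : ?X" for x by (rule Wk[OF that]) (simp add: P_def)
 have WK: "cdot (fst g) (W x) = 0" if "x : ?X" "g : K" for x g
  by (rule Wk[OF that(1)]) (use that in \<open>simp add: P_def\<close>)
 have WJ: "cdot (fst h) (W x) = 0" if "x : ?X" "h : J" "cmod (ev h x) <= ep" for x h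
 proof (rule Wk[OF that(1)])
  fix S w assume g: "!!g. g : ?G ==> q g x <= 1 ==> g : S" and "P S w"
  have "Inl h : S" by (rule g) (use that eps in \<open>auto simp: q_def\<close>)
  thus "cdot (fst h) w = 0" using \<open>P S w\<close> unfolding P_def by blast
 qed
 have WL: "cdot (fst y) (W x) = 0" if "x : ?X" "(y, a) : L" "a / 2 <= cmod (ev y x)" for x y a
 proof (rule Wk[OF that(1)])
  fix S w assume g: "!!g. g : ?G ==> q g x <= 1 ==> g : S" and "P S w"
  have "Inr (y, a) : S" by (rule g) (use that L(2)[OF that(2)] in \<open>auto simp: q_def field_simps\<close>)
  thus "cdot (fst y) w = 0" using \<open>P S w\<close> unfolding P_def by blast
 qed
 define Bd where "Bd = C * (SUM g:J Un fst ` L. SUM i:UNIV. cmod (fst g $ i)) + 1"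
 have fin: "finite (J Un fst ` L)" using J L by auto
 have Bd0: "Bd > 0"
  unfolding Bd_def using W(2) by (intro add_nonneg_pos mult_nonneg_nonneg sum_nonneg) auto
 have Bd: "cmod (cdot (fst g) (W x)) <= Bd" if "x : ?X" "g : J Un fst ` L" for x g
 proof -
  have "cmod (cdot (fst g) (W x)) <= (SUM i:UNIV. cmod (fst g $ i)) * norm (W x)" by (rule cdot_le)
  also have "... <= (SUM g:J Un fst ` L. SUM i:UNIV. cmod (fst g $ i)) * C"
  proof (rule mult_mono)
   show "(SUM i:UNIV. cmod (fst g $ i)) <= (SUM g:J Un fst ` L. SUM i:UNIV. cmod (fst g $ i))"
    by (rule member_le_sum[OF that(2) _ fin]) (simp add: sum_nonneg)
  qed (use W(3)[OF that(1)] in \<open>auto intro!: sum_nonneg\<close>)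
  finally show ?thesis by (simp add: Bd_def mult.commute)
 qed
 \<comment> \<open>A step will move each functional by at most a quarter of the smallest threshold.
   This keeps values above \<open>ep\<close> above \<open>ep / 2\<close>, and values below
   \<open>a / 2\<close> below \<open>a\<close>.\<close>
 define amin where "amin = Min (insert ep (snd ` L))"
 have amin: "amin > 0" "amin <= ep" "!!g a. (g, a) : L ==> amin <= a"
  unfolding amin_def using L eps by (auto simp: Min_gr_iff intro!: Min_le image_eqI[of _ snd])
 define etp where "etp = min etp0 (amin / (4 * Bd))"
 have etpp: "0 < etp" "etp <= etp0" "etp * Bd <= amin / 4"
  using etp amin(1) Bd0 by (auto simp: etp_def min_def field_simps)
 \<comment> \<open>\<open>W\<close> is controlled only where \<open>ev u x\<close> lies in
   \<open>Z\<close>. As \<open>ze\<close> vanishes off the closed set \<open>Zc\<close> inside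
   \<open>Z\<close>, the extension by 0 is continuous.\<close>
 define V where "V x = (if ev u x : Z then ze etp (ev u x) *s W x else 0)" for x
 have Vc: "continuous_on A V"
 proof -
  have A_eq: "{x : A. ev u x : Z} Un {x : A. ev u x : - Zc} = A" using Z(3) by auto
  have op: "openin (top_of_set A) {x : A. ev u x : Z'}" if "open Z'" for Z'
  proof -
   have "continuous_on A (ev u)" by (intro continuous_intros)
   from continuous_openin_preimage_gen[OF this that] show ?thesis by (simp add: vimage_def Int_def)
  qed
  have "continuous_on ({x : A. ev u x : Z} Un {x : A. ev u x : - Zc}) V"
  proof (rule continuous_on_Un_local_open)
   show "openin (top_of_set ({x : A. ev u x : Z} Un {x : A. ev u x : - Zc})) {x : A. ev u x : Z}"
    "openin (top_of_set ({x : A. ev u x : Z} Un {x : A. ev u x : - Zc})) {x : A. ev u x : - Zc}"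
    unfolding A_eq using op[OF Z(1)] op[of "- Zc"] Z(2) by (auto simp: open_closed[symmetric] closed_def)
   show "continuous_on {x : A. ev u x : Z} V"
   proof (rule continuous_on_eq)
    show "continuous_on {x : A. ev u x : Z} (%x. ze etp (ev u x) *s W x)"
     by (intro continuous_intros W(1) continuous_on_compose2[OF ze(1)[OF etpp(1)]]) auto
   qed (auto simp: V_def)
   show "continuous_on {x : A. ev u x : - Zc} V"
    by (rule continuous_on_eq[of _ "%x. 0"]) (auto simp: V_def ze(3)[OF etpp(1)])
  qed
  thus ?thesis unfolding A_eq .
 qed
 define h where "h x t = x + (t * etp) *\<^sub>R V x" for x t
 have evh: "ev g (h x t) = ev g x + of_real (t * etp) * cdot (fst g) (V x)" for g x t
  by (simp add: h_def ev_add)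
 have Vsmall: "cmod (of_real (t * etp) * cdot (fst g) (V x)) <= amin / 4"
  if "x : A" "t : {0..1}" "g : J Un fst ` L" for x t g
 proof (cases "ev u x : Z")
  case True
  have "cmod (ze etp (ev u x)) * cmod (cdot (fst g) (W x)) <= 1 * Bd"
   using ze(2)[OF etpp(1)] Bd[of x g] that True by (intro mult_mono) auto
  hence "(t * etp) * (cmod (ze etp (ev u x)) * cmod (cdot (fst g) (W x))) <= (1 * etp) * Bd"
   using that etpp(1) Bd0 by (intro mult_mono) auto
  also have "... <= amin / 4" using etpp(3) by simp
  finally have "(t * etp) * (cmod (ze etp (ev u x)) * cmod (cdot (fst g) (W x))) <= amin / 4" .
  thus ?thesis using that(2) etpp(1) True by (simp add: V_def norm_mult)
 next
  case False
  thus ?thesis using amin by (simp add: V_def)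
 qed
 have Vu: "cdot (fst u) (V x) = ze etp (ev u x)" if "x : A" for x
  using Wu[of x] that Z(3) ze(3)[OF etpp(1), of "ev u x"] by (auto simp: V_def)
 have step: "fstep J ep K L u (%z. of_real etp * ze etp z) x (h x t)" if x: "x : A" and t: "0 <= t" "t <= 1" for x t
  unfolding fstep_def
 proof (intro conjI ballI)
  fix g assume g: "g : J"
  show "ev g (h x t) = ev g x \<or> ep < cmod (ev g x) & ep / 2 < cmod (ev g (h x t))"
  proof (cases "cmod (ev g x) <= ep")
   case True
   thus ?thesis using WJ[of x g] x g by (simp add: evh V_def)
  next
   case False
   show ?thesis using norm_triangle_ineq4[of "ev g (h x t)" "of_real (t * etp) * cdot (fst g) (V x)"] using Vsmall[of x t g] x t g False amin eps
    by (simp add: evh)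
  qed
 next
  fix g assume g: "g : K"
  show "ev g (h x t) = ev g x" using WK[of x g] x g by (simp add: evh V_def)
 next
  fix ga assume ga: "ga : L"
  obtain g a where gae: "ga = (g, a)" by (cases ga)
  show "case ga of (g, a) => ev g (h x t) = ev g x \<or> cmod (ev g x) < a / 2 & cmod (ev g (h x t)) < a"
  proof (cases "a / 2 <= cmod (ev g x)")
   case True
   thus ?thesis using WL[of x g a] x ga gae by (simp add: evh V_def)
  next
   case False
   have "cmod (ev g (h x t)) <= cmod (ev g x) + cmod (of_real (t * etp) * cdot (fst g) (V x))"
    unfolding evh by (rule norm_triangle_ineq)
   thus ?thesis using ga gae using Vsmall[of x t g] x t False amin(1) amin(3)[of g a] ga gae
    by force
  qed
 next
  show "EX s:{0..1}. ev u (h x t) = ev u x + of_real s * (of_real etp * ze etp (ev u x))"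
   using t Vu[OF x] by (intro bexI[of _ t]) (auto simp: evh)
 qed
 show ?thesis
 proof (rule thz_push[where h = h])
  show "continuous_on (A \<times> {0..1}) (%z. h (fst z) (snd z))"
   unfolding h_def by (intro continuous_intros continuous_on_compose2[OF Vc]) auto
  show "h x t : A" if "x : A" "0 <= t" "t <= 1" for x t
   using A[OF etpp(1,2) that(1) step[OF that]] .
  show hB: "h x t : B" if "x : B" "0 <= t" "t <= 1" for x t
   using B[OF etpp(1,2) that(1) step[OF _ that(2,3)]] that(1) BA by auto
  fix Q assume Q: "compact Q" "Q <= A"
  obtain c where c: "c > 0" "!!x x'. x : A - B ==> x' : A ==> ev u x' = ev u x + of_real etp * ze etp (ev u x) ==> x' : B \<or> m (ev u x') <= m (ev u x) - c"
   using m(3)[OF etpp(1,2)] by blast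
  have "bounded ((%x. m (ev u x)) ` Q)"
   by (intro compact_imp_bounded compact_continuous_image Q continuous_on_compose2[OF m(1)] continuous_intros) auto
  then obtain D where D: "!!x. x : Q ==> m (ev u x) <= D"
   unfolding bounded_iff by (metis abs_le_D1 imageI real_norm_def)
  obtain N :: nat where N: "D - m0 < of_nat N * c" using reals_Archimedean3[OF c(1)] by blast
  have hN: "(((%x. h x 1) ^^ n) x : B) \<or> (((%x. h x 1) ^^ n) x : A & m (ev u (((%x. h x 1) ^^ n) x)) <= D - of_nat n * c)" if "x : Q" for x n
  proof (induction n)
   case 0
   thus ?case using D[OF that] that Q(2) by auto
  next
   case (Suc n)
   let ?x = "((%x. h x 1) ^^ n) x"
   show ?case
   proof (cases "?x : B")
    case True
    thus ?thesis using hB[of ?x 1] by simp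
   next
    case False
    hence x: "?x : A" "m (ev u ?x) <= D - of_nat n * c" using Suc by auto
    have "ev u (h ?x 1) = ev u ?x + of_real etp * ze etp (ev u ?x)"
     using Vu[OF x(1)] by (simp add: evh)
    moreover have hA: "h ?x 1 : A" using A[OF etpp(1,2) x(1) step[OF x(1), of 1]] by simp
    ultimately show ?thesis using c(2)[of ?x "h ?x 1"] x(1) False using x(2) hA
     by (auto simp: algebra_simps)
   qed
  qed
  show "EX N. ALL x:Q. ((%x. h x 1) ^^ N) x : B" using hN m(2) N by (smt (verit) hN m(2) N ballI)
 qed (use AM BA in \<open>auto simp: h_def\<close>)
qed

text \<open>The speed of \<open>u\<close> is independent of the step size here; the dependence
  serves to hit a prescribed value of \<open>u\<close> exactly.\<close>

lemma uflow:
 fixes ze :: "complex => complex"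
 assumes J: "finite J" and L: "finite L" "!!g a. (g, a) : L ==> 0 < a" and hol: "holonomy (MM J) ta" and eps: "0 < ep"
  and Z: "open Z" "closed Zc" "Zc <= Z" and ze: "continuous_on UNIV ze" "!!z. cmod (ze z) <= 1" "!!z. z ~: Zc ==> ze z = 0"
  and AM: "A <= MM J" and BA: "B <= A" and etp: "0 < etp0"
  and A: "!!x x' etp. 0 < etp ==> etp <= etp0 ==> x : A ==> fstep J ep K L u (%z. of_real etp * ze z) x x' ==> x' : A"
  and B: "!!x x' etp. 0 < etp ==> etp <= etp0 ==> x : B ==> fstep J ep K L u (%z. of_real etp * ze z) x x' ==> x' : B"
  and nondep: "!!x S L'. x : A ==> ev u x : Z ==> S <= J ==> (!!h. h : S ==> cmod (ev h x) < 2 * ep) ==>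
    L' <= L ==> (!!g a. (g, a) : L' ==> a / 4 < cmod (ev g x)) ==> fst u ~: vec.span (fst ` (S Un K Un fst ` L'))"
  and m: "continuous_on UNIV m" "!!x. x : A ==> x ~: B ==> m0 <= m (ev u x)"
   "!!etp. 0 < etp ==> etp <= etp0 ==> EX c>0. ALL x:A - B. m (ev u x + of_real etp * ze (ev u x)) <= m (ev u x) - (c::real)"
 shows "holonomy.thz ta A B"
proof (rule uflow_gen[where ze = "%_. ze" and Z = Z and Zc = Zc and ?etp0.0 = etp0 and L = L and K = K and u = u
  and ep = ep and J = J and m = m and ?m0.0 = m0])
 show "EX c>0. ALL x:A - B. ALL x':A. ev u x' = ev u x + of_real etp * ze (ev u x) --> x' : B \<or> m (ev u x') <= m (ev u x) - c"
  if "0 < etp" "etp <= etp0" for etp using m(3)[OF that] by metis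
 show "continuous_on UNIV ze" "cmod (ze z) <= 1" "z ~: Zc ==> ze z = 0" if "0 < etp" for z and etp :: real
  by (fact ze)+
qed (fact assms)+

section \<open>Relative homology of boxes\<close>

definition Om :: "nat => (nat => 'n aff) => (nat => real) => (complex ^ 'n) set" where
 "Om k y e = {x. ALL i:{1..k}. abs (Re (ev (y i) x)) < e i & abs (Im (ev (y i) x)) < e i}"

text \<open>The exit set. A marked side (\<open>t i\<close>) comes from a critical value, which the
  sweep leaves in the direction of smaller real part. An unmarked side belongs to a multiple of a
  member of \<open>J\<close>; its box lies around the zero hyperplane, where the sweeps from both
  directions end.\<close>

definition RR :: "nat => (nat => 'n aff) => (nat => bool) => (nat => real) => (complex ^ 'n) set" where
 "RR k y t e = {x. EX i:{1..k}. t i & Re (ev (y i) x) < - e i / 2}"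

text \<open>Separated scales: \<open>e 0\<close> is the radius of the tubes, \<open>e i\<close> the
  size of the \<open>i\<close>-th side, and the final 1 bounds the largest side in the same way as
  each side bounds the previous one.\<close>

definition chain :: "real => nat => (nat => real) => bool" where
 "chain ka k e \<longleftrightarrow> 0 < e 0 & e (Suc k) = 1 & (ALL i<=k. e i < ka * e (Suc i))"

definition rk :: "('n::finite) aff set => nat => (nat => 'n aff) => nat" where
 "rk J k y = vec.dim (fst ` (J Un y ` {1..k}))"

definition XX where "XX J k y e = MM J Int Om k y e"
definition YY where "YY J k y t e = XX J k y e Int (RR k y t e Un TT J (e 0))"

text \<open>\<open>b\<close> and \<open>ka\<close> stand outside the quantifiers over scales and
  holonomies: the dimension is the same for all of them.\<close>

definition LL :: "('n::finite) aff set => nat => (nat => 'n aff) => (nat => bool) => nat => real => bool" where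
 "LL J k y t b ka \<longleftrightarrow> (ALL e ta. chain ka k e --> holonomy (MM J) ta -->
   holonomy.thc ta (XX J k y e) (YY J k y t e) (rk J k y) b)"

lemma chain_pos:
 assumes "chain ka k e" "ka > 0" "i <= Suc k"
 shows "0 < e i" using assms(3)
proof (induction i)
 case (Suc i)
 hence "0 < ka * e (Suc i)" using assms(1) Suc by (auto simp: chain_def intro: less_trans)
 thus ?case using assms(2) by (simp add: zero_less_mult_iff)
qed (use assms in \<open>simp add: chain_def\<close>)

lemma chain_mono: "chain ka k e ==> 0 < ka ==> ka <= ka' ==> chain ka' k e"
 unfolding chain_def using chain_pos[of ka k e] mult_right_mono[of ka ka' "e (Suc _)"]
 by (metis Suc_le_mono chain_def less_le_trans less_imp_le)

lemma chain_le:
 assumes c: "chain ka k e" and ka: "0 < ka" "ka <= 1" and "i <= j" "j <= Suc k"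
 shows "e i <= e j" using assms(4,5)
proof (induction j rule: dec_induct)
 case (step j)
 hence "e j < ka * e (Suc j)" using c by (auto simp: chain_def)
 also have "... <= e (Suc j)"
  using chain_pos[OF c ka(1) step.prems] ka(2) by (simp add: mult_le_cancel_right1)
 finally show ?case using step by auto
qed simp

lemma chain_less:
 assumes c: "chain ka k e" and ka: "0 < ka" "ka <= 1" and "i < j" "j <= Suc k"
 shows "e i < ka * e j"
proof -
 obtain j' where j: "j = Suc j'" "i <= j'" using assms(4) by (cases j) auto
 have "e i <= e j'" using chain_le[OF c ka j(2)] assms(5) j by simp
 also have "... < ka * e j" using c assms(5) j by (auto simp: chain_def)
 finally show ?thesis .
qed

lemma open_MM: assumes "finite J" shows "open (MM J)"
proof -
 have eq: "MM J = (INT h:J. {x. ev h x ~= 0})" by (auto simp: MM_def)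
 show ?thesis unfolding eq by (intro open_INT assms ballI open_Collect_neq continuous_intros)
qed

lemma open_TT: "open (TT J ep)"
proof -
 have eq: "TT J ep = (UN h:J. {x. cmod (ev h x) < ep})" by (auto simp: TT_def)
 show ?thesis unfolding eq by (intro open_UN ballI open_Collect_less continuous_intros)
qed

lemma open_Om: "open (Om k y e)"
proof -
 have "Om k y e = (INT i:{1..k}. {x. abs (Re (ev (y i) x)) < e i} Int {x. abs (Im (ev (y i) x)) < e i})"
  by (auto simp: Om_def)
 moreover have "open ({x. abs (Re (ev (y i) x)) < e i} Int {x. abs (Im (ev (y i) x)) < e i})" for i
  by (intro open_Int open_Collect_less continuous_intros)
 ultimately show ?thesis by (simp add: open_INT)
qed

lemma open_Re_less: "open {x. Re (ev u x) < r}" "open {x. r < Re (ev u x)}"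
 by (intro open_Collect_less continuous_intros)+

lemma open_RR: "open (RR k y t e)"
proof -
 have "RR k y t e = (UN i:{i:{1..k}. t i}. {x. Re (ev (y i) x) < - e i / 2})" by (auto simp: RR_def)
 thus ?thesis  by (auto intro: open_UN ballI open_Re_less)
qed

lemma open_XX: "finite J ==> open (XX J k y e)" unfolding XX_def by (intro open_Int open_MM open_Om)

lemma Om_cong: "(!!g. g : y ` {1..k} ==> ev g x' = ev g x) ==> x : Om k y e ==> x' : Om k y e"
 unfolding Om_def by simp

lemma RR_cong: "(!!g. g : y ` {1..k} ==> ev g x' = ev g x) ==> x : RR k y t e ==> x' : RR k y t e"
 unfolding RR_def by auto

lemma Om_Suc: "Om (Suc k) y e = Om k y e Int {x. abs (Re (ev (y (Suc k)) x)) < e (Suc k) & abs (Im (ev (y (Suc k)) x)) < e (Suc k)}"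
 by (auto simp: Om_def atLeastAtMostSuc_conv)

lemma RR_Suc: "RR (Suc k) y t e = RR k y t e Un {x. t (Suc k) & Re (ev (y (Suc k)) x) < - e (Suc k) / 2}"
 by (auto simp: RR_def atLeastAtMostSuc_conv)

lemma Om_upd: "Om k (y(Suc k := a)) (e(Suc k := b, Suc (Suc k) := c)) = Om k y e"
 by (auto simp: Om_def)

lemma RR_upd: "RR k (y(Suc k := a)) (t(Suc k := r)) (e(Suc k := b, Suc (Suc k) := c)) = RR k y t e"
 unfolding RR_def by (intro Collect_cong bex_cong) auto

section \<open>Sweeping one functional across its critical values\<close>

definition clamp1 :: "real => real" where "clamp1 r = max 0 (min 1 r)"

lemma clamp1: "0 <= clamp1 r" "clamp1 r <= 1" "r <= 0 ==> clamp1 r = 0" "1 <= r ==> clamp1 r = 1" "0 < r ==> 0 < clamp1 r"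
 by (auto simp: clamp1_def)

lemma continuous_clamp1 [continuous_intros]: "continuous_on S f ==> continuous_on S (%x. clamp1 (f x))"
 unfolding clamp1_def by (intro continuous_intros)

text \<open>A continuous cut-off of the sign function. It vanishes for
  \<open>abs r <= s / 2\<close>, where a critical value may prevent the field from existing.\<close>

definition im_push :: "real => real => real" where
 "im_push s r = clamp1 (r - s / 2) - clamp1 (- r - s / 2)"

lemma im_push:
 assumes "0 < s"
 shows "abs (im_push s r) <= 1" "abs r <= s / 2 ==> im_push s r = 0" "abs (im_push s r) <= abs r" "0 <= r * im_push s r"
  "s <= abs r ==> min 1 (s / 2) <= abs (im_push s r)"
proof -
 consider "s / 2 < r" | "r < - s / 2" | "abs r <= s / 2" by linarith
 hence "abs (im_push s r) <= 1 & (abs r <= s / 2 --> im_push s r = 0) & abs (im_push s r) <= abs r & 0 <= r * im_push s r &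
  (s <= abs r --> min 1 (s / 2) <= abs (im_push s r))"
 proof cases
  case 1
  thus ?thesis using assms using 1 assms by (auto simp: im_push_def clamp1_def)
 next
  case 2
  thus ?thesis using assms using 2 assms by (simp add: im_push_def clamp1_def min_def mult_nonpos_nonneg)
 next
  case 3
  thus ?thesis using clamp1(3)[of "r - s / 2"] clamp1(3)[of "- r - s / 2"] using 3 assms
   by (auto simp: im_push_def abs_le_iff)
 qed
 thus "abs (im_push s r) <= 1" "abs r <= s / 2 ==> im_push s r = 0" "abs (im_push s r) <= abs r" "0 <= r * im_push s r"
  "s <= abs r ==> min 1 (s / 2) <= abs (im_push s r)" by blast+
qed

lemma im_push_step:
 assumes "0 < s" "0 <= c" "c <= 1"
 shows "abs (r - c * im_push s r) = abs r - c * abs (im_push s r)"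
proof -
 note p = im_push[OF assms(1), of r]
 have "c * abs (im_push s r) <= 1 * abs r" using assms p(3) by (intro mult_mono) auto
 thus ?thesis
  using p(4) assms(2) by (cases "r >= 0"; cases "im_push s r >= 0") (auto simp: zero_le_mult_iff abs_if split: if_splits)
qed

text \<open>The real part of \<open>u\<close> is swept over the box with sides \<open>y 1\<close>,
  ..., \<open>y k\<close>. \<open>V\<close> contains a critical value for every set of functionals
  on which \<open>u\<close> depends, their real parts are \<open>4 * s\<close> apart, and
  \<open>C * (2 * E) < s / 4\<close> excludes dependence on small functionals farther than
  \<open>s / 4\<close> from \<open>V\<close>.\<close>

locale sweep =
 fixes J :: "('n::finite) aff set" and k :: nat and y :: "nat => 'n aff" and t :: "nat => bool"
  and e :: "nat => real" and ta and u :: "'n aff" and V :: "complex set" and s C E :: real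
 assumes J: "finite J" and hol: "holonomy (MM J) ta" and V: "finite V"
  and dep: "!!S. S <= J ==> fst u : vec.span (fst ` (S Un y ` {1..k})) ==>
   EX v:V. domi (S Un y ` {1..k}) u v C"
  and s: "0 < s" and gap: "!!v v'. v : V ==> v' : V ==> v ~= v' ==> 4 * s <= abs (Re v - Re v')"
  and e: "!!i. i <= k ==> 0 < e i" "!!i. i <= k ==> e i <= E" and C: "0 <= C" "C * (2 * E) < s / 4"
begin

sublocale holonomy "MM J" ta by (rule hol)

abbreviation "X == XX J k y e"
abbreviation "Y == YY J k y t e"
abbreviation "Q == RR k y t e Un TT J (e 0)"

lemma XM: "X <= MM J" by (simp add: XX_def)

lemma openX: "open X" and openY: "open Y"
 unfolding YY_def by (intro open_XX J open_Int open_Un open_RR open_TT)+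

text \<open>Dependence on functionals that are small at \<open>x\<close> would put
  \<open>ev u x\<close> within \<open>C * (2 * E)\<close> of a critical value. The 2 covers both the
  bound \<open>2 * e 0\<close> of \<open>nondep\<close> and the passage from real and imaginary part
  to the modulus.\<close>

lemma near_crit:
 assumes x: "x : X" and far: "!!v. v : V ==> s / 4 <= cmod (ev u x - v)"
  and S: "S <= J" "!!h. h : S ==> cmod (ev h x) < 2 * e 0"
 shows "fst u ~: vec.span (fst ` (S Un y ` {1..k}))"
proof
 assume "fst u : vec.span (fst ` (S Un y ` {1..k}))"
 then obtain v where v: "v : V" "!!m. 0 <= m ==> ALL g:S Un y ` {1..k}. cmod (ev g x) <= m ==> cmod (ev u x - v) <= C * m"
  using dep[OF S(1)] by blast
 have "cmod (ev u x - v) <= C * (2 * E)"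
 proof (rule v(2), use e(1,2)[of 0] in simp, rule ballI)
  fix g assume "g : S Un y ` {1..k}"
  then consider "g : S" | i where "i : {1..k}" "g = y i" by blast
  thus "cmod (ev g x) <= 2 * E"
  proof cases
   case 1
   thus ?thesis using S(2)[of g] e(2)[of 0] by auto
  next
   case 2
   have "cmod (ev g x) <= abs (Re (ev g x)) + abs (Im (ev g x))" by (rule cmod_le)
   also have "... <= e i + e i" using x 2 by (intro add_mono) (auto simp: XX_def Om_def less_imp_le)
   also have "... <= 2 * E" using e(2)[of i] 2 by auto
   finally show ?thesis .
  qed
 qed
 thus False using far[OF v(1)] C(2) by linarith
qed

lemma X_step:
 assumes f: "fstep J (e 0) (y ` {1..k}) {} u ze x x'" and x: "x : X"
 shows "x' : X"
proof -
 have "ev g x' = ev g x" if "g : y ` {1..k}" for g using f that unfolding fstep_def by blast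
 hence "x' : Om k y e" by (rule Om_cong) (use x in \<open>auto simp: XX_def\<close>)
 thus ?thesis using fstep_MM[OF f] e(1)[of 0] x by (auto simp: XX_def)
qed

lemma Q_step:
 assumes f: "fstep J (e 0) (y ` {1..k}) {} u ze x x'" and x: "x : Q"
 shows "x' : Q"
proof -
 have "ev g x' = ev g x" if "g : y ` {1..k}" for g using f that unfolding fstep_def by blast
 hence "x : RR k y t e ==> x' : RR k y t e" by (rule RR_cong)
 thus ?thesis using fstep_TT[OF f] x by auto
qed

text \<open>In the slab around \<open>Re v\<close> the other critical values are far away, and
  \<open>v\<close> itself is avoided once the imaginary parts differ by more than
  \<open>s / 4\<close>. The real part of \<open>u\<close> stands still, so sets cut out by it are
  preserved.\<close>

lemma im_flow:
 assumes v: "v : V" and AU: "A <= X Int {x. abs (Re (ev u x - v)) < s}"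
  and A: "!!x x' ze. x : A ==> fstep J (e 0) (y ` {1..k}) {} u ze x x' ==> Re (ev u x') = Re (ev u x) ==> x' : A"
 shows "thz A (A Int {x. abs (Im (ev u x - v)) < s})"
proof -
 define ze where "ze z = Complex 0 (- im_push s (Im (z - v)))" for z
 define Z where "Z = {z. s / 4 < abs (Im (z - v))}"
 define Zc where "Zc = {z. s / 2 <= abs (Im (z - v))}"
 have cze: "continuous_on UNIV ze" unfolding ze_def im_push_def complex_eq_iff[symmetric]
  by (simp add: Complex_eq) (intro continuous_intros)
 have stepu: "Re (ev u x') = Re (ev u x) & abs (Im (ev u x' - v)) <= abs (Im (ev u x - v))"
  if f: "fstep J (e 0) (y ` {1..k}) {} u (%z. of_real etp * ze z) x x'" and "0 < etp" "etp <= 1" for x x' etp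
 proof -
  obtain c where c: "c : {0..1}" "ev u x' = ev u x + of_real c * (of_real etp * ze (ev u x))"
   using f unfolding fstep_def by blast
  have "0 <= c * etp" "c * etp <= 1" using c(1) that(2,3) by (auto intro: mult_le_one)
  thus ?thesis using im_push_step[OF s, of "c * etp" "Im (ev u x - v)"] mult_nonneg_nonneg[of "c * etp" "abs (im_push s (Im (ev u x - v)))"] using c(2)
   by (simp add: c(2) ze_def algebra_simps)
 qed
 show ?thesis
 proof (rule uflow[where Z = Z and Zc = Zc and ze = ze and ?etp0.0 = 1 and L = "{}" and K = "y ` {1..k}" and u = u
    and ep = "e 0" and J = J and m = "%z. abs (Im (z - v))" and ?m0.0 = 0])
  show "open Z" "closed Zc"
   unfolding Z_def Zc_def by (intro open_Collect_less closed_Collect_le continuous_intros)+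
  show "Zc <= Z" using s by (auto simp: Z_def Zc_def)
  show "cmod (ze z) <= 1" for z using im_push(1)[OF s] by (simp add: ze_def cmod_def)
  show "ze z = 0" if "z ~: Zc" for z
   using im_push(2)[OF s] that by (simp add: ze_def Zc_def complex_eq_iff)
  show "x' : A" if "x : A" "fstep J (e 0) (y ` {1..k}) {} u (%z. of_real etp * ze z) x x'" "0 < etp" "etp <= 1" for x x' etp
   using A[OF that(1,2)] stepu[OF that(2-4)] by blast
  thus "x' : A Int {x. abs (Im (ev u x - v)) < s}" if "x : A Int {x. abs (Im (ev u x - v)) < s}"
    "fstep J (e 0) (y ` {1..k}) {} u (%z. of_real etp * ze z) x x'" "0 < etp" "etp <= 1" for x x' etp
   using that stepu[OF that(2-4)] by fastforce
  show "fst u ~: vec.span (fst ` (S Un y ` {1..k} Un fst ` L'))"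
   if x: "x : A" "ev u x : Z" and S: "S <= J" "!!h. h : S ==> cmod (ev h x) < 2 * e 0" and L: "L' <= {}" for x S L'
  proof -
   have "s / 4 <= cmod (ev u x - w)" if "w : V" for w
   proof (cases "w = v")
    case True
    thus ?thesis using x(2) abs_Im_le_cmod[of "ev u x - v"] by (auto simp: Z_def)
   next
    case False
    show ?thesis using AU x(1) using gap[OF v that] False s using abs_Re_le_cmod[of "ev u x - w"] s
     by auto
   qed
   from near_crit[OF _ this S] show ?thesis using AU x(1) L by auto
  qed
  show "EX c>0. ALL x:A - A Int {x. abs (Im (ev u x - v)) < s}. abs (Im (ev u x + of_real etp * ze (ev u x) - v)) <= abs (Im (ev u x - v)) - c"
   if "0 < etp" "etp <= 1" for etp
  proof (intro exI[of _ "etp * min 1 (s / 2)"] conjI ballI)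
   show "0 < etp * min 1 (s / 2)" using that s by simp
   fix x assume "x : A - A Int {x. abs (Im (ev u x - v)) < s}"
   hence "etp * min 1 (s / 2) <= etp * abs (im_push s (Im (ev u x - v)))" using im_push(5)[OF s] that
    by (intro mult_left_mono) auto
   moreover have eq: "Im (ev u x + of_real etp * ze (ev u x) - v) = Im (ev u x - v) - etp * im_push s (Im (ev u x - v))"
    by (simp add: ze_def)
   ultimately show "abs (Im (ev u x + of_real etp * ze (ev u x) - v)) <= abs (Im (ev u x - v)) - etp * min 1 (s / 2)"
    unfolding eq im_push_step[OF s less_imp_le[OF that(1)] that(2)] by linarith
  qed
 qed (use J hol e(1)[of 0] AU XM cze in \<open>auto intro!: continuous_intros\<close>)
qed

text \<open>The real part of \<open>u\<close> decreases at full speed where it is at least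
  \<open>b\<close> and rests below \<open>b - s / 4\<close>, so the lower edge
  \<open>b - s / 2\<close> of the region is not crossed.\<close>

lemma re_flow:
 assumes U: "U = X Int {x. b - s / 2 < Re (ev u x) & Re (ev u x) : I}" and I: "!!r r'. r : I ==> b - s / 2 < r' ==> r' <= r ==> r' : I"
  and far: "!!v r. v : V ==> b - s / 2 < r ==> r : I ==> s / 2 <= abs (r - Re v)"
 shows "thz U (U Int ({x. Re (ev u x) < b} Un Q))"
proof -
 define ze where "ze z = complex_of_real (- clamp1 ((Re z - (b - s / 4)) * (4 / s)))" for z
 have stepu: "Re (ev u x') <= Re (ev u x) & (b - s / 2 < Re (ev u x) --> b - s / 2 < Re (ev u x'))"
  if f: "fstep J (e 0) (y ` {1..k}) {} u (%z. of_real etp * ze z) x x'" and "0 < etp" "etp <= s / 4" for x x' etp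
 proof -
  obtain c where c: "c : {0..1}" "ev u x' = ev u x + of_real c * (of_real etp * ze (ev u x))"
   using f unfolding fstep_def by blast
  let ?c = "clamp1 ((Re (ev u x) - (b - s / 4)) * (4 / s))"
  have Rex: "Re (ev u x') = Re (ev u x) - (c * etp) * ?c" using c(2) by (simp add: ze_def)
  have "c * (etp * ?c) <= 1 * (etp * 1)" using c(1) that(2) clamp1(1,2) by (intro mult_mono) auto
  hence c1: "(c * etp) * ?c <= s / 4" using that(3) by simp
  show ?thesis
  proof (cases "Re (ev u x) <= b - s / 4")
   case True
   hence "(Re (ev u x) - (b - s / 4)) * (4 / s) <= 0" using s by (intro mult_nonpos_nonneg) auto
   hence "?c = 0" by (rule clamp1(3))
   thus ?thesis using Rex by simp
  next
   case False
   thus ?thesis using Rex c(1) that(2) clamp1(1) c1 by simp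
  qed
 qed
 have A: "x' : U" if "x : U" "fstep J (e 0) (y ` {1..k}) {} u (%z. of_real etp * ze z) x x'" "0 < etp" "etp <= s / 4" for x x' etp
  using that X_step[OF that(2)] stepu[OF that(2-4)] I[of "Re (ev u x)" "Re (ev u x')"] by (auto simp: U)
 show ?thesis
 proof (rule uflow[where Z = UNIV and Zc = UNIV and ze = ze and ?etp0.0 = "s / 4" and L = "{}" and K = "y ` {1..k}" and u = u
    and ep = "e 0" and J = J and m = Re and ?m0.0 = b])
  show "x' : U Int ({x. Re (ev u x) < b} Un Q)" if "x : U Int ({x. Re (ev u x) < b} Un Q)"
    "fstep J (e 0) (y ` {1..k}) {} u (%z. of_real etp * ze z) x x'" "0 < etp" "etp <= s / 4" for x x' etp
   using A[OF _ that(2-4)] that(1) stepu[OF that(2-4)] Q_step[OF that(2)] by fastforce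
  show "fst u ~: vec.span (fst ` (S Un y ` {1..k} Un fst ` L'))"
   if x: "x : U" and S: "S <= J" "!!h. h : S ==> cmod (ev h x) < 2 * e 0" and L: "L' <= {}" for x S L'
  proof -
   have "s / 4 <= cmod (ev u x - w)" if "w : V" for w
    using far[OF that, of "Re (ev u x)"] x abs_Re_le_cmod[of "ev u x - w"] s by (auto simp: U)
   from near_crit[OF _ this S] show ?thesis using x L by (auto simp: U)
  qed
  show "EX c>0. ALL x:U - U Int ({x. Re (ev u x) < b} Un Q). Re (ev u x + of_real etp * ze (ev u x)) <= Re (ev u x) - c"
   if "0 < etp" "etp <= s / 4" for etp
  proof (intro exI[of _ etp] conjI ballI)
   fix x assume "x : U - U Int ({x. Re (ev u x) < b} Un Q)"
   thus "Re (ev u x + of_real etp * ze (ev u x)) <= Re (ev u x) - etp" using s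
    by (auto simp: ze_def clamp1(4))
  qed (use that in simp)
  show "cmod (ze z) <= 1" for z unfolding ze_def norm_of_real using clamp1(1,2) by simp
  show "continuous_on UNIV ze" unfolding ze_def by (intro continuous_intros)
  show "x' : U" if "0 < etp" "etp <= s / 4" "x : U" "fstep J (e 0) (y ` {1..k}) {} u (%z. of_real etp * ze z) x x'" for x x' etp
   by (rule A[OF that(3,4,1,2)])
  show "U <= MM J" using XM by (auto simp: U)
  show "b <= Re (ev u x)" if "x : U" "x ~: U Int ({x. Re (ev u x) < b} Un Q)" for x
   using that by auto
  show "continuous_on UNIV Re" by (intro continuous_intros)
 qed (use J hol e(1)[of 0] s in simp_all)
qed

text \<open>The filtration by the real part of \<open>u\<close>, each stage enlarged by the subspace
  \<open>Y\<close>.\<close>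

definition N :: "real set => (complex ^ 'n) set" where "N I = X Int {x. Re (ev u x) : I} Un Y"

definition Xv where "Xv v = X Int {x. abs (Re (ev u x - v)) < s & abs (Im (ev u x - v)) < s}"

lemma Y_eq: "Y = X Int Q" by (simp add: YY_def)

lemma N_sub: "N I <= X" by (auto simp: N_def Y_eq)

lemma N_mono: "I <= I' ==> N I <= N I'" by (auto simp: N_def)

lemma open_Re_vimage: "open I ==> open {x. Re (ev u x) : I}"
 using open_vimage[of I "%x. Re (ev u x)", OF _ continuous_on_Re[OF continuous_on_ev[OF continuous_on_id]]]
 by (simp add: vimage_def)

lemma open_N: "open I ==> open (N I)"
 unfolding N_def by (intro open_Un open_Int openX openY open_Re_vimage)

text \<open>Only the region above \<open>b - s / 2\<close> is moved; excision glues the rest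
  back.\<close>

lemma step_reg:
 assumes "open I" and I: "!!r r'. r : I ==> b - s / 2 < r' ==> r' <= r ==> r' : I"
  and far: "!!v r. v : V ==> b - s / 2 < r ==> r : I ==> s / 2 <= abs (r - Re v)"
 shows "thz (N I) (N (I Int {..<b}))"
proof -
 define U where "U = X Int {x. b - s / 2 < Re (ev u x) & Re (ev u x) : I}"
 have "thz U (U Int ({x. Re (ev u x) < b} Un Q))" by (rule re_flow[OF U_def I far])
 moreover have "U Int ({x. Re (ev u x) < b} Un Q) = U Int N (I Int {..<b})"
  by (auto simp: U_def N_def Y_eq)
 moreover have "U Un N (I Int {..<b}) = N I" using s by (auto simp: U_def N_def Y_eq)
 moreover have "open U"
  unfolding U_def Collect_conj_eq by (intro open_Int openX open_Re_less open_Re_vimage assms(1))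
 moreover have "open (N (I Int {..<b}))" by (intro open_N open_Int assms(1)) simp
 ultimately show ?thesis
  using thc_excision_open[of U "N (I Int {..<b})" 0 0] N_sub[of I] XM thz_thc by auto
qed

lemma crit_slab:
 assumes v: "v : V" and W: "!!x x'. Re (ev u x') = Re (ev u x) ==> x : W ==> x' : W"
  and crit: "thc (Xv v) (Xv v Int (W Un Q)) d \<beta>"
 shows "thc (X Int {x. abs (Re (ev u x - v)) < s}) (X Int {x. abs (Re (ev u x - v)) < s} Int (W Un Q)) d \<beta>"
proof -
 let ?U = "X Int {x. abs (Re (ev u x - v)) < s}" and ?I = "{x. abs (Im (ev u x - v)) < s}"
 have U1: "thz ?U (?U Int ?I)" by (rule im_flow[OF v]) (auto intro: X_step)
 have U2: "thz (?U Int (W Un Q)) ((?U Int (W Un Q)) Int ?I)"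
 proof (rule im_flow[OF v])
  fix x x' ze assume x: "x : ?U Int (W Un Q)" and f: "fstep J (e 0) (y ` {1..k}) {} u ze x x'" and R: "Re (ev u x') = Re (ev u x)"
  thus "x' : ?U Int (W Un Q)" using X_step[OF f] Q_step[OF f] W[OF R] by auto
 qed auto
 have "?U Int ?I = Xv v" "(?U Int (W Un Q)) Int ?I = Xv v Int (W Un Q)" by (auto simp: Xv_def)
 from thc_pair[OF _ _ _ _ _ U1[unfolded this] U2[unfolded this]] show ?thesis
  using crit XM by (auto simp: Xv_def)
qed

text \<open>Crossing a critical value attaches the box \<open>Xv v\<close> along its exit set;
  \<open>- s / 2\<close> is the threshold that \<open>RR\<close> uses for a side of size
  \<open>s\<close>.\<close>

lemma step_crit:
 assumes "open I" and v: "v : V" and I: "!!r. Re v - s < r ==> r < Re v + s ==> r : I"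
  and crit: "thc (Xv v) (Xv v Int (W Un Q)) d \<beta>" and W: "W = {x. Re (ev u x - v) < - s / 2}"
 shows "thc (N (I Int {..<Re v + s})) (N (I Int {..<Re v - s / 2})) d \<beta>"
proof -
 define U where "U = X Int {x. abs (Re (ev u x - v)) < s}"
 have "open U" unfolding U_def by (intro open_Int openX open_Collect_less continuous_intros)
 moreover have "thc U (U Int (W Un Q)) d \<beta>"
  unfolding U_def by (rule crit_slab[OF v _ crit]) (simp add: W)
 moreover have "U Int (W Un Q) = U Int N (I Int {..<Re v - s / 2})"
  using I by (auto simp: U_def N_def Y_eq W abs_less_iff)
 moreover have "U Un N (I Int {..<Re v - s / 2}) = N (I Int {..<Re v + s})"
  using I s by (auto simp: U_def N_def Y_eq abs_less_iff)
 moreover have "open (N (I Int {..<Re v - s / 2}))" by (intro open_N open_Int assms(1)) simp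
 ultimately show ?thesis
  using thc_excision_open[of U "N (I Int {..<Re v - s / 2})" d \<beta>] N_sub[of "I Int {..<Re v + s}"] XM by auto
qed

text \<open>Induction on the number of critical values to the right of \<open>b\<close>. The
  leftmost one is split off and the region beyond \<open>Re v + s\<close> is covered by the
  hypothesis; all pieces live in the same degree, so \<open>thc_triple\<close> adds up.\<close>

lemma sweep_right:
 assumes I: "open I" "!!r r'. r : I ==> r <= r' ==> r' : I" "!!r. b - s < r ==> r : I"
  and adm: "!!v. v : V ==> Re v + s <= b \<or> b + s <= Re v"
  and crit: "!!v. v : V ==> b <= Re v ==> thc (Xv v) (Xv v Int ({x. Re (ev u x - v) < - s / 2} Un Q)) d (\<beta> v)"
 shows "thc (N I) (N (I Int {..<b})) d (SUM v:{v:V. b <= Re v}. \<beta> v)" using I(3) adm crit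
proof (induction "card {v:V. b <= Re v}" arbitrary: b)
 case 0
 hence E: "{v:V. b <= Re v} = {}" using V by simp
 have "thz (N I) (N (I Int {..<b}))"
 proof (rule step_reg[OF I(1)])
  show "r' : I" if "r : I" "b - s / 2 < r'" for r r' using 0(2)[of r'] that s by auto
  show "s / 2 <= abs (r - Re v)" if "v : V" "b - s / 2 < r" for v r
   using 0(3)[OF that(1)] E that s by auto
 qed
 thus ?case unfolding E using thz_thc by simp
next
 case (Suc n)
 let ?W = "{v:V. b <= Re v}"
 have fin: "finite ?W" and ne: "?W ~= {}" using V Suc(2) card.empty by fastforce+
 have "Min (Re ` ?W) : Re ` ?W" by (rule Min_in) (use fin ne in auto)
 then obtain v where v: "v : ?W" and "Re v = Min (Re ` ?W)" by force
 hence vmin: "Re v <= Re w" if "w : ?W" for w using Min_le[of "Re ` ?W" "Re w"] fin that by auto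
 have vb: "b + s <= Re v" and vV: "v : V" using Suc.prems(2)[of v] v s by auto
 define b' where "b' = Re v + s"
 have W': "{v:V. b' <= Re v} = ?W - {v}"
 using gap vmin vV s vb by (fastforce simp: b'_def intro: equalityI)
 have IHp: "thc (N I) (N (I Int {..<b'})) d (SUM v:{v:V. b' <= Re v}. \<beta> v)"
 proof (rule Suc.hyps(1))
  show "n = card {v:V. b' <= Re v}" unfolding W' using Suc(2) v fin by simp
  show "r : I" if "b' - s < r" for r by (rule Suc.prems(1)) (use that vb s in \<open>simp add: b'_def\<close>)
  show "Re w + s <= b' \<or> b' + s <= Re w" if "w : V" for w
  proof (cases "w = v")
   case False
   thus ?thesis using gap[OF that vV] using s by (auto simp: b'_def)
  qed (simp add: b'_def)
  show "thc (Xv w) (Xv w Int ({x. Re (ev u x - w) < - s / 2} Un Q)) d (\<beta> w)" if "w : V" "b' <= Re w" for w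
   using Suc.prems(3)[OF that(1)] that(2) vb s by (simp add: b'_def)
 qed
 have mid: "thc (N (I Int {..<b'})) (N (I Int {..<Re v - s / 2})) d (\<beta> v)" unfolding b'_def
 proof (rule step_crit[OF I(1) vV _ _ refl])
  show "r : I" if "Re v - s < r" for r by (rule Suc.prems(1)) (use that vb s in simp)
  show "thc (Xv v) (Xv v Int ({x. Re (ev u x - v) < - s / 2} Un Q)) d (\<beta> v)"
   using Suc.prems(3)[OF vV] v by simp
 qed
 have "thz (N (I Int {..<Re v - s / 2})) (N ((I Int {..<Re v - s / 2}) Int {..<b}))"
 proof (rule step_reg)
  show "open (I Int {..<Re v - s / 2})" by (intro open_Int open_lessThan I(1))
  show "r' : I Int {..<Re v - s / 2}" if "r : I Int {..<Re v - s / 2}" "b - s / 2 < r'" "r' <= r" for r r'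
   using Suc.prems(1)[of r'] that s by auto
  show "s / 2 <= abs (r - Re w)" if w: "w : V" "b - s / 2 < r" "r : I Int {..<Re v - s / 2}" for w r
  using vmin w Suc.prems(2) s by (fastforce simp: abs_if)
 qed
 moreover have "(I Int {..<Re v - s / 2}) Int {..<b} = I Int {..<b}" using vb s by auto
 ultimately have low: "thc (N (I Int {..<Re v - s / 2})) (N (I Int {..<b})) d 0"
  using thz_thc by simp
 have N1: "N (I Int {..<b}) <= N (I Int {..<Re v - s / 2})" "N (I Int {..<Re v - s / 2}) <= N (I Int {..<b'})" "N (I Int {..<b'}) <= N I"
  using vb s by (auto intro!: N_mono simp: b'_def)
 have NM: "N I' <= MM J" for I' using N_sub XM by blast
 have "thc (N I) (N (I Int {..<b})) d ((SUM v:{v:V. b' <= Re v}. \<beta> v) + (\<beta> v + 0))" 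
  by (fastforce intro: thc_triple[OF NM N1(2,1) mid low] thc_triple[OF NM N1(3) order_trans[OF N1(1,2)] IHp])
 moreover have "(SUM v:?W. \<beta> v) = (SUM v:{v:V. b' <= Re v}. \<beta> v) + \<beta> v"
  unfolding W' using sum.remove[OF fin v, of \<beta>] by simp
 ultimately show ?case by simp
qed

text \<open>The slab around 0, where the sweeps end, has no exit side of its own and is compared
  with \<open>Y\<close> directly.\<close>

lemma step_start:
 assumes v: "0 : V" and crit: "thc (Xv 0) (Xv 0 Int Q) d \<beta>"
 shows "thc (N {- s<..<s}) Y d \<beta>"
proof -
 define U where "U = X Int {x. abs (Re (ev u x - 0)) < s}"
 have "open U" unfolding U_def by (intro open_Int openX open_Collect_less continuous_intros)
 moreover have "thc U (U Int Q) d \<beta>" unfolding U_def using crit_slab[OF v, of "{}" d \<beta>] crit by simp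
 moreover have "U Int Q = U Int Y" "U Un Y = N {- s<..<s}"
  by (auto simp: U_def N_def Y_eq abs_less_iff)
 ultimately show ?thesis using thc_excision_open[of U Y d \<beta>] openY N_sub[of "{- s<..<s}"] XM by auto
qed

end

section \<open>Enlarging the box by the swept functional\<close>

definition asc :: "complex => ('n::finite) aff => 'n aff" where "asc c h = (c *s fst h, c * snd h)"

definition ash :: "('n::finite) aff => complex => 'n aff" where "ash h v = (fst h, snd h - v)"

lemma ev_asc [simp]: "ev (asc c h) x = c * ev h x" and fst_asc [simp]: "fst (asc c h) = c *s fst h"
 by (simp_all add: asc_def ev_def algebra_simps)

lemma ev_ash [simp]: "ev (ash h v) x = ev h x - v" and fst_ash [simp]: "fst (ash h v) = fst h"
 by (simp_all add: ash_def ev_def)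

definition valid :: "('n::finite) aff set => nat => (nat => 'n aff) => (nat => bool) => bool" where
 "valid J k y t \<longleftrightarrow> inj_on (%i. fst (y i)) {1..k} & vec.independent ((%i. fst (y i)) ` {1..k}) &
   (ALL i:{1..k}. ~ t i --> (EX h:J. EX c. c ~= 0 & y i = asc c h))"

lemma valid_upd:
 assumes v: "valid J k y t" and nin: "fst a ~: vec.span ((%i. fst (y i)) ` {1..k})"
  and t: "~ r ==> EX h:J. EX c. c ~= 0 & a = asc c h"
 shows "valid J (Suc k) (y(Suc k := a)) (t(Suc k := r))"
proof -
 let ?y = "y(Suc k := a)"
 have im: "(%i. fst (?y i)) ` {1..k} = (%i. fst (y i)) ` {1..k}" by (intro image_cong) auto
 have I: "{1..Suc k} = insert (Suc k) {1..k}" by auto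
 have a: "fst a ~: (%i. fst (y i)) ` {1..k}" using nin vec.span_base[of "fst a"] by metis
 have yk: "?y i = y i" if "i : {1..k}" for i using that by auto
 have "inj_on (%i. fst (?y i)) {1..Suc k}"
 proof (rule inj_onI)
  fix i j assume ij: "i : {1..Suc k}" "j : {1..Suc k}" "fst (?y i) = fst (?y j)"
  consider "i = Suc k" "j = Suc k" | "i = Suc k" "j : {1..k}" | "i : {1..k}" "j = Suc k" | "i : {1..k}" "j : {1..k}"
   using ij(1,2) unfolding I by blast
  thus "i = j"
  proof cases
   case 2
   thus ?thesis using ij(3) yk[of j] using a 2 by simp
  next
   case 3
   hence "fst a = fst (y i)" using ij(3) yk[of i] by simp
   thus ?thesis using a 3 by blast
  next
   case 4
   thus ?thesis using ij(3) yk[of i] yk[of j] using v 4 unfolding valid_def inj_on_def by metis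
  qed simp
 qed
 moreover have "vec.independent ((%i. fst (?y i)) ` {1..Suc k})"
  unfolding I image_insert im using vec.independent_insertI[OF nin] v by (simp add: valid_def)
 ultimately show ?thesis using v t by (simp add: valid_def)
qed

text \<open>Multiplying by \<open>Complex 1 r\<close> gives a difference with parts
  \<open>a\<close>, \<open>c\<close> the real part \<open>a - r * c\<close>. For \<open>c\<close>
  not 0 this vanishes for a single \<open>r\<close>, and \<open>bad\<close> collects these.\<close>

lemma rotate_distinct_Re:
 assumes "finite V" obtains omp :: complex where "omp ~= 0" "inj_on (%v. Re (omp * v)) V"
proof -
 define bad where "bad = (%(v, w). Re (v - w) / Im (v - w)) ` (V \<times> V)"
 have "finite bad" using assms by (simp add: bad_def)
 then obtain r where r: "r ~: bad" using ex_new_if_finite[OF infinite_UNIV_char_0] by blast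
 show ?thesis
 proof
  show "Complex 1 r ~= 0" by (simp add: complex_eq_iff)
  show "inj_on (%v. Re (Complex 1 r * v)) V"
  proof (rule inj_onI)
   fix v w assume vw: "v : V" "w : V" "Re (Complex 1 r * v) = Re (Complex 1 r * w)"
   hence eq: "Re (v - w) = r * Im (v - w)" by (simp add: algebra_simps)
   show "v = w"
   proof (cases "Im (v - w) = 0")
    case True
    thus ?thesis using eq by (simp add: complex_eq_iff)
   next
    case False
    hence "r : bad" using eq using vw unfolding bad_def by (intro image_eqI[of _ _ "(v, w)"]) auto
    thus ?thesis using r by simp
   qed
  qed
 qed
qed

text \<open>Each subset \<open>S\<close> of \<open>J\<close>, together with the sides, contributes
  one value: the constant of \<open>dependent_bound\<close> for \<open>h0\<close> if
  \<open>h0\<close> depends on them. The value 0 is added, and the factor \<open>omp\<close>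
  separates the real parts.\<close>

lemma crit_values:
 assumes J: "finite J" and h0: "h0 : J"
 obtains omp V C where "omp ~= 0" "finite V" "0 : V" "inj_on Re V" "0 <= C"
  "ALL S. S <= J --> fst (asc omp h0) : vec.span (fst ` (S Un y ` {1..k})) -->
   (EX v:V. ALL x m. 0 <= m --> (ALL g:S Un y ` {1..k::nat}. cmod (ev g x) <= m) --> cmod (ev (asc omp h0) x - v) <= C * m)"
proof -
 have "ALL S:Pow J. EX v C. fst h0 : vec.span (fst ` (S Un y ` {1..k})) -->
   0 <= C & (domi (S Un y ` {1..k}) h0 v C)"
 proof
  fix S assume "S : Pow J"
  hence fin: "finite (S Un y ` {1..k})" using J finite_subset by auto
  show "EX v C. fst h0 : vec.span (fst ` (S Un y ` {1..k})) -->
   0 <= C & (domi (S Un y ` {1..k}) h0 v C)"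
  proof (cases "fst h0 : vec.span (fst ` (S Un y ` {1..k}))")
   case True
   from dependent_bound[OF fin True] show ?thesis by metis
  qed simp
 qed
 then obtain v0 C0 where vC: "!!S. S : Pow J ==> fst h0 : vec.span (fst ` (S Un y ` {1..k})) ==>
   0 <= C0 S & (ALL x m. 0 <= m --> (ALL g:S Un y ` {1..k}. cmod (ev g x) <= m) --> cmod (ev h0 x - v0 S) <= C0 S * m)"
  by metis
 define V0 where "V0 = insert 0 (v0 ` Pow J)"
 have finV0: "finite V0" using J by (simp add: V0_def)
 obtain omp where omp: "omp ~= 0" "inj_on (%v. Re (omp * v)) V0"
  by (rule rotate_distinct_Re[OF finV0])
 define C where "C = cmod omp * (SUM S:Pow J. abs (C0 S))"
 show ?thesis
 proof (rule that[OF omp(1), of "(*) omp ` V0" C])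
  show "finite ((*) omp ` V0)" "0 : (*) omp ` V0" using finV0 by (auto simp: V0_def)
  show "inj_on Re ((*) omp ` V0)" using omp(2) by (auto simp: inj_on_def)
  show "0 <= C" by (simp add: C_def sum_nonneg)
 next
  show "ALL S. S <= J --> fst (asc omp h0) : vec.span (fst ` (S Un y ` {1..k})) -->
   (EX v:(*) omp ` V0. domi (S Un y ` {1..k}) (asc omp h0) v C)"
  proof (intro allI impI)
  fix S assume S: "S <= J" and sp: "fst (asc omp h0) : vec.span (fst ` (S Un y ` {1..k}))"
  have "(1 / omp) *s fst (asc omp h0) : vec.span (fst ` (S Un y ` {1..k}))"
   by (rule vec.span_scale[OF sp])
  hence "fst h0 : vec.span (fst ` (S Un y ` {1..k}))" using omp(1) by simp
  from vC[OF _ this] have v: "0 <= C0 S" "!!x m. 0 <= m ==> (ALL g:S Un y ` {1..k}. cmod (ev g x) <= m) ==> cmod (ev h0 x - v0 S) <= C0 S * m"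
   using S by blast+
  show "EX v:(*) omp ` V0. domi (S Un y ` {1..k}) (asc omp h0) v C"
  proof (intro bexI[of _ "omp * v0 S"] allI impI)
   fix x and m :: real assume m0: "0 <= m" and m: "ALL g:S Un y ` {1..k}. cmod (ev g x) <= m"
   have "cmod (ev (asc omp h0) x - omp * v0 S) = cmod omp * cmod (ev h0 x - v0 S)"
    by (simp add: right_diff_distrib[symmetric] norm_mult)
   also have "... <= cmod omp * (C0 S * m)" by (intro mult_left_mono v(2)[OF m0 m]) simp
   also have "... <= cmod omp * ((SUM S:Pow J. abs (C0 S)) * m)"
    using member_le_sum[of S "Pow J" "%S. abs (C0 S)"] S J m0 v(1)
    by (intro mult_left_mono mult_right_mono) auto
   finally show "cmod (ev (asc omp h0) x - omp * v0 S) <= C * m" by (simp add: C_def mult.assoc)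
  qed (use S in \<open>auto simp: V0_def\<close>)
  qed
 qed
qed

text \<open>\<open>u\<close> is swept from both directions towards the slab around 0, the left half
  being the right half for \<open>w = - u\<close>. At a critical value, \<open>u\<close> or
  \<open>w\<close> shifted by it becomes a further marked side; at 0, \<open>u\<close> becomes an
  unmarked side, being a multiple of \<open>h0\<close>. In all cases \<open>IH\<close> applies with
  \<open>Suc k\<close> sides.\<close>

lemma LL_step:
 assumes J: "finite J" and v: "valid J k y t" and h0: "h0 : J" "fst h0 ~: vec.span ((%i. fst (y i)) ` {1..k})"
  and IH: "!!y' t'. valid J (Suc k) y' t' ==> rk J (Suc k) y' = rk J k y ==> EX b ka. 0 < ka & LL J (Suc k) y' t' b ka"
 shows "EX b ka. 0 < ka & LL J k y t b ka"
proof -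
 obtain omp V C where omp: "omp ~= 0" and V: "finite V" "0 : V" "inj_on Re V" and C: "0 <= C"
  and dep: "ALL S. S <= J --> fst (asc omp h0) : vec.span (fst ` (S Un y ` {1..k})) -->
   (EX v:V. domi (S Un y ` {1..k}) (asc omp h0) v C)" by (rule crit_values[OF J h0(1)])
 define u where "u = asc omp h0"
 define w where "w = asc (- 1) u"
 have span: "c *s fst u ~: vec.span ((%i. fst (y i)) ` {1..k})" if "c ~= 0" for c
 proof
  assume "c *s fst u : vec.span ((%i. fst (y i)) ` {1..k})"
  hence "(1 / (c * omp)) *s (c *s fst u) : vec.span ((%i. fst (y i)) ` {1..k})"
   by (rule vec.span_scale)
  thus False using h0(2) that omp by (simp add: u_def)
 qed
 define Y' where "Y' a = y(Suc k := a)" for a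
 define T' where "T' r = t(Suc k := r)" for r
  have rk: "rk J (Suc k) (Y' a) = rk J k y" if "fst a = c *s fst u" for a c
  proof -
   have "fst ` (J Un Y' a ` {1..Suc k}) = insert (fst a) (fst ` (J Un y ` {1..k}))" unfolding Y'_def unfolding atLeastAtMostSuc_conv[of 1 k, OF le_add1[of 1 k, unfolded plus_1_eq_Suc]]
    by (simp only: image_insert image_Un Un_insert_right) (simp add: Y'_def)
   moreover have "fst a : vec.span (fst ` (J Un y ` {1..k}))"
    unfolding that u_def fst_asc using h0(1) by (intro vec.span_scale vec.span_base) auto
   ultimately show ?thesis unfolding rk_def by (metis vec.dim_span vec.span_redundant)
  qed
 have "EX b ka. 0 < ka & LL J (Suc k) (Y' u) (T' False) b ka"
 proof (rule IH)
  show "valid J (Suc k) (Y' u) (T' False)"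
   unfolding Y'_def T'_def using span[of 1] h0(1) omp by (intro valid_upd[OF v]) (auto simp: u_def)
 qed (rule rk[of _ 1], simp)
 then obtain bZ kaZ where Z: "0 < kaZ" "LL J (Suc k) (Y' u) (T' False) bZ kaZ" by blast
 have "EX b ka. 0 < ka & LL J (Suc k) (Y' (ash u v')) (T' True) b ka" for v'
 proof (rule IH)
  show "valid J (Suc k) (Y' (ash u v')) (T' True)"
   unfolding Y'_def T'_def using span[of 1] by (intro valid_upd[OF v]) auto
 qed (rule rk[of _ 1], simp)
 then obtain bR kaR where R: "!!v. 0 < kaR v" "!!v. LL J (Suc k) (Y' (ash u v)) (T' True) (bR v) (kaR v)"
  by metis
 have "EX b ka. 0 < ka & LL J (Suc k) (Y' (ash w v')) (T' True) b ka" for v'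
 proof (rule IH)
  show "valid J (Suc k) (Y' (ash w v')) (T' True)"
   unfolding Y'_def T'_def w_def using span[of "- 1"] by (intro valid_upd[OF v]) auto
 qed (rule rk[of _ "- 1"], simp add: w_def)
 then obtain bL kaL where L: "!!v. 0 < kaL v" "!!v. LL J (Suc k) (Y' (ash w v)) (T' True) (bL v) (kaL v)"
  by metis
 define KK where "KK = insert 1 (insert kaZ (kaR ` V Un kaL ` uminus ` V))"
 have KK: "finite KK" "KK ~= {}" "!!x. x : KK ==> 0 < x"
  using V(1) Z(1) R(1) L(1) by (auto simp: KK_def)
 define ka0 where "ka0 = Min KK"
 have ka0: "0 < ka0" "!!x. x : KK ==> ka0 <= x" using KK by (auto simp: ka0_def)
 define GG where "GG = insert 1 ((%(v, v'). abs (Re v - Re v')) ` {(v, v'). v : V & v' : V & v ~= v'})"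
 have finG: "finite GG"
  unfolding GG_def using V(1) by (auto intro!: finite_subset[OF _ finite_cartesian_product[OF V(1) V(1)]])
 have "0 < Min GG" using finG V(3) by (auto simp: GG_def inj_on_def Min_gr_iff)
 \<comment> \<open>\<open>s\<close> will be the size of the new side, so it has to be below
   \<open>ka0\<close> to fit under the final scale 1; a quarter of the smallest gap keeps the boxes
   apart.\<close>
 define s where "s = min (Min GG / 4) (ka0 / 2)"
 have s: "0 < s" "s < ka0" "s <= 1" "!!v v'. v : V ==> v' : V ==> v ~= v' ==> 4 * s <= abs (Re v - Re v')"
 proof -
  show "0 < s" "s < ka0" "s <= 1"
   using \<open>0 < Min GG\<close> ka0(1) ka0(2)[of 1] by (auto simp: s_def KK_def)
  fix v v' assume "v : V" "v' : V" "v ~= v'"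
  hence "abs (Re v - Re v') : GG"
   unfolding GG_def by (intro insertI2 image_eqI[of _ _ "(v, v')"]) auto
  hence "Min GG <= abs (Re v - Re v')" using finG by simp
  thus "4 * s <= abs (Re v - Re v')" by (auto simp: s_def min_def)
 qed
 \<comment> \<open>The first bound lets \<open>s\<close> be inserted as a scale after
   \<open>e k\<close>; the second yields the condition \<open>C * (2 * E) < s / 4\<close> of the
   sweep with \<open>E = ka\<close>.\<close>
 define ka where "ka = min (ka0 * s) (s / (16 * (C + 1)))"
 have ka: "0 < ka" "ka <= ka0 * s" "ka <= 1" "ka <= ka0" "C * (2 * ka) < s / 4"
 proof -
  show "0 < ka" "ka <= ka0 * s" using ka0(1) s(1) C by (auto simp: ka_def)
  have "ka0 * s <= ka0 * 1" using ka0(1) s(3) by (intro mult_left_mono) auto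
  thus "ka <= ka0" by (auto simp: ka_def)
  thus "ka <= 1" using ka0(2)[of 1] by (simp add: KK_def)
  have "C * (2 * ka) <= C * (2 * (s / (16 * (C + 1))))"
   using C by (intro mult_left_mono) (auto simp: ka_def)
  also have "... < s / 4" using C s(1) by (simp add: divide_simps)
  finally show "C * (2 * ka) < s / 4" .
 qed
 have "LL J k y t ((SUM v:{v : uminus ` V. s <= Re v}. bL v) + ((SUM v:{v : V. s <= Re v}. bR v) + bZ)) ka"
  unfolding LL_def
 proof (intro allI impI)
  fix e ta assume ch: "chain ka k e" and hol: "holonomy (MM J) ta"
  have ei: "0 < e i" "e i <= ka" if "i <= k" for i
  proof -
   show "0 < e i" using chain_pos[OF ch ka(1)] that by simp
   show "e i <= ka" using chain_less[OF ch ka(1,3), of i "Suc k"] that ch by (simp add: chain_def)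
  qed
  have wdep: "EX v:uminus ` V. domi (S Un y ` {1..k}) w v C"
   if S: "S <= J" and sp: "fst w : vec.span (fst ` (S Un y ` {1..k}))" for S
  proof -
   have "(- 1) *s fst w : vec.span (fst ` (S Un y ` {1..k}))" by (rule vec.span_scale[OF sp])
   hence "fst (asc omp h0) : vec.span (fst ` (S Un y ` {1..k}))" by (simp add: w_def u_def)
   from dep[rule_format, OF S this] obtain v where v: "v : V" "domi (S Un y ` {1..k}) u v C"
    unfolding u_def by blast
   have "cmod (ev w x - (- v)) = cmod (ev u x - v)" for x by (simp add: w_def norm_minus_commute)
   thus ?thesis using v by (intro bexI[of _ "- v"]) auto
  qed
  interpret A: sweep J k y t e ta u V s C ka
  proof (rule sweep.intro)
   show "EX v:V. domi (S Un y ` {1..k}) u v C"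
    if "S <= J" "fst u : vec.span (fst ` (S Un y ` {1..k}))" for S
    using dep[rule_format, OF that(1)] that(2) unfolding u_def by blast
   show "4 * s <= abs (Re v - Re v')" if "v : V" "v' : V" "v ~= v'" for v v' by (rule s(4)[OF that])
  qed (use J hol V s(1) ei C ka in simp_all)
  interpret B: sweep J k y t e ta w "uminus ` V" s C ka
  proof (rule sweep.intro)
   show "4 * s <= abs (Re v - Re v')" if "v : uminus ` V" "v' : uminus ` V" "v ~= v'" for v v'
    using s(4)[of "- v" "- v'"] that by (auto simp: abs_minus_commute)
   show "EX v:uminus ` V. domi (S Un y ` {1..k}) w v C"
    if "S <= J" "fst w : vec.span (fst ` (S Un y ` {1..k}))" for S by (rule wdep[OF that])
  qed (use J hol V s(1) ei C ka in simp_all)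
  let ?e = "e(Suc k := s, Suc (Suc k) := 1)"
  have che: "chain ka' (Suc k) ?e" if "ka0 <= ka'" for ka' unfolding chain_def
  proof (intro conjI allI impI)
   show "0 < ?e 0" "?e (Suc (Suc k)) = 1" using ei(1)[of 0] by auto
   fix i assume "i <= Suc k"
   then consider "i < k" | "i = k" | "i = Suc k" by linarith
   thus "?e i < ka' * ?e (Suc i)"
   proof cases
    case 1
    hence "e i < ka * e (Suc i)" using ch by (simp add: chain_def)
    also have "... <= ka' * e (Suc i)"
     using ei(1)[of "Suc i"] 1 ka(4) that by (intro mult_right_mono) auto
    finally show ?thesis using 1 by simp
   next
    case 2
    have "e k < ka * 1" using ch by (auto simp: chain_def)
    also have "... <= ka' * s"
     using order_trans[OF ka(2) mult_right_mono[OF that, of s]] s(1) by simp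
    finally show ?thesis using 2 by simp
   next
    case 3
    thus ?thesis using s(2) that by simp
   qed
  qed
  have XXeq: "XX J (Suc k) (Y' a) ?e = XX J k y e Int {x. abs (Re (ev a x)) < s & abs (Im (ev a x)) < s}" for a
   unfolding XX_def Om_Suc Y'_def Om_upd by auto
  have YYeq: "YY J (Suc k) (Y' a) (T' r) ?e = XX J (Suc k) (Y' a) ?e Int ({x. r & Re (ev a x) < - s / 2} Un (RR k y t e Un TT J (e 0)))" for a r
   unfolding YY_def RR_Suc Y'_def T'_def RR_upd by auto
  have cZ: "A.thc (A.Xv 0) (A.Xv 0 Int A.Q) (rk J k y) bZ"
  proof -
   have "A.thc (XX J (Suc k) (Y' u) ?e) (YY J (Suc k) (Y' u) (T' False) ?e) (rk J (Suc k) (Y' u)) bZ"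
    using Z(2) che[of kaZ] ka0(2)[of kaZ] hol by (auto simp: LL_def KK_def)
   moreover have "rk J (Suc k) (Y' u) = rk J k y" by (rule rk[of u 1]) simp
   ultimately show ?thesis unfolding YYeq XXeq A.Xv_def by simp
  qed
  have cR: "A.thc (A.Xv v) (A.Xv v Int ({x. Re (ev u x - v) < - s / 2} Un A.Q)) (rk J k y) (bR v)" if "v : V" for v
  proof -
   have "A.thc (XX J (Suc k) (Y' (ash u v)) ?e) (YY J (Suc k) (Y' (ash u v)) (T' True) ?e) (rk J (Suc k) (Y' (ash u v))) (bR v)"
    using R(2)[of v] che[of "kaR v"] ka0(2)[of "kaR v"] that hol by (auto simp: LL_def KK_def)
   moreover have "rk J (Suc k) (Y' (ash u v)) = rk J k y" by (rule rk[of _ 1]) simp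
   ultimately show ?thesis unfolding YYeq XXeq A.Xv_def by simp
  qed
  have cL: "A.thc (B.Xv v) (B.Xv v Int ({x. Re (ev w x - v) < - s / 2} Un B.Q)) (rk J k y) (bL v)" if "v : uminus ` V" for v
  proof -
   have "A.thc (XX J (Suc k) (Y' (ash w v)) ?e) (YY J (Suc k) (Y' (ash w v)) (T' True) ?e) (rk J (Suc k) (Y' (ash w v))) (bL v)"
    using L(2)[of v] che[of "kaL v"] ka0(2)[of "kaL v"] that hol by (auto simp: LL_def KK_def)
   moreover have "rk J (Suc k) (Y' (ash w v)) = rk J k y" by (rule rk[of _ "- 1"]) (simp add: w_def)
   ultimately show ?thesis unfolding YYeq XXeq B.Xv_def by simp
  qed
  have adm: "Re v + s <= s \<or> s + s <= Re v" if "v : V" for v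
   using s(4)[OF that V(2)] s(1) by (cases "v = 0") auto
  have admw: "Re v + s <= s \<or> s + s <= Re v" if v: "v : uminus ` V" for v
  using v s(4) V(2) s(1) by fastforce
  have "A.thc (A.N {- s<..}) (A.N ({- s<..} Int {..<s})) (rk J k y) (SUM v:{v : V. s <= Re v}. bR v)"
   by (rule A.sweep_right) (use adm cR s(1) in auto)
  moreover have "{- s<..} Int {..<s} = {- s<..<s}" by auto
  ultimately have r: "A.thc (A.N {- s<..}) (A.N {- s<..<s}) (rk J k y) (SUM v:{v : V. s <= Re v}. bR v)"
   by simp
  have "A.thc (B.N UNIV) (B.N (UNIV Int {..<s})) (rk J k y) (SUM v:{v : uminus ` V. s <= Re v}. bL v)"
   by (rule B.sweep_right) (use admw cL s(1) in auto)
  \<comment> \<open>In terms of \<open>u\<close>, the part where \<open>w\<close> has real part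
    below \<open>s\<close> is the part above \<open>- s\<close>; here the two half sweeps
    meet.\<close>
  moreover have "B.N UNIV = XX J k y e" "B.N (UNIV Int {..<s}) = A.N {- s<..}"
   unfolding B.N_def A.N_def by (auto simp: YY_def w_def)
  ultimately have l: "A.thc (XX J k y e) (A.N {- s<..}) (rk J k y) (SUM v:{v : uminus ` V. s <= Re v}. bL v)"
   by simp
  have z: "A.thc (A.N {- s<..<s}) (YY J k y t e) (rk J k y) bZ" by (rule A.step_start[OF V(2) cZ])
  have N1: "A.N {- s<..<s} <= A.N {- s<..}" "A.N {- s<..} <= XX J k y e" "YY J k y t e <= A.N {- s<..<s}"
   using A.N_mono[of "{- s<..<s}" "{- s<..}"] A.N_sub by (auto simp: A.N_def)
  have "A.thc (A.N {- s<..}) (YY J k y t e) (rk J k y) ((SUM v:{v : V. s <= Re v}. bR v) + bZ)"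
   by (rule A.thc_triple[OF _ N1(1,3) r z]) (use N1(2) A.XM in blast)
  thus "A.thc (XX J k y e) (YY J k y t e) (rk J k y) ((SUM v:{v : uminus ` V. s <= Re v}. bL v) + ((SUM v:{v : V. s <= Re v}. bR v) + bZ))"
   by (rule A.thc_triple[OF A.XM N1(2) order_trans[OF N1(3,1)] l])
 qed
 thus ?thesis using ka(1) by blast
qed

section \<open>Pulling a holonomy back along a map homotopic to the inclusion\<close>

lemma (in holonomy) hol_square:
 fixes F :: "real => real => 'a"
 assumes cont: "continuous_on ({0..1} \<times> {0..1}) (%z. F (fst z) (snd z))"
  and F: "!!s t. s : {0..1} ==> t : {0..1} ==> F s t : X"
 shows "hol (%s. F s 0) * hol (%t. F 1 t) = hol (%t. F 0 t) * hol (%s. F s 1)"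
proof -
 define K :: "(nat => real) set" where "K = {z. z 0 : {0..1} & z 1 : {0..1}}"
 define G where "G z = F (z 0) (z (1::nat))" for z
 define q where "q a b = (%i::nat. if i = 0 then a else if i = 1 then b else (0::real))" for a b
 have K: "fconvex K" unfolding fconvex_def K_def seg_def
  by (auto intro!: add_nonneg_nonneg mult_nonneg_nonneg convex_bound_le)
 have Gc: "continuous_on K G"
 proof -
  show ?thesis using continuous_on_compose2[OF cont, of K "%z. (z 0, z 1)"]
   by (fastforce intro: continuous_on_Pair continuous_on_subset[OF continuous_on_product_coordinates subset_UNIV] simp: K_def G_def[abs_def])
 qed
 have GX: "G ` K <= X" unfolding G_def K_def using F by auto
 have qK: "q 0 0 : K" "q 1 0 : K" "q 0 1 : K" "q 1 1 : K" by (auto simp: q_def K_def)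
 show ?thesis using wt_trans[OF K Gc GX qK(1,2,4)] wt_trans[OF K Gc GX qK(1,3,4)]
  by (simp_all add: wt_def G_def q_def seg_def o_def)
qed

lemma holonomy_pullback:
 assumes "holonomy X hol" and r: "continuous_on X' r" "r ` X' <= X"
 shows "holonomy X' (%gam. hol (r o gam))"
proof -
 interpret holonomy X hol by fact
 have p: "path (r o g) & path_image (r o g) <= X" if "path g" "path_image g <= X'" for g
  using that r by (auto simp: path_image_compose intro!: path_continuous_image continuous_on_subset[OF r(1)])
 show ?thesis
 proof
  show "hol (r o g) ~= 0" if "path g" "path_image g <= X'" for g using hol_nz p[OF that] by blast
  show "hol (r o (g +++ h)) = hol (r o g) * hol (r o h)"
   if "path g" "path_image g <= X'" "path h" "path_image h <= X'" "pathfinish g = pathstart h" for g h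
   unfolding path_compose_join using p[OF that(1,2)] p[OF that(3,4)] that(5)
   by (intro hol_join) (auto simp: pathfinish_compose pathstart_compose)
  show "hol (r o g) = hol (r o h)" if "homotopic_paths X' g h" for g h
   using homotopic_paths_continuous_image[OF that r(1)] r(2) by (intro hol_homotopic) auto
 qed
qed

text \<open>The holonomies of the tracks \<open>H x\<close> from \<open>x\<close> to
  \<open>r x\<close> form, by \<open>hol_square\<close>, a gauge transformation over
  \<open>S\<close> between the system and its pullback along \<open>r\<close>.\<close>

lemma thc_homotopic_pullback:
 fixes H :: "'a::real_normed_vector => real => 'a"
 assumes h: "holonomy X hol" and r: "continuous_on X' r" "r ` X' <= X"
  and S: "S <= X" "S <= X'" and H: "continuous_on (S \<times> {0..1}) (%z. H (fst z) (snd z))"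
  "!!x t. x : S ==> t : {0..1} ==> H x t : X" "!!x. x : S ==> H x 0 = x" "!!x. x : S ==> H x 1 = r x"
  and AB: "A <= S" "B <= A" and hc: "holonomy.thc (%gam. hol (r o gam)) A B k b"
 shows "holonomy.thc hol A B k b"
proof -
 interpret holonomy X hol by fact
 have Hp: "path (H x)" "path_image (H x) <= X" if "x : S" for x
 proof -
  show "path (H x)"
   unfolding path_def by (rule continuous_on_compose2[OF H(1), of "{0..1}" "%t. (x, t)", simplified])
    (use that in \<open>auto intro!: continuous_intros\<close>)
  show "path_image (H x) <= X" using H(2)[OF that] by (auto simp: path_image_def)
 qed
 have "holonomy.thc hol (id ` A) (id ` B) k b"
 proof (rule thc_transport[OF holonomy_pullback[OF h r] h S(2), where g = id and g' = id and u = "%x. hol (H x)"])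
  fix gam :: "real => 'a" assume g: "path gam" "path_image gam <= S"
  have gS: "gam s : S" if "s : {0..1}" for s using g(2) that by (auto simp: path_image_def)
  have sq: "hol (%s. H (gam s) 0) * hol (%t. H (gam 1) t) = hol (%t. H (gam 0) t) * hol (%s. H (gam s) 1)"
  proof (rule hol_square)
   have "continuous_on ({0..1} \<times> {0..1}) (%z. gam (fst z))"
    using g(1) unfolding path_def by (rule continuous_on_compose2) (auto intro!: continuous_intros)
   thus "continuous_on ({0..1} \<times> {0..1}) (%z. H (gam (fst z)) (snd z))"
    by (intro continuous_on_compose2[OF H(1), of _ "%z. (gam (fst z), snd z)", simplified])
     (auto intro!: continuous_intros gS)
   show "H (gam s) t : X" if "s : {0..1}" "t : {0..1}" for s t using H(2) gS that by blast
  qed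
  have "hol gam = hol (%s. H (gam s) 0)" using g S gS H(3) by (intro hol_cong) auto
  moreover have "hol (r o gam) = hol (%s. H (gam s) 1)"
  proof (rule hol_cong)
   show "path (r o gam)"
    using g S(2) by (intro path_continuous_image continuous_on_subset[OF r(1)]) auto
   show "path_image (r o gam) <= X" using g S(2) r(2) by (auto simp: path_image_compose)
  qed (use H(4) gS in auto)
  ultimately show "hol (id o gam) = hol (H (pathstart gam)) * hol (r o gam) / hol (H (pathfinish gam))" using hol_nz Hp gS[of 1] using sq
   by (simp add: pathstart_def pathfinish_def field_simps)
 next
  show "hol (H x) ~= 0" if "x : S" for x using hol_nz Hp[OF that] by blast
 qed (use S(1) AB hc in \<open>auto simp: o_def\<close>)
 thus ?thesis by simp
qed

text \<open>All hyperplanes and all sides of the box pass through \<open>p\<close>, so dependences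
  between the functionals are homogeneous: 0 is the only critical value.\<close>

locale central =
 fixes J :: "('n::finite) aff set" and k :: nat and y :: "nat => 'n aff" and t :: "nat => bool" and p
 assumes J: "finite J" and Jp: "!!h. h : J ==> ev h p = 0" and yp: "!!i. i : {1..k} ==> ev (y i) p = 0"
  and valid: "valid J k y t"
begin

text \<open>The constant of \<open>dependent_bound\<close> is the value at the common zero
  \<open>p\<close>, hence 0, and the finitely many dependences have a common bound.\<close>

lemma bound_exists:
 "EX C>=0. ALL S<=J. ALL l:{1..k}. fst (y l) : vec.span (fst ` (S Un y ` {1..<l})) -->
   (ALL x m. 0 <= m --> (ALL g:S Un y ` {1..<l}. cmod (ev g x) <= m) --> cmod (ev (y l) x) <= C * m)"
proof -
 have "ALL z:Pow J \<times> {1..k}. EX C. 0 <= C & (fst (y (snd z)) : vec.span (fst ` (fst z Un y ` {1..<snd z})) -->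
   (ALL x m. 0 <= m --> (ALL g:fst z Un y ` {1..<snd z}. cmod (ev g x) <= m) --> cmod (ev (y (snd z)) x) <= C * m))"
 proof
  fix z assume z: "z : Pow J \<times> {1..k}"
  let ?F = "fst z Un y ` {1..<snd z}"
  have fin: "finite ?F" using z J finite_subset by auto
  show "EX C. 0 <= C & (fst (y (snd z)) : vec.span (fst ` ?F) -->
    (ALL x m. 0 <= m --> (ALL g:?F. cmod (ev g x) <= m) --> cmod (ev (y (snd z)) x) <= C * m))"
  proof (cases "fst (y (snd z)) : vec.span (fst ` ?F)")
   case True
   obtain v C where C: "0 <= C" "!!x m. (!!g. g : ?F ==> cmod (ev g x) <= m) ==> cmod (ev (y (snd z)) x - v) <= C * m"
    "!!p. (!!g. g : ?F ==> ev g p = 0) ==> v = ev (y (snd z)) p"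
    by (rule dependent_bound[OF fin True]) metis
   have "v = ev (y (snd z)) p" using z Jp yp by (intro C(3)) auto
   thus ?thesis using z yp using C(1,2) by auto
  qed (auto intro: exI[of _ 0])
 qed
 then obtain C where C: "!!z. z : Pow J \<times> {1..k} ==> 0 <= C z & (fst (y (snd z)) : vec.span (fst ` (fst z Un y ` {1..<snd z})) -->
   (ALL x m. 0 <= m --> (ALL g:fst z Un y ` {1..<snd z}. cmod (ev g x) <= m) --> cmod (ev (y (snd z)) x) <= C z * m))"
  by metis
 have fin: "finite (Pow J \<times> {1..k})" using J by simp
 show ?thesis
 proof (intro exI[of _ "SUM z:Pow J \<times> {1..k}. C z"] conjI allI ballI impI)
  show "0 <= (SUM z:Pow J \<times> {1..k}. C z)" using C by (intro sum_nonneg) blast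
  fix S l x and m :: real
  assume S: "S <= J" and l: "l : {1..k}" and sp: "fst (y l) : vec.span (fst ` (S Un y ` {1..<l}))"
   and m: "0 <= m" "ALL g:S Un y ` {1..<l}. cmod (ev g x) <= m"
  have z: "(S, l) : Pow J \<times> {1..k}" using S l by auto
  have "cmod (ev (y l) x) <= C (S, l) * m" using C[OF z] sp m by simp
  also have "... <= (SUM z:Pow J \<times> {1..k}. C z) * m"
   using member_le_sum[OF z _ fin, of C] C m(1) by (intro mult_right_mono) auto
  finally show "cmod (ev (y l) x) <= (SUM z:Pow J \<times> {1..k}. C z) * m" .
 qed
qed

definition C where "C = (SOME C. C >= 0 & (ALL S<=J. ALL l:{1..k}. fst (y l) : vec.span (fst ` (S Un y ` {1..<l})) -->
   (ALL x m. 0 <= m --> (ALL g:S Un y ` {1..<l}. cmod (ev g x) <= m) --> cmod (ev (y l) x) <= C * m)))"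

lemma C: "0 <= C" "!!S l x m. S <= J ==> l : {1..k} ==> fst (y l) : vec.span (fst ` (S Un y ` {1..<l})) ==>
  0 <= m ==> (ALL g:S Un y ` {1..<l}. cmod (ev g x) <= m) ==> cmod (ev (y l) x) <= C * m"
 using someI_ex[OF bound_exists] unfolding C_def[symmetric] by blast+

text \<open>Makes \<open>2 * C * ka0\<close> at most \<open>1 / 4\<close>, which is what contradicts
  the lower bound \<open>e l / 4\<close> in \<open>indep\<close>.\<close>

definition ka0 where "ka0 = 1 / (8 * (C + 1))"

lemma ka0: "0 < ka0" "ka0 <= 1" "8 * C * ka0 <= 1" using C(1) by (auto simp: ka0_def field_simps)

text \<open>If \<open>y l\<close> depended on functionals of size at most
  \<open>2 * e (l - 1)\<close>, its own size would be at most \<open>2 * C * e (l - 1)\<close>, and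
  the separation of scales puts this below \<open>e l / 4\<close>.\<close>

lemma indep:
 assumes ch: "chain ka0 k e" and S: "S <= J" "!!h. h : S ==> cmod (ev h x) < 2 * e 0"
  and l: "l : {1..k}" and x: "!!j. 1 <= j ==> j < l ==> cmod (ev (y j) x) <= 2 * e j" and big: "e l / 4 < cmod (ev (y l) x)"
 shows "fst (y l) ~: vec.span (fst ` (S Un y ` {1..<l}))"
proof
 assume sp: "fst (y l) : vec.span (fst ` (S Un y ` {1..<l}))"
 let ?m = "2 * e (l - 1)"
 have le: "e j <= e (l - 1)" if "j < l" for j
  using chain_le[OF ch ka0(1,2), of j "l - 1"] that l by auto
 have m0: "0 <= ?m"
  using chain_pos[OF ch ka0(1), of "l - 1", OF le_SucI[OF order_trans[OF diff_le_self]]] l by auto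
 have "cmod (ev (y l) x) <= C * ?m"
 proof (rule C(2)[OF S(1) l sp m0], rule ballI)
  fix g assume "g : S Un y ` {1..<l}"
  thus "cmod (ev g x) <= ?m"
  proof
   assume "g : S"
   thus ?thesis using S(2)[of g] le[of 0] l by auto
  next
   assume "g : y ` {1..<l}"
   then obtain j where "1 <= j" "j < l" "g = y j" by auto
   thus ?thesis using x[of j] le[of j] by auto
  qed
 qed
 also have "... <= C * (2 * (ka0 * e l))"
  using chain_less[OF ch ka0(1,2), of "l - 1" l] l C(1) by (intro mult_left_mono) auto
 also have "... = (8 * C * ka0) * (e l / 4)" by simp
 also have "... <= 1 * (e l / 4)"
  using chain_pos[OF ch ka0(1), of l] l ka0(3) by (intro mult_right_mono) auto
 finally show False using big by simp
qed

lemma Om_cmod: "x : Om l y e ==> 1 <= j ==> j <= l ==> cmod (ev (y j) x) <= 2 * e j"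
 using cmod_le[of "ev (y j) x"] by (force simp: Om_def)

text \<open>\<open>w\<close> leaves the arrangement fixed and moves a side of the box. That side is
  marked, since unmarked ones are multiples of members of \<open>J\<close>, so everything can flow
  out through the exit set.\<close>

lemma deficient:
 assumes w: "!!h. h : J ==> cdot (fst h) w = 0" and i0: "i0 : {1..k}" "cdot (fst (y i0)) w ~= 0"
 shows "LL J k y t 0 ka0"
proof -
 \<comment> \<open>With the smallest index, the sides before \<open>i\<close> are constant along
   \<open>w\<close>. The later ones have larger scales and may move while they are below half their
   own size.\<close>
 define i where "i = (LEAST i. i : {1..k} & cdot (fst (y i)) w ~= 0)"
 have i: "i : {1..k}" "cdot (fst (y i)) w ~= 0"
  using LeastI[of "%i. i : {1..k} & cdot (fst (y i)) w ~= 0" i0] i0 by (auto simp: i_def)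
 have min: "cdot (fst (y j)) w = 0" if "1 <= j" "j < i" for j
  using not_less_Least[of j "%i. i : {1..k} & cdot (fst (y i)) w ~= 0"] that i by (auto simp: i_def)
 have ti: "t i"
 proof (rule ccontr)
  assume "~ t i"
  then obtain h c where "h : J" "y i = asc c h" using valid i(1) by (auto simp: valid_def)
  thus False using i(2) w by simp
 qed
 show ?thesis unfolding LL_def
 proof (intro allI impI)
  fix e ta assume ch: "chain ka0 k e" and hol: "holonomy (MM J) ta"
  interpret holonomy "MM J" ta by fact
  have epos: "0 < e j" if "j <= k" for j using chain_pos[OF ch ka0(1)] that by simp
  \<comment> \<open>Full speed down to the exit threshold \<open>- e i / 2\<close>, rest below
    \<open>- 3 * e i / 4\<close>: the wall at \<open>- e i\<close> is never reached.\<close>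
  define ze where "ze z = complex_of_real (- clamp1 ((Re z + 3 * e i / 4) * (4 / e i)))" for z
  define L where "L = (%l. (y l, e l)) ` {i<..k}"
  have ei: "0 < e i" using epos i by auto
  have stepu: "Re (ev (y i) x') <= Re (ev (y i) x) & (- e i < Re (ev (y i) x) --> - e i < Re (ev (y i) x')) & Im (ev (y i) x') = Im (ev (y i) x)"
   if f: "fstep J (e 0) (y ` {1..<i}) L (y i) (%z. of_real etp * ze z) x x'" and etp: "0 < etp" "etp <= e i / 8" for x x' etp
  proof -
   obtain c where c: "c : {0..1}" "ev (y i) x' = ev (y i) x + of_real c * (of_real etp * ze (ev (y i) x))"
    using f unfolding fstep_def by blast
   let ?c = "clamp1 ((Re (ev (y i) x) + 3 * e i / 4) * (4 / e i))"
   have Rex: "Re (ev (y i) x') = Re (ev (y i) x) - (c * etp) * ?c" "Im (ev (y i) x') = Im (ev (y i) x)"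
    using c(2) by (simp_all add: ze_def)
   have "c * ?c <= 1 * 1" using c(1) clamp1(1,2) by (intro mult_mono) auto
   hence "(c * etp) * ?c <= etp"
    using mult_left_mono[of "c * ?c" 1 etp] etp(1) by (simp only: mult_ac) simp
   hence c1: "(c * etp) * ?c <= e i / 8" using etp(2) by linarith
   show ?thesis
   proof (cases "Re (ev (y i) x) <= - 3 * e i / 4")
    case True
    hence "(Re (ev (y i) x) + 3 * e i / 4) * (4 / e i) <= 0"
     using ei by (intro mult_nonpos_nonneg) auto
    hence "?c = 0" by (rule clamp1(3))
    thus ?thesis using Rex by simp
   next
    case False
    thus ?thesis using Rex c(1) etp clamp1(1) c1 ei by simp
   qed
  qed
  have stepj: "ev (y j) x' = ev (y j) x" if "fstep J (e 0) (y ` {1..<i}) L (y i) ze' x x'" "1 <= j" "j < i" for j x x' ze'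
   using that unfolding fstep_def by auto
  have stepl: "ev (y l) x' = ev (y l) x \<or> (cmod (ev (y l) x) < e l / 2 & cmod (ev (y l) x') < e l)"
   if "fstep J (e 0) (y ` {1..<i}) L (y i) ze' x x'" "i < l" "l <= k" for l x x' ze'
   using that unfolding fstep_def L_def by auto
  have XXstep: "x' : XX J k y e" if x: "x : XX J k y e" and f: "fstep J (e 0) (y ` {1..<i}) L (y i) (%z. of_real etp * ze z) x x'" "0 < etp" "etp <= e i / 8" for x x' etp
  proof -
   have "x' : MM J" using fstep_MM[OF f(1)] x epos[of 0] by (auto simp: XX_def)
   moreover have "abs (Re (ev (y j) x')) < e j & abs (Im (ev (y j) x')) < e j" if j: "j : {1..k}" for j
   proof -
    have old: "abs (Re (ev (y j) x)) < e j" "abs (Im (ev (y j) x)) < e j"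
     using x j by (auto simp: XX_def Om_def)
    consider "j < i" | "j = i" | "i < j" by linarith
    thus ?thesis
    proof cases
     case 1
     thus ?thesis using stepj[OF f(1)] j old by simp
    next
     case 2
     thus ?thesis using stepu[OF f] old by auto
    next
     case 3
     then consider "ev (y j) x' = ev (y j) x" | "cmod (ev (y j) x') < e j"
      using stepl[OF f(1) 3] j by auto
     thus ?thesis
      using old abs_Re_le_cmod[of "ev (y j) x'"] abs_Im_le_cmod[of "ev (y j) x'"] by cases auto
    qed
   qed
   ultimately show ?thesis by (auto simp: XX_def Om_def)
  qed
  have RRstep: "x' : RR k y t e" if x: "x : RR k y t e" and f: "fstep J (e 0) (y ` {1..<i}) L (y i) (%z. of_real etp * ze z) x x'" "0 < etp" "etp <= e i / 8" for x x' etp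
  proof -
   obtain j where j: "j : {1..k}" "t j" "Re (ev (y j) x) < - e j / 2" using x by (auto simp: RR_def)
   consider "j < i" | "j = i" | "i < j" by linarith
   hence "Re (ev (y j) x') < - e j / 2"
   proof cases
    case 1
    thus ?thesis using stepj[OF f(1)] j by simp
   next
    case 2
    thus ?thesis using stepu[OF f] j by auto
   next
    case 3
    show ?thesis using j(3) abs_Re_le_cmod[of "ev (y j) x"] using stepl[OF f(1) 3] j using j by auto
   qed
   thus ?thesis using j by (auto simp: RR_def)
  qed
  have "thz (XX J k y e) (YY J k y t e)"
  proof (rule uflow[where Z = UNIV and Zc = UNIV and ze = ze and ?etp0.0 = "e i / 8" and L = L and K = "y ` {1..<i}" and u = "y i"
     and ep = "e 0" and J = J and m = Re and ?m0.0 = "- e i / 2"])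
   show "x' : XX J k y e" if "0 < etp" "etp <= e i / 8" "x : XX J k y e" "fstep J (e 0) (y ` {1..<i}) L (y i) (%z. of_real etp * ze z) x x'" for x x' etp
    by (rule XXstep[OF that(3,4,1,2)])
   show "x' : YY J k y t e" if "0 < etp" "etp <= e i / 8" "x : YY J k y t e" "fstep J (e 0) (y ` {1..<i}) L (y i) (%z. of_real etp * ze z) x x'" for x x' etp
    using that(3) XXstep[OF _ that(4,1,2)] RRstep[OF _ that(4,1,2)] fstep_TT[OF that(4)] by (auto simp: YY_def)
   show "fst (y i) ~: vec.span (fst ` (S Un y ` {1..<i} Un fst ` L'))"
    if x: "x : XX J k y e" and S: "S <= J" "!!h. h : S ==> cmod (ev h x) < 2 * e 0"
     and L': "L' <= L" "!!g a. (g, a) : L' ==> a / 4 < cmod (ev g x)" for x S L'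
   proof -
    define D where "D = {l:{i<..k}. (y l, e l) : L'}"
    have fL: "fst ` L' = y ` D" using L'(1) by (force simp: D_def L_def)
    have xj: "cmod (ev (y j) x) <= 2 * e j" if "1 <= j" "j <= k" for j
     using Om_cmod[of x k e j] x that by (auto simp: XX_def)
    \<comment> \<open>The large sides are added in increasing order. By \<open>indep\<close> the
      side \<open>Suc l\<close> is independent of everything of smaller index, \<open>y i\<close>
      included, so by exchange it cannot bring \<open>y i\<close> into the span.\<close>
    have "fst (y i) ~: vec.span (fst ` (S Un y ` {1..<i} Un y ` (D Int {..l})))" if "i <= l" "l <= k" for l
     using that
    proof (induction l rule: dec_induct)
     case base
     have "D Int {..i} = {}" by (auto simp: D_def)
     moreover have "cdot v w = 0" if "v : vec.span (fst ` (S Un y ` {1..<i}))" for v using that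
     proof (induction rule: vec.span_induct_alt)
      case (step c a b)
      thus ?case using w S(1) min using step by auto
     qed simp
     ultimately show ?case using i(2) by auto
    next
     case (step l)
     let ?F = "fst ` (S Un y ` {1..<i} Un y ` (D Int {..l}))"
     have IH: "fst (y i) ~: vec.span ?F" using step by simp
     show ?case
     proof (cases "Suc l : D")
      case False
      hence "D Int {..Suc l} = D Int {..l}" by (auto simp: le_Suc_eq)
      thus ?thesis using IH by simp
     next
      case True
      hence D: "D Int {..Suc l} = insert (Suc l) (D Int {..l})" by (auto simp: le_Suc_eq)
      have eq: "fst ` (S Un y ` {1..<i} Un y ` (D Int {..Suc l})) = insert (fst (y (Suc l))) ?F"
       unfolding D by auto
      have lk: "Suc l : {1..k}" and big: "e (Suc l) / 4 < cmod (ev (y (Suc l)) x)"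
       using True L'(2) by (auto simp: D_def)
      have "fst (y (Suc l)) ~: vec.span (fst ` (S Un y ` {1..<Suc l}))"
       by (rule indep[OF ch S lk _ big]) (use xj step.prems in auto)
      moreover have "insert (fst (y i)) ?F <= fst ` (S Un y ` {1..<Suc l})"
       using step.hyps i by (auto simp: D_def)
      ultimately show ?thesis using vec.span_mono unfolding eq using vec.in_span_insert[OF _ IH]
       by blast
     qed
    qed
    from this[of k] have "fst (y i) ~: vec.span (fst ` (S Un y ` {1..<i} Un y ` (D Int {..k})))"
     using i by auto
    moreover have "D Int {..k} = D" by (auto simp: D_def)
    ultimately show ?thesis unfolding fL by simp
   qed
   show "EX c>0. ALL x:XX J k y e - YY J k y t e. Re (ev (y i) x + of_real etp * ze (ev (y i) x)) <= Re (ev (y i) x) - c"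
    if "0 < etp" "etp <= e i / 8" for etp
   proof (intro exI[of _ etp] conjI ballI)
    fix x assume "x : XX J k y e - YY J k y t e"
    thus "Re (ev (y i) x + of_real etp * ze (ev (y i) x)) <= Re (ev (y i) x) - etp" using i ti using ei
     by (auto simp: YY_def RR_def ze_def clamp1(4))
   qed (use that in simp)
   show "- e i / 2 <= Re (ev (y i) x)" if "x : XX J k y e" "x ~: YY J k y t e" for x
    using that i ti by (auto simp: YY_def RR_def)
   show "cmod (ze z) <= 1" for z unfolding ze_def norm_of_real using clamp1(1,2) by simp
   show "continuous_on UNIV ze" "continuous_on UNIV Re"
    unfolding ze_def by (intro continuous_intros)+
   show "finite L" "!!g a. (g, a) : L ==> 0 < a" using epos by (auto simp: L_def)
   show "YY J k y t e <= XX J k y e" "XX J k y e <= MM J" by (auto simp: YY_def XX_def)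
  qed (use J hol epos[of 0] ei in simp_all)
  thus "thc (XX J k y e) (YY J k y t e) (rk J k y) 0" using thz_thc by blast
 qed
qed

end

section \<open>Exit faces of a central box and their slices\<close>

context central
begin

text \<open>The exit face of side \<open>i\<close>, with only the sides up to \<open>l\<close>
  imposed.\<close>

definition FF where "FF e i l = MM J Int Om l y e Int {x. Re (ev (y i) x) < - e i / 2}" for e :: "nat => real"

text \<open>Sets determined by the sides before \<open>i\<close> and by the tubes, the latter only
  in the direction in which flows preserve them. What face \<open>i\<close> meets when the faces
  before it and the tubes are already there has this form.\<close>

definition closedG :: "(nat => real) => nat => (complex ^ 'n) set => bool" where
 "closedG e i G \<longleftrightarrow> (ALL x x'. x : G --> (ALL j:{1..<i}. ev (y j) x' = ev (y j) x) --> (x : TT J (e 0) --> x' : TT J (e 0)) --> x' : G)"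

lemma closedG: "closedG e i UNIV" "1 <= i ==> closedG e i (RR (i - 1) y t e Un TT J (e 0))"
proof -
 show "closedG e i UNIV" by (simp add: closedG_def)
 assume "1 <= i"
 thus "closedG e i (RR (i - 1) y t e Un TT J (e 0))" unfolding closedG_def RR_def by fastforce
qed

text \<open>A side \<open>l\<close> beyond \<open>i\<close> may be dropped: where \<open>y l\<close>
  is not small it is independent of the smaller sides and the nearby hyperplanes by
  \<open>indep\<close>, so it can be contracted radially while those stand still.\<close>

lemma free_one:
 assumes ch: "chain ka0 k e" and hol: "holonomy (MM J) ta" and il: "1 <= i" "i < l" "l <= k" and G: "closedG e i G"
 shows "holonomy.thz ta (FF e i (l - 1) Int G) (FF e i l Int G)"
proof -
 have el: "0 < e l" using chain_pos[OF ch ka0(1)] il by simp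
 \<comment> \<open>Radial inward motion with speed \<open>clamp1 (cmod z - e l / 2)\<close>. The
   \<open>max\<close> differs from \<open>cmod z\<close> only where this speed is 0 and keeps the
   quotient continuous there.\<close>
 define c where "c z = clamp1 (cmod z - e l / 2) / max (cmod z) (e l / 4)" for z
 define ze where "ze z = - (of_real (c z) * z)" for z
 have mx: "0 < max (cmod z) (e l / 4)" for z using el by (simp add: less_max_iff_disj)
 have c0: "0 <= c z" for z unfolding c_def using clamp1(1) mx[of z] by simp
 have c1: "etp * c z <= 1" if "0 < etp" "etp <= e l / 4" for etp z
 proof -
  have "etp * clamp1 (cmod z - e l / 2) <= (e l / 4) * 1"
   using that clamp1(1,2) by (intro mult_mono) auto
  thus ?thesis unfolding c_def using mx[of z] by (simp add: divide_le_eq max_def)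
 qed
 have stepu: "EX r:{0..1}. ev (y l) x' = of_real r * ev (y l) x"
  if f: "fstep J (e 0) (y ` {1..<l}) {} (y l) (%z. of_real etp * ze z) x x'" and etp: "0 < etp" "etp <= e l / 4" for x x' etp
 proof -
  obtain s where s: "s : {0..1}" "ev (y l) x' = ev (y l) x + of_real s * (of_real etp * ze (ev (y l) x))"
   using f unfolding fstep_def by blast
  let ?z = "ev (y l) x"
  have "s * (etp * c ?z) <= 1 * 1" "0 <= s * (etp * c ?z)"
   using s(1) c1[OF etp, of ?z] c0[of ?z] etp by (intro mult_mono | simp)+
  thus ?thesis
   using s(2) by (intro bexI[of _ "1 - s * (etp * c ?z)"]) (auto simp: ze_def algebra_simps)
 qed
 have stepj: "ev (y j) x' = ev (y j) x" if "fstep J (e 0) (y ` {1..<l}) {} (y l) ze' x x'" "1 <= j" "j < l" for j x x' ze'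
  using that unfolding fstep_def by auto
 have Gstep: "x' : G" if "x : G" "fstep J (e 0) (y ` {1..<l}) {} (y l) ze' x x'" for x x' ze'
  using G that stepj[OF that(2)] fstep_TT[OF that(2)] il unfolding closedG_def by auto
 have Astep: "x' : FF e i (l - 1)" if x: "x : FF e i (l - 1)" and f: "fstep J (e 0) (y ` {1..<l}) {} (y l) ze' x x'" for x x' ze'
 proof -
  have "x' : MM J" using fstep_MM[OF f] x ch by (auto simp: FF_def chain_def)
  moreover have "ev (y j) x' = ev (y j) x" if "j : {1..l - 1}" for j using stepj[OF f] that by auto
  ultimately show ?thesis using x il stepj[OF f, of i] by (auto simp: FF_def Om_def)
 qed
 have Fl: "FF e i l = FF e i (l - 1) Int {x. abs (Re (ev (y l) x)) < e l & abs (Im (ev (y l) x)) < e l}"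
  using Om_Suc[of "l - 1" y e] il by (auto simp: FF_def)
 have rz: "abs (r * a) < b" if "abs a < b" "r : {0..1}" for r a b :: real
  using mult_right_mono[of r 1 "abs a"] that by (auto simp: abs_mult)
 interpret holonomy "MM J" ta by fact
 show ?thesis
 proof (rule uflow[where Z = "{z. e l / 4 < cmod z}" and Zc = "{z. e l / 2 <= cmod z}" and ze = ze and ?etp0.0 = "e l / 4" and L = "{}"
    and K = "y ` {1..<l}" and u = "y l" and ep = "e 0" and J = J and m = cmod and ?m0.0 = 0])
  show "open {z. e l / 4 < cmod z}" "closed {z. e l / 2 <= cmod z}"
   by (intro open_Collect_less closed_Collect_le continuous_intros)+
  show "{z. e l / 2 <= cmod z} <= {z. e l / 4 < cmod z}" using el by auto
  show "continuous_on UNIV ze"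
   unfolding ze_def c_def using mx by (intro continuous_intros) (metis less_irrefl)
  show "cmod (ze z) <= 1" for z
  proof -
   have "clamp1 (cmod z - e l / 2) * cmod z <= 1 * max (cmod z) (e l / 4)"
    using clamp1(1,2) by (intro mult_mono) auto
   thus ?thesis
    using mx[of z] by (simp add: ze_def c_def norm_mult norm_divide divide_le_eq abs_of_nonneg[OF clamp1(1)])
  qed
  show "ze z = 0" if "z ~: {z. e l / 2 <= cmod z}" for z
   using that clamp1(3)[of "cmod z - e l / 2"] by (simp add: ze_def c_def)
  show "x' : FF e i (l - 1) Int G" if "0 < etp" "etp <= e l / 4" "x : FF e i (l - 1) Int G"
   "fstep J (e 0) (y ` {1..<l}) {} (y l) (%z. of_real etp * ze z) x x'" for x x' etp
   using Astep[OF _ that(4)] Gstep[OF _ that(4)] that(3) by blast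
  show "x' : FF e i l Int G" if etp: "0 < etp" "etp <= e l / 4" and x: "x : FF e i l Int G"
   and f: "fstep J (e 0) (y ` {1..<l}) {} (y l) (%z. of_real etp * ze z) x x'" for x x' etp
  proof -
   obtain r where "r : {0..1}" "ev (y l) x' = of_real r * ev (y l) x" using stepu[OF f etp] by blast
   thus ?thesis using Astep[OF _ f] Gstep[OF _ f] x rz unfolding Fl by auto
  qed
  show "fst (y l) ~: vec.span (fst ` (S Un y ` {1..<l} Un fst ` L'))"
   if x: "x : FF e i (l - 1) Int G" "ev (y l) x : {z. e l / 4 < cmod z}" and S: "S <= J" "!!h. h : S ==> cmod (ev h x) < 2 * e 0"
    and L': "L' <= {}" for x S L'
  proof -
   have "fst (y l) ~: vec.span (fst ` (S Un y ` {1..<l}))"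
    by (rule indep[OF ch S]) (use il x Om_cmod[of x "l - 1" e] in \<open>auto simp: FF_def\<close>)
   thus ?thesis using L' by simp
  qed
  show "EX ca>0. ALL x:FF e i (l - 1) Int G - FF e i l Int G. cmod (ev (y l) x + of_real etp * ze (ev (y l) x)) <= cmod (ev (y l) x) - ca"
   if etp: "0 < etp" "etp <= e l / 4" for etp
  proof (intro exI[of _ "etp * clamp1 (e l / 2)"] conjI ballI)
   show "0 < etp * clamp1 (e l / 2)" using etp el clamp1(5)[of "e l / 2"] by simp
   fix x assume x: "x : FF e i (l - 1) Int G - FF e i l Int G"
   let ?z = "ev (y l) x"
   have z: "e l <= cmod ?z" using x abs_Re_le_cmod[of ?z] abs_Im_le_cmod[of ?z] unfolding Fl by auto
   have "clamp1 (e l / 2) <= clamp1 (cmod ?z - e l / 2)" using z by (auto simp: clamp1_def)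
   hence "etp * clamp1 (e l / 2) <= etp * (c ?z * cmod ?z)" using z el using etp
    by (cases "?z = 0") (auto simp: c_def max_def)
   moreover have "cmod (?z + of_real etp * ze ?z) = (1 - etp * c ?z) * cmod ?z"
   proof -
    have "?z + of_real etp * ze ?z = of_real (1 - etp * c ?z) * ?z"
     by (simp add: ze_def algebra_simps)
    thus ?thesis using c1[OF etp, of ?z] by (simp only: norm_mult norm_of_real)
   qed
   ultimately show "cmod (?z + of_real etp * ze ?z) <= cmod ?z - etp * clamp1 (e l / 2)"
    by (simp add: algebra_simps)
  qed
  show "FF e i (l - 1) Int G <= MM J" "FF e i l Int G <= FF e i (l - 1) Int G"
   unfolding Fl by (auto simp: FF_def)
  show "continuous_on UNIV cmod" by (intro continuous_intros)
 qed (use J hol ch el in \<open>simp_all add: chain_def\<close>)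
qed

lemma free_all:
 assumes ch: "chain ka0 k e" and hol: "holonomy (MM J) ta" and i: "1 <= i" "i <= k" and G: "closedG e i G"
  and hc: "holonomy.thc ta (FF e i i) (FF e i i Int G) d b"
 shows "holonomy.thc ta (FF e i k) (FF e i k Int G) d b"
proof -
 interpret holonomy "MM J" ta by fact
 have "thc (FF e i l) (FF e i l Int G) d b" if "i <= l" "l <= k" for l using that
 proof (induction l rule: dec_induct)
  case (step l)
  have "FF e i (Suc l) <= FF e i l" unfolding FF_def Om_Suc by blast
  thus ?case using free_one[OF ch hol i(1) _ step.prems closedG(1)] free_one[OF ch hol i(1) _ step.prems G] step.hyps using thc_pair[of "FF e i l" "FF e i l Int G" "FF e i (Suc l) Int G" "FF e i (Suc l)" d b] step
   by (auto simp: FF_def)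
 qed (use hc in simp)
 thus ?thesis using i by simp
qed

text \<open>The slice at the middle of the interval from \<open>- e i\<close> to
  \<open>- e i / 2\<close> left to the real part of \<open>y i\<close> on the face.\<close>

definition SS where "SS e i = FF e i i Int {x. ev (y i) x = - complex_of_real (3 * e i / 4)}" for e :: "nat => real"

text \<open>On the face \<open>y i\<close> is large on its scale, hence independent of what is
  smaller, and can be moved straight to its target. To arrive exactly after finitely many steps the
  speed depends on the step size: a point within \<open>etp\<close> of the target is sent onto
  it.\<close>

lemma to_slice:
 assumes ch: "chain ka0 k e" and hol: "holonomy (MM J) ta" and i: "1 <= i" "i <= k" and G: "closedG e i G"
 shows "holonomy.thz ta (FF e i i Int G) (SS e i Int G)"
proof -
 have ei: "0 < e i" using chain_pos[OF ch ka0(1)] i by simp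
 define t0 where "t0 = - complex_of_real (3 * e i / 4)"
 define ze where "ze etp z = of_real (1 / max etp (cmod (t0 - z))) * (t0 - z)" for etp z
 have stepu: "EX r:{0..1}. ev (y i) x' = of_real (1 - r) * ev (y i) x + of_real r * t0"
  if f: "fstep J (e 0) (y ` {1..<i}) {} (y i) (%z. of_real etp * ze etp z) x x'" and etp: "0 < etp" for x x' etp
 proof -
  obtain s where s: "s : {0..1}" "ev (y i) x' = ev (y i) x + of_real s * (of_real etp * ze etp (ev (y i) x))"
   using f unfolding fstep_def by blast
  let ?r = "s * (etp / max etp (cmod (t0 - ev (y i) x)))"
  have "?r <= 1 * 1" "0 <= ?r" using s(1) etp by (intro mult_mono | simp add: divide_le_eq)+
  then obtain r where "r : {0..1}" "ev (y i) x' = ev (y i) x + of_real r * (t0 - ev (y i) x)" using s(2)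
   by (simp add: ze_def)
  thus ?thesis by (intro bexI[of _ r]) (auto simp: algebra_simps)
 qed
 have stepj: "ev (y j) x' = ev (y j) x" if "fstep J (e 0) (y ` {1..<i}) {} (y i) ze' x x'" "1 <= j" "j < i" for j x x' ze'
  using that unfolding fstep_def by auto
 have Gstep: "x' : G" if x: "x : G" and f: "fstep J (e 0) (y ` {1..<i}) {} (y i) ze' x x'" for x x' ze'
 proof -
  show ?thesis using stepj[OF f] using fstep_TT[OF f] using G x unfolding closedG_def by auto
 qed
 have Fi: "FF e i i = MM J Int Om (i - 1) y e Int {x. - e i < Re (ev (y i) x) & Re (ev (y i) x) < - e i / 2 & abs (Im (ev (y i) x)) < e i}"
 proof -
  have O: "Om i y e = Om (i - 1) y e Int {x. abs (Re (ev (y i) x)) < e i & abs (Im (ev (y i) x)) < e i}"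
   using Om_Suc[of "i - 1" y e] i by simp
  have "(abs a < e i & P) & a < - e i / 2 \<longleftrightarrow> - e i < a & a < - e i / 2 & P" for a :: real and P
   using ei by auto
  thus ?thesis unfolding FF_def O by blast
 qed
 have Astep: "x' : FF e i i" if x: "x : FF e i i" and f: "fstep J (e 0) (y ` {1..<i}) {} (y i) (%z. of_real etp * ze etp z) x x'" and etp: "0 < etp" for x x' etp
 proof -
  have "x' : MM J" using fstep_MM[OF f] x ch by (auto simp: FF_def chain_def)
  moreover have "ev (y j) x' = ev (y j) x" if "j : {1..i - 1}" for j using stepj[OF f] that by auto
  hence "x' : Om (i - 1) y e" using x unfolding Fi by (auto simp: Om_def)
  moreover obtain r where r: "0 <= r" "r <= 1" and z: "ev (y i) x' = of_real (1 - r) * ev (y i) x + of_real r * t0"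
   using stepu[OF f etp] by auto
  have R: "Re (ev (y i) x') = (1 - r) * Re (ev (y i) x) + r * (- (3 * e i / 4))" "Im (ev (y i) x') = (1 - r) * Im (ev (y i) x) + r * 0"
   unfolding z t0_def by simp_all
  have old: "Re (ev (y i) x) < - e i / 2" "- Re (ev (y i) x) < e i" "Im (ev (y i) x) < e i" "- Im (ev (y i) x) < e i"
   using x unfolding Fi by auto
  have "Re (ev (y i) x') < - e i / 2" unfolding R by (rule convex_bound_lt) (use old r ei in auto)
  moreover have "(1 - r) * (- Re (ev (y i) x)) + r * (3 * e i / 4) < e i"
   by (rule convex_bound_lt) (use old r ei in auto)
  moreover have "(1 - r) * Im (ev (y i) x) + r * 0 < e i"
   by (rule convex_bound_lt) (use old r ei in auto)
  moreover have "(1 - r) * (- Im (ev (y i) x)) + r * 0 < e i"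
   by (rule convex_bound_lt) (use old r ei in auto)
  ultimately show ?thesis unfolding Fi using R by (auto simp: abs_less_iff)
 qed
 interpret holonomy "MM J" ta by fact
 have SS: "SS e i = FF e i i Int {x. ev (y i) x = t0}" by (simp add: SS_def t0_def)
 show ?thesis
 proof (rule uflow_gen[where Z = UNIV and Zc = UNIV and ze = ze and ?etp0.0 = 1 and L = "{}"
    and K = "y ` {1..<i}" and u = "y i" and ep = "e 0" and J = J and m = "%z. cmod (t0 - z)" and ?m0.0 = 0])
  show "continuous_on UNIV (ze etp)" if "0 < etp" for etp
   unfolding ze_def using that by (intro continuous_intros) (auto simp: max_def)
  show "cmod (ze etp z) <= 1" if "0 < etp" for etp z
   using that by (simp add: ze_def norm_mult norm_divide divide_le_eq)
  show "x' : FF e i i Int G" if "0 < etp" "etp <= 1" "x : FF e i i Int G"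
   "fstep J (e 0) (y ` {1..<i}) {} (y i) (%z. of_real etp * ze etp z) x x'" for x x' etp
   using Astep[OF _ that(4,1)] Gstep[OF _ that(4)] that(3) by blast
  show "x' : SS e i Int G" if etp: "0 < etp" "etp <= 1" and x: "x : SS e i Int G"
   and f: "fstep J (e 0) (y ` {1..<i}) {} (y i) (%z. of_real etp * ze etp z) x x'" for x x' etp
  proof -
   obtain r where "ev (y i) x' = of_real (1 - r) * ev (y i) x + of_real r * t0"
    using stepu[OF f etp(1)] by blast
   thus ?thesis
    using Astep[OF _ f etp(1)] Gstep[OF _ f] x unfolding SS by (auto simp: algebra_simps)
  qed
  show "fst (y i) ~: vec.span (fst ` (S Un y ` {1..<i} Un fst ` L'))"
   if x: "x : FF e i i Int G" and S: "S <= J" "!!h. h : S ==> cmod (ev h x) < 2 * e 0"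
    and L': "L' <= {}" for x S L'
  proof -
   have "fst (y i) ~: vec.span (fst ` (S Un y ` {1..<i}))" using x abs_Re_le_cmod[of "ev (y i) x"] ei unfolding Fi
    by (intro indep[OF ch S]) (use i x Om_cmod[of x "i - 1" e] in \<open>auto simp: Fi\<close>)
   thus ?thesis using L' by simp
  qed
  show "EX c>0. ALL x:FF e i i Int G - SS e i Int G. ALL x':FF e i i Int G. ev (y i) x' = ev (y i) x + of_real etp * ze etp (ev (y i) x) -->
    x' : SS e i Int G \<or> cmod (t0 - ev (y i) x') <= cmod (t0 - ev (y i) x) - c"
   if etp: "0 < etp" "etp <= 1" for etp
  proof (intro exI[of _ etp] conjI ballI impI)
   fix x x' assume x': "x' : FF e i i Int G" and eq: "ev (y i) x' = ev (y i) x + of_real etp * ze etp (ev (y i) x)"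
   let ?w = "t0 - ev (y i) x"
   show "x' : SS e i Int G \<or> cmod (t0 - ev (y i) x') <= cmod ?w - etp"
   proof (cases "cmod ?w <= etp")
    case True
    thus ?thesis using eq etp using x' by (simp add: ze_def max_def SS split: if_splits)
   next
    case False
    hence "t0 - ev (y i) x' = of_real (1 - etp / cmod ?w) * ?w"
     using eq by (simp add: ze_def max_def algebra_simps)
    moreover have "abs (1 - etp / cmod ?w) = 1 - etp / cmod ?w"
     using False etp by (simp add: divide_le_eq)
    ultimately have "cmod (t0 - ev (y i) x') = (1 - etp / cmod ?w) * cmod ?w"
     by (simp only: norm_mult norm_of_real)
    also have "... = cmod ?w - etp"
     using False etp by (cases "?w = 0") (auto simp: left_diff_distrib)
    finally show ?thesis by simp
   qed
  qed (use etp in simp)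
  show "continuous_on UNIV (%z. cmod (t0 - z))" by (intro continuous_intros)
  show "FF e i i Int G <= MM J" "SS e i Int G <= FF e i i Int G" by (auto simp: FF_def SS)
 qed (use J hol ch in \<open>simp_all add: chain_def\<close>)
qed

end

text \<open>When \<open>cdot (fst a) ee = 1\<close>, this is the linear part of \<open>h\<close>
  after projection along \<open>ee\<close> onto \<open>cdot (fst a) z = - 1\<close>. It is the trace
  of \<open>h\<close> on the slice, written as a functional on the whole space that is constant
  along \<open>ee\<close>.\<close>

definition psi :: "('n::finite) aff => complex ^ 'n => 'n aff => 'n aff" where
 "psi a ee h = (fst h - cdot (fst h) ee *s fst a, - cdot (fst h) ee)"

lemma chain_cmod: "cmod (of_real c * z) = abs c * cmod z" by (simp add: norm_mult)

section \<open>The slice as an arrangement of smaller rank\<close>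

context central
begin

definition y1 :: "nat => 'n aff" where "y1 j = (fst (y j), 0)"

lemma dual_vector:
 assumes "i : {1..k}"
 obtains ee where "cdot (fst (y i)) ee = 1" "ALL j:{1..<i}. cdot (fst (y j)) ee = 0"
proof -
 let ?S = "(%j. fst (y j)) ` {1..k}"
 have inj: "inj_on (%j. fst (y j)) {1..k}" and ind: "vec.independent ?S"
  using valid by (simp_all add: valid_def)
 have sub: "(%j. fst (y j)) ` {1..<i} <= ?S - {fst (y i)}"
 proof
  fix x assume "x : (%j. fst (y j)) ` {1..<i}"
  then obtain j where j: "j : {1..<i}" "x = fst (y j)" by blast
  thus "x : ?S - {fst (y i)}" using inj_onD[OF inj, of j i] assms by auto
 qed
 have "fst (y i) ~: vec.span (?S - {fst (y i)})"
 proof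
  assume "fst (y i) : vec.span (?S - {fst (y i)})"
  hence "vec.dependent ?S"
   unfolding vec.dependent_def using imageI[OF assms] by (intro bexI[of _ "fst (y i)"])
  thus False using ind by simp
 qed
 hence "fst (y i) ~: vec.span ((%j. fst (y j)) ` {1..<i})"
  using subsetD[OF vec.span_mono[OF sub]] by blast
 from cdot_annihilate[OF this] obtain w where w: "!!s. s : (%j. fst (y j)) ` {1..<i} ==> cdot s w = 0" "cdot (fst (y i)) w = 1"
  by blast
 show ?thesis using w(1)[OF imageI] by (auto intro: that[OF w(2)])
qed

context
 fixes i ee
 assumes i: "i : {1..k}" and ee: "cdot (fst (y i)) ee = 1" "ALL j:{1..<i}. cdot (fst (y j)) ee = 0"
begin

abbreviation "J1 == psi (y i) ee ` J"

lemma valid_slice: "valid J1 (i - 1) y1 t" unfolding valid_def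
proof (intro conjI ballI impI)
 have sub: "{1..i - 1} <= {1..k}" using i by auto
 have eq: "(%i. fst (y1 i)) = (%i. fst (y i))" by (simp add: y1_def)
 show "inj_on (%i. fst (y1 i)) {1..i - 1}"
  unfolding eq using valid sub by (auto simp: valid_def intro: inj_on_subset)
 show "vec.independent ((%i. fst (y1 i)) ` {1..i - 1})"
  unfolding eq using valid vec.independent_mono[OF _ image_mono[OF sub]] by (auto simp: valid_def)
 fix j assume j: "j : {1..i - 1}" "~ t j"
 then obtain h c where h: "h : J" "c ~= 0" "y j = asc c h" using valid sub by (auto simp: valid_def)
 have "cdot (fst (y j)) ee = 0" using ee(2) j by auto
 hence "y1 j = asc c (psi (y i) ee h)" using h using h(3) by (simp add: y1_def psi_def asc_def)
 thus "EX h:J1. EX c. c ~= 0 & y1 j = asc c h" using h by blast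
qed

text \<open>Under \<open>full\<close> the slice functionals and \<open>y i\<close> together span the
  same space as \<open>J\<close>. \<open>ee\<close> annihilates the former but not
  \<open>y i\<close>, so exactly one dimension is lost.\<close>

lemma rk_slice:
 assumes full: "!!j. j : {1..k} ==> fst (y j) : vec.span (fst ` J)"
 shows "rk J k y = Suc (rk J1 (i - 1) y1)"
proof -
 let ?T = "fst ` (J1 Un y1 ` {1..i - 1})"
 have ann: "cdot v ee = 0" if "v : vec.span ?T" for v using that
 proof (induction rule: vec.span_induct_alt)
  case (step c x z)
  then consider h where "h : J" "x = fst (psi (y i) ee h)" | j where "j : {1..i - 1}" "x = fst (y j)"
   by (auto simp: y1_def)
  thus ?case using ee using step by cases (auto simp: psi_def)
 qed simp
 have yi: "fst (y i) ~: vec.span ?T" using ann ee(1) by force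
 have yT: "fst (y i) : vec.span (insert (fst (y i)) ?T)" by (intro vec.span_base) simp
 have 1: "insert (fst (y i)) ?T <= vec.span (fst ` J)"
 proof
  fix x assume "x : insert (fst (y i)) ?T"
  then consider "x = fst (y i)" | h where "h : J" "x = fst (psi (y i) ee h)" | j where "j : {1..i - 1}" "x = fst (y j)"
   by (auto simp: y1_def)
  thus "x : vec.span (fst ` J)"
  proof cases
   case 1
   thus ?thesis using full i by simp
  next
   case 2
   show ?thesis unfolding 2(2) psi_def fst_conv
    by (rule vec.span_diff[OF vec.span_base[OF imageI[OF 2(1)]] vec.span_scale[OF full[OF i]]])
  next
   case 3
   thus ?thesis using full[of j] i by auto
  qed
 qed
 have 2: "fst ` J <= vec.span (insert (fst (y i)) ?T)"
 proof
  fix x assume "x : fst ` J"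
  then obtain h where h: "h : J" "x = fst h" by blast
  have "fst (psi (y i) ee h) : vec.span (insert (fst (y i)) ?T)"
   using h(1) by (intro vec.span_base) auto
  hence "fst (psi (y i) ee h) + cdot (fst h) ee *s fst (y i) : vec.span (insert (fst (y i)) ?T)"
   by (intro vec.span_add vec.span_scale yT)
  thus "x : vec.span (insert (fst (y i)) ?T)" by (simp add: psi_def h(2))
 qed
 have "vec.span (insert (fst (y i)) ?T) = vec.span (fst ` J)"
  using vec.span_minimal[OF 1] vec.span_minimal[OF 2] by (auto simp: vec.subspace_span)
 moreover have "vec.span (fst ` (J Un y ` {1..k})) = vec.span (fst ` J)"
 proof -
  have "fst ` (J Un y ` {1..k}) <= vec.span (fst ` J)"
   using full vec.span_superset[of "fst ` J"] unfolding image_Un by blast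
  hence "vec.span (fst ` (J Un y ` {1..k})) <= vec.span (fst ` J)"
   using vec.span_minimal vec.subspace_span by blast
  moreover have "vec.span (fst ` J) <= vec.span (fst ` (J Un y ` {1..k}))"
   by (intro vec.span_mono) auto
  ultimately show ?thesis by blast
 qed
 ultimately have "vec.dim (fst ` (J Un y ` {1..k})) = vec.dim (insert (fst (y i)) ?T)"
  by (metis vec.dim_span)
 thus ?thesis using vec.dim_insert[of "fst (y i)" ?T] yi by (simp add: rk_def)
qed

text \<open>By homogeneity the slice is the hyperplane \<open>sl\<close>, scaled by \<open>c\<close>
  about \<open>p\<close>. The pair of smaller rank lives on the whole space and is invariant along
  \<open>ee\<close>, so it is first retracted to \<open>sl\<close> and then scaled.\<close>

lemma slice_IH:
 assumes LL1: "LL J1 (i - 1) y1 t b ka1" "0 < ka1" and ch: "chain ka k e" "0 < ka" "ka <= 1" "ka <= ka1 / 2" and hol: "holonomy (MM J) ta"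
 shows "holonomy.thc ta (SS e i) (SS e i Int (RR (i - 1) y t e Un TT J (e 0))) (rk J1 (i - 1) y1) b"
proof -
 have epos: "0 < e j" if "j <= k" for j using chain_pos[OF ch(1,2)] that by simp
 define c where "c = 3 * e i / 4"
 have c: "0 < c" using epos i by (simp add: c_def)
 \<comment> \<open>After division by \<open>c\<close> the final scale 1 takes the place of side
   \<open>i\<close>. That \<open>c\<close> is \<open>3 * e i / 4\<close> rather than
   \<open>e i\<close> costs a factor below 2, which is why \<open>ka <= ka1 / 2\<close> is
   assumed.\<close>
 define e1 where "e1 j = (if j < i then e j / c else 1)" for j
 have ch1: "chain ka1 (i - 1) e1" unfolding chain_def
 proof (intro conjI allI impI)
  show "0 < e1 0" "e1 (Suc (i - 1)) = 1" using i c epos[of 0] by (auto simp: e1_def)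
  fix j assume j: "j <= i - 1"
  have lt: "e j < ka * e (Suc j)" using ch(1) i j by (auto simp: chain_def)
  show "e1 j < ka1 * e1 (Suc j)"
  proof (cases "Suc j < i")
   case True
   have "e j < ka1 * e (Suc j)"
   proof (rule less_le_trans[OF lt mult_right_mono])
    show "ka <= ka1" using ch(4) LL1(2) by simp
    show "0 <= e (Suc j)" using epos[of "Suc j"] i True by simp
   qed
   thus ?thesis using c using True by (auto intro: divide_strict_right_mono simp: e1_def)
  next
   case False
   hence "Suc j = i" using j i by auto
   have "e j < ka1 / 2 * e i" using \<open>Suc j = i\<close>[symmetric] apply (simp only:)
    by (rule less_le_trans[OF lt mult_right_mono[OF ch(4)]]) (use epos[of i] i \<open>Suc j = i\<close> in simp)
   also have "... <= ka1 * c" using epos[of i] i LL1(2) by (simp add: c_def)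
   finally show ?thesis using c \<open>Suc j = i\<close> by (auto simp: e1_def divide_less_eq)
  qed
 qed
 define Pj where "Pj z = z - (cdot (fst (y i)) z + 1) *s ee" for z
 define g where "g z = p + complex_of_real c *s z" for z
 \<comment> \<open>Projection onto \<open>sl\<close> followed by the scaling; the equivalences
   \<open>mm\<close>, \<open>tt\<close>, \<open>om\<close> and \<open>rr\<close> say that
   \<open>G\<close> pulls the data of \<open>J\<close> back to those of \<open>J1\<close>.\<close>
 define G where "G z = g (Pj z)" for z
 have evh: "ev h (G z) = of_real c * ev (psi (y i) ee h) z" if "h : J" for h z
 proof -
  show ?thesis using Jp[OF that] by (simp add: G_def g_def Pj_def ev_def psi_def algebra_simps)
 qed
 have snd_y: "snd (y j) = - cdot (fst (y j)) p" if "j : {1..k}" for j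
  using yp[OF that] by (simp add: ev_def eq_neg_iff_add_eq_0 add.commute)
 have evj: "ev (y j) (G z) = of_real c * ev (y1 j) z" if "j : {1..i - 1}" for j z
 proof -
  have j: "j : {1..k}" "j : {1..<i}" using that i by auto
  show ?thesis
   using snd_y[OF j(1)] ee(2)[rule_format, OF j(2)] by (simp add: G_def g_def Pj_def ev_def y1_def algebra_simps)
 qed
 have evi: "ev (y i) (G z) = - of_real c" for z
  using snd_y[OF i] ee(1) by (simp add: G_def g_def Pj_def ev_def algebra_simps)
 have mm: "z : MM J1 \<longleftrightarrow> G z : MM J" for z using evh c by (auto simp: MM_def)
 have tt: "z : TT J1 (e1 0) \<longleftrightarrow> G z : TT J (e 0)" for z
  using evh c i by (auto simp: TT_def e1_def chain_cmod pos_less_divide_eq mult.commute)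
 have om: "z : Om (i - 1) y1 e1 \<longleftrightarrow> G z : Om (i - 1) y e" for z
 using i c by (auto simp: evj e1_def abs_mult pos_less_divide_eq mult.commute Om_def)
 have rr: "z : RR (i - 1) y1 t e1 \<longleftrightarrow> G z : RR (i - 1) y t e" for z
 proof -
  have "Re (ev (y1 j) z) < - e1 j / 2 \<longleftrightarrow> Re (ev (y j) (G z)) < - e j / 2" if "j : {1..i - 1}" for j
  proof -
   have "Re (ev (y1 j) z) < - e1 j / 2 \<longleftrightarrow> c * Re (ev (y1 j) z) < c * (- e1 j / 2)"
    using c by (rule mult_less_cancel_left_pos[symmetric])
   thus ?thesis using that i using c evj[OF that, of z] by (auto simp: e1_def)
  qed
  thus ?thesis by (auto simp: RR_def)
 qed
 let ?X1 = "XX J1 (i - 1) y1 e1" and ?Y1 = "YY J1 (i - 1) y1 t e1"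
 define sl where "sl = {z. cdot (fst (y i)) z = - 1}"
 define ta1 where "ta1 gam = ta (G o gam)" for gam
 have Gc: "continuous_on S G" for S unfolding G_def g_def Pj_def by (intro continuous_intros)
 have hol1: "holonomy (MM J1) ta1"
  unfolding ta1_def using mm by (intro holonomy_pullback[OF hol Gc]) auto
 interpret A: holonomy "MM J" ta by fact
 interpret B: holonomy "MM J1" ta1 by fact
 have "B.thc ?X1 ?Y1 (rk J1 (i - 1) y1) b" using LL1(1) ch1 hol1 by (simp add: LL_def)
 have GPj: "G (z - (of_real s * (cdot (fst (y i)) z + 1)) *s ee) = G z" for z s
  using ee(1) by (simp add: G_def Pj_def algebra_simps)
 have slice: "B.thz W (W Int sl)" if W: "W <= MM J1" "!!z z'. z : W ==> G z' = G z ==> z' : W" for W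
 proof (rule B.thz_push[where h = "%z s. z - (of_real s * (cdot (fst (y i)) z + 1)) *s ee"])
  show "continuous_on (W \<times> {0..1}) (%z. fst z - (complex_of_real (snd z) * (cdot (fst (y i)) (fst z) + 1)) *s ee)"
   by (intro continuous_intros)
  show "z - (of_real s * (cdot (fst (y i)) z + 1)) *s ee : W" if "z : W" for z s
   using W(2)[OF that GPj] .
  thus "z - (of_real s * (cdot (fst (y i)) z + 1)) *s ee : W Int sl" if "z : W Int sl" for z s
   using that ee(1) by (auto simp: sl_def)
  show "EX N. ALL z:K. ((%z. z - (of_real 1 * (cdot (fst (y i)) z + 1)) *s ee) ^^ N) z : W Int sl" if "K <= W" for K
  proof (intro exI[of _ 1] ballI)
   fix z assume "z : K"
   thus "((%z. z - (of_real 1 * (cdot (fst (y i)) z + 1)) *s ee) ^^ 1) z : W Int sl" using W(2)[OF _ GPj, of z 1] that using ee(1)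
    by (auto simp: sl_def)
  qed
 qed (use W(1) in auto)
 have X1: "B.thz ?X1 (?X1 Int sl)" and Y1: "B.thz ?Y1 (?Y1 Int sl)"
  by (intro slice; auto simp: XX_def YY_def mm om rr tt simp del: One_nat_def)+
 have "B.thc ?X1 ?Y1 (rk J1 (i - 1) y1) b \<longleftrightarrow> B.thc (?X1 Int sl) (?Y1 Int sl) (rk J1 (i - 1) y1) b"
  by (rule B.thc_pair[OF _ _ _ _ _ X1 Y1]) (auto simp: XX_def YY_def)
 hence hc1: "B.thc (?X1 Int sl) (?Y1 Int sl) (rk J1 (i - 1) y1) b"
  using \<open>B.thc ?X1 ?Y1 (rk J1 (i - 1) y1) b\<close> by simp
 have Pjsl: "Pj z = z" if "z : sl" for z using that by (simp add: sl_def Pj_def)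
 define g' where "g' x = complex_of_real (1 / c) *s (x - p)" for x
 have gg: "g' (g z) = z" "g (g' x) = x" for z x using c by (simp_all add: g_def g'_def)
 have "A.thc (g ` (?X1 Int sl)) (g ` (?Y1 Int sl)) (rk J1 (i - 1) y1) b"
 proof (rule thc_transport[OF hol1 hol, where S = "?X1 Int sl" and g' = g' and u = "%_. 1"])
  show "?X1 Int sl <= MM J1" "?Y1 Int sl <= ?X1 Int sl" by (auto simp: XX_def YY_def)
  show gim: "g ` (?X1 Int sl) <= MM J" using mm Pjsl by (auto simp: XX_def G_def)
  show gcont: "continuous_on (?X1 Int sl) g" "continuous_on (g ` (?X1 Int sl)) g'"
   unfolding g_def g'_def by (intro continuous_intros)+
  fix gam :: "real => complex ^ 'n" assume gam: "path gam" "path_image gam <= ?X1 Int sl"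
  have "ta (g o gam) = ta (G o gam)"
  proof (rule A.hol_cong)
   show "path (g o gam)"
    using gam by (intro path_continuous_image continuous_on_subset[OF gcont(1)]) auto
   show "path_image (g o gam) <= MM J" using gam(2) gim by (auto simp: path_image_compose)
   show "(g o gam) s = (G o gam) s" if "s : {0..1}" for s
   proof -
    show ?thesis using gam(2) that by (fastforce simp: path_image_def G_def Pjsl)
   qed
  qed
  thus "ta (g o gam) = 1 * ta1 gam / 1" by (simp add: ta1_def)
 qed (use hc1 gg in auto)
 note hcg = this
 have gimage: "g ` (W' Int sl) = {x. ev (y i) x = - of_real c} Int W" if W: "!!z. z : W' \<longleftrightarrow> G z : W" for W' W
 proof (intro equalityI subsetI)
  fix x assume "x : g ` (W' Int sl)"
  then obtain z where z: "z : W'" "z : sl" "x = g z" by blast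
  thus "x : {x. ev (y i) x = - of_real c} Int W" using z(1) W using evi[of z]
   by (simp add: G_def Pjsl)
 next
  fix x assume x: "x : {x. ev (y i) x = - of_real c} Int W"
  have s: "g' x : sl" using x snd_y[OF i] using c unfolding g'_def sl_def mem_Collect_eq cdot_simps(6)
   by (simp add: ev_def)
  hence "g' x : W'" using gg(2) using W x by (simp add: G_def Pjsl)
  thus "x : g ` (W' Int sl)" using s gg(2) by (metis IntI image_eqI)
 qed
 have E1: "g ` (?X1 Int sl) = {x. ev (y i) x = - of_real c} Int (MM J Int Om (i - 1) y e)"
  by (rule gimage) (auto simp: XX_def mm om simp del: One_nat_def)
 have E2: "g ` (?Y1 Int sl) = {x. ev (y i) x = - of_real c} Int ((MM J Int Om (i - 1) y e) Int (RR (i - 1) y t e Un TT J (e 0)))"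
  by (rule gimage) (auto simp: XX_def YY_def mm om rr tt simp del: One_nat_def)
 have E3: "SS e i = {x. ev (y i) x = - of_real c} Int (MM J Int Om (i - 1) y e)"
 proof -
  have O: "Om i y e = Om (i - 1) y e Int {x. abs (Re (ev (y i) x)) < e i & abs (Im (ev (y i) x)) < e i}"
   using Om_Suc[of "i - 1" y e] i by simp
  have "abs (Re z) < e i & abs (Im z) < e i & Re z < - e i / 2" if "z = - of_real c" for z
   using epos[of i] i that by (simp add: c_def)
  thus ?thesis unfolding SS_def FF_def O c_def[symmetric] by blast
 qed
 show ?thesis using hcg unfolding E1 E2 E3 Int_assoc .
qed

end

end

section \<open>Central boxes whose sides are spanned by the arrangement\<close>

context central
begin

text \<open>The arrangement is conical: halving the distance to \<open>p\<close> halves every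
  functional, so repeated steps carry a compact set into a tube without leaving the box or meeting a
  hyperplane.\<close>

lemma scale_to_center:
 assumes hol: "holonomy (MM J) ta" and "J ~= {}" "0 < ep" and epos: "!!i. i : {1..k} ==> 0 < e i"
 shows "holonomy.thz ta (XX J k y e) (XX J k y e Int TT J ep)"
proof -
 interpret holonomy "MM J" ta by fact
 define h where "h x s = x + (s / 2) *\<^sub>R (p - x)" for x s
 have cdotp: "cdot (fst g) p = - snd g" if "ev g p = 0" for g
  using that by (simp add: ev_def eq_neg_iff_add_eq_0)
 have ev0: "ev g (h x s) = of_real (1 - s / 2) * ev g x" if "ev g p = 0" for g x s
  using cdotp[OF that] by (simp add: h_def ev_def algebra_simps)
 have cm: "cmod (ev g (h x s)) = (1 - s / 2) * cmod (ev g x)" if "ev g p = 0" "0 <= s" "s <= 1" for g x s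
  using that by (simp add: ev0 norm_mult del: of_real_diff)
 have XX: "h x s : XX J k y e" if x: "x : XX J k y e" and s: "0 <= s" "s <= 1" for x s
 proof -
  have "ev g (h x s) ~= 0" if "g : J" for g
   using ev0[OF Jp[OF that], of x s] x s that by (auto simp: XX_def MM_def simp del: of_real_diff)
  moreover have "abs (Re (ev (y i) (h x s))) < e i & abs (Im (ev (y i) (h x s))) < e i" if i: "i : {1..k}" for i
  proof -
   have old: "abs (Re (ev (y i) x)) < e i" "abs (Im (ev (y i) x)) < e i"
    using x i by (auto simp: XX_def Om_def)
   have "(1 - s / 2) * a <= 1 * a" if "0 <= a" for a using s that by (intro mult_right_mono) auto
   from this[of "abs (Re (ev (y i) x))"] this[of "abs (Im (ev (y i) x))"] show ?thesis
    using old s ev0[OF yp[OF i], of x s] by (simp add: abs_mult del: of_real_diff)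
  qed
  ultimately show ?thesis by (auto simp: XX_def MM_def Om_def)
 qed
 have TT: "h x s : TT J ep" if x: "x : TT J ep" and s: "0 <= s" "s <= 1" for x s
 proof -
  obtain g where g: "g : J" "cmod (ev g x) < ep" using x by (auto simp: TT_def)
  have "(1 - s / 2) * cmod (ev g x) <= 1 * cmod (ev g x)" using s by (intro mult_right_mono) auto
  hence "cmod (ev g (h x s)) < ep" using g(2) cm[OF Jp[OF g(1)] s, of x] by simp
  thus ?thesis using g(1) unfolding TT_def by blast
 qed
 show ?thesis
 proof (rule thz_push[where h = h])
  show "continuous_on (XX J k y e \<times> {0..1}) (%z. h (fst z) (snd z))"
   unfolding h_def by (intro continuous_intros) auto
  show "h x s : XX J k y e" if "x : XX J k y e" "0 <= s" "s <= 1" for x s by (rule XX[OF that])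
  show "h x s : XX J k y e Int TT J ep" if "x : XX J k y e Int TT J ep" "0 <= s" "s <= 1" for x s
   using XX TT that by blast
  fix K assume K: "compact K" "K <= XX J k y e"
  obtain g where g: "g : J" using assms(2) by blast
  have "bounded ((%x. ev g x) ` K)"
   by (intro compact_imp_bounded compact_continuous_image K continuous_intros)
  then obtain D where D: "!!x. x : K ==> cmod (ev g x) <= D" unfolding bounded_iff by blast
  obtain N where N: "(1 / 2) ^ N * (abs D + 1) < ep"
  proof -
   obtain N where "(1 / 2) ^ N < ep / (abs D + 1)"
    using real_arch_pow_inv[of "ep / (abs D + 1)" "1 / 2"] assms(3) by auto
   thus ?thesis by (intro that[of N]) (simp add: pos_less_divide_eq)
  qed
  have it: "((%x. h x 1) ^^ n) x : XX J k y e & cmod (ev g (((%x. h x 1) ^^ n) x)) = (1 / 2) ^ n * cmod (ev g x)" if "x : XX J k y e" for x n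
   using that by (induction n) (auto intro: XX simp: cm[OF Jp[OF g]])
  show "EX N. ALL x:K. ((%x. h x 1) ^^ N) x : XX J k y e Int TT J ep"
  proof (intro exI[of _ N] ballI)
   fix x assume x: "x : K"
   have "(1 / 2) ^ N * cmod (ev g x) <= (1 / 2) ^ N * (abs D + 1)"
    using D[OF x] by (intro mult_left_mono) auto
   moreover have xX: "x : XX J k y e" using x K(2) by blast
   ultimately have "cmod (ev g (((%x. h x 1) ^^ N) x)) < ep"
    using conjunct2[OF it[OF xX, of N]] N by linarith
   thus "((%x. h x 1) ^^ N) x : XX J k y e Int TT J ep"
    using it[OF xX, of N] g unfolding TT_def by blast
  qed
 qed (auto simp: h_def XX_def)
qed

text \<open>The box has no homology relative to the tubes, so its homology relative to
  \<open>YY\<close> is that of \<open>YY\<close> relative to the tubes, one degree higher. The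
  latter is built up face by face, each marked face contributing the homology of its slice, of rank
  one less.\<close>

lemma full_case:
 assumes k: "1 <= k" and full: "!!j. j : {1..k} ==> fst (y j) : vec.span (fst ` J)"
  and IH: "!!(J' :: ('n aff) set) k' y' t'. finite J' ==> Submission.valid J' k' y' t' ==> rk J' k' y' < rk J k y ==> EX b ka. 0 < ka & LL J' k' y' t' b ka"
 shows "EX b ka. 0 < ka & LL J k y t b ka"
proof -
 define d where "d = rk J k y - 1"
 have d: "rk J k y = Suc d" using dual_vector[of 1] rk_slice[of 1, OF _ _ _ full] k unfolding d_def
  by (metis atLeastAtMost_iff diff_Suc_1 order_refl)
 have ne: "J ~= {}"
 proof
  assume "J = {}"
  thus False using full[of 1] k using valid k vec.dependent_zero[of "(%i. fst (y i)) ` {1..k}"] unfolding valid_def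
   by simp
 qed
 have "ALL i:{1..k}. EX b ka. 0 < ka & (ALL ka' e ta. 0 < ka' --> ka' <= ka --> ka' <= ka0 --> chain ka' k e --> holonomy (MM J) ta -->
   holonomy.thc ta (FF e i k) (FF e i k Int (RR (i - 1) y t e Un TT J (e 0))) d b)"
 proof
  fix i assume i: "i : {1..k}"
  obtain ee where ee: "cdot (fst (y i)) ee = 1" "ALL j:{1..<i}. cdot (fst (y j)) ee = 0"
   by (rule dual_vector[OF i])
  have r: "rk (J1 i ee) (i - 1) y1 = d" using rk_slice[OF i ee full] d by simp
  then obtain b ka1 where b: "0 < ka1" "LL (J1 i ee) (i - 1) y1 t b ka1"
   using IH[OF finite_imageI[OF J] valid_slice[OF i ee]] d by auto
  show "EX b ka. 0 < ka & (ALL ka' e ta. 0 < ka' --> ka' <= ka --> ka' <= ka0 --> chain ka' k e --> holonomy (MM J) ta -->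
   holonomy.thc ta (FF e i k) (FF e i k Int (RR (i - 1) y t e Un TT J (e 0))) d b)"
  proof (intro exI[of _ b] exI[of _ "ka1 / 2"] conjI allI impI)
   fix ka' e ta assume *: "0 < ka'" "ka' <= ka1 / 2" "ka' <= ka0" "chain ka' k e" and hol: "holonomy (MM J) ta"
   interpret holonomy "MM J" ta by fact
   have ch: "chain ka0 k e" by (rule chain_mono[OF *(4,1,3)])
   let ?G = "RR (i - 1) y t e Un TT J (e 0)"
   have G: "closedG e i ?G" using i by (intro closedG(2)) simp
   have "thc (SS e i) (SS e i Int ?G) d b"
    using slice_IH[OF i ee b(2,1) *(4,1) _ *(2) hol] *(3) ka0(2) r by simp
   moreover have "thz (FF e i i Int UNIV) (SS e i Int UNIV)" "thz (FF e i i Int ?G) (SS e i Int ?G)"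
    using i by (intro to_slice[OF ch hol _ _ closedG(1)] to_slice[OF ch hol _ _ G]; simp)+
   ultimately have "thc (FF e i i) (FF e i i Int ?G) d b"
    using thc_pair[of "FF e i i" "FF e i i Int ?G" "SS e i Int ?G" "SS e i" d b] by (auto simp: FF_def SS_def)
   thus "thc (FF e i k) (FF e i k Int ?G) d b" using i by (intro free_all[OF ch hol _ _ G]) auto
  qed (use b in simp)
 qed
 then obtain b ka where b: "!!i. i : {1..k} ==> 0 < ka i"
  "!!i ka' e ta. i : {1..k} ==> 0 < ka' ==> ka' <= ka i ==> ka' <= ka0 ==> chain ka' k e ==> holonomy (MM J) ta ==>
   holonomy.thc ta (FF e i k) (FF e i k Int (RR (i - 1) y t e Un TT J (e 0))) d (b i)" by metis
 define K where "K = Min (insert ka0 (ka ` {1..k}))"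
 have K: "0 < K" "K <= ka0" "!!i. i : {1..k} ==> K <= ka i"
 proof -
  show "0 < K" using b(1) ka0(1) by (auto simp: K_def Min_gr_iff)
  show "K <= ka0" "!!i. i : {1..k} ==> K <= ka i" unfolding K_def by (intro Min_le; simp)+
 qed
 have "LL J k y t (SUM i:{i:{1..k}. t i}. b i) K" unfolding LL_def
 proof (intro allI impI)
  fix e ta assume ch: "chain K k e" and hol: "holonomy (MM J) ta"
  interpret holonomy "MM J" ta by fact
  let ?X = "XX J k y e" and ?T = "TT J (e 0)"
  have XM: "?X <= MM J" by (simp add: XX_def)
  \<comment> \<open>Faces are added in the order of the scales, so that face \<open>Suc j\<close>
    meets what is already there in a set of the form \<open>closedG\<close>.\<close>
  have "thc (?X Int (RR j y t e Un ?T)) (?X Int ?T) d (SUM i:{i:{1..j}. t i}. b i)" if "j <= k" for j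
   using that
  proof (induction j)
   case 0
   have "RR 0 y t e = {}" by (auto simp: RR_def)
   moreover have "thz (?X Int ?T) (?X Int ?T)" using XM by (intro thz_same) auto
   ultimately show ?case using thz_thc by simp
  next
   case (Suc j)
   show ?case
   proof (cases "t (Suc j)")
    case False
    hence "RR (Suc j) y t e = RR j y t e" "{i:{1..Suc j}. t i} = {i:{1..j}. t i}"
     by (auto simp: RR_Suc le_Suc_eq)
    thus ?thesis using Suc by simp
   next
    case True
    let ?A = "FF e (Suc j) k" and ?B = "?X Int (RR j y t e Un ?T)"
    have A: "?A = ?X Int {x. Re (ev (y (Suc j)) x) < - e (Suc j) / 2}" by (simp add: FF_def XX_def)
    have "?A Un ?B = ?X Int (RR (Suc j) y t e Un ?T)" unfolding A RR_Suc using True by blast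
    moreover have "?A Int ?B = ?A Int (RR (Suc j - 1) y t e Un ?T)" unfolding A by auto
    moreover have "open ?A" "open ?B"
     unfolding A by (intro open_Int open_Un open_XX J open_RR open_TT open_Re_less)+
    ultimately have "thc (?X Int (RR (Suc j) y t e Un ?T)) ?B d (b (Suc j))"
     using thc_excision_open[of ?A ?B d "b (Suc j)"] XM b(2)[OF _ K(1) K(3) K(2) ch hol, of "Suc j"] Suc.prems by auto
    moreover have "thc ?B (?X Int ?T) d (SUM i:{i:{1..j}. t i}. b i)" using Suc by simp
    ultimately have "thc (?X Int (RR (Suc j) y t e Un ?T)) (?X Int ?T) d (b (Suc j) + (SUM i:{i:{1..j}. t i}. b i))"
     by (rule thc_triple[rotated 3]) (use XM RR_Suc[of j y t e] in auto)
    moreover have "{i:{1..Suc j}. t i} = insert (Suc j) {i:{1..j}. t i}"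
     using True by (auto simp: le_Suc_eq)
    ultimately show ?thesis by simp
   qed
  qed
  from this[of k] have "thc (YY J k y t e) (?X Int ?T) d (SUM i:{i:{1..k}. t i}. b i)"
   by (simp add: YY_def)
  moreover have "thz ?X (?X Int ?T)"
   by (rule scale_to_center[OF hol ne]) (use ch chain_pos[OF ch K(1)] in \<open>auto simp: chain_def\<close>)
  ultimately show "thc ?X (YY J k y t e) (rk J k y) (SUM i:{i:{1..k}. t i}. b i)"
   unfolding d by (intro thc_shift[of ?X "YY J k y t e" "?X Int ?T"]) (use XM in \<open>auto simp: YY_def\<close>)
 qed
 thus ?thesis using K(1) by blast
qed

end

text \<open>When the sides span the linear parts of \<open>J\<close>, members of \<open>J\<close>
  are nearly constant on a small box, and those not vanishing at \<open>p\<close> stay above the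
  tube radius and affect neither space. Since the holonomy lives on \<open>MM J\<close>, it is
  carried to \<open>MM Jp\<close> by a map that shrinks everything into a ball around
  \<open>p\<close> missing the other hyperplanes.\<close>

lemma LL_local:
 assumes J: "finite J" and yp: "!!i. i : {1..k} ==> ev (y i) p = 0" and sp: "!!h. h : J ==> fst h : vec.span (fst ` y ` {1..k::nat})"
  and Jp: "Jp = {h : J. ev h p = 0}" and LL: "LL Jp k y t b ka0" "0 < ka0"
 shows "EX b ka. 0 < ka & LL J k y t b ka"
proof -
 have fJp: "finite Jp" using J Jp by simp
 have "ALL h:J. EX C. 0 <= C & (ALL x m. (ALL g:y ` {1..k}. cmod (ev g x) <= m) --> cmod (ev h x - ev h p) <= C * m)"
 proof
  fix h assume "h : J"
  then obtain v C where "0 <= C" "!!x m. (!!g. g : y ` {1..k} ==> cmod (ev g x) <= m) ==> cmod (ev h x - v) <= C * m"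
   "!!p. (!!g. g : y ` {1..k} ==> ev g p = 0) ==> v = ev h p"
   using dependent_bound[of "y ` {1..k}" h] sp by (metis finite_atLeastAtMost finite_imageI)
  moreover from this(3) have "v = ev h p" using yp by blast
  ultimately show "EX C. 0 <= C & (ALL x m. (ALL g:y ` {1..k}. cmod (ev g x) <= m) --> cmod (ev h x - ev h p) <= C * m)"
   by blast
 qed
 then obtain C where C: "!!h. h : J ==> 0 <= C h" "!!h x m. h : J ==> (ALL g:y ` {1..k}. cmod (ev g x) <= m) ==> cmod (ev h x - ev h p) <= C h * m"
  by metis
 define F where "F = insert 1 (insert ka0 ((%h. cmod (ev h p) / (4 * (C h + 1))) ` (J - Jp)))"
 define ka where "ka = Min F"
 have F: "finite F" "F ~= {}" using J by (simp_all add: F_def)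
 have Fpos: "0 < r" if r: "r : F" for r
 using r Jp C(1) LL(2) by (fastforce simp: F_def intro: divide_pos_pos)
 have ka: "0 < ka" "ka <= 1" "ka <= ka0" "!!h. h : J - Jp ==> ka <= cmod (ev h p) / (4 * (C h + 1))"
 proof -
  show "0 < ka" unfolding ka_def by (rule Fpos[OF Min_in[OF F]])
  have le: "ka <= r" if "r : F" for r unfolding ka_def by (rule Min_le[OF F(1) that])
  show "ka <= 1" "ka <= ka0" "!!h. h : J - Jp ==> ka <= cmod (ev h p) / (4 * (C h + 1))"
   by (intro le; simp add: F_def)+
 qed
 have "LL J k y t b ka" unfolding LL_def
 proof (intro allI impI)
  fix e ta assume ch: "chain ka k e" and hol: "holonomy (MM J) ta"
  have e: "0 < e i" "e i <= ka" if "i <= k" for i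
  proof -
   show "0 < e i" using chain_pos[OF ch ka(1)] that by simp
   show "e i <= ka" using chain_less[OF ch ka(1,2), of i "Suc k"] that ch by (simp add: chain_def)
  qed
  have far: "e 0 <= cmod (ev h x) & 0 < cmod (ev h x)" if h: "h : J - Jp" and x: "x : Om k y e" for h x
  proof -
   have "cmod (ev g x) <= 2 * ka" if g: "g : y ` {1..k}" for g
   proof -
    obtain i where i: "i : {1..k}" "g = y i" using g by blast
    have "cmod (ev g x) <= abs (Re (ev g x)) + abs (Im (ev g x))" by (rule cmod_le)
    also have "... <= e i + e i" using x i by (intro add_mono) (auto simp: Om_def less_imp_le)
    finally show ?thesis using e(2)[of i] i by auto
   qed
   hence 1: "cmod (ev h x - ev h p) <= C h * (2 * ka)" using C(2) h by blast
   have 2: "ka * (4 * (C h + 1)) <= cmod (ev h p)"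
    using ka(4)[OF h] C(1)[of h] h by (simp add: pos_le_divide_eq)
   have "0 <= C h * ka" using C(1)[of h] h ka(1) by simp
   hence "2 * ka <= cmod (ev h p) - cmod (ev h x - ev h p)"
    using 1 2 ka(1) by (simp add: algebra_simps)
   also have "... <= cmod (ev h x)"
    using norm_triangle_ineq2[of "ev h p" "ev h p - ev h x"] by (simp add: norm_minus_commute)
   finally show ?thesis using e(2)[of 0] ka(1) by auto
  qed
  have Xeq: "XX J k y e = XX Jp k y e" using far unfolding XX_def MM_def Jp by fastforce
  have Teq: "x : TT J (e 0) \<longleftrightarrow> x : TT Jp (e 0)" if "x : Om k y e" for x
   using far[OF _ that] unfolding TT_def Jp by fastforce
  have Yeq: "YY J k y t e = YY Jp k y t e" unfolding YY_def Xeq using Teq by (auto simp: XX_def)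
  have rk: "rk Jp k y = rk J k y"
  proof -
   have "vec.span (fst ` (J' Un y ` {1..k})) = vec.span (fst ` y ` {1..k})" if "J' <= J" for J'
   proof
    show "vec.span (fst ` (J' Un y ` {1..k})) <= vec.span (fst ` y ` {1..k})"
     using sp that vec.span_superset[of "fst ` y ` {1..k}"]
     by (intro vec.span_minimal vec.subspace_span) blast
    show "vec.span (fst ` y ` {1..k}) <= vec.span (fst ` (J' Un y ` {1..k}))"
     by (intro vec.span_mono) auto
   qed
   from this[of J] this[of Jp] have "vec.span (fst ` (Jp Un y ` {1..k})) = vec.span (fst ` (J Un y ` {1..k}))"
    by (auto simp: Jp)
   thus ?thesis unfolding rk_def by (metis vec.dim_span)
  qed
  obtain ro where ro: "0 < ro" "!!h x. h : J - Jp ==> norm (x - p) < ro ==> ev h x ~= 0"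
  proof -
   have "open (MM (J - Jp))" using J by (intro open_MM) simp
   moreover have "p : MM (J - Jp)" by (auto simp: MM_def Jp)
   ultimately obtain ro where "0 < ro" "ball p ro <= MM (J - Jp)" using open_contains_ball by blast
   thus ?thesis by (intro that[of ro]) (auto simp: MM_def subset_iff dist_norm norm_minus_commute)
  qed
  \<comment> \<open>A homothety about \<open>p\<close> by a positive factor depending on the point:
    the identity for \<open>s = 0\<close>, with image in the ball of radius \<open>ro\<close> for
    \<open>s = 1\<close>.\<close>
  define c where "c s x = (1 - s) + s * (ro / (ro + norm (x - p)))" for s :: real and x
  define H where "H x s = p + c s x *\<^sub>R (x - p)" for x s
  have frac: "0 < ro / (ro + norm (x - p))" "ro / (ro + norm (x - p)) <= 1" for x
   using ro(1) by (auto simp: add_pos_nonneg divide_le_eq)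
  have c: "0 < c s x" "c s x <= 1" if "s : {0..1}" for s x
  proof -
   show "0 < c s x"
   proof (cases "s = 0")
    case False
    hence "0 < s * (ro / (ro + norm (x - p)))" using that frac(1)[of x] by (intro mult_pos_pos) auto
    thus ?thesis using that unfolding c_def by (intro add_nonneg_pos) auto
   qed (simp add: c_def)
   have "s * (ro / (ro + norm (x - p))) <= s * 1"
    using frac[of x] that by (intro mult_left_mono) auto
   thus "c s x <= 1" by (simp add: c_def)
  qed
  have evH: "ev g (H x s) = of_real (c s x) * ev g x" if "ev g p = 0" for g x s
  proof -
   have "cdot (fst g) p = - snd g" using that by (simp add: ev_def eq_neg_iff_add_eq_0)
   thus ?thesis by (simp add: H_def ev_def algebra_simps)
  qed
  have HM: "H x s : MM Jp" if "x : MM Jp" "s : {0..1}" for x s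
   using that c(1)[OF that(2), of x] evH by (auto simp: MM_def Jp)
  have HO: "H x s : Om k y e" if x: "x : Om k y e" and s: "s : {0..1}" for x s unfolding Om_def
  proof (intro CollectI ballI)
   fix i assume i: "i : {1..k}"
   have old: "abs (Re (ev (y i) x)) < e i" "abs (Im (ev (y i) x)) < e i"
    using x i by (auto simp: Om_def)
   have "c s x * a <= 1 * a" if "0 <= a" for a
    using c[OF s, of x] that by (intro mult_right_mono) auto
   from this[of "abs (Re (ev (y i) x))"] this[of "abs (Im (ev (y i) x))"]
   show "abs (Re (ev (y i) (H x s))) < e i & abs (Im (ev (y i) (H x s))) < e i"
    using old c[OF s, of x] evH[OF yp[OF i], of x s] by (simp add: abs_mult)
  qed
  have near: "norm (H x 1 - p) < ro" for x
  proof -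
   have "norm (H x 1 - p) = ro * (norm (x - p) / (ro + norm (x - p)))"
    using ro(1) by (simp add: H_def c_def abs_of_pos add_pos_nonneg)
   also have "... < ro * 1"
    using ro(1) by (intro mult_strict_left_mono) (auto simp: divide_less_eq add_pos_nonneg)
   finally show ?thesis by simp
  qed
  have HJ: "H x 1 : MM J" if "x : MM Jp" for x
   using HM[OF that, of 1] ro(2)[OF _ near[of x]] by (auto simp: MM_def)
  have Hc: "continuous_on S (%z. H (fst z) (snd z))" "continuous_on S' (%x. H x 1)" for S S'
   unfolding H_def c_def using ro(1) by (intro continuous_intros; simp add: add_pos_nonneg less_imp_neq[THEN not_sym])+
  have "holonomy (MM Jp) (%gam. ta ((%x. H x 1) o gam))"
   using HJ by (intro holonomy_pullback[OF hol Hc(2)]) auto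
  hence "holonomy.thc (%gam. ta ((%x. H x 1) o gam)) (XX Jp k y e) (YY Jp k y t e) (rk Jp k y) b"
   using LL(1) chain_mono[OF ch ka(1,3)] unfolding LL_def by blast
  hence "holonomy.thc ta (XX Jp k y e) (YY Jp k y t e) (rk Jp k y) b"
  proof (rule thc_homotopic_pullback[OF hol Hc(2), where S = "XX Jp k y e" and H = H and X' = "MM Jp", rotated -1])
   show "(%x. H x 1) ` MM Jp <= MM J" using HJ by blast
   show "XX Jp k y e <= MM J" unfolding Xeq[symmetric] by (simp add: XX_def)
   show "H x s : MM J" if "x : XX Jp k y e" "s : {0..1}" for x s
   proof -
    have "H x s : XX Jp k y e"
     using HM[OF _ that(2)] HO[OF _ that(2)] that(1) by (auto simp: XX_def)
    thus ?thesis unfolding Xeq[symmetric] by (simp add: XX_def)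
   qed
   show "continuous_on (XX Jp k y e \<times> {0..1}) (%z. H (fst z) (snd z))" by (rule Hc(1))
  qed (auto simp: XX_def YY_def H_def c_def)
  thus "holonomy.thc ta (XX J k y e) (YY J k y t e) (rk J k y) b" unfolding Xeq Yeq rk .
 qed
 thus ?thesis using ka(1) by blast
qed

section \<open>The induction on the rank and on the number of sides\<close>

lemma valid_le_rk: "valid J k y t ==> k <= rk J k y"
proof -
 assume v: "valid J k y t"
 have "k = card ((%i. fst (y i)) ` {1..k})" using v by (simp add: valid_def card_image)
 also have "... = vec.dim ((%i. fst (y i)) ` {1..k})"
  using v by (simp add: valid_def vec.dim_eq_card_independent)
 also have "... <= vec.dim (fst ` (J Un y ` {1..k}))" by (rule vec.dim_subset) auto
 finally show ?thesis by (simp add: rk_def)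
qed

text \<open>The base case, all functionals being constant: the complement is empty, or it is the
  contractible whole space and small tubes are empty.\<close>

lemma LL_zero:
 assumes J: "finite J" and sp: "!!h. h : J ==> fst h = (0 :: complex ^ 'n)"
 shows "EX b ka. 0 < ka & LL J 0 y t b ka"
proof -
 have rk: "rk J 0 y = 0" using sp by (auto simp: rk_def intro!: vec.dim_le_card)
 have ev: "ev h x = snd h" if "h : J" for h x using sp[OF that] by (simp add: ev_def)
 have X: "XX J 0 y e = MM J" for e by (simp add: XX_def Om_def)
 have RR0: "RR 0 y t e = {}" for e by (simp add: RR_def)
 show ?thesis
 proof (cases "EX h:J. snd h = 0")
  case True
  hence M: "MM J = {}" using ev by (auto simp: MM_def)
  have "LL J 0 y t 0 1" unfolding LL_def
  proof (intro allI impI)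
   fix e ta assume hol: "holonomy (MM J) ta"
   then interpret holonomy "MM J" ta .
   show "thc (XX J 0 y e) (YY J 0 y t e) (rk J 0 y) 0"
    using thz_empty thz_thc by (simp add: YY_def X M)
  qed
  thus ?thesis by (rule_tac x = 0 in exI, rule_tac x = 1 in exI) simp
 next
  case False
  hence M: "MM J = UNIV" using ev by (auto simp: MM_def)
  define ka where "ka = Min (insert 1 ((%h. cmod (snd h)) ` J))"
  have ka: "0 < ka" unfolding ka_def using J False by (subst Min_gr_iff) auto
  have le: "ka <= cmod (snd h)" if "h : J" for h
   unfolding ka_def using J that by (intro Min_le) auto
  have "LL J 0 y t 1 ka" unfolding LL_def
  proof (intro allI impI)
   fix e ta assume ch: "chain ka 0 e" and hol: "holonomy (MM J) ta"
   from hol interpret holonomy "MM J" ta .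
   have "TT J (e 0) = {}" using ch using le ev by (fastforce simp: chain_def TT_def)
   moreover have "thc UNIV {} 0 1" by (rule thc_convex) (use M in auto)
   ultimately show "thc (XX J 0 y e) (YY J 0 y t e) (rk J 0 y) 1" by (simp add: YY_def X M RR0 rk)
  qed
  thus ?thesis using ka by blast
 qed
qed

lemma common_zero:
 assumes v: "valid J k y t"
 shows "EX p. ALL i:{1..k}. ev (y i) p = 0"
proof -
 have "EX w. ALL j:{1..k}. cdot (fst (y j)) w = (if j = i then 1 else 0)" if i: "i : {1..k}" for i
 proof -
  let ?f = "%i. fst (y i)"
  have inj: "inj_on ?f {1..k}" and ind: "vec.independent (?f ` {1..k})"
   using v by (simp_all add: valid_def)
  have "?f i ~: vec.span (?f ` {1..k} - {?f i})"
  using imageI ind by (metis imageI ind vec.dependent_def bexI i)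
  from cdot_annihilate[OF this] obtain w where w: "!!s. s : ?f ` {1..k} - {?f i} ==> cdot s w = 0" "cdot (?f i) w = 1"
   by blast
  have "cdot (?f j) w = 0" if "j : {1..k}" "j ~= i" for j
   using w(1)[of "?f j"] that inj_onD[OF inj, of j i] i by auto
  thus ?thesis using w(2) by (intro exI[of _ w]) auto
 qed
 then obtain w where w: "!!i j. i : {1..k} ==> j : {1..k} ==> cdot (fst (y j)) (w i) = (if j = i then 1 else 0)"
  by metis
 let ?p = "SUM i:{1..k}. (- snd (y i)) *s w i"
 have "ev (y j) ?p = 0" if j: "j : {1..k}" for j
 proof -
  have "cdot (fst (y j)) ?p = (SUM i:{1..k}. if j = i then - snd (y i) else 0)"
   unfolding cdot_sum by (intro sum.cong refl) (use w j in auto)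
  also have "... = - snd (y j)" using j by simp
  finally show ?thesis by (simp add: ev_def)
 qed
 thus ?thesis by blast
qed

text \<open>The outer induction lowers the rank by slicing; the inner one lowers
  \<open>rk J k y - k\<close> by sweeping along a member of \<open>J\<close> outside the span of the
  sides. When none is left, \<open>common_zero\<close> gives a centre, and the box becomes central
  after the hyperplanes that miss the centre are discarded.\<close>

theorem LL_main:
 fixes J :: "(('n::finite) aff) set"
 assumes "finite J" "valid J k y t"
 shows "EX b ka. 0 < ka & LL J k y t b ka" using assms
proof (induction "rk J k y" arbitrary: J k y t rule: less_induct)
 case outer: less
 define r where "r = rk J k y"
 have IH: "!!(J' :: ('n aff) set) k' y' t'. finite J' ==> valid J' k' y' t' ==> rk J' k' y' < r ==> EX b ka. 0 < ka & LL J' k' y' t' b ka"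
  using outer.hyps unfolding r_def by blast
 from outer.prems(2) r_def[symmetric] show ?case
 proof (induction "rk J k y - k" arbitrary: k y t rule: less_induct)
  case less
  let ?sp = "vec.span ((%i. fst (y i)) ` {1..k})"
  show ?case
  proof (cases "EX h:J. fst h ~: ?sp")
   case True
   then obtain h0 where h0: "h0 : J" "fst h0 ~: ?sp" by blast
   show ?thesis
   proof (rule LL_step[OF outer.prems(1) less.prems(1) h0])
    fix y' t' assume v: "valid J (Suc k) y' t'" and r: "rk J (Suc k) y' = rk J k y"
    have "Suc k <= rk J (Suc k) y'" by (rule valid_le_rk[OF v])
    thus "EX b ka. 0 < ka & LL J (Suc k) y' t' b ka" using r using r less.prems(2)
     by (intro less.hyps v) simp_all
   qed
  next
   case False
   hence sp: "fst h : vec.span (fst ` y ` {1..k})" if "h : J" for h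
    using that by (simp add: image_image)
   show ?thesis
   proof (cases "k = 0")
    case True
    have "fst h = 0" if "h : J" for h using sp[OF that] True by simp
    thus ?thesis unfolding True by (intro LL_zero outer.prems(1))
   next
    case k: False
    obtain p where p: "!!i. i : {1..k} ==> ev (y i) p = 0"
     using common_zero[OF less.prems(1)] by blast
    define Jp where "Jp = {h : J. ev h p = 0}"
    have v: "valid Jp k y t" unfolding valid_def
    using less.prems(1) p by (fastforce simp: valid_def Jp_def intro: ballI)
    have c: "central Jp k y t p"
     using outer.prems(1) p v by (intro central.intro) (auto simp: Jp_def)
    have "EX b ka. 0 < ka & LL Jp k y t b ka"
    proof (cases "ALL j:{1..k}. fst (y j) : vec.span (fst ` Jp)")
     case True
     have "rk Jp k y <= rk J k y" unfolding rk_def by (rule vec.dim_subset) (auto simp: Jp_def)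
     thus ?thesis using less.prems(2) using True k by (intro central.full_case[OF c] IH) (simp_all del: One_nat_def)
    next
     case False
     then obtain j where j: "j : {1..k}" "fst (y j) ~: vec.span (fst ` Jp)" by blast
     from cdot_annihilate[OF j(2)] obtain w where w: "!!s. s : fst ` Jp ==> cdot s w = 0" "cdot (fst (y j)) w = 1"
      by blast
     show ?thesis
      using central.deficient[OF c] central.ka0[OF c] w j(1) by (metis imageI zero_neq_one)
    qed
    thus ?thesis using LL_local[OF outer.prems(1) p sp Jp_def] by blast
   qed
  qed
 qed
qed

section \<open>Neighbourhoods of the singular set\<close>

lemma norm_smult: "norm (c *s x) = cmod c * norm (x :: complex ^ 'n)"
 by (simp add: norm_vec_def vector_scalar_mult_def norm_mult L2_set_right_distrib)

text \<open>A new functional that depends on the others is close to a constant \<open>v\<close>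
  where these are small; if \<open>v\<close> is not 0, it cannot be small there as well.\<close>

lemma common_zero_or_far:
 fixes S :: "('n::finite) aff set"
 assumes "finite S"
 shows "(EX p. ALL h:S. ev h p = 0) \<or> (EX de>0. ALL x. EX h:S. de <= cmod (ev h x))" using assms
proof (induction S rule: finite_induct)
 case (insert u S)
 show ?case
 proof (cases "EX p. ALL h:S. ev h p = 0")
  case False
  thus ?thesis using insert.IH by blast
 next
  case True
  then obtain p where p: "!!h. h : S ==> ev h p = 0" by blast
  show ?thesis
  proof (cases "fst u : vec.span (fst ` S)")
   case False
   from cdot_annihilate[OF False] obtain w where w: "!!s. s : fst ` S ==> cdot s w = 0" "cdot (fst u) w = 1"
    by blast
   have "ev h (p + (- ev u p) *s w) = 0" if h: "h : insert u S" for h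
    using w(1)[OF imageI, of h] w(2) p[of h] h unfolding ev_add cdot_simps by (cases "h = u") auto
   thus ?thesis by blast
  next
   case True
   obtain v C where C: "C >= 0" "!!x m. (!!g. g : S ==> cmod (ev g x) <= m) ==> cmod (ev u x - v) <= C * m"
    "!!p. (!!g. g : S ==> ev g p = 0) ==> v = ev u p"
    using dependent_bound[OF insert.hyps(1) True] by metis
   show ?thesis
   proof (cases "v = 0")
    case True
    thus ?thesis using p C(3)[OF p] by auto
   next
    case False
    \<comment> \<open>If all functionals were below \<open>de\<close>, then \<open>cmod v\<close>
      would be below \<open>de + C * de\<close>, which is \<open>cmod v\<close>.\<close>
    define de where "de = cmod v / (C + 1)"
    have de: "0 < de" "de * (C + 1) = cmod v" using False C(1) by (auto simp: de_def)
    have "EX h:insert u S. de <= cmod (ev h x)" for x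
    proof (rule ccontr)
     assume "~ (EX h:insert u S. de <= cmod (ev h x))"
     hence s: "cmod (ev h x) < de" if "h : insert u S" for h using that by force
     have "cmod (ev u x - v) <= C * de" using s by (intro C(2)) (simp add: less_imp_le)
     thus False using norm_triangle_ineq4[of "ev u x" "ev u x - v"] using s[of u] de(2)
      by (simp add: algebra_simps)
    qed
    thus ?thesis using de(1) by blast
   qed
  qed
 qed
qed simp

text \<open>\<open>vector_field\<close> with points in place of directions: lying on the hyperplanes
  of \<open>S\<close> is again an affine condition. Functionals without common zero are never all
  below \<open>2 * ep\<close>, so such points exist. Moving towards \<open>W x\<close> shrinks all
  small functionals at once, and \<open>W\<close> is bounded.\<close>

lemma near_point:
 fixes J :: "('n::finite) aff set"
 assumes J: "finite J"
 obtains W ep C where "0 < ep" "continuous_on UNIV W" "0 < C" "!!x. norm (W x) <= C"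
  "!!x h. h : J ==> cmod (ev h x) <= ep ==> ev h (W x) = 0"
proof -
 define far where "far S de \<longleftrightarrow> 0 < de & (ALL x. EX h:S. de <= cmod (ev h x))" for S :: "'n aff set" and de
 obtain de where de: "!!S. S <= J ==> ~ (EX p. ALL h:S. ev h p = 0) ==> far S (de S)"
  using common_zero_or_far[OF finite_subset[OF _ J]] unfolding far_def by metis
 define D where "D = de ` {S. S <= J & ~ (EX p. ALL h:S. ev h p = 0)}"
 have D: "finite D" using J unfolding D_def by simp
 define ep where "ep = Min (insert 1 D) / 2"
 have m: "0 < Min (insert 1 D)" using D de by (subst Min_gr_iff) (auto simp: D_def far_def)
 have ep: "0 < ep" "!!d. d : D ==> 2 * ep <= d" using m D by (auto simp: ep_def)
 have ex: "EX p. ALL h:S. ev h p = 0" if S: "S <= J" "!!h. h : S ==> cmod (ev h x) / ep < 2" for S x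
 proof (rule ccontr)
  assume n: "\<nexists>p. ALL h:S. ev h p = 0"
  obtain h where h: "h : S" "de S <= cmod (ev h x)" using de[OF S(1) n] unfolding far_def by blast
  moreover have "2 * ep <= de S" using n S(1) by (intro ep(2)) (auto simp: D_def)
  ultimately show False using S(2)[OF h(1)] ep(1) by (simp add: divide_less_eq)
 qed
 obtain W C where W: "continuous_on UNIV W" "C > 0" "!!x. norm (W x) <= C"
  "!!x b k. (!!S w. S <= J ==> (!!g. g : J ==> cmod (ev g x) / ep <= 1 ==> g : S) ==> (ALL h:S. ev h w = 0) ==> cdot b w = k) ==>
    cdot b (W x) = k"
 proof (rule vector_field[OF J, where X = UNIV and q = "%h x. cmod (ev h x) / ep" and P = "%S p. ALL h:S. ev h p = 0"])
  show "continuous_on UNIV (%x. cmod (ev h x) / ep)" for h :: "'n aff"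
   using ep(1) by (intro continuous_intros) auto
   show "EX w. ALL h:S. ev h w = 0" if "S <= J" "!!g. g : S ==> cmod (ev g x) / ep < 2" for S x
   by (rule ex[OF that])
 qed blast
 have "ev h (W x) = 0" if h: "h : J" "cmod (ev h x) <= ep" for h x
 proof -
  have "cdot (fst h) (W x) = - snd h"
  proof (rule W(4))
   fix S w assume S: "!!g. g : J ==> cmod (ev g x) / ep <= 1 ==> g : S" "ALL h:S. ev h w = 0"
   thus "cdot (fst h) w = - snd h" using h ep(1) by (simp add: ev_def eq_neg_iff_add_eq_0)
  qed
  thus ?thesis by (simp add: ev_def)
 qed
 thus thesis using that ep(1) W(1,2,3) by blast
qed

section \<open>Acyclicity of the tube for a generic holonomy\<close>

lemma ev_affine: "ev h ((1 - s) *\<^sub>R x + s *\<^sub>R w) = of_real (1 - s) * ev h x + of_real s * ev h w"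
 by (simp add: ev_def algebra_simps)

text \<open>The homotopy ends at the identity again, but on chains it ends at multiplication by
  \<open>inverse lam\<close>. Hence \<open>inverse lam - 1\<close> times a cycle is a boundary, and
  this factor is invertible.\<close>

lemma thz_twist:
 fixes h :: "'a::real_normed_vector => real => 'a"
 assumes "holonomy X hol" and SX: "S <= X" and cont: "continuous_on (S \<times> {0..1}) (%z. h (fst z) (snd z))"
  and h01: "!!x. x : S ==> h x 0 = x" "!!x. x : S ==> h x 1 = x"
  and hS: "!!x t. x : S ==> 0 <= t ==> t <= 1 ==> h x t : S"
  and lam: "!!x. x : S ==> hol (h x) = lam" "lam ~= 1"
 shows "holonomy.thz hol S {}"
proof -
 interpret holonomy X hol by fact
 have hX: "h x t : X" if "x : S" "0 <= t" "t <= 1" for x t using hS[OF that] SX by blast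
 obtain G D where Dadd: "!!q x y. D q (x + y) = D q x + D q y"
  and Gadd: "!!q x y. G q (x + y) = G q x + G q y" and Gsc: "!!q k x. G q (sc k x) = sc k (G q x)"
  and Din: "!!q c. c : tchain q S ==> D q c : tchain (Suc q) S"
  and GD: "!!q c. c : tchain q S ==> bd (Suc q) (D q c) + D (q - 1) (bd q c) = G q c - c"
  and Ggen: "!!q f. singular_simplex q (top_of_set S) f ==>
    G q (gen f) = sc (hol (%t. h (f iv) (1 - t))) (gen (simplex_map q (%x. h x 1) f))"
 proof (rule homotopy_operators[OF SX cont h01(1) hX])
  fix G D
  assume a: "!!q x y. D q (x + y) = D q x + D q y" "!!q k x. D q (sc k x) = sc k (D q x)"
   "!!q x y. G q (x + y) = G q x + G q y" "!!q k x. G q (sc k x) = sc k (G q x)"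
   "!!q U V c. U <= S ==> c : tchain q U ==> (!!x t. x : U ==> 0 <= t ==> t <= 1 ==> h x t : V) ==>
    D q c : tchain (Suc q) V"
   "!!q U V c. U <= S ==> c : tchain q U ==> (!!x. x : U ==> h x 1 : V) ==> G q c : tchain q V"
   "!!q c. c : tchain q S ==> bd (Suc q) (D q c) + D (q - 1) (bd q c) = G q c - c"
   "!!q f. singular_simplex q (top_of_set S) f ==>
    G q (gen f) = sc (hol (%t. h (f iv) (1 - t))) (gen (simplex_map q (%x. h x 1) f))"
  have Din: "D q c : tchain (Suc q) S" if c: "c : tchain q S" for q c
   by (rule a(5)[OF order_refl c]) (rule hS)
  show thesis by (rule that[of D G]) (fact a Din)+
 qed
 have G0: "G q 0 = 0" and D0: "D q 0 = 0" for q using Gadd[of q 0 0] Dadd[of q 0 0] by simp_all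
 have G: "G q c = sc (inverse lam) c" if "c : tchain q S" for q c
 proof -
  have "supp c <= {f. singular_simplex q (top_of_set S) f}" using that by (simp add: tchain_def)
  thus ?thesis
  proof (induction rule: chain_induct)
   case (gen f)
   hence f: "singular_simplex q (top_of_set S) f" "f ` standard_simplex q <= S" "f : extensional (standard_simplex q)"
    by (auto simp: simplex_iff)
   have f0: "f iv : S" using f(2) by (auto simp: image_subset_iff)
   have p: "path (h (f iv))" "path_image (h (f iv)) <= X"
   proof -
    have "continuous_on {0..1} (%t. (%z. h (fst z) (snd z)) (f iv, t))"
     by (rule continuous_on_compose2[OF cont]) (use f0 in \<open>auto intro!: continuous_intros\<close>)
    thus "path (h (f iv))" by (simp add: path_def)
    show "path_image (h (f iv)) <= X" using hX[OF f0] by (auto simp: path_image_def)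
   qed
   have "hol (%t. h (f iv) (1 - t)) = inverse lam"
    using hol_reverse[OF p] lam(1)[OF f0] by (simp add: reversepath_def)
   moreover have "simplex_map q (%x. h x 1) f = f"
    using f(2,3) h01(2) by (auto simp: simplex_map_def restrict_def fun_eq_iff extensional_def image_subset_iff)
   ultimately show ?case using Ggen[OF f(1)] by simp
  qed (simp_all add: G0 Gadd Gsc tc.scale_right_distrib mult.commute)
 qed
 show ?thesis unfolding thz_def hz_def
 proof (intro allI subsetI)
  fix p z assume "z : rz (tch S) (tch {}) p"
  hence z: "z : tchain p S" "bd p z = 0" by (auto simp: rz_def tchain_empty)
  define \<mu> where "\<mu> = inverse lam - 1"
  have "\<mu> ~= 0" using lam(2) by (auto simp: \<mu>_def)
  have "bd (Suc p) (D p z) = sc \<mu> z"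
   using GD[OF z(1)] G[OF z(1)] z(2) by (simp add: D0 \<mu>_def tc.scale_left_diff_distrib)
  hence "z = bd (Suc p) (sc (inverse \<mu>) (D p z)) + 0" using \<open>\<mu> ~= 0\<close> by (simp add: bd_sc)
  thus "z : rb (tch S) (tch {}) p" using z(1) tchain_sc[OF Din[OF z(1)], of "inverse \<mu>"]
   by (intro rbI[of "sc (inverse \<mu>) (D p z)" _ _ 0]) (simp_all add: tchain_empty)
 qed
qed

text \<open>On \<open>V\<close> the functionals not vanishing at \<open>p\<close> stay above the
  tube radius, so homotheties towards \<open>p\<close> preserve the piece of the tube. They end in a
  ball where rotation about \<open>p\<close> has holonomy \<open>lam\<close> at every point.\<close>

lemma thz_local:
 fixes J :: "('n::finite) aff set"
 assumes J: "finite J" and hol: "holonomy (MM J) ta" and V: "open V" "convex V" "p : V" and ep: "0 < ep"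
  and far: "!!h x. h : J ==> ev h p ~= 0 ==> x : V ==> ep <= cmod (ev h x)"
  and h0: "h0 : J" "ev h0 p = 0" and r: "0 < r" "lam ~= 1"
  and rot: "!!x. x : MM J ==> x : ball p r ==> ta (%t. p + cis (2 * pi * t) *s (x - p)) = lam"
 shows "holonomy.thz ta (V Int (TT J ep Int MM J)) {}"
proof -
 interpret holonomy "MM J" ta by fact
 obtain ro0 where ro0: "0 < ro0" "ball p ro0 <= V Int TT J ep" using V(1,3) open_Int[OF V(1) open_TT[of J ep]] h0 ep
  by (auto simp: TT_def intro!: bexI[of _ h0] intro: openE)
 define ro where "ro = min ro0 r"
 have ro: "0 < ro" "ball p ro <= V" "ball p ro <= TT J ep" "ball p ro <= ball p r"
  using ro0 r by (auto simp: ro_def)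
 have evp: "ev h (p + c *s (x - p)) = c * ev h x" if "ev h p = 0" for h c x
 proof -
  have "cdot (fst h) p = - snd h" using that by (simp add: ev_def eq_neg_iff_add_eq_0)
  thus ?thesis by (simp add: ev_def algebra_simps)
 qed
 \<comment> \<open>Functionals vanishing at \<open>p\<close> are multiplied by \<open>c\<close>; the
   others have no zero on \<open>V\<close>.\<close>
 have MMI: "p + c *s (x - p) : MM J" if "x : MM J" "p + c *s (x - p) : V" "c ~= 0" for x c
 proof -
  have "ev h (p + c *s (x - p)) ~= 0" if "h : J" for h
   using far[OF that _ \<open>p + c *s (x - p) : V\<close>] evp[of h c x] ep \<open>x : MM J\<close> that \<open>c ~= 0\<close> by (cases "ev h p = 0") (auto simp: MM_def)
  thus ?thesis by (simp add: MM_def)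
 qed
 let ?A = "V Int (TT J ep Int MM J)" and ?B = "ball p ro Int MM J"
 define h where "h x s = p + complex_of_real (1 - s / 2) *s (x - p)" for x s
 have hV: "h x s : V" if "x : V" "0 <= s" "s <= 1" for x s
 proof -
  show ?thesis using convexD[OF V(2) that(1) V(3), of "1 - s / 2" "s / 2"] that
   by (simp add: h_def scaleR_vec_eq[symmetric] algebra_simps del: of_real_diff)
 qed
 have hM: "h x s : MM J" if "x : V Int MM J" "0 <= s" "s <= 1" for x s
  using that hV[of x s] unfolding h_def by (intro MMI) (auto simp del: of_real_diff)
 have hn: "norm (h x s - p) = (1 - s / 2) * norm (x - p)" if "0 <= s" "s <= 1" for x s
  unfolding h_def add_diff_cancel_left' norm_smult norm_of_real using that by simp
 have hB: "h x s : ball p ro" if "x : ball p ro" "0 <= s" "s <= 1" for x s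
 proof -
  have "(1 - s / 2) * norm (x - p) <= 1 * norm (x - p)" using that by (intro mult_right_mono) auto
  thus ?thesis using that hn[of s x] by (simp add: dist_norm norm_minus_commute)
 qed
 have "thz ?A ?B"
 proof (rule thz_push[where h = h])
  show "continuous_on (?A \<times> {0..1}) (%z. h (fst z) (snd z))"
   unfolding h_def by (intro continuous_intros) auto
  show "h x s : ?A" if x: "x : ?A" and s: "0 <= s" "s <= 1" for x s
  proof -
   obtain g where g: "g : J" "cmod (ev g x) < ep" using x by (auto simp: TT_def)
   have "ev g p = 0"
   proof (rule ccontr)
    assume "ev g p ~= 0"
    thus False using far[OF g(1), of x] g(2) x by simp
   qed
   hence "cmod (ev g (h x s)) = (1 - s / 2) * cmod (ev g x)"
    unfolding h_def evp[OF \<open>ev g p = 0\<close>] norm_mult norm_of_real using s by simp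
   also have "... <= 1 * cmod (ev g x)" using s by (intro mult_right_mono) auto
   finally show ?thesis using g unfolding TT_def using x s hV hM by (auto intro!: bexI[of _ g])
  qed
  show "h x s : ?B" if "x : ?B" "0 <= s" "s <= 1" for x s using that hB hM ro(2) by blast
  fix K assume K: "compact K" "K <= ?A"
  obtain D where D: "!!x. x : K ==> norm (x - p) <= D" "0 < D"
  proof -
   have "bounded ((%x. x - p) ` K)"
    by (intro compact_imp_bounded compact_continuous_image K continuous_intros)
   thus ?thesis using that unfolding bounded_pos by blast
  qed
  obtain N where N: "(1 / 2) ^ N * D < ro"
  proof -
   obtain N where "(1 / 2) ^ N < ro / D"
    using real_arch_pow_inv[of "ro / D" "1 / 2"] ro(1) D(2) by auto
   thus ?thesis using D(2) by (intro that[of N]) (simp add: pos_less_divide_eq)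
  qed
  have it: "((%x. h x 1) ^^ n) x : V Int MM J & norm (((%x. h x 1) ^^ n) x - p) = (1 / 2) ^ n * norm (x - p)" if "x : V Int MM J" for x n
  proof (induction n)
   case (Suc n)
   let ?y = "((%x. h x 1) ^^ n) x"
   have "norm (h ?y 1 - p) = 1 / 2 * norm (?y - p)" by (subst hn) auto
   thus ?case using Suc hV[of ?y 1] hM[of ?y 1] by simp
  qed (use that in simp)
  show "EX N. ALL x:K. ((%x. h x 1) ^^ N) x : ?B"
  proof (intro exI[of _ N] ballI)
   fix x assume x: "x : K"
   hence xV: "x : V Int MM J" using K(2) by blast
   have "(1 / 2) ^ N * norm (x - p) <= (1 / 2) ^ N * D"
    using D(1)[OF x] by (intro mult_left_mono) auto
   thus "((%x. h x 1) ^^ N) x : ?B"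
    using it[OF xV, of N] N unfolding mem_ball dist_norm norm_minus_commute[of p] Int_iff by linarith
  qed
 qed (use ro in \<open>auto simp: h_def\<close>)
 moreover have "thz ?B {}"
 proof (rule thz_twist[where h = "%x t. p + cis (2 * pi * t) *s (x - p)" and lam = lam, OF hol])
  show "continuous_on (?B \<times> {0..1}) (%z. p + cis (2 * pi * snd z) *s (fst z - p))"
   by (intro continuous_intros)
  show "p + cis (2 * pi * t) *s (x - p) : ?B" if "x : ?B" for x t
  proof -
   have "norm (p + cis (2 * pi * t) *s (x - p) - p) = norm (x - p)"
    unfolding add_diff_cancel_left' norm_smult by simp
   hence "p + cis (2 * pi * t) *s (x - p) : ball p ro"
    using that by (simp add: dist_norm norm_minus_commute del: add_diff_cancel_left')
   thus ?thesis using that MMI[of x "cis (2 * pi * t)"] ro(2) by auto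
  qed
  show "ta (%t. p + cis (2 * pi * t) *s (x - p)) = lam" if "x : ?B" for x
   using that ro(4) by (intro rot) auto
  show "lam ~= 1" by (rule r)
 qed simp_all
 ultimately show ?thesis using ro(2,3) using thz_trans[of ?A ?B "{}"] by blast+
qed

text \<open>A cycle of \<open>A\<close> is homologous to one in \<open>B\<close>, which bounds in
  \<open>C\<close>; \<open>B\<close> is a way station between the tube and a union of pieces known
  to be acyclic.\<close>

lemma (in holonomy) thz_factor:
 assumes AX: "A <= X" and CA: "C <= A" and BC: "B <= C" and AB: "thz A B" and C: "thz C {}"
 shows "thz A {}" unfolding thz_def hz_def
proof (intro allI subsetI)
 fix p z assume "z : rz (tch A) (tch {}) p"
 hence z: "z : tchain p A" "bd p z = 0" by (auto simp: rz_def tchain_empty)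
 obtain e y where e: "e : tchain (Suc p) A" and y: "y : tchain p B" and zey: "z = bd (Suc p) e + y" using z(2) tchain_0 using hzD[OF AB[unfolded thz_def] z(1)]
  by metis
 have "e : tchain (Suc p) X" using e tchain_mono[OF AX] by blast
 from bd_bd[OF this] have "bd p y : tchain (p - 1) {}" using z(2) unfolding zey bd_add
  by (simp add: tchain_empty)
 then obtain f y' where f: "f : tchain (Suc p) C" "y' : tchain p {}" "y = bd (Suc p) f + y'" using y tchain_mono[OF BC] using hzD[OF C[unfolded thz_def]]
  by blast
 have fA: "f : tchain (Suc p) A" using f(1) tchain_mono[OF CA] by blast
 have "z = bd (Suc p) (e + f) + 0" using f(2,3) zey by (simp add: bd_add tchain_empty add.assoc)
 thus "z : rb (tch A) (tch {}) p"
  by (intro rbI[of "e + f" _ _ 0] tchain_add e fA z(1)) (simp_all add: tchain_empty)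
qed

text \<open>Points with a definite margin to the complement. The margin turns the statement that a
  hyperplane misses an intersection of cover members into a lower bound for its functional.\<close>

definition inner :: "'a::metric_space set => nat => 'a set" where
 "inner U m = {x. EX r>1 / real (Suc m). ball x r <= U}"

lemma inner_subset: "inner U m <= U"
proof
 fix x assume "x : inner U m"
 then obtain r where r: "1 / real (Suc m) < r" "ball x r <= U" unfolding inner_def by blast
 have "0 < 1 / real (Suc m)" by simp
 also note r(1)
 finally show "x : U" using centre_in_ball[of x r] r(2) by blast
qed

lemma inner_mono: assumes "m <= m'" shows "inner U m <= inner U m'"
proof -
 have "1 / real (Suc m') <= 1 / real (Suc m)" using assms by (intro divide_left_mono) auto
 thus ?thesis unfolding inner_def by (auto intro: le_less_trans)
qed

lemma open_inner: "open (inner U m)" unfolding open_dist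
proof
 fix x assume "x : inner U m"
 then obtain r where r: "1 / real (Suc m) < r" "ball x r <= U" unfolding inner_def by blast
 define d where "d = (r - 1 / real (Suc m)) / 2"
 have "0 < d" "r - 2 * d = 1 / real (Suc m)"
  using r(1) by (simp_all only: d_def) (simp_all add: field_simps)
 hence d: "0 < d" "1 / real (Suc m) < r - d" by simp_all
 show "EX e>0. ALL y. dist y x < e --> y : inner U m"
 proof (intro exI[of _ d] conjI allI impI d(1))
  fix y assume y: "dist y x < d"
  have "ball y (r - d) <= ball x r"
  proof
   fix z assume "z : ball y (r - d)"
   thus "z : ball x r" using y dist_triangle[of x z y] by (simp add: dist_commute)
  qed
  thus "y : inner U m" unfolding inner_def using d(2) r(2) by blast
 qed
qed

lemma in_inner: assumes "open U" "x : U" shows "EX m. x : inner U m"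
proof -
 obtain r where r: "0 < r" "ball x r <= U" using assms by (rule openE)
 obtain m where "1 / real (Suc m) < r"
  using reals_Archimedean[OF r(1)] by (auto simp: inverse_eq_divide)
 thus ?thesis unfolding inner_def using r(2) by blast
qed

lemma convex_inner:
 fixes U :: "'a::real_normed_vector set"
 assumes "convex U"
 shows "convex (inner U m)"
proof (rule convexI)
 fix x y and u v :: real assume xy: "x : inner U m" "y : inner U m" and uv: "0 <= u" "0 <= v" "u + v = 1"
 obtain r1 r2 where r: "1 / real (Suc m) < r1" "ball x r1 <= U" "1 / real (Suc m) < r2" "ball y r2 <= U"
  using xy by (auto simp: inner_def)
 have "ball (u *\<^sub>R x + v *\<^sub>R y) (min r1 r2) <= U"
 proof
  fix w assume w: "w : ball (u *\<^sub>R x + v *\<^sub>R y) (min r1 r2)"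
  define d where "d = w - (u *\<^sub>R x + v *\<^sub>R y)"
  have "u *\<^sub>R (x + d) + v *\<^sub>R (y + d) : U" using w using r(2,4) using assms uv
   by (simp add: d_def dist_norm norm_minus_commute dist_norm subset_iff convex_def)
  moreover have "u *\<^sub>R (x + d) + v *\<^sub>R (y + d) = u *\<^sub>R x + v *\<^sub>R y + (u + v) *\<^sub>R d"
   by (simp only: scaleR_right_distrib scaleR_left_distrib ac_simps)
  ultimately show "w : U" using uv(3) by (simp add: d_def)
 qed
 thus "u *\<^sub>R x + v *\<^sub>R y : inner U m"
  unfolding inner_def using r by (intro CollectI exI[of _ "min r1 r2"]) auto
qed

lemma ev_bounded:
 assumes "finite (J :: ('n::finite) aff set)"
 shows "EX D>0. ALL h:J. ALL x. norm x <= C --> cmod (ev h x) <= D" using assms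
proof (induction J rule: finite_induct)
 case (insert u J)
 then obtain D where D: "0 < D" "!!h x. h : J ==> norm x <= C ==> cmod (ev h x) <= D" by blast
 let ?a = "SUM i:UNIV. cmod (fst u $ i)"
 have "cmod (ev u x) <= ?a * abs C + cmod (snd u)" if x: "norm x <= C" for x
 proof -
  have "cmod (ev u x) <= cmod (cdot (fst u) x) + cmod (snd u)"
   unfolding ev_def by (rule norm_triangle_ineq)
  also have "cmod (cdot (fst u) x) <= ?a * norm x" by (rule cdot_le)
  also have "?a * norm x <= ?a * abs C" using x by (intro mult_left_mono sum_nonneg) auto
  finally show ?thesis by simp
 qed
 thus ?case
  using D by (intro exI[of _ "max D (?a * abs C + cmod (snd u))"]) (auto intro: le_max_iff_disj[THEN iffD2])
qed (auto intro: exI[of _ 1])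

text \<open>The cover may be infinite, and its members may come arbitrarily close to hyperplanes
  that they do not meet. Moving towards the bounded field \<open>W\<close> brings compact sets into
  a ball and a thinner tube. There compactness leaves finitely many members, shrunk by
  \<open>inner\<close>, and a radius \<open>de\<close> with the lower bounds that
  \<open>thz_local\<close> asks for.\<close>

lemma thz_TT:
 fixes J :: "('n::finite) aff set" and U :: "'i => (complex ^ 'n) set"
 assumes J: "finite J" "!!h. h : J ==> fst h ~= 0" and hol: "holonomy (MM J) ta"
  and W: "0 < ep" "continuous_on UNIV W" "0 < C" "!!x. norm (W x) <= C" "!!x h. h : J ==> cmod (ev h x) <= ep ==> ev h (W x) = 0"
  and U: "!!i. i : I ==> open (U i)" "!!i. i : I ==> convex (U i)"
  and cov: "!!x h. h : J ==> ev h x = 0 ==> EX i:I. x : U i"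
  and center: "!!s. finite s ==> s ~= {} ==> s <= I ==> (INT i:s. U i) ~= {} ==>
   EX p:INT i:s. U i. (ALL h:J. ALL x:INT i:s. U i. ev h x = 0 --> ev h p = 0) & (EX h:J. ev h p = 0) &
    (EX lam r. 0 < r & lam ~= 1 & (ALL x. x : MM J --> x : ball p r --> ta (%t. p + cis (2 * pi * t) *s (x - p)) = lam))"
 shows "holonomy.thz ta (TT J ep Int MM J) {}"
proof -
 interpret holonomy "MM J" ta by fact
 define R where "R = C + 1"
 obtain D where D: "0 < D" "!!h x. h : J ==> norm x <= C ==> cmod (ev h x) <= D"
  using ev_bounded[OF J(1), of C] by blast
 \<comment> \<open>A functional above \<open>ep\<close>, mixed with its value at \<open>W x\<close>
   of size at most \<open>D\<close>, must not vanish: \<open>(1 - th) * ep - th * D\<close> equals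
   \<open>ep / 2\<close>.\<close>
 define th where "th = ep / (2 * (ep + D))"
 have th: "0 < th" "th < 1" "th * (ep + D) = ep / 2"
 proof -
  have "0 < ep + D" using W(1) D(1) by simp
  thus "0 < th" "th < 1" using W(1) D(1) by (simp_all add: th_def divide_less_eq)
  have "e / (2 * S) * S = e / 2" if "0 < S" for e S :: real using that by simp
  from this[OF \<open>0 < ep + D\<close>] show "th * (ep + D) = ep / 2" unfolding th_def .
 qed
 define h where "h x t = (1 - th * t) *\<^sub>R x + (th * t) *\<^sub>R W x" for x t
 have tht: "0 <= th * t" "th * t <= th" if "0 <= t" "t <= 1" for t
  using that th(1) by (auto simp: mult_left_le)
 have near: "cmod (ev g (h x t)) = (1 - th * t) * cmod (ev g x)"
  if "g : J" "cmod (ev g x) <= ep" "0 <= t" "t <= 1" for g x t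
  unfolding h_def ev_affine W(5)[OF that(1,2)] using tht[OF that(3,4)] th(2)
  by (simp add: norm_mult del: of_real_diff of_real_mult)
 have far: "0 < cmod (ev g (h x t))" if g: "g : J" "ep < cmod (ev g x)" and t: "0 <= t" "t <= 1" for g x t
 proof -
  let ?s = "th * t"
  have "(1 - ?s) * ep <= (1 - ?s) * cmod (ev g x)" "?s * cmod (ev g (W x)) <= ?s * D"
   using g tht[OF t] th(2) D(2)[OF g(1) W(4)] by (auto intro!: mult_left_mono)
  moreover have "?s * (ep + D) <= th * (ep + D)"
   using tht[OF t] W(1) D(1) by (intro mult_right_mono) auto
  moreover have "(1 - ?s) * cmod (ev g x) - ?s * cmod (ev g (W x)) <= cmod (ev g (h x t))"
  proof -
   have "cmod (of_real (1 - ?s) * ev g x) = (1 - ?s) * cmod (ev g x)" "cmod (of_real ?s * ev g (W x)) = ?s * cmod (ev g (W x))"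
    unfolding norm_mult norm_of_real using tht[OF t] th(2) by auto
   thus ?thesis
    unfolding h_def ev_affine using norm_diff_ineq[of "of_real (1 - ?s) * ev g x" "of_real ?s * ev g (W x)"] by linarith
  qed
  ultimately show ?thesis using th(3) W(1) by (auto simp: algebra_simps)
 qed
 have hM: "h x t : MM J" if "x : MM J" "0 <= t" "t <= 1" for x t
 proof -
  have "ev g (h x t) ~= 0" if g: "g : J" for g
  proof (cases "cmod (ev g x) <= ep")
   case True
   have "0 < (1 - th * t) * cmod (ev g x)"
    using \<open>x : MM J\<close> g tht[of t] th(2) that \<open>0 <= t\<close> \<open>t <= 1\<close> by (auto simp: MM_def)
   thus ?thesis using near[OF g True, of t] \<open>0 <= t\<close> \<open>t <= 1\<close> by auto
  next
   case False
   thus ?thesis using far[OF g, of x t] \<open>0 <= t\<close> \<open>t <= 1\<close> by auto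
  qed
  thus ?thesis by (simp add: MM_def)
 qed
 have hT: "h x t : TT J de" if x: "x : TT J de" and de: "de <= ep" and t: "0 <= t" "t <= 1" for x t de
 proof -
  obtain g where g: "g : J" "cmod (ev g x) < de" using x by (auto simp: TT_def)
  have "(1 - th * t) * cmod (ev g x) <= 1 * cmod (ev g x)"
   using tht[OF t] by (intro mult_right_mono) auto
  hence "cmod (ev g (h x t)) < de" using near[OF g(1) _ t, of x] g(2) de by simp
  thus ?thesis unfolding TT_def using g(1) by blast
 qed
 have hR: "norm (h x t) <= (1 - th * t) * norm x + th * t * C" if t: "0 <= t" "t <= 1" for x t
 proof -
  have "norm (h x t) <= norm ((1 - th * t) *\<^sub>R x) + norm ((th * t) *\<^sub>R W x)"
   unfolding h_def by (rule norm_triangle_ineq)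
  also have "... = (1 - th * t) * norm x + th * t * norm (W x)"
   unfolding norm_scaleR using tht[OF t] th(2) by simp
  also have "... <= (1 - th * t) * norm x + th * t * C"
   using tht[OF t] W(4)[of x] by (intro add_left_mono mult_left_mono) auto
  finally show ?thesis .
 qed
 let ?A = "TT J ep Int MM J" and ?B = "%de. TT J de Int MM J Int ball 0 R"
 have push: "thz ?A (?B de)" if de: "0 < de" "de <= ep" for de
 proof (rule thz_push[where h = h])
  show "continuous_on (?A \<times> {0..1}) (%z. h (fst z) (snd z))"
   unfolding h_def by (intro continuous_intros continuous_on_compose2[OF W(2)]) auto
  show "?A <= MM J" "?B de <= ?A" using de(2) by (auto simp: TT_def intro: less_le_trans)
  show "h x 0 = x" for x by (simp add: h_def)
  show "h x t : ?A" if "x : ?A" "0 <= t" "t <= 1" for x t using that hT[OF _ order_refl] hM by blast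
  show "h x t : ?B de" if x: "x : ?B de" and t: "0 <= t" "t <= 1" for x t
  proof -
   have "norm x < R" using x by simp
   hence "(1 - th * t) * norm x < (1 - th * t) * R"
    using tht[OF t] th(2) by (intro mult_strict_left_mono) auto
   moreover have "th * t * C <= th * t * R"
    using tht[OF t] by (intro mult_left_mono) (auto simp: R_def)
   ultimately have "norm (h x t) < R" using hR[OF t, of x] by (simp add: algebra_simps)
   thus ?thesis using x t hT[OF _ de(2) t] hM by simp
  qed
  fix K assume K: "compact K" "K <= ?A"
  obtain M where M: "!!x. x : K ==> norm x <= M" "0 < M"
   using compact_imp_bounded[OF K(1)] unfolding bounded_pos by blast
  obtain N where "(1 - th) ^ N < min 1 de / (M + ep)"
   using real_arch_pow_inv[of "min 1 de / (M + ep)" "1 - th"] th de(1) M(2) W(1) by auto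
  hence N: "(1 - th) ^ N * (M + ep) < min 1 de" using M(2) W(1) by (simp add: pos_less_divide_eq)
  have it: "((%x. h x 1) ^^ n) x : MM J & norm (((%x. h x 1) ^^ n) x) <= C + (1 - th) ^ n * M &
    cmod (ev g (((%x. h x 1) ^^ n) x)) <= (1 - th) ^ n * ep" if x: "x : K" and g: "g : J" "cmod (ev g x) < ep" for x n g
  proof (induction n)
   case 0
   show ?case using x g K(2) M W(3) by (force intro: less_imp_le order_trans)
  next
   case (Suc n)
   let ?y = "((%x. h x 1) ^^ n) x"
   have "(1 - th) ^ n <= 1 ^ n" using th by (intro power_mono) auto
   hence "(1 - th) ^ n * ep <= 1 * ep" using W(1) by (intro mult_right_mono) auto
   hence "cmod (ev g (h ?y 1)) = (1 - th) * cmod (ev g ?y)" using near[OF g(1), of ?y 1] Suc by simp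
   also have "... <= (1 - th) * ((1 - th) ^ n * ep)" using Suc th(2) by (intro mult_left_mono) auto
   finally have 1: "cmod (ev g (h ?y 1)) <= (1 - th) ^ Suc n * ep" by (simp add: mult.assoc)
   have "norm (h ?y 1) <= (1 - th) * norm ?y + th * C" using hR[of 1 ?y] by simp
   also have "... <= (1 - th) * (C + (1 - th) ^ n * M) + th * C"
    using Suc th(2) by (intro add_right_mono mult_left_mono) auto
   finally have "norm (h ?y 1) <= C + (1 - th) ^ Suc n * M" by (simp add: algebra_simps)
   thus ?case using 1 Suc hM[of ?y 1] by simp
  qed
  show "EX N. ALL x:K. ((%x. h x 1) ^^ N) x : ?B de"
  proof (intro exI[of _ N] ballI)
   fix x assume x: "x : K"
   then obtain g where g: "g : J" "cmod (ev g x) < ep" using K(2) by (auto simp: TT_def)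
   let ?y = "((%x. h x 1) ^^ N) x"
   have "0 <= (1 - th) ^ N * M" "0 <= (1 - th) ^ N * ep" using th(2) M(2) W(1) by auto
   hence "cmod (ev g ?y) < de" "norm ?y < R"
    using it[OF x g, of N] N by (auto simp: R_def algebra_simps)
   moreover have "?y : MM J" using it[OF x g, of N] by blast
   ultimately show "?y : ?B de" using g(1) by (auto simp: TT_def)
  qed
 qed
 have w: "EX w. cdot (fst g) w = 1" if "g : J" for g
 proof -
  have "fst g ~: vec.span {}" using J(2)[OF that] by simp
  from cdot_annihilate[OF this] show ?thesis by blast
 qed
 then obtain w where w: "!!g. g : J ==> cdot (fst g) (w g) = 1" by metis
 have compS: "compact (cball 0 R Int {x. EX g:J. ev g x = 0})"
 proof -
  have "closed (UN g:J. {x. ev g x = 0})"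
   by (intro closed_UN ballI J closed_Collect_eq continuous_intros)
  moreover have "(UN g:J. {x. ev g x = 0}) = {x. EX g:J. ev g x = 0}" by auto
  ultimately show ?thesis by (simp add: compact_Int_closed)
 qed
 obtain I' where I': "I' <= I \<times> UNIV" "finite I'" "cball 0 R Int {x. EX g:J. ev g x = 0} <= (UN (i, m):I'. inner (U i) m)"
 proof (rule compactE_image[OF compS, of "I \<times> UNIV" "%(i, m). inner (U i) m"])
  show "cball 0 R Int {x. EX g:J. ev g x = 0} <= (UN (i, m):I \<times> UNIV. inner (U i) m)"
  proof
   fix x assume "x : cball 0 R Int {x. EX g:J. ev g x = 0}"
   then obtain i where i: "i : I" "x : U i" using cov by blast
   then obtain m where "x : inner (U i) m" using in_inner U(1) by blast
   thus "x : (UN (i, m):I \<times> UNIV. inner (U i) m)" using i(1) by blast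
  qed
  show "open (case z of (i, m) => inner (U i) m)" for z by (cases z) (simp add: open_inner)
 qed (rule that)
 define I0 where "I0 = fst ` I'"
 have I0: "finite I0" "I0 <= I" using I'(1,2) by (auto simp: I0_def)
 define SS where "SS = {s. s <= I0 & s ~= {} & (INT i:s. U i) ~= {}}"
 have SSf: "finite SS" using I0(1) by (auto simp: SS_def)
 define Q where "Q s p \<longleftrightarrow> p : (INT i:s. U i) & (ALL h:J. ALL x:INT i:s. U i. ev h x = 0 --> ev h p = 0) & (EX h:J. ev h p = 0) &
    (EX lam r. 0 < r & lam ~= 1 & (ALL x. x : MM J --> x : ball p r --> ta (%t. p + cis (2 * pi * t) *s (x - p)) = lam))" for s p
 have "ALL s:SS. EX p. Q s p"
 proof
  fix s assume "s : SS"
  hence s: "finite s" "s ~= {}" "s <= I" "(INT i:s. U i) ~= {}"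
   using I0 finite_subset by (auto simp: SS_def)
  show "EX p. Q s p" unfolding Q_def using center[OF s] unfolding Bex_def .
 qed
 then obtain p where Q: "!!s. s : SS ==> Q s (p s)" by metis
 have p: "p s : (INT i:s. U i)" "!!h x. h : J ==> x : (INT i:s. U i) ==> ev h x = 0 ==> ev h (p s) = 0"
  "EX h:J. ev h (p s) = 0"
  "EX lam r. 0 < r & lam ~= 1 & (ALL x. x : MM J --> x : ball (p s) r --> ta (%t. p s + cis (2 * pi * t) *s (x - p s)) = lam)"
  if "s : SS" for s using Q[OF that] unfolding Q_def by blast+
 have "ALL s:SS. ALL i:s. EX m. p s : inner (U i) m"
 using p(1) I0(2) U(1) by (auto simp: SS_def intro!: ballI in_inner)
 then obtain ms where ms: "!!s i. s : SS ==> i : s ==> p s : inner (U i) (ms s i)" by metis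
 define Ms where "Ms = snd ` I' Un (UN s:SS. ms s ` s)"
 have Ms: "finite Ms" using I'(2) SSf I0(1) finite_subset unfolding Ms_def SS_def by auto
 \<comment> \<open>One margin for all: it is fine enough for the finite subcover and keeps each
   centre \<open>p s\<close> inside the shrunken intersection.\<close>
 define m where "m = Max (insert 0 Ms)"
 have m: "k <= m" if "k : Ms" for k unfolding m_def using Ms that by (intro Max_ge) auto
 define V where "V i = inner (U i) m" for i
 have pV: "p s : (INT i:s. V i)" if "s : SS" for s
 proof
  fix i assume i: "i : s"
  hence "ms s i <= m" using that by (intro m) (auto simp: Ms_def)
  thus "p s : V i" unfolding V_def using ms[OF that i] inner_mono by blast
 qed
 have Sig: "x : (UN i:I0. V i)" if x: "x : cball 0 R" "g : J" "ev g x = 0" for x g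
 proof -
  obtain i k where ik: "(i, k) : I'" "x : inner (U i) k" using I'(3) x by blast
  hence "k <= m" by (intro m) (force simp: Ms_def)
  thus ?thesis using ik inner_mono unfolding V_def I0_def by force
 qed
 have "ALL g:J. EX de>0. ALL x:cball 0 R - (UN i:I0. V i). de <= cmod (ev g x)"
 proof
  fix g assume g: "g : J"
  let ?K = "cball 0 R - (UN i:I0. V i)"
  have K: "compact ?K" unfolding V_def by (intro compact_diff open_UN ballI open_inner) auto
  show "EX de>0. ALL x:?K. de <= cmod (ev g x)"
  proof (cases "?K = {}")
   case False
   have "continuous_on ?K (%x. cmod (ev g x))" by (intro continuous_intros)
   from continuous_attains_inf[OF K False this]
   obtain x where x: "x : ?K" "!!y. y : ?K ==> cmod (ev g x) <= cmod (ev g y)" by blast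
   moreover have "ev g x ~= 0" using Sig[OF _ g] x(1) by blast
   ultimately show ?thesis by (intro exI[of _ "cmod (ev g x)"]) auto
  qed (auto intro: exI[of _ 1])
 qed
 then obtain deg where deg: "!!g. g : J ==> 0 < deg g" "!!g x. g : J ==> x : cball 0 R - (UN i:I0. V i) ==> deg g <= cmod (ev g x)"
  by metis
 \<comment> \<open>Below \<open>dew g\<close>, the shift of \<open>x\<close> along
   \<open>w g\<close> onto the hyperplane of \<open>g\<close> is shorter than the margin.\<close>
 define dew where "dew g = 1 / real (Suc m) / (norm (w g) + 1)" for g
 define F where "F = insert ep (deg ` J Un dew ` J)"
 define de where "de = Min F"
 have F: "finite F" "F ~= {}" using J(1) by (auto simp: F_def)
 have "0 < dew g" for g unfolding dew_def by (intro divide_pos_pos add_nonneg_pos) auto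
 hence de0: "0 < de" unfolding de_def using F W(1) deg(1) by (subst Min_gr_iff) (auto simp: F_def)
 have de: "de <= ep" "!!g. g : J ==> de <= deg g" "!!g. g : J ==> de <= dew g"
  unfolding de_def using F(1) by (intro Min_le; simp add: F_def)+
 let ?W = "%i. V i Int (TT J de Int MM J)"
 have "thz (UN i:I0. ?W i) {}"
 proof (rule thz_Union[OF I0(1)])
  show "open (?W i)" "?W i <= MM J" if "i : I0" for i
   unfolding V_def by (intro open_Int open_inner open_TT open_MM J) auto
  fix s assume s: "s <= I0" "s ~= {}"
  show "thz (INT i:s. ?W i) {}"
  proof (cases "s : SS")
   case False
   hence "(INT i:s. U i) = {}" using s by (simp add: SS_def)
   moreover have "(INT i:s. ?W i) <= (INT i:s. U i)" unfolding V_def using inner_subset by fast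
   ultimately show ?thesis using thz_empty by simp
  next
   case True
   have eq: "(INT i:s. ?W i) = (INT i:s. V i) Int (TT J de Int MM J)" using s(2) by auto
   obtain h0 where h0: "h0 : J" "ev h0 (p s) = 0" using p(3)[OF True] by blast
   obtain lam r where lr: "0 < r" "lam ~= 1" "!!x. x : MM J ==> x : ball (p s) r ==> ta (%t. p s + cis (2 * pi * t) *s (x - p s)) = lam"
    using p(4)[OF True] by blast
   show ?thesis unfolding eq
   proof (rule thz_local[OF J(1) hol _ _ pV[OF True] de0 _ h0 lr])
    show "open (INT i:s. V i)"
     unfolding V_def using finite_subset[OF s(1) I0(1)] by (intro open_INT ballI open_inner)
    show "convex (INT i:s. V i)"
     unfolding V_def using s(1) I0(2) U(2) by (intro convex_INT convex_inner) blast
    fix g x assume g: "g : J" "ev g (p s) ~= 0" and x: "x : (INT i:s. V i)"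
    show "de <= cmod (ev g x)"
    proof (rule ccontr)
     assume "~ de <= cmod (ev g x)"
     hence lt: "cmod (ev g x) < dew g" using de(3)[OF g(1)] by simp
     define y where "y = x - ev g x *s w g"
     have "dist x y = cmod (ev g x) * norm (w g)" by (simp add: y_def dist_norm norm_smult)
     also have "... <= cmod (ev g x) * (norm (w g) + 1)" by (intro mult_left_mono) auto
     also have "... < 1 / real (Suc m)"
      using lt by (simp add: dew_def pos_less_divide_eq add_nonneg_pos mult_ac del: of_nat_Suc)
     finally have d: "dist x y < 1 / real (Suc m)" .
     have "y : (INT i:s. U i)" using x d by (fastforce simp: V_def inner_def)
     thus False using w[OF g(1)] using p(2)[OF True g(1)] g(2) by (simp add: y_def ev_def)
    qed
   qed
  qed
 qed
 moreover have "?B de <= (UN i:I0. ?W i)"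
 proof
  fix x assume x: "x : ?B de"
  then obtain g where g: "g : J" "cmod (ev g x) < de" by (auto simp: TT_def)
  have "x : (UN i:I0. V i)"
  proof (rule ccontr)
   assume "x ~: (UN i:I0. V i)"
   hence "deg g <= cmod (ev g x)" using x by (intro deg(2)[OF g(1)]) auto
   thus False using g(2) de(2)[OF g(1)] by simp
  qed
  thus "x : (UN i:I0. ?W i)" using x by blast
 qed
 moreover have "(UN i:I0. ?W i) <= ?A" using de(1) by (auto simp: TT_def intro: less_le_trans)
 ultimately show ?thesis using thz_factor[OF _ _ _ push[OF de0 de(1)]] by blast
qed

section \<open>Holonomy of a loop around several hyperplanes\<close>

context holonomy
begin

text \<open>The two sides of the square traced by the base point agree and cancel.\<close>

lemma hol_free:
 fixes F :: "real => real => 'a"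
 assumes cont: "continuous_on ({0..1} \<times> {0..1}) (%z. F (fst z) (snd z))"
  and F: "!!s t. s : {0..1} ==> t : {0..1} ==> F s t : X" and loop: "!!t. t : {0..1} ==> F 0 t = F 1 t"
 shows "hol (%s. F s 0) = hol (%s. F s 1)"
proof -
 have p: "path (F 0)"
  unfolding path_def by (rule continuous_on_compose2[OF cont, of "{0..1}" "%t. (0, t)", simplified]) (auto intro!: continuous_intros)
 have i: "path_image (F 0) <= X" using F by (auto simp: path_image_def)
 have "hol (F 0) = hol (F 1)" by (rule hol_cong[OF p i loop])
 thus ?thesis using hol_square[OF cont F] hol_nz[OF p i] by simp
qed

lemma hol_loops:
 assumes "homotopic_loops X p q"
 shows "hol p = hol q"
proof -
 obtain h :: "real \<times> real => 'a" where h: "continuous_on ({0..1} \<times> {0..1}) h" "h : ({0..1} \<times> {0..1}) \<rightarrow> X"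
  "!!x. x : {0..1} ==> h (0, x) = p x" "!!x. x : {0..1} ==> h (1, x) = q x"
  "!!t. t : {0..1} ==> pathfinish (h o Pair t) = pathstart (h o Pair t)"
  using assms unfolding homotopic_loops by blast
 have c: "continuous_on ({0..1} \<times> {0..1}) (%z. h (snd z, fst z))"
  by (rule continuous_on_compose2[OF h(1)]) (auto intro!: continuous_intros)
 have pq: "path p" "path q" "path_image p <= X" "path_image q <= X"
  using homotopic_loops_imp_path[OF assms] homotopic_loops_imp_subset[OF assms] by auto
 have "hol (%s. h (0, s)) = hol (%s. h (1, s))"
  using h(2,5) by (intro hol_free[of "%s t. h (t, s)"] c) (auto simp: pathfinish_def pathstart_def)
 thus ?thesis
  using hol_cong[OF pq(1,3), of "%s. h (0, s)"] hol_cong[OF pq(2,4), of "%s. h (1, s)"] h(3,4) by simp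
qed

lemma hol_simply_connected:
 assumes "convex S" "S <= X" "path p" "path_image p <= S" "path q" "path_image q <= S"
  "pathstart p = pathstart q" "pathfinish p = pathfinish q"
 shows "hol p = hol q"
proof -
 have "homotopic_paths S p q"
  using convex_imp_simply_connected[OF assms(1)] assms(3-) unfolding simply_connected_eq_homotopic_paths by metis
 thus ?thesis using assms(2) by (intro hol_homotopic) (rule homotopic_paths_subset)
qed

section \<open>Loops in a plane with finitely many punctures\<close>

abbreviation "sg a b == hol (linepath a b)"

lemma sg_trans:
 assumes "convex S" "S <= X" "a : S" "b : S" "c : S"
 shows "sg a b * sg b c = sg a c"
proof -
 have seg: "closed_segment u v <= S" if "u : S" "v : S" for u v
  using assms(1) that by (rule closed_segment_subset[rotated 2])
 have "sg a b * sg b c = hol (linepath a b +++ linepath b c)"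
  by (subst hol_join) (use seg assms in auto)
 also have "... = sg a c"
  using seg assms by (intro hol_simply_connected[OF assms(1,2)]) (auto simp: path_image_join)
 finally show ?thesis .
qed

end

text \<open>A complex line with the points cut out by hyperplanes removed. Distinct real parts allow
  vertical cuts between the punctures, and the radii leave room for the square of side 1 between the
  punctures and the unit circle.\<close>

locale planar = holonomy X hol for X :: "complex set" and hol +
 fixes F :: "complex set" and ro :: "complex => real"
 assumes F: "finite F" "F <= ball 0 (1 / 4)" "inj_on Re F" and X: "X = ball 0 2 - F"
  and ro: "!!z. z : F ==> 0 < ro z" "!!z. z : F ==> cball z (ro z) - {z} <= X"
begin

text \<open>Winding numbers classify loops in the punctured plane; the radial retraction
  \<open>r\<close> moves the homotopy into the annulus and hence into \<open>X\<close>.\<close>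

lemma annulus_loops:
 assumes p: "path p" "pathfinish p = pathstart p" and q: "path q" "pathfinish q = pathstart q"
  and w: "winding_number p c = winding_number q c"
  and a: "0 < a" "a <= b" and X': "{z. a <= cmod (z - c) & cmod (z - c) <= b} <= X"
  and P: "!!z. z : path_image p Un path_image q ==> a <= cmod (z - c) & cmod (z - c) <= b"
 shows "hol p = hol q"
proof -
 define k where "k z = max a (min b (cmod (z - c))) / cmod (z - c)" for z
 define r where "r z = c + of_real (k z) * (z - c)" for z
 have rid: "r z = z" if "a <= cmod (z - c)" "cmod (z - c) <= b" for z
  using that a(1) by (simp add: r_def k_def min_absorb2 max_absorb2)
 have c: "c ~: path_image p" "c ~: path_image q" using P a(1) by force+
 have "homotopic_loops (- {c}) p q"
  using winding_number_homotopic_loops_eq[OF p(1) c(1) q(1) c(2) p(2) q(2)] w by simp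
 hence "homotopic_loops X (r o p) (r o q)"
 proof (rule homotopic_loops_continuous_image)
  show "continuous_on (- {c}) r" unfolding r_def k_def by (intro continuous_intros) auto
  show "r : - {c} \<rightarrow> X"
  proof
   fix z assume z: "z : - {c}"
   have "0 <= k z" "k z * cmod (z - c) = max a (min b (cmod (z - c)))"
    using z a(1) by (simp_all add: k_def)
   thus "r z : X" using X' a(2) by (auto simp: r_def norm_mult)
  qed
 qed
 from hol_loops[OF this] have "hol (r o p) = hol (r o q)" .
 moreover have "hol p = hol (r o p)" "hol q = hol (r o q)"
  using P X' rid p(1) q(1) by (auto intro!: hol_cong simp: path_image_def)
 ultimately show ?thesis by simp
qed

text \<open>The counterclockwise boundary of a rectangle, as a product of its four edges so that
  common edges can be cancelled.\<close>

definition R where "R x x' = sg (Complex x (-1/2)) (Complex x' (-1/2)) * sg (Complex x' (-1/2)) (Complex x' (1/2)) *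
  (sg (Complex x' (1/2)) (Complex x (1/2)) * sg (Complex x (1/2)) (Complex x (-1/2)))"

definition adm where "adm x \<longleftrightarrow> abs x <= 1 / 2 & x ~: Re ` F"

lemma F_small: assumes "z : F" shows "abs (Re z) < 1 / 4" "abs (Im z) < 1 / 4"
 using F(2) assms abs_Re_le_cmod[of z] abs_Im_le_cmod[of z] by (auto simp: subset_iff)

lemma box_ball: assumes "abs (Re z) <= 1 / 2" "abs (Im z) <= 1 / 2" shows "cmod z <= 1"
 using cmod_le[of z] assms by linarith

lemma
 shows horizontal: "abs y = 1 / 2 ==> {z. Im z = y & abs (Re z) <= 1 / 2} <= X"
  and vertical: "adm x ==> {z. Re z = x & abs (Im z) <= 1 / 2} <= X"
 using box_ball F_small unfolding X adm_def by (fastforce, force)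

lemma convex_horizontal: "convex {z. Im z = y & abs (Re z) <= d}" and convex_vertical: "convex {z. Re z = y & abs (Im z) <= d}"
proof -
 have "{z. Im z = y & abs (Re z) <= d} = cbox (Complex (-d) y) (Complex d y)" "{z. Re z = y & abs (Im z) <= d} = cbox (Complex y (-d)) (Complex y d)"
  by (auto simp: in_cbox_complex_iff)
 thus "convex {z. Im z = y & abs (Re z) <= d}" "convex {z. Re z = y & abs (Im z) <= d}"
  by (simp_all add: convex_box)
qed

text \<open>The edge over \<open>y\<close> is run up in one rectangle and down in the other; since
  the values commute, the different base points do no harm.\<close>

lemma R_split: assumes "adm x" "adm y" "adm z" shows "R x z = R x y * R y z"
proof -
 note hz = sg_trans[OF convex_horizontal horizontal]
 have "sg (Complex x (-1/2)) (Complex y (-1/2)) * sg (Complex y (-1/2)) (Complex z (-1/2)) = sg (Complex x (-1/2)) (Complex z (-1/2))"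
  using assms by (intro hz[of "-1/2"]) (auto simp: adm_def)
 moreover have "sg (Complex z (1/2)) (Complex y (1/2)) * sg (Complex y (1/2)) (Complex x (1/2)) = sg (Complex z (1/2)) (Complex x (1/2))"
  using assms by (intro hz[of "1/2"]) (auto simp: adm_def)
 moreover have "sg (Complex y (-1/2)) (Complex y (1/2)) * sg (Complex y (1/2)) (Complex y (-1/2)) = sg (Complex y (-1/2)) (Complex y (-1/2))"
  using assms by (intro sg_trans[OF convex_vertical vertical]) auto
 moreover have "sg (Complex y (-1/2)) (Complex y (-1/2)) = 1"
 proof -
  have "Complex y (-1/2) : X" using vertical[OF assms(2)] by auto
  thus ?thesis using hol_const by (simp add: linepath_refl)
 qed
 moreover have "(A12 * V2 * (B21 * D1)) * (A23 * V3 * (B32 * D2)) = (A12 * A23) * V3 * ((B32 * B21) * D1) * (V2 * D2)"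
  for A12 V2 B21 D1 A23 V3 B32 D2 :: complex by (simp only: mult_ac)
 ultimately show ?thesis unfolding R_def by (simp only: mult_1_right)
qed

lemma R_rectpath:
 assumes "adm x" "adm y"
 shows "R x y = hol (rectpath (Complex x (-1/2)) (Complex y (1/2)))"
proof -
 have h: "closed_segment (Complex a t) (Complex b t) <= X" if "adm a" "adm b" "abs t = 1 / 2" for a b t
 proof -
  have "closed_segment (Complex a t) (Complex b t) <= {z. Im z = t & abs (Re z) <= 1 / 2}"
   using that by (intro closed_segment_subset convex_horizontal) (auto simp: adm_def)
  thus ?thesis using horizontal[OF that(3)] by blast
 qed
 have v: "closed_segment (Complex a t) (Complex a u) <= X" if "adm a" "abs t <= 1 / 2" "abs u <= 1 / 2" for a t u
 proof -
  have "closed_segment (Complex a t) (Complex a u) <= {z. Re z = a & abs (Im z) <= 1 / 2}"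
   using that by (intro closed_segment_subset convex_vertical) auto
  thus ?thesis using vertical[OF that(1)] by blast
 qed
 show ?thesis
  unfolding R_def rectpath_def Let_def using h[OF assms, of "-1/2"] h[OF assms(2,1), of "1/2"] v[OF assms(1)] v[OF assms(2)]
  by (simp add: hol_join path_image_join)
qed

lemma rectpath_scale:
 "rectpath (c + of_real t * (a - c)) (c + of_real t * (b - c)) s = c + of_real t * (rectpath a b s - c)"
 unfolding rectpath_def Let_def joinpaths_def linepath_def by (simp add: complex_eq_iff algebra_simps)

text \<open>The rectangle is shrunk towards its puncture into the disc of radius
  \<open>ro z\<close>, where the winding number decides. The factor \<open>ro z / 3\<close> suffices
  because the rectangle is within distance 3 of \<open>z\<close>.\<close>

lemma R_one:
 assumes xy: "adm x" "adm y" "x < y" and z: "z : F" "x < Re z" "Re z < y" and only: "!!w. w : F ==> x < Re w ==> Re w < y ==> w = z"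
 shows "R x y = hol (circlepath z (ro z))"
proof -
 let ?a = "Complex x (-1/2)" and ?b = "Complex y (1/2)"
 define t where "t = min 1 (ro z / 3)"
 have t: "0 < t" "t <= 1" "3 * t <= ro z" using ro(1)[OF z(1)] by (auto simp: t_def)
 let ?p = "rectpath ?a ?b"
 let ?q = "rectpath (z + of_real t * (?a - z)) (z + of_real t * (?b - z))"
 have pbox: "?p s : cbox ?a ?b - {z}" if "s : {0..1}" for s
 proof -
  have "?p s : path_image ?p" using that by (auto simp: path_image_def)
  thus ?thesis using z F_small[OF z(1)] using xy path_image_rectpath_cbox_minus_box[of ?a ?b]
   by (auto simp: in_box_complex_iff)
 qed
 have cb: "cbox ?a ?b - {z} <= X"
 proof
  fix w assume w: "w : cbox ?a ?b - {z}"
  hence "x <= Re w" "Re w <= y" "abs (Im w) <= 1 / 2" by (auto simp: in_cbox_complex_iff)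
  moreover have "abs (Re w) <= 1 / 2" using calculation xy by (auto simp: adm_def)
  moreover have "w ~: F"
   using calculation only[of w] xy w unfolding adm_def by (metis Diff_iff image_eqI insertCI order_le_less)
  ultimately show "w : X" using box_ball[of w] by (auto simp: X)
 qed
 have qs: "?q s = z + of_real t * (?p s - z)" for s by (rule rectpath_scale)
 have "homotopic_loops (cbox ?a ?b - {z}) ?p ?q"
 proof (rule homotopic_loops_linear)
  fix s :: real assume s: "s : {0..1}"
  show "closed_segment (?p s) (?q s) <= cbox ?a ?b - {z}"
  proof
   fix w assume "w : closed_segment (?p s) (?q s)"
   then obtain u where u: "0 <= u" "u <= 1" "w = (1 - u) *\<^sub>R ?p s + u *\<^sub>R ?q s"
    by (auto simp: in_segment)
   define k where "k = 1 - u + u * t"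
   have "w = z + of_real k * (?p s - z)"
    unfolding u(3) qs by (simp add: k_def scaleR_conv_of_real algebra_simps)
   moreover have "0 < k" using u t by (cases "u = 0") (auto simp: k_def add_nonneg_pos)
   moreover have "k <= 1" using u t mult_left_mono[of t 1 u] by (simp add: k_def)
   moreover have "z + of_real k * (?p s - z) = (1 - k) *\<^sub>R z + k *\<^sub>R ?p s"
    by (simp add: scaleR_conv_of_real algebra_simps)
   moreover have "z : cbox ?a ?b" using z F_small[OF z(1)] by (auto simp: in_cbox_complex_iff)
   ultimately show "w : cbox ?a ?b - {z}"
    using convexD[OF convex_box(1), of z ?a ?b "?p s" "1 - k" k] pbox[OF s] by auto
  qed
 qed auto
 hence "hol ?p = hol ?q" using homotopic_loops_subset[OF _ cb] by (intro hol_loops)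
 also have "... = hol (circlepath z (ro z))"
 proof -
  have q_eq: "cmod (?q s - z) = t * cmod (?p s - z)" for s
   unfolding qs using t(1) by (simp add: norm_mult)
  have pi: "compact (path_image ?p)" "path_image ?p ~= {}" by (auto simp: compact_path_image)
  have "continuous_on (path_image ?p) (%v. cmod (v - z))" by (intro continuous_intros)
  from continuous_attains_inf[OF pi this]
  obtain w where w: "w : path_image ?p" "!!v. v : path_image ?p ==> cmod (w - z) <= cmod (v - z)"
   by blast
  obtain s where "s : {0..1}" "w = ?p s" using w(1) unfolding path_image_def by blast
  hence "w ~= z" using pbox by simp
  define a where "a = t * cmod (w - z)"
  have a0: "0 < a" using t(1) \<open>w ~= z\<close> by (simp add: a_def)
  have q1: "a <= cmod (?q s - z) & cmod (?q s - z) <= ro z" if s: "s : {0..1}" for s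
  proof -
   have "a <= cmod (?q s - z)" using s unfolding q_eq a_def using w(2) t(1)
    by (auto simp: path_image_def)
   moreover have "cmod (?p s - z) <= 3" using pbox[OF s] xy using box_ball[of "?p s"] norm_triangle_ineq4[of "?p s" z] F(2) z(1)
    by (fastforce simp: in_cbox_complex_iff adm_def subset_iff)
   hence "t * cmod (?p s - z) <= t * 3" using t(1) by (intro mult_left_mono) auto
   ultimately show ?thesis using q_eq t(3) by (simp add: mult.commute)
  qed
  have ar: "a <= ro z" using q1[of 0] by simp
  have "winding_number ?q z = 1" using z F_small[OF z(1)] t(1) by (auto simp: in_box_complex_iff mult_pos_neg mult_pos_pos intro: winding_number_rectpath)
  thus ?thesis using ro(1)[OF z(1)] a0 ar q1
  proof (intro annulus_loops[of ?q "circlepath z (ro z)" z a "ro z"])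
   show "{w. a <= cmod (w - z) & cmod (w - z) <= ro z} <= X"
    using ro(2)[OF z(1)] a0 by (auto simp: dist_norm norm_minus_commute subset_iff)
   show "a <= cmod (v - z) & cmod (v - z) <= ro z" if "v : path_image ?q Un path_image (circlepath z (ro z))" for v
    using that
   proof
    assume "v : path_image ?q"
    then obtain s where "s : {0..1}" "v = ?q s" unfolding path_image_def by blast
    thus ?thesis using q1 by simp
   qed (use ar ro(1)[OF z(1)] in \<open>auto simp: dist_norm norm_minus_commute\<close>)
  qed (auto simp: winding_number_circlepath_centre)
 qed
 finally show ?thesis unfolding R_rectpath[OF xy(1,2)] .
qed

text \<open>Cut between two punctures until every rectangle contains at most one.\<close>

lemma R_prod:
 assumes "adm x" "adm y" "x < y"
 shows "R x y = (PROD z:{z : F. x < Re z & Re z < y}. hol (circlepath z (ro z)))" using assms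
proof (induction "card {z : F. x < Re z & Re z < y}" arbitrary: x y rule: less_induct)
 case less
 let ?G = "%x y. {z : F. x < Re z & Re z < y}"
 note xy = less.prems
 consider "?G x y = {}" | z where "?G x y = {z}" | z1 z2 where "z1 : ?G x y" "z2 : ?G x y" "z1 ~= z2"
  by blast
 thus ?case
 proof cases
  case 1
  let ?a = "Complex x (-1/2)" and ?b = "Complex y (1/2)"
  have cb: "cbox ?a ?b <= X"
  proof
   fix w assume "w : cbox ?a ?b"
   hence w: "x <= Re w" "Re w <= y" "abs (Im w) <= 1 / 2" by (auto simp: in_cbox_complex_iff)
   moreover have "w ~: F" using w 1 xy unfolding adm_def by (force simp: order_le_less)
   ultimately show "w : X" using w xy using box_ball[of w] by (fastforce simp: adm_def X)
  qed
  have "hol (rectpath ?a ?b) = sg ?a ?a"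
  proof (rule hol_simply_connected[OF convex_box(1) cb])
   show "path_image (rectpath ?a ?b) <= cbox ?a ?b"
    using xy by (intro path_image_rectpath_subset_cbox) auto
   show "path_image (linepath ?a ?a) <= cbox ?a ?b" using xy by (auto simp: in_cbox_complex_iff)
  qed auto
  also have "... = 1"
  proof -
   have "?a : X" using xy using cb by (auto simp: in_cbox_complex_iff)
   thus ?thesis using hol_const by (simp add: linepath_refl)
  qed
  finally show ?thesis unfolding 1 using R_rectpath xy by simp
 next
  case 2
  hence G: "w : ?G x y \<longleftrightarrow> w = z" for w by simp
  have "R x y = hol (circlepath z (ro z))" by (rule R_one[OF xy]) (use G[of z] G in auto)
  thus ?thesis unfolding 2 by simp
 next
  case 3
  have "EX u v. u : ?G x y & v : ?G x y & Re u < Re v"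
  proof (cases "Re z1 < Re z2")
   case True
   thus ?thesis using 3(1,2) by (intro exI[of _ z1] exI[of _ z2] conjI)
  next
   case False
   have "Re z1 ~= Re z2"
   proof
    assume "Re z1 = Re z2"
    from inj_onD[OF F(3) this] show False using 3 by simp
   qed
   thus ?thesis using False using 3(1,2) by (fastforce intro: exI[of _ z2] exI[of _ z1] conjI)
  qed
  then obtain u v where uv: "u : ?G x y" "v : ?G x y" "Re u < Re v" by (elim exE conjE)
  have "infinite ({Re u<..<Re v} - Re ` F)" using uv(3) F(1) by (simp add: Diff_infinite_finite)
  then obtain m where m: "m : {Re u<..<Re v} - Re ` F" by (metis finite.emptyI all_not_in_conv)
  have am: "adm m" "x < m" "m < y" using m uv xy by (auto simp: adm_def)
  have lt: "card (?G x m) < card (?G x y)" "card (?G m y) < card (?G x y)"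
  proof -
   have "?G x m \<subset> ?G x y" "?G m y \<subset> ?G x y" using uv m am by force+
   thus "card (?G x m) < card (?G x y)" "card (?G m y) < card (?G x y)"
    using F(1) by (auto intro!: psubset_card_mono)
  qed
  have "Re z ~= m" if "z : F" for z using m that by blast
  hence "?G x y = ?G x m Un ?G m y" "?G x m Int ?G m y = {}" using am by fastforce+
  thus ?thesis using less.hyps[OF lt(1) xy(1) am(1,2)] less.hyps[OF lt(2) am(1) xy(2) am(3)] F(1) using R_split[OF xy(1) am(1) xy(2)]
   by (simp add: prod.union_disjoint)
 qed
qed

theorem hol_circle: "hol (circlepath 0 1) = (PROD z:F. hol (circlepath z (ro z)))"
proof -
 have adm: "adm (-1/2)" "adm (1/2)" using F_small by (force simp: adm_def)+
 have e: "{z : F. -1/2 < Re z & Re z < 1/2} = F" using F_small by force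
 let ?a = "Complex (-1/2) (-1/2)" and ?b = "Complex (1/2) (1/2)"
 have n: "1 / 4 <= cmod v & cmod v <= 1" if "v : path_image (rectpath ?a ?b)" for v
 proof -
  have v: "abs (Re v) = 1 / 2 & abs (Im v) <= 1 / 2 \<or> abs (Re v) <= 1 / 2 & abs (Im v) = 1 / 2"
   using that by (subst (asm) path_image_rectpath) auto
  thus ?thesis using box_ball[of v] abs_Re_le_cmod[of v] abs_Im_le_cmod[of v] by linarith
 qed
 have "hol (circlepath 0 1) = hol (rectpath ?a ?b)"
 proof (rule annulus_loops[where c = 0 and a = "1/4" and b = 1])
  have "winding_number (rectpath ?a ?b) 0 = 1"
   by (rule winding_number_rectpath) (auto simp: in_box_complex_iff)
  thus "winding_number (circlepath 0 1) 0 = winding_number (rectpath ?a ?b) 0"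
   by (simp add: winding_number_circlepath_centre)
  show "{z. 1 / 4 <= cmod (z - 0) & cmod (z - 0) <= 1} <= X" using F(2) by (force simp: X)
  show "1 / 4 <= cmod (z - 0) & cmod (z - 0) <= 1" if "z : path_image (circlepath 0 1) Un path_image (rectpath ?a ?b)" for z
   using that n by auto
 qed auto
 also have "... = R (-1/2) (1/2)" using R_rectpath[OF adm] by simp
 also have "... = (PROD z:F. hol (circlepath z (ro z)))" using R_prod[OF adm] unfolding e by simp
 finally show ?thesis .
qed

end

lemma circlepath_cis: "circlepath z r = (%t. z + of_real r * cis (2 * pi * t))"
 by (simp add: circlepath cis_conv_exp mult_ac)

text \<open>The conjugate \<open>w\<close> of the new functional has a positive value under it, and
  on the line through the old solution in direction \<open>w\<close> each condition excludes at most
  one point.\<close>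

lemma avoid_real_hyperplanes:
 fixes N :: "(complex ^ 'n) set"
 assumes "finite N" "0 ~: N"
 shows "EX y. ALL a:N. Re (cdot a y) ~= 0" using assms
proof (induction N rule: finite_induct)
 case (insert a N)
 then obtain y where y: "!!b. b : N ==> Re (cdot b y) ~= 0" by auto
 define w :: "complex ^ 'n" where "w = (\<chi> i. cnj (a $ i))"
 have aw: "Re (cdot a w) ~= 0"
 proof -
  obtain i where i: "a $ i ~= 0" using insert.prems by (auto simp: vec_eq_iff)
  have "Re (cdot a w) = (SUM i:UNIV. (cmod (a $ i))\<^sup>2)"
   by (simp add: cdot_def w_def complex_mult_cnj cmod_power2)
  also have "... > 0" using i by (intro sum_pos2[of _ i]) auto
  finally show ?thesis by simp
 qed
 let ?bad = "(%b. - Re (cdot b y) / Re (cdot b w)) ` insert a N"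
 have "infinite ({0<..<1::real} - ?bad)" using insert.hyps(1) by (simp add: Diff_infinite_finite)
 then obtain t where t: "t : {0<..<1} - ?bad" by (metis finite.emptyI all_not_in_conv)
 have "Re (cdot b (y + t *\<^sub>R w)) ~= 0" if b: "b : insert a N" for b
 proof (cases "Re (cdot b w) = 0")
  case True
  thus ?thesis using b y aw by auto
 next
  case False
  have "t ~= - Re (cdot b y) / Re (cdot b w)" using t b by blast
  thus ?thesis using False by (auto simp: field_simps)
 qed
 thus ?case by blast
qed simp

text \<open>Perturbing \<open>p\<close> separates the hyperplanes through it on the complex line of the loop; the loop then
  encloses one puncture for each of them.\<close>

lemma rotation_holonomy:
 fixes J :: "('n::finite) aff set"
 assumes J: "finite J" and hol: "holonomy (MM J) ta"
  and distinct: "!!h h' c. h : J ==> h' : J ==> h' = (c *s fst h, c * snd h) ==> h = h'"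
  and mu: "!!h q v. h : J ==> ev h q = 0 ==> (ALL h':J - {h}. ev h' q ~= 0) ==>
   (ALL z. 0 < cmod z & cmod z <= 1 --> q + z *s v : MM J) ==> ta (%t. q + cis (2 * pi * t) *s v) = mu h"
 shows "EX r>0. ALL x. x : MM J --> x : ball p r -->
  ta (%t. p + cis (2 * pi * t) *s (x - p)) = (PROD h:{h:J. ev h p = 0}. mu h)"
proof -
 interpret holonomy "MM J" ta by fact
 define Jp where "Jp = {h : J. ev h p = 0}"
 have fJp: "finite Jp" and Jp: "!!h. h : Jp ==> h : J" "!!h. h : Jp ==> ev h p = 0"
  using J by (auto simp: Jp_def)
 have "open (MM (J - Jp))" using J by (intro open_MM) simp
 then obtain r0 where r0: "0 < r0" "ball p r0 <= MM (J - Jp)" 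
  by (auto simp: MM_def Jp_def intro: openE)
 \<comment> \<open>The shift of the centre takes one third of \<open>r0\<close>, the disc of radius
   2 that \<open>planar\<close> uses takes two.\<close>
 define r where "r = r0 / 3"
 have r: "0 < r" "3 * r = r0" using r0(1) by (auto simp: r_def)
 have "ta (%t. p + cis (2 * pi * t) *s (x - p)) = (PROD h:Jp. mu h)" if x: "x : MM J" "x : ball p r" for x
 proof -
  define v where "v = x - p"
  have v: "norm v < r" using x(2) by (simp add: v_def dist_norm norm_minus_commute)
  define c where "c h = cdot (fst h) v" for h :: "'n aff"
  have c: "c h ~= 0" if "h : Jp" for h
  proof -
   show ?thesis using ev_add[of h p v] Jp(2)[OF that] using x(1) Jp(1)[OF that]
    by (auto simp: v_def c_def MM_def)
  qed
  \<comment> \<open>Normalised to have the value 1 on \<open>v\<close>, the linear parts of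
    different hyperplanes through \<open>p\<close> remain different; a shift \<open>y\<close> that
    avoids finitely many real hyperplanes then separates the real parts of the punctures.\<close>
  define nf where "nf h = (1 / c h) *s fst h" for h
  have nf: "nf h ~= nf h'" if h: "h : Jp" "h' : Jp" "h ~= h'" for h h'
  proof
   assume eq: "nf h = nf h'"
   have "fst h' = c h' *s nf h'" using c[OF h(2)] by (simp add: nf_def vector_smult_assoc)
   also have "... = (c h' / c h) *s fst h"
    unfolding eq[symmetric] by (simp add: nf_def vector_smult_assoc)
   finally have f: "fst h' = (c h' / c h) *s fst h" .
   have "snd k = - cdot (fst k) p" if "k : Jp" for k
    using Jp(2)[OF that] by (simp add: ev_def eq_neg_iff_add_eq_0 add.commute)
   thus False using h f using distinct[of h h' "c h' / c h"] f h Jp(1) by (simp add: prod_eq_iff)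
  qed
  define N where "N = {nf h - nf h' |h h'. h : Jp & h' : Jp & h ~= h'}"
  have "finite N"
   using fJp by (intro finite_subset[of N "(%(h, h'). nf h - nf h') ` (Jp \<times> Jp)"]) (force simp: N_def)+
  moreover have "0 ~: N" using nf by (auto simp: N_def)
  moreover note avoid_real_hyperplanes
  ultimately obtain y where y: "!!a. a : N ==> Re (cdot a y) ~= 0"  by metis
  define D where "D = insert (r / (norm y + 1)) ((%h. 1 / (4 * (cmod (cdot (nf h) y) + 1))) ` Jp)"
  define d where "d = Min D / 2"
  have D: "finite D" "D ~= {}" using fJp by (auto simp: D_def)
  have "0 < Min D"
   using D r(1) by (subst Min_gr_iff) (auto simp: D_def intro!: divide_pos_pos add_nonneg_pos)
  hence d0: "0 < d" and dD: "!!k. k : D ==> d < k" using Min_le[OF D(1)] by (force simp: d_def)+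
  have lt: "d * a < b" if "d < b / (a + 1)" "0 <= a" for a b :: real
  proof -
   show ?thesis using that using d0 by (simp add: pos_less_divide_eq algebra_simps)
  qed
  have dy: "d * norm y < r" by (rule lt) (auto intro: dD simp: D_def)
  have dn: "d * cmod (cdot (nf h) y) < 1 / 4" if "h : Jp" for h
   using dD[of "1 / (4 * (cmod (cdot (nf h) y) + 1))"] that by (intro lt) (auto simp: D_def)
  define p' where "p' = p + d *\<^sub>R y"
  \<comment> \<open>The parameter at which the shifted line meets the hyperplane of
    \<open>h\<close>.\<close>
  define z where "z h = - of_real d * cdot (nf h) y" for h
  define F where "F = z ` Jp"
  have evJ: "ev h (p + t *\<^sub>R (d *\<^sub>R y) + w *s v) = c h * (w - of_real t * z h)" if "h : Jp" for h t w
  proof -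
   show ?thesis using c[OF that] using Jp(2)[OF that] by (simp add: nf_def ev_add z_def c_def algebra_simps)
  qed
  have ev': "ev h (p' + w *s v) = c h * (w - z h)" if "h : Jp" for h w
   using evJ[OF that, of 1 w] by (simp add: p'_def)
  have ball: "p + t *\<^sub>R (d *\<^sub>R y) + w *s v : ball p r0" if "t : {0..1}" "cmod w < 2" for t w
  proof -
   have "norm (t *\<^sub>R (d *\<^sub>R y)) <= 1 * norm (d *\<^sub>R y)"
    unfolding norm_scaleR using that d0 by (intro mult_right_mono) auto
   moreover have "cmod w * norm v <= 2 * norm v" using that by (intro mult_right_mono) auto
   ultimately have "norm (t *\<^sub>R (d *\<^sub>R y) + w *s v) < r0"
    using norm_triangle_ineq[of "t *\<^sub>R (d *\<^sub>R y)" "w *s v"] dy d0 v r(2) by (simp add: norm_smult)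
   thus ?thesis
    by (simp only: add.assoc mem_ball dist_norm norm_minus_commute[of p] add_diff_cancel_left')
  qed
  have MJ: "u : MM J" if "u : ball p r0" "!!h. h : Jp ==> ev h u ~= 0" for u
  proof -
   have "ev h u ~= 0" if "h : J" for h
    using that r0(2) \<open>u : ball p r0\<close> \<open>!!h. h : Jp ==> ev h u ~= 0\<close> by (cases "h : Jp") (auto simp: MM_def)
   thus ?thesis by (simp add: MM_def)
  qed
  have zs: "cmod (z h) < 1 / 4" if "h : Jp" for h
   using dn[OF that] d0 by (simp add: z_def norm_mult)
  have zinj: "Re (z h) ~= Re (z h')" if "h : Jp" "h' : Jp" "h ~= h'" for h h'
  proof -
   have "Re (cdot (nf h - nf h') y) ~= 0" using that by (intro y) (unfold N_def, blast)
   thus ?thesis using d0 by (auto simp: z_def)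
  qed
  have "EX e>0. ALL w:F. w ~= u --> e <= dist u w" for u
   using finite_set_avoid[of F u] fJp by (simp add: F_def)
  then obtain e where e: "!!u. 0 < e u" "!!u w. w : F ==> w ~= u ==> e u <= dist u w" by metis
  define ro where "ro u = min 1 (e u) / 2" for u
  have ro: "0 < ro u" "ro u < 1" "ro u < e u" for u using e(1)[of u] by (auto simp: ro_def)
  let ?X = "ball 0 2 - F" and ?ph = "%w. p' + w *s v"
  have ph: "?ph w : MM J" if "w : ?X" for w
  proof (rule MJ)
   show "?ph w : ball p r0" using ball[of 1 w] that by (simp add: p'_def)
   show "ev h (?ph w) ~= 0" if "h : Jp" for h
    using ev'[OF that, of w] c[OF that] \<open>w : ?X\<close> that by (auto simp: F_def)
  qed
  have roX: "cball u (ro u) - {u} <= ?X" if uF: "u : F" for u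
  proof
   fix w assume w: "w : cball u (ro u) - {u}"
   hence "w ~: F" using e(2)[of w u] ro(3)[of u] by (auto simp: dist_commute)
   moreover have "cmod w < 2"
   proof -
    have "cmod w <= cmod u + cmod (w - u)" by (metis norm_triangle_sub)
    moreover obtain h where "h : Jp" "u = z h" using uF unfolding F_def by blast
    ultimately show ?thesis using w using ro(2)[of u] zs[of h]
     by (simp add: dist_norm norm_minus_commute)
   qed
   ultimately show "w : ?X" by simp
  qed
  have "planar ?X (%gam. ta (?ph o gam)) F ro"
  proof (intro planar.intro planar_axioms.intro)
   show "holonomy ?X (%gam. ta (?ph o gam))"
    using ph by (intro holonomy_pullback[OF hol] continuous_intros) auto
   show "inj_on Re F" using zinj by (auto simp: F_def inj_on_def)
  qed (use fJp zs ro roX in \<open>auto simp: F_def\<close>)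
  then interpret P: planar ?X "%gam. ta (?ph o gam)" F ro .
  \<comment> \<open>Moving the centre from \<open>p\<close> to \<open>p'\<close> is a free homotopy
    of loops, because the moving punctures stay inside the unit circle.\<close>
  have "ta (%s. p + cis (2 * pi * s) *s v) = ta (%s. p' + cis (2 * pi * s) *s v)"
  proof -
   have "ta (%s. p + 0 *\<^sub>R (d *\<^sub>R y) + cis (2 * pi * s) *s v) = ta (%s. p + 1 *\<^sub>R (d *\<^sub>R y) + cis (2 * pi * s) *s v)"
   proof (rule hol_free[where F = "%s t. p + t *\<^sub>R (d *\<^sub>R y) + cis (2 * pi * s) *s v"])
    show "continuous_on ({0..1} \<times> {0..1}) (%z. p + snd z *\<^sub>R (d *\<^sub>R y) + cis (2 * pi * fst z) *s v)"
     by (intro continuous_intros)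
    fix s t :: real assume st: "s : {0..1}" "t : {0..1}"
    show "p + t *\<^sub>R (d *\<^sub>R y) + cis (2 * pi * s) *s v : MM J"
    proof (rule MJ)
     show "p + t *\<^sub>R (d *\<^sub>R y) + cis (2 * pi * s) *s v : ball p r0"
      using ball[OF st(2), of "cis (2 * pi * s)"] by simp
     fix h assume h: "h : Jp"
     have "cmod (of_real t * z h) <= 1 * cmod (z h)"
      unfolding norm_mult using st by (intro mult_right_mono) auto
     hence "cmod (of_real t * z h) < cmod (cis (2 * pi * s))" using zs[OF h] by simp
     hence "cis (2 * pi * s) - of_real t * z h ~= 0" by (metis eq_iff_diff_eq_0 less_irrefl)
     thus "ev h (p + t *\<^sub>R (d *\<^sub>R y) + cis (2 * pi * s) *s v) ~= 0"
      unfolding evJ[OF h] using c[OF h] by simp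
    qed
   qed simp
   thus ?thesis by (simp add: p'_def)
  qed
  also have "... = (PROD w:F. ta (?ph o circlepath w (ro w)))"
   using P.hol_circle by (simp add: circlepath_cis[of 0 1] o_def)
  also have "... = (PROD h:Jp. ta (?ph o circlepath (z h) (ro (z h))))"
  proof -
   have "inj_on z Jp" by (rule inj_onI) (use zinj in metis)
   thus ?thesis unfolding F_def by (simp add: prod.reindex)
  qed
  also have "... = (PROD h:Jp. mu h)"
  proof (rule prod.cong[OF refl])
   fix h assume h: "h : Jp"
   have eq: "?ph (z h + w * of_real (ro (z h))) = ?ph (z h) + w *s (of_real (ro (z h)) *s v)" for w
    by (simp add: vector_smult_assoc vector_sadd_rdistrib add.assoc)
   have "?ph o circlepath (z h) (ro (z h)) = (%t. ?ph (z h) + cis (2 * pi * t) *s (of_real (ro (z h)) *s v))"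
    unfolding circlepath_cis o_def eq[symmetric] by (simp add: mult.commute)
   moreover have "ta (%t. ?ph (z h) + cis (2 * pi * t) *s (of_real (ro (z h)) *s v)) = mu h"
   proof (rule mu[OF Jp(1)[OF h]])
    show "ev h (?ph (z h)) = 0" unfolding ev'[OF h] by simp
    show "ALL h':J - {h}. ev h' (?ph (z h)) ~= 0"
    proof
     fix h' assume h': "h' : J - {h}"
     show "ev h' (?ph (z h)) ~= 0"
     proof (cases "h' : Jp")
      case True
      thus ?thesis using zinj[OF h True] h' unfolding ev'[OF True] using c[OF True] by auto
     next
      case False
      show ?thesis using ball[of 1 "z h"] zs[OF h] using r0(2) False h'
       by (auto simp: p'_def MM_def)
     qed
    qed
    show "ALL w. 0 < cmod w & cmod w <= 1 --> ?ph (z h) + w *s (of_real (ro (z h)) *s v) : MM J"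
    proof (intro allI impI)
     fix w :: complex assume w: "0 < cmod w & cmod w <= 1"
     have "z h + w * of_real (ro (z h)) : cball (z h) (ro (z h)) - {z h}" using w ro(1)[of "z h"] using w ro(1)[of "z h"]
      by (auto simp: dist_norm norm_mult)
     thus "?ph (z h) + w *s (of_real (ro (z h)) *s v) : MM J"
      unfolding eq[symmetric] using roX[of "z h"] h by (intro ph) (auto simp: F_def)
    qed
   qed
   ultimately show "ta (?ph o circlepath (z h) (ro (z h))) = mu h" by simp
  qed
  finally show ?thesis by (simp add: v_def)
 qed
 thus ?thesis using r(1) by (auto simp: Jp_def)
qed

section \<open>Vector spaces of cosets\<close>

lemma field_complex_ring: "field complex_ring"
proof -
 have "cring complex_ring"
  unfolding complex_ring_def by unfold_locales (auto simp: algebra_simps intro: exI[of _ "- _"] add.right_inverse simp: Units_def)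
 thus ?thesis
  by (rule cring.cring_fieldI2) (auto simp: complex_ring_def intro: exI[of _ "inverse _"] right_inverse)
qed

text \<open>A surjective coordinate map with kernel \<open>N\<close> identifies cosets with its
  fibres, indexed by \<open>b\<close>-tuples that are encoded as sequences vanishing from
  \<open>b\<close> on.\<close>

locale coordinates = abelian_group M for M :: "(complex, 'm) module" (structure) +
 fixes \<Psi> :: "'m => nat => complex" and b :: nat and N :: "'m set"
 assumes smult_closed: "x : carrier M ==> a \<odot> x : carrier M"
  and \<Psi>_add: "x : carrier M ==> y : carrier M ==> \<Psi> (x \<oplus> y) i = \<Psi> x i + \<Psi> y i"
  and \<Psi>_smult: "x : carrier M ==> \<Psi> (a \<odot> x) i = a * \<Psi> x i"
  and \<Psi>_onto: "\<Psi> ` carrier M = {v. ALL i>=b. v i = 0}" and N: "N = {x : carrier M. \<Psi> x = (%i. 0)}"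
begin

abbreviation "Q == quotient_module M N"

definition "fib v = {x : carrier M. \<Psi> x = v}"

definition "vs = {v :: nat => complex. ALL i>=b. v i = 0}"

lemma sub_add: assumes "x : carrier M" "y : carrier M" shows "(x \<ominus> y) \<oplus> y = x"
proof -
 have "(x \<ominus> y) \<oplus> y = x \<oplus> (\<ominus> y \<oplus> y)" unfolding minus_eq by (rule a_assoc) (use assms in auto)
 thus ?thesis using assms by (simp add: l_neg)
qed

lemma \<Psi>_minus: assumes "x : carrier M" "y : carrier M" shows "\<Psi> (x \<ominus> y) i = \<Psi> x i - \<Psi> y i"
proof -
 have "\<Psi> x i = \<Psi> (x \<ominus> y) i + \<Psi> y i"
  using \<Psi>_add[OF minus_closed[OF assms] assms(2), of i] unfolding sub_add[OF assms] .
 from this[symmetric] show ?thesis by (simp only: eq_diff_eq)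
qed

lemma fib_ne: "v : vs ==> EX x. x : fib v"
proof -
 assume "v : vs"
 hence "v : \<Psi> ` carrier M" unfolding \<Psi>_onto vs_def .
 thus ?thesis unfolding fib_def by blast
qed

lemma fib_inj: "v : vs ==> fib v = fib w ==> v = w" using fib_ne unfolding fib_def by blast

lemma coset: assumes x: "x : carrier M" shows "N +> x = fib (\<Psi> x)"
proof
 show "N +> x <= fib (\<Psi> x)" using x by (auto simp: a_r_coset_def' N fib_def \<Psi>_add)
 show "fib (\<Psi> x) <= N +> x"
 proof
  fix y assume y: "y : fib (\<Psi> x)"
  hence "y \<ominus> x : N" using x \<Psi>_minus[of y x] by (auto simp: fib_def N)
  thus "y : N +> x" using x y sub_add[of y x] unfolding a_r_coset_def' by (fastforce simp: fib_def)
 qed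
qed

lemma Q_carrier: "carrier Q = fib ` vs"
proof -
 have "carrier Q = (%x. fib (\<Psi> x)) ` carrier M"
  by (simp add: quotient_module_def A_RCOSETS_def' coset) (auto simp: coset)
 also have "... = fib ` \<Psi> ` carrier M" by (simp add: image_image)
 finally show ?thesis by (simp add: \<Psi>_onto vs_def)
qed

lemma Q_zero: "\<zero>\<^bsub>Q\<^esub> = fib (%i. 0)" by (simp add: quotient_module_def N fib_def)

lemma Q_add: assumes "v : vs" "w : vs" shows "fib v \<oplus>\<^bsub>Q\<^esub> fib w = fib (%i. v i + w i)"
proof -
 have "set_add M (fib v) (fib w) = fib (%i. v i + w i)"
 proof
  show "set_add M (fib v) (fib w) <= fib (%i. v i + w i)" by (auto simp: set_add_def' fib_def \<Psi>_add)
  show "fib (%i. v i + w i) <= set_add M (fib v) (fib w)"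
  proof
   fix z assume z: "z : fib (%i. v i + w i)"
   obtain y where y: "y : fib w" using fib_ne[OF assms(2)] by blast
   have "z \<ominus> y : fib v" using z y \<Psi>_minus[of z y] by (auto simp: fib_def)
   thus "z : set_add M (fib v) (fib w)" using z y sub_add[of z y] unfolding set_add_def' using y
    by (fastforce simp: fib_def)
  qed
 qed
 thus ?thesis by (simp add: quotient_module_def)
qed

lemma Q_smult: assumes "v : vs" shows "a \<odot>\<^bsub>Q\<^esub> fib v = fib (%i. a * v i)"
proof -
 have "N +> (a \<odot> s) = fib (%i. a * v i)" if "s : fib v" for s
 proof -
  show ?thesis using that using coset[OF smult_closed, of s a] that
   by (fastforce simp: fib_def \<Psi>_smult fib_def)
 qed
 thus ?thesis using fib_ne[OF assms] by (auto simp: quotient_module_def)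
qed

lemma vs_simps: "(%i. 0) : vs" "v : vs ==> w : vs ==> (%i. v i + w i) : vs" "v : vs ==> (%i. a * v i) : vs"
 by (auto simp: vs_def)

lemma vectorspace_Q: "vectorspace complex_ring Q"
proof -
 interpret K: field complex_ring by (rule field_complex_ring)
 have ag: "abelian_group Q"
 proof (rule abelian_groupI; (unfold Q_carrier Q_zero)?)
  show "x \<oplus>\<^bsub>Q\<^esub> y : fib ` vs" if "x : fib ` vs" "y : fib ` vs" for x y
   using that by (auto simp: Q_add vs_simps)
  show "(x \<oplus>\<^bsub>Q\<^esub> y) \<oplus>\<^bsub>Q\<^esub> z = x \<oplus>\<^bsub>Q\<^esub> (y \<oplus>\<^bsub>Q\<^esub> z)" if "x : fib ` vs" "y : fib ` vs" "z : fib ` vs" for x y z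
   using that by (auto simp: Q_add vs_simps add.assoc)
  show "x \<oplus>\<^bsub>Q\<^esub> y = y \<oplus>\<^bsub>Q\<^esub> x" if "x : fib ` vs" "y : fib ` vs" for x y
   using that by (auto simp: Q_add vs_simps add.commute)
  show "fib (%i. 0) : fib ` vs" by (simp add: vs_simps)
  show "fib (%i. 0) \<oplus>\<^bsub>Q\<^esub> x = x" if "x : fib ` vs" for x using that by (auto simp: Q_add vs_simps)
  show "EX y:fib ` vs. y \<oplus>\<^bsub>Q\<^esub> x = fib (%i. 0)" if "x : fib ` vs" for x
  proof -
   obtain v where v: "v : vs" "x = fib v" using \<open>x : fib ` vs\<close> by blast
   thus ?thesis
    using vs_simps(3)[OF v(1), of "-1"] Q_add[OF vs_simps(3)[OF v(1), of "-1"] v(1)] by (intro bexI[of _ "fib (%i. -1 * v i)"]) auto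
  qed
 qed
 have "module complex_ring Q"
 proof (rule moduleI[OF K.is_cring ag]; (unfold Q_carrier)?)
  show "a \<odot>\<^bsub>Q\<^esub> x : fib ` vs" if "x : fib ` vs" for a x using that by (auto simp: Q_smult vs_simps)
  show "(a \<oplus>\<^bsub>complex_ring\<^esub> c) \<odot>\<^bsub>Q\<^esub> x = a \<odot>\<^bsub>Q\<^esub> x \<oplus>\<^bsub>Q\<^esub> c \<odot>\<^bsub>Q\<^esub> x" if "x : fib ` vs" for a c x
   using that by (auto simp: Q_smult Q_add vs_simps complex_ring_def algebra_simps)
  show "a \<odot>\<^bsub>Q\<^esub> (x \<oplus>\<^bsub>Q\<^esub> y) = a \<odot>\<^bsub>Q\<^esub> x \<oplus>\<^bsub>Q\<^esub> a \<odot>\<^bsub>Q\<^esub> y" if "x : fib ` vs" "y : fib ` vs" for a x y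
   using that by (auto simp: Q_smult Q_add vs_simps algebra_simps)
  show "(a \<otimes>\<^bsub>complex_ring\<^esub> c) \<odot>\<^bsub>Q\<^esub> x = a \<odot>\<^bsub>Q\<^esub> (c \<odot>\<^bsub>Q\<^esub> x)" if "x : fib ` vs" for a c x
   using that by (auto simp: Q_smult vs_simps complex_ring_def mult.assoc)
  show "\<one>\<^bsub>complex_ring\<^esub> \<odot>\<^bsub>Q\<^esub> x = x" if "x : fib ` vs" for x
   using that by (auto simp: Q_smult complex_ring_def)
 qed
 thus ?thesis unfolding vectorspace_def using field_complex_ring by blast
qed

definition "unit j = fib (%i. if i = j then 1 else 0)"

lemma fin_dim_Q: "vectorspace.fin_dim complex_ring Q" and dim_Q: "vectorspace.dim complex_ring Q = b"
proof -
 interpret W: vectorspace complex_ring Q by (rule vectorspace_Q)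
 have uvs: "(%i. if i = j then 1 else 0) : vs" if "j < b" for j using that by (auto simp: vs_def)
 have u: "unit j : carrier Q" if "j < b" for j
  unfolding unit_def Q_carrier using uvs[OF that] by blast
 have inj: "inj_on unit {..<b}"
 proof (rule inj_onI)
  fix i j assume ij: "i : {..<b}" "j : {..<b}" "unit i = unit j"
  hence "(%k. if k = i then 1 else (0::complex)) = (%k. if k = j then 1 else 0)"
   unfolding unit_def by (intro fib_inj uvs) auto
  thus "i = j" by (metis zero_neq_one)
 qed
 have K: "carrier complex_ring = UNIV" "\<zero>\<^bsub>complex_ring\<^esub> = 0" by (simp_all add: complex_ring_def)
 have lc: "W.lincomb a (unit ` {..<j}) = fib (%i. if i < j then a (unit i) else 0)" if "j <= b" for j a
  using that
 proof (induction j)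
  case 0
  thus ?case using Q_zero by simp
 next
  case (Suc j)
  have nin: "unit j ~: unit ` {..<j}" using Suc.prems inj_onD[OF inj, of j] by fastforce
  have v: "(%i. if i < j then a (unit i) else 0) : vs" using Suc.prems by (auto simp: vs_def)
  have "W.lincomb a (unit ` {..<Suc j}) = W.lincomb a (insert (unit j) (unit ` {..<j}))"
   by (simp add: lessThan_Suc)
  also have "... = a (unit j) \<odot>\<^bsub>Q\<^esub> unit j \<oplus>\<^bsub>Q\<^esub> W.lincomb a (unit ` {..<j})"
   using u Suc.prems nin by (intro W.lincomb_insert2) (auto simp: K)
  also have "... = fib (%i. a (unit j) * (if i = j then 1 else 0)) \<oplus>\<^bsub>Q\<^esub> fib (%i. if i < j then a (unit i) else 0)"
   using Suc uvs[of j] Q_smult[of "%i. if i = j then 1 else 0" "a (unit j)"] by (simp add: unit_def)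
  also have "... = fib (%i. a (unit j) * (if i = j then 1 else 0) + (if i < j then a (unit i) else 0))"
   using Suc.prems v vs_simps(3)[OF uvs[of j], of "a (unit j)"] by (intro Q_add) auto
  also have "(%i. a (unit j) * (if i = j then 1 else 0) + (if i < j then a (unit i) else 0)) = (%i. if i < Suc j then a (unit i) else 0)"
   by (auto simp: less_Suc_eq)
  finally show ?case .
 qed
 let ?B = "unit ` {..<b}"
 have B: "finite ?B" "?B <= carrier Q" using u by auto
 have "carrier Q <= W.span ?B"
 proof
  fix x assume "x : carrier Q"
  then obtain v where v: "v : vs" "x = fib v" unfolding Q_carrier by blast
  define a where "a y = v (the_inv_into {..<b} unit y)" for y
  have "(%i. if i < b then a (unit i) else 0) = v"
   using v(1) by (auto simp: a_def the_inv_into_f_f[OF inj] vs_def)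
  thus "x : W.span ?B" using lc[of b a] v(2) unfolding W.span_def using B(1) K by blast
 qed
 hence g: "W.gen_set ?B" using W.span_is_subset2[OF B(2)] by blast
 have "W.lin_indpt ?B"
 proof (rule W.finite_lin_indpt2[OF B])
  fix a assume "W.lincomb a ?B = \<zero>\<^bsub>Q\<^esub>"
  hence "(%i. if i < b then a (unit i) else 0) = (%i. 0)" using lc[of b a] Q_zero
   by (intro fib_inj) (auto simp: vs_def)
  hence "a (unit i) = 0" if "i < b" for i using that by (metis (full_types))
  thus "ALL v:?B. a v = \<zero>\<^bsub>complex_ring\<^esub>" by (auto simp: K)
 qed
 hence "W.basis ?B" unfolding W.basis_def using g B(2) by blast
 thus "W.dim = b" using W.dim_basis[OF B(1)] card_image[OF inj] by simp
 show "W.fin_dim" unfolding W.fin_dim_def using B g by blast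
qed

lemma Q_trivial: "b = 0 ==> carrier Q = {\<zero>\<^bsub>Q\<^esub>}"
proof -
 assume "b = 0"
 hence "vs = {%i. 0}" unfolding vs_def by auto
 thus ?thesis by (simp add: Q_carrier Q_zero)
qed

end

section \<open>Linear functionals on chains\<close>

text \<open>The linear extension of \<open>ph\<close>, written as \<open>lext\<close> into chains on
  a one-point set so that the rules for \<open>lext\<close> apply.\<close>

definition fev :: "('s => complex) => ('s \<Rightarrow>\<^sub>0 complex) => complex" where
 "fev ph c = coe (lext (%s. Poly_Mapping.single () (ph s)) c) ()"

lemma fev_simps [simp]: "fev ph (a + b) = fev ph a + fev ph b" "fev ph (a - b) = fev ph a - fev ph b" "fev ph (sc k a) = k * fev ph a" "fev ph 0 = 0" "fev ph (gen s) = ph s"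
 by (simp_all add: fev_def lext_add lext_diff lext_sc lookup_add lookup_minus)

lemma fev_sum: "fev ph (SUM i:I. f i) = (SUM i:I. fev ph (f i))"
 by (induction I rule: infinite_finite_induct) auto

lemma fev_unique:
 assumes "supp c <= S" "!!s. s : S ==> g (gen s) = ph s" "!!x y. g (x + y) = g x + g y" "!!k x. g (sc k x) = k * g x"
 shows "fev ph c = g c" using assms(1)
proof (induction rule: chain_induct)
 case zero
 show ?case using assms(4)[of 0 0] by simp
qed (simp_all add: assms)

interpretation tp: vector_space_pair sc "(*) :: complex => complex => complex"
 by unfold_locales (auto simp: algebra_simps)

interpretation tt: vector_space_pair sc sc by unfold_locales

lemma separating_functional:
 assumes S: "tc.subspace S" and x: "x ~: S"
 shows "EX g. Vector_Spaces.linear sc (*) g & (ALL y:S. g y = 0) & g x = (1::complex)"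
proof -
 obtain B where B: "B <= S" "tc.independent B" "S <= tc.span B"
  using tc.maximal_independent_subset[of S] by blast
 have sp: "tc.span B = S" using B tc.span_minimal[OF B(1) S] by auto
 have ind: "tc.independent (insert x B)" using tc.independent_insertI[of x B] x B(2) sp by simp
 obtain g where g: "Vector_Spaces.linear sc (*) g" "ALL y:insert x B. g y = (if y = x then 1 else (0::complex))"
  using tp.linear_independent_extend[OF ind, of "%y. if y = x then 1 else 0"] by blast
 interpret g: Vector_Spaces.linear sc "(*)" g by (rule g(1))
 have "g y = 0" if "y : S" for y
 proof -
  have "y : tc.span B" using that sp by simp
  thus ?thesis
  proof (induction rule: tc.span_induct_alt)
   case (step c u v)
   thus ?case using B(1) x using step g(2) by (auto simp: g.add g.scale)
  qed (simp add: g.zero)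
 qed
 thus ?thesis using g by auto
qed

text \<open>\<open>S j\<close> consists of the elements without \<open>j\<close>-th coordinate
  modulo \<open>B\<close>; a functional separating \<open>v j\<close> from it is the dual
  coordinate.\<close>

lemma dual_functionals:
 fixes b :: nat
 assumes B: "tc.subspace B" and qd: "ALL i<b. v i : Z" "!!z. z : Z ==> EX a. z - (\<Sum>i<b. sc (a i) (v i)) : B"
  "!!a. (\<Sum>i<b. sc (a i) (v i)) : B ==> (ALL i<b. a i = 0)"
 shows "EX g. (ALL j<b. Vector_Spaces.linear sc (*) (g j)) & (ALL j<b. ALL x:B. g j x = (0::complex)) &
  (ALL j<b. ALL i<b. g j (v i) = (if i = j then 1 else 0)) & (ALL z:Z. z - (\<Sum>i<b. sc (g i z) (v i)) : B)"
proof -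
 define S where "S j = {y. EX a. a j = 0 & y - (\<Sum>i<b. sc (a i) (v i)) : B}" for j
 have S: "tc.subspace (S j)" for j
 proof (rule tc.subspaceI)
  show "0 : S j"
   unfolding S_def using tc.subspace_0[OF B] by (intro CollectI exI[of _ "%_. 0"]) simp
  fix x y assume "x : S j" "y : S j"
  then obtain a c where a: "a j = 0" "x - (\<Sum>i<b. sc (a i) (v i)) : B" and c: "c j = 0" "y - (\<Sum>i<b. sc (c i) (v i)) : B"
   unfolding S_def by blast
  have eq: "x + y - (\<Sum>i<b. sc (a i + c i) (v i)) = (x - (\<Sum>i<b. sc (a i) (v i))) + (y - (\<Sum>i<b. sc (c i) (v i)))"
   by (simp only: tc.scale_left_distrib sum.distrib add_diff_add)
  have "x + y - (\<Sum>i<b. sc (a i + c i) (v i)) : B"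
   unfolding eq by (rule tc.subspace_add[OF B a(2) c(2)])
  thus "x + y : S j"
   unfolding S_def using a(1) c(1) by (intro CollectI exI[of _ "%i. a i + c i"]) simp
 next
  fix k x assume "x : S j"
  then obtain a where a: "a j = 0" "x - (\<Sum>i<b. sc (a i) (v i)) : B" unfolding S_def by blast
  have "sc k x - (\<Sum>i<b. sc (k * a i) (v i)) : B" using tc.subspace_scale[OF B a(2)]
   by (simp add: tc.scale_right_diff_distrib tc.scale_sum_right)
  thus "sc k x : S j" unfolding S_def using a(1) by (intro CollectI exI[of _ "%i. k * a i"]) simp
 qed
 have BS: "x : S j" if "x : B" for x j
  unfolding S_def using that by (intro CollectI exI[of _ "%_. 0"]) simp
 have unit: "(\<Sum>i<b. sc (if i = k then 1 else 0) (v i)) = v k" if "k < b" for k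
 proof -
  have "(\<Sum>i<b. sc (if i = k then 1 else 0) (v i)) = (\<Sum>i<b. if i = k then v i else 0)"
   by (intro sum.cong) auto
  thus ?thesis using that by (simp add: sum.delta)
 qed
 have vS: "v k : S j" if "k < b" "k ~= j" for k j
  unfolding S_def using that unit tc.subspace_0[OF B] by (intro CollectI exI[of _ "%i. if i = k then 1 else 0"]) simp
 have vn: "v j ~: S j" if j: "j < b" for j
 proof
  assume "v j : S j"
  then obtain a where a: "a j = 0" "v j - (\<Sum>i<b. sc (a i) (v i)) : B" unfolding S_def by blast
  have "(\<Sum>i<b. sc ((if i = j then 1 else 0) - a i) (v i)) : B"
   using a(2) unit[OF j] by (simp add: tc.scale_left_diff_distrib sum_subtractf)
  from qd(3)[OF this] show False using a(1) j by auto
 qed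
 obtain g where g: "!!j. j < b ==> Vector_Spaces.linear sc (*) (g j)" "!!j y. j < b ==> y : S j ==> g j y = (0::complex)"
  "!!j. j < b ==> g j (v j) = 1" using separating_functional[OF S vn] by (metis lessThan_iff)
 have gB: "g j x = 0" if "j < b" "x : B" for j x by (rule g(2)[OF that(1) BS[OF that(2)]])
 have gv: "g j (v i) = (if i = j then 1 else 0)" if "i < b" "j < b" for i j
  using g(3)[OF that(2)] g(2)[OF that(2) vS[OF that(1)]] by auto
 have "z - (\<Sum>i<b. sc (g i z) (v i)) : B" if z: "z : Z" for z
 proof -
  obtain a where a: "z - (\<Sum>i<b. sc (a i) (v i)) : B" using qd(2)[OF z] by blast
  have "a j = g j z" if j: "j < b" for j
  proof -
   interpret g: Vector_Spaces.linear sc "(*)" "g j" by (rule g(1)[OF j])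
   have "g j (z - (\<Sum>i<b. sc (a i) (v i))) = 0" by (rule gB[OF j a])
   hence "g j z = (\<Sum>i<b. a i * g j (v i))" by (simp add: g.diff g.sum g.scale)
   also have "... = (\<Sum>i<b. if i = j then a i else 0)" using j by (intro sum.cong) (auto simp: gv)
   also have "... = a j" using j by (simp add: sum.delta)
   finally show ?thesis by simp
  qed
  thus ?thesis using a by simp
 qed
 thus ?thesis using g(1) gB gv by (intro exI[of _ g]) simp
qed

section \<open>Cohomology of a flat line bundle\<close>

locale line_bundle = flat_line_bundle cscale X L
 for cscale :: "complex => 'v::ab_group_add => 'v" and X :: "'a::real_normed_vector set" and L
begin

lemma fibre_gen: assumes "x : X" shows "EX e. e ~= 0 & fibre L x = range (%a. cscale a e)"
proof -
 obtain B where B: "B <= fibre L x" "independent B" "fibre L x <= span B" "card B = 1"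
  using basis_exists[of "fibre L x"] fibre_dim[OF assms] by metis
 then obtain e where e: "B = {e}" by (auto simp: card_1_singleton_iff)
 have "e ~= 0" using B(2) dependent_zero[of B] e by auto
 thus ?thesis using B(1,3) span_minimal[OF B(1) fibre_subspace[OF assms]] using e span_singleton[of e]
  by auto
qed

text \<open>An arbitrary choice in each fibre, without any continuity; \<open>tr\<close> is the
  transport relative to it.\<close>

definition e where "e x = (SOME e. e ~= 0 & fibre L x = range (%a. cscale a e))"

lemma e: assumes "x : X" shows "e x ~= 0" "fibre L x = range (%a. cscale a (e x))" "cscale a (e x) : fibre L x" "e x : fibre L x"
proof -
 show 1: "e x ~= 0" and 2: "fibre L x = range (%a. cscale a (e x))"
  using someI_ex[OF fibre_gen[OF assms]] unfolding e_def by blast+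
 show "cscale a (e x) : fibre L x" unfolding 2 by blast
 have "cscale 1 (e x) : fibre L x" unfolding 2 by blast
 thus "e x : fibre L x" by simp
qed

definition co where "co x w = (THE a. cscale a (e x) = w)"

lemma co_scale [simp]: "x : X ==> co x (cscale a (e x)) = a"
 unfolding co_def using e(1) by (intro the_equality) auto

lemma co: assumes "x : X" "w : fibre L x" shows "cscale (co x w) (e x) = w"
 using assms(2) unfolding e(2)[OF assms(1)] by (auto simp: assms(1))

definition tr where "tr g = co (pathfinish g) (transport L g (e (pathstart g)))"

lemma ends: "path_image g <= X ==> pathstart g : X & pathfinish g : X"
 by (meson pathstart_in_path_image pathfinish_in_path_image subsetD)

lemma transport_in: "path g ==> path_image g <= X ==> w : fibre L (pathstart g) ==> transport L g w : fibre L (pathfinish g)"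
 using transport_bij bij_betwE by metis

lemma transport_e: "path g ==> path_image g <= X ==> transport L g (e (pathstart g)) = cscale (tr g) (e (pathfinish g))"
 unfolding tr_def using co[OF _ transport_in] e(4) ends by metis

lemma transport_tr:
 assumes "path g" "path_image g <= X" "w : fibre L (pathstart g)"
 shows "transport L g w = cscale (co (pathstart g) w * tr g) (e (pathfinish g))"
proof -
 have s: "pathstart g : X" using ends[OF assms(2)] by simp
 have "transport L g w = transport L g (cscale (co (pathstart g) w) (e (pathstart g)))"
  using co[OF s assms(3)] by simp
 also have "... = cscale (co (pathstart g) w) (cscale (tr g) (e (pathfinish g)))"
  using transport_scale[OF assms(1,2) e(4)[OF s]] transport_e[OF assms(1,2)] by simp
 finally show ?thesis by simp
qed

lemma holonomy_tr: "holonomy X tr"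
proof
 fix g assume g: "path g" "path_image g <= X"
 have s: "pathstart g : X" using ends[OF g(2)] by simp
 note es = e(4)[OF s]
 have 0: "transport L g 0 = 0" using transport_scale[OF g es, of 0] by simp
 show "tr g ~= 0"
 proof
  assume "tr g = 0"
  hence "transport L g (e (pathstart g)) = transport L g 0" using transport_e[OF g] 0 by simp
  moreover have "0 : fibre L (pathstart g)" using e(3)[OF s, of 0] by simp
  ultimately show False using bij_betw_imp_inj_on[OF transport_bij[OF g]] es using e(1)[OF s]
   by (meson inj_onD)
 qed
 fix h assume h: "path h" "path_image h <= X" "pathfinish g = pathstart h"
 have "transport L (g +++ h) (e (pathstart g)) = transport L h (cscale (tr g) (e (pathstart h)))"
  using transport_join[OF g h es] transport_e[OF g] h(3) by simp
 also have "... = cscale (tr g * tr h) (e (pathfinish h))"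
  using transport_scale[OF h(1,2) e(4)] transport_e[OF h(1,2)] ends[OF h(2)] by simp
 finally show "tr (g +++ h) = tr g * tr h" using ends[OF h(2)] by (simp add: tr_def)
next
 fix g h assume gh: "homotopic_paths X g h"
 show "tr g = tr h" using homotopic_paths_imp_subset[OF gh] ends homotopic_paths_imp_pathstart[OF gh] homotopic_paths_imp_pathfinish[OF gh] using transport_homotopic[OF gh e(4)]
  by (simp add: tr_def)
qed

end

sublocale line_bundle < H: holonomy X tr by (rule holonomy_tr)

context line_bundle
begin

abbreviation "sx q == singular_simplex q (top_of_set X)"

definition phi where "phi c f = co (f iv) (c f)"

definition coch where "coch q g f = (if sx q f then cscale (g (gen f)) (e (f iv)) else 0)"

lemma sx_in: "sx q f ==> x : standard_simplex q ==> f x : X"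
 by (auto simp: simplex_iff image_subset_iff)

lemma cochain_eq: "c : carrier (cochain_space cscale X L q) ==> sx q f ==> c f = cscale (phi c f) (e (f iv))"
 unfolding phi_def by (subst co) (auto simp: cochain_space_def intro!: sx_in split: if_splits)

lemma coch_in: "coch q g : carrier (cochain_space cscale X L q)"
 by (auto simp: cochain_space_def coch_def intro!: e(3) sx_in)

lemma fev_coch:
 assumes "x : tchain q X" "Vector_Spaces.linear sc (*) g"
 shows "fev (phi (coch q g)) x = g x"
proof -
 interpret g: Vector_Spaces.linear sc "(*)" g by fact
 show ?thesis using assms(1) unfolding tchain_def
  by (intro fev_unique[of _ "{f. sx q f}"]) (auto simp: phi_def coch_def sx_in g.add g.scale)
qed

lemma fev_phi_add: "c : carrier (cochain_space cscale X L q) ==> d : carrier (cochain_space cscale X L q) ==> x : tchain q X ==>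
  fev (phi (%f. c f + d f)) x = fev (phi c) x + fev (phi d) x"
 and fev_phi_scale: "c : carrier (cochain_space cscale X L q) ==> x : tchain q X ==> fev (phi (%f. cscale a (c f))) x = a * fev (phi c) x"
proof -
 assume c: "c : carrier (cochain_space cscale X L q)" and x: "x : tchain q X"
 have "fev (phi (%f. cscale a (c f))) x = (%x. a * fev (phi c) x) x" using x unfolding tchain_def
 proof (intro fev_unique[of _ "{f. sx q f}"])
  fix f assume "f : {f. sx q f}"
  hence f: "sx q f" by simp
  show "a * fev (phi c) (gen f) = phi (%f. cscale a (c f)) f" unfolding phi_def[of "%f. cscale a (c f)"] cochain_eq[OF c f] using sx_in[OF f]
   by simp
 qed (auto simp: algebra_simps)
 thus "fev (phi (%f. cscale a (c f))) x = a * fev (phi c) x" .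
 assume d: "d : carrier (cochain_space cscale X L q)"
 have "fev (phi (%f. c f + d f)) x = (%x. fev (phi c) x + fev (phi d) x) x"
  using x unfolding tchain_def
 proof (intro fev_unique[of _ "{f. sx q f}"])
  fix f assume "f : {f. sx q f}"
  hence f: "sx q f" by simp
  show "fev (phi c) (gen f) + fev (phi d) (gen f) = phi (%f. c f + d f) f" unfolding phi_def[of "%f. c f + d f"] cochain_eq[OF c f] cochain_eq[OF d f] using sx_in[OF f]
   by (simp flip: scale_left_distrib)
 qed (auto simp: algebra_simps)
 thus "fev (phi (%f. c f + d f)) x = fev (phi c) x + fev (phi d) x" .
qed

text \<open>The cochain complex is the dual of the twisted chain complex: all faces but the 0-th
  share the initial vertex and have weight 1, and the 0-th has the transport along
  \<open>first_edge\<close> as weight.\<close>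

lemma coboundary_fev:
 assumes c: "c : carrier (cochain_space cscale X L q)" and f: "sx (Suc q) f"
 shows "coboundary cscale X L q c f = cscale (fev (phi c) (H.bd (Suc q) (gen f))) (e (f iv))"
proof -
 let ?v = iv
 let ?k = "%k. singular_face (Suc q) k (idp (Suc q))" and ?f = "%k. singular_face (Suc q) k f"
 have idp: "singular_simplex (Suc q) (top_of_set (standard_simplex (Suc q))) (idp (Suc q))"
  using idp_chain[of "Suc q"] by (simp only: singular_chain_of)
 have face: "simplical_face k x : standard_simplex (Suc q)" if "k <= Suc q" "x : standard_simplex q" for k x
  using simplical_face_in_standard_simplex[of "Suc q" k x] that by simp
 have ff: "simplex_map q f (?k k) = ?f k" if "k <= Suc q" for k
  using face[OF that] by (auto simp: simplex_map_def singular_face_def fun_eq_iff)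
 have fs: "sx q (?f k)" if "k <= Suc q" for k
  using singular_simplex_singular_face[OF f, of k] that by simp
 have kv: "?k k ?v = simplical_face k ?v" if "k <= Suc q" for k
  using face[OF that initial_vertex_simplex] by (simp add: singular_face_def)
 have k0: "simplical_face k ?v = ?v" if "1 <= k" for k
  using that by (auto simp: simplical_face_def initial_vertex_def fun_eq_iff)
 have fv: "?f k ?v = f ?v" if "1 <= k" for k using k0[OF that] by (simp add: singular_face_def)
 have fc: "continuous_on (standard_simplex (Suc q)) f" "f ` standard_simplex (Suc q) <= X"
  using f by (auto simp: simplex_iff)
 have seg: "seg (simplical_face 0 ?v) ?v = first_edge"
  by (auto simp: seg_def simplical_face_def initial_vertex_def first_edge_def fun_eq_iff)
 define w where "w k = H.wt f (?k k ?v) ?v" for k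
 have w0: "w 0 = tr (f o first_edge)" using kv[of 0] seg by (simp add: w_def H.wt_def)
 have w1: "w k = 1" if "1 <= k" "k <= Suc q" for k
  unfolding w_def kv[OF that(2)] k0[OF that(1)] by (rule H.wt_refl[OF fconvex_simplex fc, of ?v ?v ?v]) auto
 have "H.bd (Suc q) (gen f) = H.Tw q f ?v (\<Sum>k\<le>Suc q. frag_cmul ((-1) ^ k) (frag_of (?k k)))"
  by (simp add: H.bd_gen chain_boundary_def)
 also have "... = (\<Sum>k\<le>Suc q. sc ((-1) ^ k) (H.Tw q f ?v (frag_of (?k k))))"
  by (simp only: H.Tw_sum H.Tw_cmul of_int_power of_int_minus of_int_1)
 also have "... = (\<Sum>k\<le>Suc q. sc ((-1) ^ k) (sc (w k) (gen (?f k))))"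
  by (rule sum.cong) (simp_all only: H.Tw_of w_def ff atMost_iff)
 finally have "fev (phi c) (H.bd (Suc q) (gen f)) = (\<Sum>k\<le>Suc q. (-1) ^ k * (w k * phi c (?f k)))"
  by (simp only: fev_sum fev_simps)
 also have "{..Suc q} = insert 0 {1..Suc q}" by auto
 also have "(SUM k:insert 0 {1..Suc q}. (-1) ^ k * (w k * phi c (?f k))) = w 0 * phi c (?f 0) + (\<Sum>k = 1..Suc q. (-1) ^ k * phi c (?f k))"
  using w1 by (subst sum.insert) (auto intro!: sum.cong)
 finally have fev: "fev (phi c) (H.bd (Suc q) (gen f)) = w 0 * phi c (?f 0) + (\<Sum>k = 1..Suc q. (-1) ^ k * phi c (?f k))" .
 have p: "path (f o first_edge)" "path_image (f o first_edge) <= X"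
 proof -
  have fe: "path first_edge" "path_image first_edge <= standard_simplex (Suc q)"
   using path_seg[of "simplical_face 0 ?v" ?v] H.path_seg_in[OF fconvex_simplex[of "Suc q"] face[OF _ initial_vertex_simplex], of 0 ?v] unfolding seg by auto
  show "path (f o first_edge)"
   by (rule path_continuous_image[OF fe(1) continuous_on_subset[OF fc(1) fe(2)]])
  show "path_image (f o first_edge) <= X" unfolding path_image_compose using fe(2) fc(2) by blast
 qed
 have ends: "pathstart (f o first_edge) = ?f 0 ?v" "pathfinish (f o first_edge) = f ?v"
  unfolding seg[symmetric] by (simp_all add: pathstart_def pathfinish_def singular_face_def)
 have c0: "c (?f 0) : fibre L (pathstart (f o first_edge))"
  using c fs[of 0] unfolding ends by (auto simp: cochain_space_def split: if_splits)
 have "coboundary cscale X L q c f = transport L (f o first_edge) (c (?f 0)) + (\<Sum>k = 1..Suc q. cscale ((-1) ^ k) (c (?f k)))"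
  using f by (simp add: coboundary_def)
 also have "transport L (f o first_edge) (c (?f 0)) = cscale (w 0 * phi c (?f 0)) (e (f ?v))"
  using transport_tr[OF p c0] by (simp add: ends w0 phi_def mult.commute)
 also have "(\<Sum>k = 1..Suc q. cscale ((-1) ^ k) (c (?f k))) = (\<Sum>k = 1..Suc q. cscale ((-1) ^ k * phi c (?f k)) (e (f ?v)))"
  using cochain_eq[OF c fs] fv by (intro sum.cong) auto
 finally show ?thesis unfolding fev by (simp only: scale_left_distrib scale_sum_left)
qed

lemma cocycle_iff:
 assumes c: "c : carrier (cochain_space cscale X L q)"
 shows "c : cocycles cscale X L q \<longleftrightarrow> (ALL x:tchain (Suc q) X. fev (phi c) (H.bd (Suc q) x) = 0)"
proof
 assume "c : cocycles cscale X L q"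
 hence z: "coboundary cscale X L q c f = 0" for f by (simp add: cocycles_def fun_eq_iff)
 have g: "fev (phi c) (H.bd (Suc q) (gen f)) = 0" if f: "sx (Suc q) f" for f
  using z[of f] coboundary_fev[OF c f] e(1)[OF sx_in[OF f initial_vertex_simplex]] by simp
 show "ALL x:tchain (Suc q) X. fev (phi c) (H.bd (Suc q) x) = 0"
 proof
  fix x assume "x : tchain (Suc q) X"
  hence "supp x <= {f. sx (Suc q) f}" by (simp add: tchain_def)
  thus "fev (phi c) (H.bd (Suc q) x) = 0"
   by (induction rule: chain_induct) (simp_all add: g H.bd_add H.bd_sc)
 qed
next
 assume z: "ALL x:tchain (Suc q) X. fev (phi c) (H.bd (Suc q) x) = 0"
 have "coboundary cscale X L q c f = 0" for f
 proof (cases "sx (Suc q) f")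
  case True
  thus ?thesis using z coboundary_fev[OF c True] by (simp add: tchain_gen)
 qed (simp add: coboundary_def)
 thus "c : cocycles cscale X L q" using c by (simp add: cocycles_def fun_eq_iff)
qed

lemma cochain_cong:
 assumes c: "c : carrier (cochain_space cscale X L q)" "d : carrier (cochain_space cscale X L q)" and eq: "!!f. sx q f ==> phi c f = phi d f"
 shows "c = d"
proof
 fix f
 show "c f = d f"
  using cochain_eq[OF c(1)] cochain_eq[OF c(2)] eq c by (cases "sx q f") (auto simp: cochain_space_def)
qed

lemma coboundary_in: "c : carrier (cochain_space cscale X L q) ==> coboundary cscale X L q c : carrier (cochain_space cscale X L (Suc q))"
 using coboundary_fev e(3) sx_in by (auto simp: cochain_space_def[of _ _ _ "Suc q"] coboundary_def)

text \<open>Universal coefficients over a field: modulo coboundaries a cocycle is determined by its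
  values on a basis \<open>v\<close> of the homology, and the dual functionals show that all values
  occur.\<close>

theorem cohomology:
 assumes qd: "H.qd (H.rz (tch X) (tch {}) q) (H.rb (tch X) (tch {}) q) b"
 shows "vectorspace.fin_dim complex_ring (local_cohomology cscale X L q)" "vectorspace.dim complex_ring (local_cohomology cscale X L q) = b"
  "b = 0 ==> carrier (local_cohomology cscale X L q) = {\<zero>\<^bsub>local_cohomology cscale X L q\<^esub>}"
proof -
 let ?Z = "H.rz (tch X) (tch {}) q" and ?B = "H.rb (tch X) (tch {}) q"
 let ?C = "carrier (cochain_space cscale X L q)"
 have cx: "H.subcx (tch X)" "H.subcx (tch {})" by (intro H.subcx_tchain; simp)+
 have Bs: "tc.subspace ?B" by (rule H.rb_subspace[OF cx])
 obtain v where v: "ALL i<b. v i : ?Z" "!!z. z : ?Z ==> EX a. z - (\<Sum>i<b. sc (a i) (v i)) : ?B"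
  "!!a. (\<Sum>i<b. sc (a i) (v i)) : ?B ==> (ALL i<b. a i = 0)" using qd unfolding H.qd_def by blast
 obtain g where g: "!!j. j < b ==> Vector_Spaces.linear sc (*) (g j)" "!!j x. j < b ==> x : ?B ==> g j x = (0::complex)"
  "!!i j. i < b ==> j < b ==> g j (v i) = (if i = j then 1 else 0)" "!!z. z : ?Z ==> z - (\<Sum>i<b. sc (g i z) (v i)) : ?B"
  using dual_functionals[OF Bs v] by blast
 have Zc: "?Z <= tchain q X" by (rule H.rz_subset)
 have vt: "v i : tchain q X" if "i < b" for i using v(1) Zc that by blast
 have Z_iff: "x : ?Z \<longleftrightarrow> x : tchain q X & H.bd q x = 0" for x by (auto simp: H.rz_def tchain_empty)
 have B_iff: "x : ?B \<longleftrightarrow> (EX y:tchain (Suc q) X. x = H.bd (Suc q) y)" for x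
  using H.bd_in[of _ "Suc q" X] by (auto simp: H.rb_def tchain_empty)
 define \<Psi> where "\<Psi> c i = (if i < b then fev (phi c) (v i) else 0)" for c i
 let ?M = "(cochain_space cscale X L q)\<lparr>carrier := cocycles cscale X L q\<rparr>"
 have cocC: "cocycles cscale X L q <= ?C" by (auto simp: cocycles_def)
 have add_in: "(%f. c f + d f) : ?C" if "c : ?C" "d : ?C" for c d
  using that subspace_add[OF fibre_subspace] sx_in[of q _ iv] by (auto simp: cochain_space_def)
 have sc_in: "(%f. cscale a (c f)) : ?C" if "c : ?C" for a c
  using that subspace_scale[OF fibre_subspace] sx_in[of q _ iv] by (auto simp: cochain_space_def)
 have z_add: "(%f. c f + d f) : cocycles cscale X L q" if cd: "c : cocycles cscale X L q" "d : cocycles cscale X L q" for c d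
 proof -
  have cC: "c : ?C" "d : ?C" using cd cocC by auto
  show ?thesis
   using cd H.bd_in[of _ "Suc q" X] unfolding cocycle_iff[OF add_in[OF cC]] cocycle_iff[OF cC(1)] cocycle_iff[OF cC(2)] by (auto simp: fev_phi_add[OF cC])
 qed
 have z_sc: "(%f. cscale a (c f)) : cocycles cscale X L q" if c: "c : cocycles cscale X L q" for a c
 proof -
  have cC: "c : ?C" using c cocC by auto
  show ?thesis
   using c H.bd_in[of _ "Suc q" X] unfolding cocycle_iff[OF sc_in[OF cC]] cocycle_iff[OF cC] by (auto simp: fev_phi_scale[OF cC])
 qed
 have ops: "carrier ?M = cocycles cscale X L q" "add ?M c d = (%f. c f + d f)" "\<zero>\<^bsub>?M\<^esub> = (%f. 0)" "a \<odot>\<^bsub>?M\<^esub> c = (%f. cscale a (c f))" for a c d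
  by (simp_all add: cochain_space_def)
 have z0: "(%f. 0) : ?C" using e(3)[of _ 0] sx_in[of q _ iv] by (auto simp: cochain_space_def)
 have zero: "(%f. 0) : cocycles cscale X L q"
  using fev_phi_scale[OF z0, of _ 0] H.bd_in[of _ "Suc q" X] unfolding cocycle_iff[OF z0] by simp
 have "coordinates ?M \<Psi> b (coboundaries cscale X L q)"
 proof (intro coordinates.intro coordinates_axioms.intro)
  show "abelian_group ?M"
  proof (rule abelian_groupI; unfold ops)
   show "EX y:cocycles cscale X L q. (%f. y f + x f) = (%f. 0)" if "x : cocycles cscale X L q" for x
    using z_sc[OF that, of "-1"] by (intro bexI[of _ "%f. cscale (-1) (x f)"]) auto
  qed (auto intro: z_add zero simp: algebra_simps)
  fix x y a i
  assume "x : carrier ?M"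
  hence x: "x : cocycles cscale X L q" "x : ?C" using cocC by (auto simp: ops)
  show "a \<odot>\<^bsub>?M\<^esub> x : carrier ?M" unfolding ops by (rule z_sc[OF x(1)])
  show "\<Psi> (a \<odot>\<^bsub>?M\<^esub> x) i = a * \<Psi> x i" unfolding ops \<Psi>_def using fev_phi_scale[OF x(2) vt] by simp
  assume "y : carrier ?M"
  thus "\<Psi> (x \<oplus>\<^bsub>?M\<^esub> y) i = \<Psi> x i + \<Psi> y i" using cocC unfolding ops \<Psi>_def using fev_phi_add[OF x(2) _ vt]
   by (auto simp: ops)
 next
  show "\<Psi> ` carrier ?M = {w. ALL i>=b. w i = 0}"
  proof
   show "\<Psi> ` carrier ?M <= {w. ALL i>=b. w i = 0}" by (auto simp: \<Psi>_def)
   show "{w. ALL i>=b. w i = 0} <= \<Psi> ` carrier ?M"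
   proof
    fix w :: "nat => complex" assume w: "w : {w. ALL i>=b. w i = 0}"
    define G where "G x = (\<Sum>j<b. w j * g j x)" for x
    have G: "Vector_Spaces.linear sc (*) G" unfolding G_def
     using g(1) by (intro tp.linear_compose_sum) (auto intro!: tp.linear_compose_scale_right)
    have "fev (phi (coch q G)) (H.bd (Suc q) x) = 0" if x: "x : tchain (Suc q) X" for x
    proof -
     have "H.bd (Suc q) x : ?B" using x B_iff by blast
     thus ?thesis using H.bd_in[OF x] g(2) by (simp add: fev_coch[OF _ G] G_def)
    qed
    hence "coch q G : cocycles cscale X L q" using cocycle_iff[OF coch_in] by blast
    moreover have "\<Psi> (coch q G) = w"
    proof
     fix i
     show "\<Psi> (coch q G) i = w i"
      using w g(3)[of i] fev_coch[OF vt G, of i] by (auto simp: \<Psi>_def G_def if_distrib[of "%x. w _ * x"] cong: if_cong)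
    qed
    ultimately show "w : \<Psi> ` carrier ?M" unfolding ops by blast
   qed
  qed
  show "coboundaries cscale X L q = {x : carrier ?M. \<Psi> x = (%i. 0)}"
  proof (intro Set.set_eqI iffI)
   fix c assume c: "c : coboundaries cscale X L q"
   show "c : {x : carrier ?M. \<Psi> x = (%i. 0)}"
   proof (cases q)
    case 0
    thus ?thesis using c using fev_phi_scale[OF z0 vt, of _ 0] using zero
     by (auto simp: coboundaries_def \<Psi>_def)
   next
    case (Suc r)
    then obtain d where d: "d : carrier (cochain_space cscale X L r)" "c = coboundary cscale X L r d"
     using c by (auto simp: coboundaries_def)
    have cC: "c : ?C" using coboundary_in[OF d(1)] d(2) Suc by simp
    have pc: "phi c f = fev (phi d) (H.bd q (gen f))" if "sx q f" for f
     using coboundary_fev[OF d(1), of f] that sx_in[OF that initial_vertex_simplex] unfolding d(2) Suc phi_def[of "coboundary cscale X L r d"] by simp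
    have fc: "fev (phi c) x = fev (phi d) (H.bd q x)" if "x : tchain q X" for x
     using that unfolding tchain_def
     by (intro fev_unique[of _ "{f. sx q f}" "%x. fev (phi d) (H.bd q x)"]) (auto simp: pc H.bd_add H.bd_sc)
    have "fev (phi c) (H.bd (Suc q) x) = 0" if x: "x : tchain (Suc q) X" for x
     using fc[of "H.bd (Suc q) x"] H.bd_in[OF x] H.bd_bd[OF x] by simp
    hence "c : cocycles cscale X L q" unfolding cocycle_iff[OF cC] by blast
    thus ?thesis using fc[OF vt] v(1) Z_iff by (auto simp: \<Psi>_def)
   qed
  next
   fix c assume "c : {x : carrier ?M. \<Psi> x = (%i. 0)}"
   hence c: "c : cocycles cscale X L q" "c : ?C" and \<Psi>0: "!!i. \<Psi> c i = 0"
    using cocC by (auto simp: ops)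
   have B0: "fev (phi c) x = 0" if "x : ?B" for x using that B_iff c(1) cocycle_iff[OF c(2)] by auto
   have Z0: "fev (phi c) x = 0" if x: "x : ?Z" for x
   proof -
    have "fev (phi c) (x - (\<Sum>i<b. sc (g i x) (v i))) = 0" by (rule B0[OF g(4)[OF x]])
    moreover have "fev (phi c) (v i) = 0" if "i < b" for i using \<Psi>0[of i] that by (simp add: \<Psi>_def)
    ultimately show ?thesis by (simp add: fev_sum)
   qed
   show "c : coboundaries cscale X L q"
   proof (cases q)
    case 0
    have "phi c f = phi (%f. 0) f" if f: "sx q f" for f
    proof -
     show ?thesis using f 0 Z_iff using Z0[of "gen f"] using co_scale[OF sx_in[OF f initial_vertex_simplex], of 0]
      by (simp add: tchain_gen H.bd_degree_0 phi_def)
    qed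
    thus ?thesis using 0 by (auto intro: cochain_cong[OF c(2) z0] simp: coboundaries_def)
   next
    case (Suc r)
    \<comment> \<open>A cochain that vanishes on cycles factors through the boundary; a linear right
      inverse \<open>s\<close> of the boundary on its image provides the cochain \<open>?d\<close>
      with coboundary \<open>c\<close>.\<close>
    have "Vector_Spaces.linear sc sc (H.bd q)" by unfold_locales (auto simp: H.bd_add H.bd_sc)
    from tt.linear_exists_right_inverse_on[OF this tchain_subspace, of q X]
    obtain s where s: "range s <= tchain q X" "Vector_Spaces.linear sc sc s" "!!y. y : H.bd q ` tchain q X ==> H.bd q (s y) = y"
     by blast
    interpret s: Vector_Spaces.linear sc sc s by (rule s(2))
    define G where "G y = fev (phi c) (s y)" for y
    have G: "Vector_Spaces.linear sc (*) G"
     by unfold_locales (auto simp: G_def s.add s.scale algebra_simps)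
    have bq: "H.bd q x : tchain r X" if "x : tchain q X" for x using H.bd_in[OF that] Suc by simp
    have Gx: "G (H.bd q x) = fev (phi c) x" if x: "x : tchain q X" for x
    proof -
     have "s (H.bd q x) - x : ?Z" using s(3) x unfolding Z_iff using s(1) x
      by (simp add: H.bd_diff tchain_diff image_subset_iff)
     from Z0[OF this] show ?thesis by (simp add: G_def)
    qed
    let ?d = "coch r G"
    have "c = coboundary cscale X L r ?d"
    proof (rule cochain_cong[OF c(2)])
     show "coboundary cscale X L r ?d : ?C" using coboundary_in[OF coch_in, of r G] Suc by simp
     fix f assume f: "sx q f"
     have t: "gen f : tchain q X" using f by (simp add: tchain_gen)
     have "phi (coboundary cscale X L r ?d) f = fev (phi ?d) (H.bd q (gen f))"
      using coboundary_fev[OF coch_in, of r f G] f sx_in[OF f initial_vertex_simplex] unfolding Suc phi_def[of "coboundary cscale X L r ?d"] by simp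
     also have "... = phi c f" using Gx[OF t] fev_coch[OF bq[OF t] G] by simp
     finally show "phi c f = phi (coboundary cscale X L r ?d) f" by simp
    qed
    thus ?thesis unfolding coboundaries_def Suc using coch_in by auto
   qed
  qed
 qed
 then interpret Q: coordinates ?M \<Psi> b "coboundaries cscale X L q" .
 show "vectorspace.fin_dim complex_ring (local_cohomology cscale X L q)" "vectorspace.dim complex_ring (local_cohomology cscale X L q) = b"
  "b = 0 ==> carrier (local_cohomology cscale X L q) = {\<zero>\<^bsub>local_cohomology cscale X L q\<^esub>}"
  unfolding local_cohomology_def by (rule Q.fin_dim_Q Q.dim_Q Q.Q_trivial; assumption?)+
qed

end

section \<open>Integral and complex homology\<close>

text \<open>Coordinates of the complex numbers in \<open>K\<close> with respect to a basis \<open>B\<close> of a free abelian group which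
  contains them up to the common denominator \<open>n\<close>.\<close>

definition int_coords :: "complex set => complex set => int => (complex => complex => int) => bool" where
 "int_coords K B n m \<longleftrightarrow> finite B & n > 0 & (ALL z:K. of_int n * z = (SUM b:B. of_int (m z b) * b)) &
  (ALL c :: complex => int. (SUM b:B. of_int (c b) * b) = 0 --> (ALL b:B. c b = 0))"

lemma int_coordsD:
 assumes "int_coords K B n m"
 shows "finite B" "n > 0" "z : K ==> of_int n * z = (SUM b:B. of_int (m z b) * b)"
  "(SUM b:B. of_int (c b) * b) = 0 ==> (ALL b:B. c b = 0)"
 using assms unfolding int_coords_def by simp_all

text \<open>Either some multiple of the new number lies in the group generated by \<open>B\<close>,
  which enlarges the denominator, or the number is independent of \<open>B\<close> and joins
  it.\<close>

lemma integral_coordinates: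
 assumes "finite (K :: complex set)"
 shows "EX B n m. int_coords K B n m" using assms
proof (induction K rule: finite_induct)
 case empty
 show ?case unfolding int_coords_def by (intro exI[of _ "{}"] exI[of _ "1::int"]) simp
next
 case (insert z K)
 then obtain B n m where "int_coords K B n m" by blast
 note B = int_coordsD[OF this]
 show ?case
 proof (cases "EX k>0. EX c :: complex => int. of_int k * z = (SUM b:B. of_int (c b) * b)")
  case True
  then obtain k :: int and c :: "complex => int" where k: "k > 0" "of_int k * z = (SUM b:B. of_int (c b) * b)"
   by blast
  define m' where "m' u b = (if u = z then n * c b else k * m u b)" for u b
  have "of_int (n * k) * u = (SUM b:B. of_int (m' u b) * b)" if "u : insert z K" for u
  proof (cases "u = z")
   case True
   have "of_int (n * k) * u = of_int n * (of_int k * z)" using True by simp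
   thus ?thesis unfolding k(2) by (simp add: m'_def True sum_distrib_left mult.assoc)
  next
   case False
   hence "of_int (n * k) * u = of_int k * (SUM b:B. of_int (m u b) * b)"
    using B(3)[of u] that by (simp add: mult.commute mult.left_commute flip: B(3))
   thus ?thesis using False by (simp add: m'_def sum_distrib_left mult.assoc)
  qed
  thus ?thesis
   unfolding int_coords_def using B(1,2,4) k(1) by (intro exI[of _ B] exI[of _ "n * k"] exI[of _ m']) simp
 next
  case False
  have zB: "z ~: B"
  proof
   assume "z : B"
   hence "of_int 1 * z = (SUM b:B. of_int (if b = z then 1 else 0) * b)"
    using B(1) by (simp add: if_distrib[of "%x. of_int x * _"] cong: if_cong)
   hence "EX k>0. EX c :: complex => int. of_int k * z = (SUM b:B. of_int (c b) * b)"
    by (rule_tac x = "1::int" in exI, intro conjI exI) simp_all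
   thus False using False by blast
  qed
  define m' where "m' u b = (if u = z then (if b = z then n else 0) else if b = z then 0 else m u b)" for u b
  have "of_int n * u = (SUM b:insert z B. of_int (m' u b) * b)" if u: "u : insert z K" for u
  proof (cases "u = z")
   case True
   have "(SUM b:B. of_int (m' u b) * b) = (0::complex)"
    using zB True by (intro sum.neutral) (auto simp: m'_def)
   thus ?thesis using B(1) zB True by (simp add: m'_def)
  next
   case False
   have "(SUM b:B. of_int (m' u b) * b) = (SUM b:B. of_int (m u b) * b)"
    using zB False by (intro sum.cong) (auto simp: m'_def)
   thus ?thesis using B(1,3) zB False u by (simp add: m'_def)
  qed
  moreover have "ALL b:insert z B. c b = 0" if c: "(SUM b:insert z B. of_int (c b) * b) = 0" for c :: "complex => int"
  proof -
   have eq: "of_int (c z) * z = - (SUM b:B. of_int (c b) * b)"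
    using c B(1) zB by (simp add: add_eq_0_iff2)
   have "c z = 0"
   proof (rule ccontr)
    assume "c z ~= 0"
    then consider "c z > 0" | "- c z > 0" by linarith
    thus False
    proof cases
     case 1
     have "of_int (c z) * z = (SUM b:B. of_int (- c b) * b)" unfolding eq by (simp add: sum_negf)
     thus False using 1 using False by (metis exI[of _ "c z"] conjI exI[of _ "%b. - c b"])
    next
     case 2
     show False using eq using 2 using False by (fastforce intro: exI[of _ "- c z"] conjI exI[of _ c])
    qed
   qed
   thus ?thesis using eq B(4)[of c] by simp
  qed
  ultimately show ?thesis
   unfolding int_coords_def using B(1,2) by (intro exI[of _ "insert z B"] exI[of _ n] exI[of _ m']) simp
 qed
qed

lemma cx_sum: "cx (SUM i:I. f i) = (SUM i:I. cx (f i))"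
 by (induction I rule: infinite_finite_induct) (auto simp: cx_add)

lemma frag_sum: "c = (SUM f:supp c. frag_cmul (coe c f) (frag_of f))"
 by (subst frag_expansion) (simp add: frag_extend_def)

text \<open>One integral coordinate of a complex chain, taken coefficient by coefficient.\<close>

definition icoord :: "(complex => int) => ('s \<Rightarrow>\<^sub>0 complex) => ('s \<Rightarrow>\<^sub>0 int)" where
 "icoord m c = (SUM f:supp c. frag_cmul (m (coe c f)) (frag_of f))"

lemma keys_icoord: "supp (icoord m c) <= supp c"
proof -
 have "supp (frag_cmul k (frag_of f)) <= supp c" if "f : supp c" for k f
  by (rule order_trans[OF keys_cmul]) (use that in simp)
 thus ?thesis unfolding icoord_def by (intro order_trans[OF keys_sum UN_least])
qed

lemma icoord:
 assumes "finite B" "!!f. f : supp c ==> of_int n * coe c f = (SUM b:B. of_int (m (coe c f) b) * b)"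
 shows "sc (of_int n) c = (SUM b:B. sc b (cx (icoord (%z. m z b) c)))"
proof -
 have "sc (of_int n) c = sc (of_int n) (lext gen c)" by (simp add: lext_id)
 also have "... = (SUM f:supp c. sc (of_int n * coe c f) (gen f))"
  by (simp add: lext_def tc.scale_sum_right)
 also have "... = (SUM f:supp c. SUM b:B. sc (of_int (m (coe c f) b) * b) (gen f))"
  using assms(2) by (intro sum.cong) (simp_all add: tc.scale_sum_left)
 also have "... = (SUM b:B. sc b (cx (icoord (%z. m z b) c)))"
  unfolding icoord_def by (subst sum.swap) (simp add: cx_sum cx_cmul tc.scale_sum_right mult.commute)
 finally show ?thesis .
qed

text \<open>A vanishing coefficient has vanishing coordinates by independence of \<open>B\<close>,
  so taking coordinates does not enlarge supports.\<close>

lemma icoord_keys: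
 assumes n: "sc (of_int n) y = (SUM b:B. sc b (cx (d b)))" and y: "supp y <= T"
  and ind: "!!c :: complex => int. (SUM b:B. of_int (c b) * b) = 0 ==> (ALL b:B. c b = 0)" and b: "b : B"
 shows "supp (d b) <= T"
proof
 fix t assume t: "t : supp (d b)"
 show "t : T"
 proof (rule ccontr)
  assume "t ~: T"
  hence "coe (SUM b:B. sc b (cx (d b))) t = 0" using y unfolding n[symmetric]
   by (auto simp: in_keys_iff)
  thus False using ind[of "%b. coe (d b) t"] b t by (simp add: lookup_sum mult.commute in_keys_iff)
 qed
qed

section \<open>Constant coefficients: complex chains against integral ones\<close>

interpretation U: holonomy "UNIV :: 'a::real_normed_vector set" "%_. 1" by unfold_locales auto

lemma Tw_trivial: "U.Tw q F b s = cx (chain_map q F s)"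
 unfolding U.Tw_def U.wt_def chain_map_def frag_extend_def lext_def keys_cx
 by (simp add: cx_sum cx_cmul)

lemma bd_cx:
 assumes "singular_chain p (euclidean :: 'a::real_normed_vector topology) c"
 shows "U.bd p (cx c) = cx (chain_boundary p c)"
proof -
 have f: "chain_map (p - 1) f (bdi p) = chain_boundary p (frag_of f)" if "f : supp c" for f
 proof -
  have "singular_simplex p (top_of_set UNIV) f" using that assms by (auto simp: singular_chain_def)
  hence "chain_map p f (frag_of (idp p)) = frag_of f" by (rule U.chain_map_idp)
  thus ?thesis using chain_boundary_chain_map[OF idp_chain[of p], of f] by (simp del: chain_map_of)
 qed
 have "U.bd p (cx c) = (SUM f:supp c. sc (of_int (coe c f)) (cx (chain_boundary p (frag_of f))))"
  unfolding U.bd_def Tw_trivial lext_def keys_cx using f by (intro sum.cong) auto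
 also have "... = cx (chain_boundary p (SUM f:supp c. frag_cmul (coe c f) (frag_of f)))"
  by (simp add: chain_boundary_sum cx_sum chain_boundary_cmul cx_cmul)
 finally show ?thesis by (simp flip: frag_sum)
qed

context
 fixes S :: "'a::real_normed_vector set" and l :: nat
begin

abbreviation "relc == singular_relcycle l euclidean S"
abbreviation "relb == singular_relboundary l euclidean S"
abbreviation "Zr == U.rz (tch (UNIV :: 'a set)) (tch S) l"
abbreviation "Br == U.rb (tch (UNIV :: 'a set)) (tch S) l"

lemma cx_tchain: "cx c : tchain p T \<longleftrightarrow> singular_chain p (top_of_set T) c"
 by (simp add: tchain_def singular_chain_def keys_cx)

lemma relc_cx: "relc c ==> cx c : Zr"
 using bd_cx[of l c] cx_tchain[of c l UNIV] cx_tchain[of "chain_boundary l c" "l - 1" S] by (simp add: U.rz_def singular_relcycle)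

lemma relb_cx: "relb c ==> cx c : Br"
proof -
 assume "relb c"
 then obtain d e where d: "singular_chain (Suc l) euclidean d" "singular_chain l (top_of_set S) e" "c = chain_boundary (Suc l) d + e"
  by (auto simp: singular_relboundary)
 have dt: "cx d : tchain (Suc l) UNIV" and et: "cx e : tchain l S"
  using d by (simp_all add: cx_tchain)
 have eq: "cx c = U.bd (Suc l) (cx d) + cx e" using bd_cx[OF d(1)] d(3) by (simp add: cx_add)
 show ?thesis unfolding eq using U.bd_in[OF dt] et tchain_mono[of S UNIV l] using dt et eq
  by (auto intro!: tchain_add intro: U.rbI[of "cx d" _ _ "cx e"])
qed

text \<open>Coordinates split a complex relation into one integral relation for each
  \<open>b\<close> in \<open>B\<close>. As \<open>a s0\<close> is not 0, one of its coordinates is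
  not 0, and the relation for that \<open>b\<close> is taken.\<close>

lemma integral_relation:
 assumes T: "finite T" and c: "!!s. s : T ==> relc (c s)" and s0: "s0 : T" "a s0 ~= 0"
  and rel: "(SUM s:T. sc (a s) (cx (c s))) : Br"
 shows "EX k. k s0 ~= 0 & relb (SUM s:T. frag_cmul (k s) (c s))"
proof -
 obtain e y where e: "e : tchain (Suc l) UNIV" and y: "y : tchain l S" and eq: "(SUM s:T. sc (a s) (cx (c s))) = U.bd (Suc l) e + y"
  using U.rbE[OF rel] by blast
 define K where "K = a ` T Un coe e ` supp e"
 have "finite K" using T by (simp add: K_def)
 from integral_coordinates[OF this] obtain B n m where "int_coords K B n m" by blast
 note B = int_coordsD[OF this]
 define C where "C b = (SUM s:T. frag_cmul (m (a s) b) (c s))" for b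
 define E where "E b = icoord (%z. m z b) e" for b
 have Ech: "singular_chain (Suc l) euclidean (E b)" for b
  using keys_icoord[of "%z. m z b" e] e unfolding E_def singular_chain_def by (auto simp: tchain_def)
 have eE: "sc (of_int n) e = (SUM b:B. sc b (cx (E b)))"
  unfolding E_def by (rule icoord[OF B(1)]) (rule B(3), simp add: K_def)
 have "sc (of_int n) y = sc (of_int n) (SUM s:T. sc (a s) (cx (c s))) - sc (of_int n) (U.bd (Suc l) e)"
  unfolding eq by (simp add: tc.scale_right_distrib)
 also have "sc (of_int n) (SUM s:T. sc (a s) (cx (c s))) = (SUM s:T. SUM b:B. sc (of_int (m (a s) b) * b) (cx (c s)))"
  unfolding tc.scale_sum_right using B(3) by (intro sum.cong) (simp_all add: K_def tc.scale_sum_left)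
 also have "... = (SUM b:B. sc b (cx (C b)))"
  unfolding C_def by (subst sum.swap) (simp add: cx_sum cx_cmul tc.scale_sum_right mult.commute)
 also have "sc (of_int n) (U.bd (Suc l) e) = U.bd (Suc l) (SUM b:B. sc b (cx (E b)))"
  by (simp only: U.bd_sc[symmetric] eE)
 also have "... = (SUM b:B. sc b (cx (chain_boundary (Suc l) (E b))))"
 proof -
  have "U.bd (Suc l) (SUM b:B'. sc b (cx (E b))) = (SUM b:B'. sc b (cx (chain_boundary (Suc l) (E b))))" for B'
   by (induction B' rule: infinite_finite_induct) (simp_all add: U.bd_add U.bd_sc bd_cx[OF Ech])
  thus ?thesis .
 qed
 finally have yy: "sc (of_int n) y = (SUM b:B. sc b (cx (C b - chain_boundary (Suc l) (E b))))"
  by (simp add: cx_diff tc.scale_right_diff_distrib sum_subtractf)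
 have "EX b:B. m (a s0) b ~= 0"
 proof (rule ccontr)
  assume "~ (EX b:B. m (a s0) b ~= 0)"
  thus False using B(3)[of "a s0"] s0(1) using B(2) s0(2) by (simp add: K_def)
 qed
 then obtain b where b: "b : B" "m (a s0) b ~= 0" by blast
 have "supp (C b - chain_boundary (Suc l) (E b)) <= singular_simplex_set l (top_of_set S)"
  by (rule icoord_keys[OF yy _ B(4) b(1)]) (use y in \<open>auto simp: tchain_def\<close>)
 hence "singular_chain l (top_of_set S) (C b - chain_boundary (Suc l) (E b))"
  by (simp add: singular_chain_def)
 thus ?thesis unfolding singular_relboundary using Ech[of b] unfolding C_def using b(2) by fastforce
qed

text \<open>By \<open>icoord_keys\<close>, applied to the boundary, the coordinates of a complex
  relative cycle are integral relative cycles.\<close>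

lemma integral_span:
 assumes z: "z : Zr"
 shows "EX (B :: complex set) c w. finite B & (ALL b:B. relc (c b)) & z = (SUM b:B. sc (w b) (cx (c b)))"
proof -
 have zt: "z : tchain l UNIV" and dz: "U.bd l z : tchain (l - 1) S" using z by (auto simp: U.rz_def)
 have "finite (coe z ` supp z)" by simp
 from integral_coordinates[OF this] obtain B n m where "int_coords (coe z ` supp z) B n m" by blast
 note B = int_coordsD[OF this]
 define C where "C b = icoord (%u. m u b) z" for b
 have Cch: "singular_chain l euclidean (C b)" for b
  using keys_icoord[of "%u. m u b" z] zt unfolding C_def singular_chain_def by (auto simp: tchain_def)
 have zC: "sc (of_int n) z = (SUM b:B. sc b (cx (C b)))"
  unfolding C_def by (rule icoord[OF B(1)]) (rule B(3), simp)
 have "U.bd l (SUM b:B'. sc b (cx (C b))) = (SUM b:B'. sc b (cx (chain_boundary l (C b))))" for B'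
  by (induction B' rule: infinite_finite_induct) (simp_all add: U.bd_add U.bd_sc bd_cx[OF Cch])
 hence dC: "sc (of_int n) (U.bd l z) = (SUM b:B. sc b (cx (chain_boundary l (C b))))"
  by (simp only: U.bd_sc[symmetric] zC)
 have "relc (C b)" if "b : B" for b
 proof -
  have "supp (chain_boundary l (C b)) <= singular_simplex_set (l - 1) (top_of_set S)"
   by (rule icoord_keys[OF dC _ B(4) that]) (use dz in \<open>auto simp: tchain_def\<close>)
  thus ?thesis using Cch by (simp add: singular_relcycle singular_chain_def)
 qed
 moreover have "z = (SUM b:B. sc (b / of_int n) (cx (C b)))"
 proof -
  have "z = sc (1 / of_int n) (sc (of_int n) z)" using B(2) by simp
  thus ?thesis unfolding zC by (simp add: tc.scale_sum_right)
 qed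
 ultimately show ?thesis
  using B(1) by (intro exI[of _ B] exI[of _ C] exI[of _ "%b. b / of_int n"]) blast
qed

abbreviation "HG == relative_homology_group (int l) euclidean S"
abbreviation "hcls == homologous_rel_set l euclidean S"

lemma finprod_classes:
 assumes "finite T" "!!s. s : T ==> relc (c s)"
 shows "finprod HG (%s. hcls (c s) [^]\<^bsub>HG\<^esub> (k s :: int)) T = hcls (SUM s:T. frag_cmul (k s) (c s)) & relc (SUM s:T. frag_cmul (k s) (c s))"
proof -
 let ?R = "relcycle_group l euclidean S"
 have "(%a. singular_relboundary_set l euclidean S #>\<^bsub>?R\<^esub> a) : hom ?R (?R Mod singular_relboundary_set l euclidean S)"
  by (rule normal.r_coset_hom_Mod[OF normal_subgroup_singular_relboundary_relcycle])
 hence "hcls : hom ?R HG"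
  unfolding right_coset_singular_relboundary nontrivial_relative_homology_group .
 then interpret h: group_hom ?R HG hcls by (intro group_hom.intro group_hom_axioms.intro) auto
 interpret G: comm_group HG by (rule abelian_relative_homology_group)
 have pow: "x [^]\<^bsub>?R\<^esub> k = frag_cmul k x" if "relc x" for x and k :: int
 proof -
  have "x [^]\<^bsub>?R\<^esub> k = x [^]\<^bsub>chain_group l euclidean\<^esub> k"
   unfolding relcycle_group_def using that by (intro group.int_pow_subgroup_generated) (simp_all flip: relcycle_group_def)
  thus ?thesis using that by (simp add: chain_group_def singular_relcycle singular_chain_def)
 qed
 have cm: "relc (frag_cmul k x)" "hcls x [^]\<^bsub>HG\<^esub> k = hcls (frag_cmul k x)" "hcls x : carrier HG" if "relc x" for x and k :: int
 proof -
  have x: "x : carrier ?R" using that by simp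
  show "relc (frag_cmul k x)"
   using group.int_pow_closed[OF group_relcycle_group x, of k] pow[OF that] by simp
  show "hcls x [^]\<^bsub>HG\<^esub> k = hcls (frag_cmul k x)"
   using h.hom_int_pow[OF x, of k] pow[OF that] by simp
  show "hcls x : carrier HG" using h.hom_closed[OF x] .
 qed
 show ?thesis using assms
 proof (induction T rule: finite_induct)
  case empty
  show ?case using h.hom_one using h.one_closed by simp
 next
  case (insert s T)
  hence IH: "finprod HG (%s. hcls (c s) [^]\<^bsub>HG\<^esub> k s) T = hcls (SUM s:T. frag_cmul (k s) (c s))" "relc (SUM s:T. frag_cmul (k s) (c s))"
   by simp_all
  have cs: "relc (frag_cmul (k s) (c s))" using cm(1) insert.prems by simp
  have cc: "hcls (c t) [^]\<^bsub>HG\<^esub> k t : carrier HG" if "t : insert s T" for t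
   using cm(2)[OF insert.prems[OF that], of "k t"] cm(3)[OF cm(1)[OF insert.prems[OF that], of "k t"]] by simp
  have "finprod HG (%s. hcls (c s) [^]\<^bsub>HG\<^esub> k s) (insert s T) = hcls (c s) [^]\<^bsub>HG\<^esub> k s \<otimes>\<^bsub>HG\<^esub> finprod HG (%s. hcls (c s) [^]\<^bsub>HG\<^esub> k s) T"
   using insert.hyps cc by (intro G.finprod_insert) auto
  also have "... = hcls (frag_cmul (k s) (c s)) \<otimes>\<^bsub>HG\<^esub> hcls (SUM s:T. frag_cmul (k s) (c s))"
   using cm(2)[OF insert.prems, of s "k s"] IH(1) by simp
  also have "... = hcls (frag_cmul (k s) (c s) + (SUM s:T. frag_cmul (k s) (c s)))"
   using h.hom_mult[of "frag_cmul (k s) (c s)" "SUM s:T. frag_cmul (k s) (c s)"] cs IH(2) by simp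
  finally show ?case using insert.hyps singular_relcycle_add[OF cs IH(2)] by simp
 qed
qed

text \<open>\<open>P\<close> gives the coordinates of a class and vanishes exactly on boundaries.
  Independent integral classes stay independent over the complex numbers by
  \<open>integral_relation\<close>, and integral classes span by \<open>integral_span\<close>; both
  inequalities are then comparisons inside the span of \<open>b\<close> vectors.\<close>

theorem abelian_rank_homology:
 assumes qd: "U.qd Zr Br b"
 shows "abelian_rank HG = enat b"
proof -
 have cx1: "U.subcx (tch UNIV)" "U.subcx (tch S)" by (intro U.subcx_tchain; simp)+
 obtain v where v: "ALL i<b. v i : Zr" "!!z. z : Zr ==> EX a. z - (\<Sum>i<b. sc (a i) (v i)) : Br"
  "!!a. (\<Sum>i<b. sc (a i) (v i)) : Br ==> (ALL i<b. a i = 0)" using qd unfolding U.qd_def by blast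
 obtain g where g: "!!j. j < b ==> Vector_Spaces.linear sc (*) (g j)" "!!j x. j < b ==> x : Br ==> g j x = (0::complex)"
  "!!i j. i < b ==> j < b ==> g j (v i) = (if i = j then 1 else 0)" "!!z. z : Zr ==> z - (\<Sum>i<b. sc (g i z) (v i)) : Br"
  using dual_functionals[OF U.rb_subspace[OF cx1] v] by blast
 define P where "P x = (\<Sum>j<b. sc (g j x) (gen j))" for x
 have P: "Vector_Spaces.linear sc sc P"
 proof
  fix x y k
  have "g j (x + y) = g j x + g j y" "g j (sc k x) = k * g j x" if "j < b" for j
   using g(1)[OF that] by (simp_all add: tp.linear_add tp.linear_scale)
  thus "P (x + y) = P x + P y" "P (sc k x) = sc k (P x)"
   by (simp_all add: P_def tc.scale_left_distrib sum.distrib tc.scale_sum_right)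
 qed
 interpret P: Vector_Spaces.linear sc sc P by (rule P)
 have lookP: "coe (P x) j = (if j < b then g j x else 0)" for x j
  by (simp add: P_def lookup_sum lookup_single when_def if_distrib[of "%z. _ * z"] cong: if_cong)
 have PB: "x : Br" if "x : Zr" "P x = 0" for x
 proof -
  have "g j x = 0" if "j < b" for j using lookP[of x j] that \<open>P x = 0\<close> by simp
  thus ?thesis using g(4)[OF that(1)] by simp
 qed
 have P0: "P x = 0" if "x : Br" for x using g(2) that by (simp add: P_def)
 have Pspan: "P x : tc.span (gen ` {..<b})" for x
  unfolding P_def by (intro tc.span_sum tc.span_scale tc.span_base) auto
 have "card T <= b" if T: "finite T" "T <= carrier HG" "Z_independent HG T" for T
 proof -
  have "ALL s:T. EX c. relc c & s = hcls c"
   using T(2) unfolding carrier_relative_homology_group by blast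
  then obtain c where c: "!!s. s : T ==> relc (c s)" "!!s. s : T ==> s = hcls (c s)" by metis
  have ind: "ALL s:T. a s = 0" if "(SUM s:T. sc (a s) (P (cx (c s)))) = 0" for a
  proof (rule ccontr)
   assume "~ (ALL s:T. a s = 0)"
   then obtain s0 where s0: "s0 : T" "a s0 ~= 0" by blast
   have "(SUM s:T. sc (a s) (cx (c s))) : Br"
    using that by (intro PB tc.subspace_sum[OF U.rz_subspace[OF cx1]] tc.subspace_scale[OF U.rz_subspace[OF cx1]] relc_cx c(1))
     (simp_all add: P.sum P.scale)
   from integral_relation[OF T(1) c(1) s0 this] obtain k where k: "k s0 ~= 0" "relb (SUM s:T. frag_cmul (k s) (c s))"
    by blast
   have "finprod HG (%s. s [^]\<^bsub>HG\<^esub> k s) T = finprod HG (%s. hcls (c s) [^]\<^bsub>HG\<^esub> k s) T"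
   proof (rule comm_monoid.finprod_cong')
    show "comm_monoid HG" using abelian_relative_homology_group comm_group.axioms(1) by blast
    show "(%s. hcls (c s) [^]\<^bsub>HG\<^esub> k s) : T \<rightarrow> carrier HG"
     using T(2) c(2) by (auto intro!: group.int_pow_closed)
   qed (use c(2) in auto)
   also have "... = \<one>\<^bsub>HG\<^esub>"
    using finprod_classes[OF T(1) c(1), where k = k] k(2) homologous_rel_set_eq_relboundary[of l euclidean S] by simp
   finally show False using T(3) s0(1) k(1) unfolding Z_independent_def by blast
  qed
  let ?f = "%s. P (cx (c s))"
  have inj: "inj_on ?f T"
  proof (rule inj_onI, rule ccontr)
   fix s t assume st: "s : T" "t : T" "?f s = ?f t" "s ~= t"
   define a :: "_ => complex" where "a u = (if u = s then 1 else if u = t then - 1 else 0)" for u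
   have "(SUM u:T. sc (a u) (?f u)) = (SUM u:{s, t}. sc (a u) (?f u))"
    using T(1) st by (intro sum.mono_neutral_right) (auto simp: a_def)
   also have "... = 0" using st by (simp add: a_def)
   finally have "(SUM u:T. sc (a u) (?f u)) = 0" .
   from bspec[OF ind[OF this] st(1)] show False by (simp add: a_def)
  qed
  have "tc.independent (?f ` T)"
  proof
   assume "tc.dependent (?f ` T)"
   then obtain u where u: "EX x:?f ` T. u x ~= 0" "(SUM x:?f ` T. sc (u x) x) = 0" using tc.dependent_finite[OF finite_imageI[OF T(1)], of ?f]
    by auto
   show False using u(2) inj using ind[of "%s. u (?f s)"] u(1) by (simp add: sum.reindex)
  qed
  hence "card (?f ` T) <= card (gen ` {..<b})"
   using tc.independent_span_bound[of "gen ` {..<b}" "?f ` T"] Pspan by blast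
  also have "... <= b" using card_image_le[of "{..<b}" gen] by simp
  finally show ?thesis using card_image[OF inj] by simp
 qed
 moreover have "EX T. finite T & T <= carrier HG & Z_independent HG T & card T = b"
 proof -
  let ?I = "(%c. P (cx c)) ` {c. relc c}"
  obtain D where D: "D <= ?I" "tc.independent D" "?I <= tc.span D"
   using tc.maximal_independent_subset[of ?I] by blast
  have bound: "finite D" "card D <= card (gen ` {..<b})" using D(1) Pspan using tc.independent_span_bound[OF _ D(2), of "gen ` {..<b}"]
   by auto
  have "gen j : tc.span D" if j: "j < b" for j
  proof -
   from integral_span[OF v(1)[rule_format, OF j]]
   obtain B c w where w: "ALL i:(B :: complex set). relc (c i)" "v j = (SUM i:B. sc (w i) (cx (c i)))"
    by (elim exE conjE)
   have "P (v j) = gen j"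
    by (rule poly_mapping_eqI) (use j in \<open>simp add: lookP g(3) lookup_single when_def\<close>)
   moreover have "P (v j) : tc.span D" unfolding w(2) P.sum P.scale
   proof (intro tc.span_sum tc.span_scale)
    fix i assume "i : B"
    thus "P (cx (c i)) : tc.span D" using w(1) by (auto intro: subsetD[OF D(3)])
   qed
   ultimately show ?thesis by simp
  qed
  hence sub: "gen ` {..<b} <= tc.span D" by blast
  have "inj_on (gen :: nat => _) {..<b}"
   by (rule inj_onI) (metis lookup_single_eq lookup_single_not_eq zero_neq_one)
  hence cg: "card ((gen :: nat => _) ` {..<b}) = b" and ginj: "inj_on (gen :: nat => _) {..<b}"
   by (simp_all add: card_image)
  have "tc.independent ((gen :: nat => _) ` {..<b})"
  proof
   assume "tc.dependent ((gen :: nat => _) ` {..<b})"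
   then obtain u where u: "EX x:gen ` {..<b}. u x ~= 0" "(SUM x:gen ` {..<b}. sc (u x) x) = 0" using tc.dependent_finite[of "(gen :: nat => _) ` {..<b}"]
    by auto
   then obtain j where j: "j < b" "u (gen j) ~= 0" by blast
   have "coe (\<Sum>i<b. sc (u (gen i)) (gen i)) j = 0" using u(2) ginj by (simp add: sum.reindex)
   thus False
    using j by (simp add: lookup_sum lookup_single when_def if_distrib[of "%z. _ * z"] cong: if_cong)
  qed
  from tc.independent_span_bound[OF bound(1) this sub] have cD: "card D = b"
   using bound(2) cg by simp
  have "ALL d:D. EX c. relc c & P (cx c) = d" using D(1) by blast
  then obtain c where c: "!!d. d : D ==> relc (c d)" "!!d. d : D ==> P (cx (c d)) = d" by metis
  define cl where "cl d = hcls (c d)" for d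
  have inj: "inj_on cl D"
  proof (rule inj_onI)
   fix d d' assume d: "d : D" "d' : D" "cl d = cl d'"
   from d(3)[unfolded cl_def homologous_rel_set_eq] have "relb (c d - c d')"
    by (simp add: homologous_rel_def)
   from P0[OF relb_cx[OF this]] show "d = d'" using c(2) d by (simp add: cx_diff P.diff)
  qed
  have "Z_independent HG (cl ` D)" unfolding Z_independent_def
  proof (intro allI impI)
   fix k :: "_ => int" assume k: "finprod HG (%s. s [^]\<^bsub>HG\<^esub> k s) (cl ` D) = \<one>\<^bsub>HG\<^esub>"
   have cm: "comm_monoid HG" using abelian_relative_homology_group comm_group.axioms(1) by blast
   have cc: "cl d : carrier HG" if "d : D" for d
    unfolding cl_def carrier_relative_homology_group using c(1)[OF that] by blast
   have "finprod HG (%s. s [^]\<^bsub>HG\<^esub> k s) (cl ` D) = finprod HG (%d. cl d [^]\<^bsub>HG\<^esub> k (cl d)) D"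
    using cc inj by (intro comm_monoid.finprod_reindex[OF cm]) (auto intro!: group.int_pow_closed)
   hence "relb (SUM d:D. frag_cmul (k (cl d)) (c d))" using finprod_classes[OF bound(1) c(1), where k = "%d. k (cl d)"] k
    by (simp add: cl_def homologous_rel_set_eq_relboundary)
   from P0[OF relb_cx[OF this]] have "of_int (k (cl d)) = (0::complex)" if "d : D" for d using c(2) using tc.independentD[OF D(2) bound(1) order_refl, of "%d. of_int (k (cl d))"] that
    by (simp add: cx_sum cx_cmul P.sum P.scale)
   thus "ALL s:cl ` D. k s = 0" by auto
  qed
  moreover have "cl ` D <= carrier HG"
   unfolding cl_def carrier_relative_homology_group using c(1) by blast
  ultimately show ?thesis using bound(1) card_image[OF inj] cD by (intro exI[of _ "cl ` D"]) simp
 qed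
 ultimately show ?thesis unfolding abelian_rank_def
  by (intro antisym SUP_least) (auto intro: SUP_upper2)
qed

end

section \<open>Hyperplane arrangements\<close>

text \<open>Each further independent functional removes one dimension, spanned by the vector of
  \<open>cdot_annihilate\<close>.\<close>

lemma dim_annihilator:
 fixes S :: "(complex ^ 'n) set"
 shows "vec.dim {v. ALL a:S. cdot a v = 0} = CARD('n) - vec.dim S"
proof -
 define ann where "ann S = {v. ALL a:S. cdot a v = 0}" for S :: "(complex ^ 'n) set"
 have sub: "vec.subspace (ann S)" for S by (rule vec.subspaceI) (auto simp: ann_def)
 have ind: "vec.dim (ann B) + card B = CARD('n)" if "finite B" "vec.independent B" for B using that
 proof (induction B rule: finite_induct)
  case empty
  show ?case  by (simp add: ann_def card_cart_basis)
 next
  case (insert a B)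
  have iB: "vec.independent B" and a: "a ~: vec.span B"
   using insert.prems insert.hyps(2) vec.independent_insert[of a B] by auto
  obtain w where w: "!!s. s : B ==> cdot s w = 0" "cdot a w = 1"
   by (rule cdot_annihilate[OF a]) blast
  have wn: "w ~: vec.span (ann (insert a B))"
   using w(2) sub[of "insert a B"] by (auto simp: ann_def vec.span_eq_iff[THEN iffD2])
  have "ann B <= vec.span (insert w (ann (insert a B)))"
  proof
   fix v assume v: "v : ann B"
   have "v - cdot a v *s w : ann (insert a B)" using v w by (auto simp: ann_def)
   thus "v : vec.span (insert w (ann (insert a B)))" unfolding vec.span_insert
    by (auto intro: vec.span_base)
  qed
  hence "vec.dim (ann B) = vec.dim (insert w (ann (insert a B)))" using w(1) using vec.dim_mono[of "ann B" "insert w (ann (insert a B))"] vec.dim_subset[of "insert w (ann (insert a B))" "ann B"]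
   by (fastforce simp: ann_def)
  thus ?case using insert.IH[OF iB] insert.hyps wn by (simp add: vec.dim_insert)
 qed
 obtain B where B: "B <= S" "vec.independent B" "S <= vec.span B" "card B = vec.dim S"
  using vec.basis_exists[of S] by blast
 have "ann S = ann B"
 proof
  show "ann S <= ann B" using B(1) by (auto simp: ann_def)
  show "ann B <= ann S"
  proof
   fix v assume v: "v : ann B"
   have "vec.subspace {a. cdot a v = 0}" by (rule vec.subspaceI) auto
   moreover have "B <= {a. cdot a v = 0}" using v by (auto simp: ann_def)
   ultimately have "vec.span B <= {a. cdot a v = 0}" by (intro vec.span_minimal)
   thus "v : ann S" using B(3) by (auto simp: ann_def)
  qed
 qed
 thus ?thesis using ind[OF vec.finiteI_independent[OF B(2)] B(2)] B(4) by (simp add: ann_def)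
qed

text \<open>\<open>LL_main\<close> with a box without sides: there is no exit set, and the only
  scales are the radius of the tubes and 1.\<close>

lemma local_pair:
 fixes J :: "('n::finite) aff set"
 assumes J: "finite J"
 shows "EX b. EX ka>0. ALL ep ta. 0 < ep --> ep < ka --> holonomy (MM J) ta --> holonomy.thc ta (MM J) (MM J Int TT J ep) (vec.dim (fst ` J)) b"
proof -
 define y :: "nat => 'n aff" where "y i = 0" for i
 define t :: "nat => bool" where "t i = True" for i
 have "valid J 0 y t" by (simp add: valid_def vec.independent_empty)
 from LL_main[OF J this] obtain b ka where LL: "0 < ka" "LL J 0 y t b ka" by blast
 have "holonomy.thc ta (MM J) (MM J Int TT J ep) (vec.dim (fst ` J)) b" if e: "0 < ep" "ep < ka" and hol: "holonomy (MM J) ta" for ep ta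
 proof -
  define e where "e i = (if i = 0 then ep else 1)" for i :: nat
  have "holonomy.thc ta (XX J 0 y e) (YY J 0 y t e) (rk J 0 y) b" using e using LL(2) hol unfolding LL_def
   by (simp add: chain_def e_def)
  thus ?thesis  by (simp add: XX_def Om_def RR_def rk_def e_def YY_def)
 qed
 thus ?thesis using LL(1) by blast
qed

locale arrangement =
 fixes A :: "(complex ^ 'n) set set" and ph :: "(complex ^ 'n) set => 'n aff"
 assumes finA: "finite A" and ph: "H : A ==> fst (ph H) ~= 0" "H : A ==> H = {x. ev (ph H) x = 0}"
begin

definition "J = ph ` A"

lemma finJ: "finite J" by (simp add: J_def finA)

lemma ev_ph: "H : A ==> ev (ph H) x = 0 \<longleftrightarrow> x : H" using ph(2)[of H] by blast

lemma inj_ph: "inj_on ph A"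
proof (rule inj_onI)
 fix H H' assume "H : A" "H' : A" "ph H = ph H'"
 thus "H = H'" using ph(2)[of H] ph(2)[of H'] by simp
qed

lemma complement: "arr_complement A = MM J"
 by (auto simp: arr_complement_def singular_set_def MM_def J_def ev_ph)

lemma singular: "singular_set A = {x. EX h:J. ev h x = 0}"
 by (auto simp: singular_set_def J_def ev_ph)

lemma directions:
 assumes B: "B <= A" and p: "p : \<Inter>B"
 shows "{x - y |x y. x : \<Inter>B & y : \<Inter>B} = {v. ALL a:(%H. fst (ph H)) ` B. cdot a v = 0}"
proof -
 have ev: "x : \<Inter>B \<longleftrightarrow> (ALL H:B. ev (ph H) x = 0)" for x using B ev_ph by blast
 show ?thesis
 proof (intro Set.set_eqI iffI)
  fix v assume "v : {x - y |x y. x : \<Inter>B & y : \<Inter>B}"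
  then obtain x y where xy: "v = x - y" "ALL H:B. ev (ph H) x = 0" "ALL H:B. ev (ph H) y = 0"
   unfolding ev by blast
  have "cdot (fst (ph H)) v = ev (ph H) x - ev (ph H) y" for H by (simp add: xy(1) ev_def)
  thus "v : {v. ALL a:(%H. fst (ph H)) ` B. cdot a v = 0}" using xy(2,3) by simp
 next
  fix v assume "v : {v. ALL a:(%H. fst (ph H)) ` B. cdot a v = 0}"
  hence "p + v : \<Inter>B" using p unfolding ev by (simp add: ev_add)
  moreover have "v = (p + v) - p" by simp
  ultimately show "v : {x - y |x y. x : \<Inter>B & y : \<Inter>B}" using p by blast
 qed
qed

lemma codim:
 assumes "B <= A" "p : \<Inter>B"
 shows "complex_codim (\<Inter>B) = vec.dim ((%H. fst (ph H)) ` B)"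
 unfolding complex_codim_def directions[OF assms] dim_annihilator
 using vec.dim_subset[OF subset_UNIV, of "(%H. fst (ph H)) ` B"] by (simp add: card_cart_basis)

lemma flats_bar_Inter: "G : flats_bar A \<longleftrightarrow> (EX B<=A. G = \<Inter>B & G ~= {})"
 unfolding flats_bar_def flats_def by auto

text \<open>Hyperplanes whose linear parts form a basis of the span have a common point by
  \<open>common_zero\<close>. Their intersection is a flat whose codimension is the dimension of the
  span, and no flat has a larger one.\<close>

lemma rank: "arr_rank A = vec.dim (fst ` J)"
proof -
 have J': "fst ` J = (%H. fst (ph H)) ` A" by (auto simp: J_def)
 have fin: "finite (flats_bar A)"
 proof (rule finite_subset)
  show "flats_bar A <= Inter ` Pow A" by (auto simp: flats_bar_Inter)
 qed (simp add: finA)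
 show ?thesis unfolding arr_rank_def
 proof (rule Max_eqI)
  show "finite (complex_codim ` flats_bar A)" using fin by simp
  fix c assume "c : complex_codim ` flats_bar A"
  then obtain G where G: "G : flats_bar A" "c = complex_codim G" by blast
  then obtain B where B: "B <= A" "\<Inter>B ~= {}" "c = complex_codim (\<Inter>B)"
   unfolding flats_bar_Inter by blast
  thus "c <= vec.dim (fst ` J)"
   using codim[OF B(1)] unfolding J' by (metis all_not_in_conv image_mono vec.dim_subset)
 next
  obtain V where V: "V <= fst ` J" "vec.independent V" "fst ` J <= vec.span V" "card V = vec.dim (fst ` J)"
   using vec.basis_exists[of "fst ` J"] by blast
  have "ALL v:V. EX H. H : A & fst (ph H) = v" using V(1) unfolding J' by blast
  define Hv where "Hv v = (SOME H. H : A & fst (ph H) = v)" for v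
  have Hv: "Hv v : A" "fst (ph (Hv v)) = v" if "v : V" for v
   using someI_ex[OF \<open>ALL v:V. EX H. H : A & fst (ph H) = v\<close>[rule_format, OF that]] unfolding Hv_def by blast+
  have fV: "finite V" by (rule vec.finiteI_independent[OF V(2)])
  obtain n where n: "bij_betw n {1..card V} V" using ex_bij_betw_nat_finite_1[OF fV] by blast
  have nV: "n i : V" if "i : {1..card V}" for i using n that bij_betwE by blast
  define y where "y i = ph (Hv (n i))" for i
  have yn: "fst (y i) = n i" if "i : {1..card V}" for i using Hv(2) nV[OF that] by (simp add: y_def)
  have "valid J (card V) y (%_. True)"
  proof -
   have "inj_on (%i. fst (y i)) {1..card V}"
    using n inj_on_cong[of "{1..card V}" "%i. fst (y i)" n] yn by (simp add: bij_betw_def)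
   thus ?thesis using n yn using V(2) by (simp add: bij_betw_def valid_def)
  qed
  from common_zero[OF this] obtain p where p: "!!i. i : {1..card V} ==> ev (y i) p = 0" by blast
  have pB: "p : \<Inter>(Hv ` V)"
  proof (rule INT_I)
   fix v assume v: "v : V"
   then obtain i where "i : {1..card V}" "v = n i" using n by (fastforce simp: bij_betw_def)
   thus "p : Hv v" using p[of i] ev_ph[OF Hv(1)[OF v], of p] by (simp add: y_def)
  qed
  have sub: "Hv ` V <= A" using Hv(1) by blast
  have "complex_codim (\<Inter>(Hv ` V)) = vec.dim (fst ` J)" using Hv(2) using codim[OF sub pB] vec.dim_eq_card_independent[OF V(2)] V(4)
   by (force simp: image_image)
  moreover have "\<Inter>(Hv ` V) : flats_bar A" using pB unfolding flats_bar_Inter using sub by blast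
  hence "complex_codim (\<Inter>(Hv ` V)) : complex_codim ` flats_bar A" by (rule imageI)
  ultimately show "vec.dim (fst ` J) : complex_codim ` flats_bar A" by simp
 qed
qed

text \<open>Any point of \<open>V\<close> on its minimum flat will do: a hyperplane that meets
  \<open>V\<close> contains this flat, and a hyperplane through the point meets
  \<open>V\<close>.\<close>

lemma small_center:
 assumes V: "small A V"
 shows "EX p:V. (ALL h:J. ALL x:V. ev h x = 0 --> ev h p = 0) & {h : J. ev h p = 0} = ph ` arr_at A V"
proof -
 have "EX! G. is_Min A V G" using V by (simp add: small_def)
 hence "is_Min A V (Min_flat A V)" unfolding Min_flat_def by (rule theI')
 then obtain p where p: "p : Min_flat A V" "p : V" unfolding is_Min_def by blast
 have H: "H Int V ~= {} \<longleftrightarrow> Min_flat A V <= H" if "H : A" for H using V that by (simp add: small_def)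
 show ?thesis
 proof (intro bexI[of _ p] conjI p(2))
  show "ALL h:J. ALL x:V. ev h x = 0 --> ev h p = 0" using H p(1) by (auto simp: J_def ev_ph)
  have "p : H \<longleftrightarrow> Min_flat A V <= H" if "H : A" for H
  proof
   assume "p : H"
   thus "Min_flat A V <= H" using p(2) using H[OF that] by blast
  qed (use p(1) in blast)
  hence "{H : A. ev (ph H) p = 0} = arr_at A V"
   unfolding arr_at_def using ev_ph by (intro Collect_cong) auto
  thus "{h : J. ev h p = 0} = ph ` arr_at A V" unfolding J_def by blast
 qed
qed

text \<open>Excision adds the tubes to the complement and yields the whole space; moving linearly to
  \<open>W x\<close> then retracts the tubes to the singular set in one step.\<close>

lemma singular_homology:
 assumes e: "0 < ep" and W: "continuous_on UNIV W" "!!x h. h : J ==> cmod (ev h x) <= ep ==> ev h (W x) = 0"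
  and thc: "holonomy.thc (%_. 1) (MM J) (MM J Int TT J ep) (arr_rank A) b"
 shows "beta A = enat b"
proof -
 have "MM J Un TT J ep = UNIV" using e by (force simp: MM_def TT_def)
 hence UT: "U.thc UNIV (TT J ep) (arr_rank A) b"
  using U.thc_excision_open[of "MM J" "TT J ep" "arr_rank A" b] open_MM[OF finJ] open_TT[of J ep] thc by simp
 define h where "h x t = (1 - t) *\<^sub>R x + t *\<^sub>R W x" for x t
 have sT: "singular_set A <= TT J ep" using e by (auto simp: singular TT_def intro!: CollectI bexI)
 have ev: "ev g (h x t) = of_real (1 - t) * ev g x" if "g : J" "cmod (ev g x) <= ep" for g x t
  unfolding h_def ev_affine W(2)[OF that] by simp
 have "U.thz (TT J ep) (singular_set A)"
 proof (rule U.thz_push[where h = h, OF _ sT])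
  show "continuous_on (TT J ep \<times> {0..1}) (%z. h (fst z) (snd z))"
   unfolding h_def by (intro continuous_intros continuous_on_compose2[OF W(1)]) auto
  show "h x t : TT J ep" if x: "x : TT J ep" and t: "0 <= t" "t <= 1" for x t
  proof -
   obtain g where g: "g : J" "cmod (ev g x) < ep" using x by (auto simp: TT_def)
   have "cmod (ev g (h x t)) = (1 - t) * cmod (ev g x)"
    using ev[OF g(1), of x t] g(2) t by (simp add: norm_mult del: of_real_diff)
   also have "... <= 1 * cmod (ev g x)" using t by (intro mult_right_mono) auto
   finally show ?thesis unfolding TT_def using g by (intro CollectI bexI[OF _ g(1)]) simp
  qed
  show "h x t : singular_set A" if "x : singular_set A" for x t
  proof -
   obtain g where g: "g : J" "ev g x = 0" using \<open>x : singular_set A\<close> by (auto simp: singular)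
   thus ?thesis using ev[OF g(1), of x t] e by (auto simp: singular)
  qed
  fix K assume K: "K <= TT J ep"
  have "h x 1 : singular_set A" if x: "x : K" for x
  proof -
   obtain g where g: "g : J" "cmod (ev g x) < ep" using x K by (auto simp: TT_def)
   thus ?thesis using ev[OF g(1), of x 1] by (auto simp: singular)
  qed
  thus "EX N. ALL x:K. ((%x. h x 1) ^^ N) x : singular_set A" by (intro exI[of _ "Suc 0"]) simp
 qed (auto simp: h_def)
 thus ?thesis using UT U.thz_bot[of UNIV "TT J ep" "singular_set A" "arr_rank A" b] sT unfolding beta_def U.thc_def
  by (auto intro: abelian_rank_homology U.hc_qd)
qed

end

theorem theoremB:
  fixes A :: "(complex ^ 'n) set set"
    and I :: "'i set"
    and U :: "'i \<Rightarrow> (complex ^ 'n) set"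
    and cscale :: "complex \<Rightarrow> 'v::ab_group_add \<Rightarrow> 'v"
    and L :: "(complex ^ 'n, 'v) local_system"
    and \<Lambda> :: "(complex ^ 'n) set \<Rightarrow> complex"
    and l :: nat
  assumes "hyperplane_arrangement A"
    and "arr_rank A = l"
    and "\<And>i. i \<in> I \<Longrightarrow> small A (U i)"
    and "(\<Union>i\<in>I. U i) = UNIV"
    and "flat_line_bundle cscale (arr_complement A) L"
    and "has_monodromy cscale A L \<Lambda>"
    and "generic A I U \<Lambda>"
  shows "(\<forall>k. k \<noteq> l \<longrightarrow>
            carrier (local_cohomology cscale (arr_complement A) L k) =
              {\<zero>\<^bsub>local_cohomology cscale (arr_complement A) L k\<^esub>})
       \<and> vectorspace.fin_dim complex_ring (local_cohomology cscale (arr_complement A) L l)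
       \<and> enat (vectorspace.dim complex_ring (local_cohomology cscale (arr_complement A) L l)) = beta A"
proof -
 have "ALL H:A. EX h :: 'n aff. fst h ~= 0 & H = {x. ev h x = 0}"
 proof
  fix H assume "H : A"
  then obtain a b where ab: "a ~= 0" "H = {x. (SUM i:UNIV. a $ i * x $ i) = b}"
   using assms(1) unfolding hyperplane_arrangement_def complex_hyperplane_def by blast
  thus "EX h :: 'n aff. fst h ~= 0 & H = {x. ev h x = 0}"
   by (intro exI[of _ "(a, - b)"]) (auto simp: ev_def cdot_def)
 qed
 then obtain ph where ph: "!!H. H : A ==> fst (ph H :: 'n aff) ~= 0" "!!H. H : A ==> H = {x. ev (ph H) x = 0}"
  by metis
 interpret A: arrangement A ph
  using assms(1) ph by unfold_locales (simp_all add: hyperplane_arrangement_def)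
 let ?X = "arr_complement A"
 have l: "vec.dim (fst ` A.J) = l" using A.rank assms(2) by simp
 interpret B: line_bundle cscale ?X L using assms(5) by (rule line_bundle.intro)
 have hol: "holonomy (MM A.J) B.tr" using B.holonomy_tr by (simp add: A.complement)
 obtain b ka where pair: "0 < ka" "!!ep ta. 0 < ep ==> ep < ka ==> holonomy (MM A.J) ta ==> holonomy.thc ta (MM A.J) (MM A.J Int TT A.J ep) l b"
  using local_pair[OF A.finJ] unfolding l by blast
 obtain W ep0 C where W: "0 < ep0" "continuous_on UNIV W" "0 < C" "!!x. norm (W x) <= C"
  "!!x h. h : A.J ==> cmod (ev h x) <= ep0 ==> ev h (W x) = 0" by (rule near_point[OF A.finJ]) blast
 \<comment> \<open>Small enough for the pair and for the field \<open>W\<close> alike, so that one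
   radius serves both systems.\<close>
 define ep where "ep = min ep0 (ka / 2)"
 have e: "0 < ep" "ep < ka" "ep <= ep0" using W(1) pair(1) by (auto simp: ep_def)
 have We: "ev h (W x) = 0" if "h : A.J" "cmod (ev h x) <= ep" for x h
  using W(5)[OF that(1), of x] that(2) e(3) by simp
 \<comment> \<open>The constant system identifies \<open>b\<close> as \<open>beta A\<close>.\<close>
 have "holonomy (MM A.J) (%_. 1)" by unfold_locales auto
 from pair(2)[OF e(1,2) this] have beta: "beta A = enat b"
  using assms(2) by (intro A.singular_homology[OF e(1) W(2) We]) auto
 \<comment> \<open>\<open>\<Lambda>\<close> is indexed by hyperplanes, which are recovered from the
   functionals as zero sets.\<close>
 define mu where "mu h = \<Lambda> {x. ev h x = 0}" for h :: "'n aff"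
 have mu: "B.tr (%t. q + cis (2 * pi * t) *s v) = mu h"
  if h: "h : A.J" "ev h q = 0" "ALL h':A.J - {h}. ev h' q ~= 0" and z: "ALL z. 0 < cmod z & cmod z <= 1 --> q + z *s v : MM A.J" for h q v
 proof -
  let ?g = "%t. q + cis (2 * pi * t) *s v"
  obtain H where H: "H : A" "h = ph H" using h(1) by (auto simp: A.J_def)
  have "positive_meridian A H ?g" unfolding positive_meridian_def
  proof (rule exI[of _ q], rule exI[of _ v], intro conjI ballI allI impI)
   show "q : H" using h(2) A.ev_ph[OF H(1)] H(2) by simp
   show "q ~: H'" if H': "H' : A - {H}" for H'
   proof -
    show ?thesis using H' H inj_onD[OF A.inj_ph, of H' H] using h(3) A.ev_ph[of H' q] H'
     by (auto simp: A.J_def)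
   qed
   show "q + z *s v ~: singular_set A" if "0 < cmod z & cmod z <= 1" for z
    using z that by (simp add: arr_complement_def flip: A.complement)
  qed simp
  hence m: "ALL w:fibre L (pathstart ?g). transport L ?g w = cscale (\<Lambda> H) w"
   using assms(6) H(1) unfolding has_monodromy_def by blast
  have st: "pathstart ?g = q + v" "pathfinish ?g = q + v"
   by (simp_all add: pathstart_def pathfinish_def)
  have qv: "q + v : ?X" using z[rule_format, of 1] by (simp add: A.complement)
  \<comment> \<open>The meridian acts on the whole fibre by one scalar, so the vector chosen in the
    fibre does not matter.\<close>
  have "B.tr ?g = B.co (q + v) (transport L ?g (B.e (q + v)))" unfolding B.tr_def st ..
  also have "... = \<Lambda> H" using m[unfolded st] B.e(4)[OF qv] qv by simp
  finally show ?thesis using ph(2)[OF H(1)] H(2) by (simp add: mu_def)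
 qed
 have rot: "EX r>0. ALL x. x : MM A.J --> x : ball p r -->
   B.tr (%t. p + cis (2 * pi * t) *s (x - p)) = (PROD h:{h:A.J. ev h p = 0}. mu h)" for p
 proof (rule rotation_holonomy[OF A.finJ hol _ mu])
  fix h h' :: "'n aff" and c :: complex assume h: "h : A.J" "h' : A.J" "h' = (c *s fst h, c * snd h)"
  obtain H H' where H: "H : A" "h = ph H" "H' : A" "h' = ph H'" using h(1,2) by (auto simp: A.J_def)
  have "c ~= 0" using ph(1)[OF H(3)] h(3) H(4) by auto
  moreover have "ev h' x = c * ev h x" for x by (simp add: h(3) ev_def algebra_simps)
  ultimately show "h = h'" using ph(2)[OF H(1)] ph(2)[OF H(3)] H(2,4) using H by simp
 qed
 let ?I = "sing_index A I U"
 have small: "open (U i) & convex (U i)" if "i : ?I" for i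
  using assms(3)[of i] that by (simp add: small_def sing_index_def)
 \<comment> \<open>The members of the cover that meet the singular set already cover all
   hyperplanes, and genericity speaks about exactly their nerve.\<close>
 have acyclic: "B.H.thz (TT A.J ep Int MM A.J) {}"
 proof (rule thz_TT[OF A.finJ _ hol e(1) W(2,3,4) We, where I = ?I and U = U])
  show "fst h ~= 0" if "h : A.J" for h using that ph(1) by (auto simp: A.J_def)
  show "open (U i)" "convex (U i)" if "i : ?I" for i using small[OF that] by auto
  show "EX i:?I. x : U i" if x: "h : A.J" "ev h x = 0" for x h
  proof -
   obtain i where i: "i : I" "x : U i" using assms(4) by blast
   moreover have "x : singular_set A" using x by (auto simp: A.singular)
   ultimately show ?thesis by (intro bexI[of _ i]) (auto simp: sing_index_def)
  qed
  fix s assume s: "finite s" "s ~= {}" "s <= ?I" "(INT i:s. U i) ~= {}"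
  let ?V = "INT i:s. U i"
  have V: "small A ?V" "(PROD H:arr_at A ?V. \<Lambda> H) ~= 1" using s using assms(7)
   by (auto simp: nerve_def generic_def)
  obtain p where p: "p : ?V" "ALL h:A.J. ALL x:?V. ev h x = 0 --> ev h p = 0" "{h : A.J. ev h p = 0} = ph ` arr_at A ?V"
   using A.small_center[OF V(1)] by blast
  have sub: "arr_at A ?V <= A" by (auto simp: arr_at_def)
  have "(PROD h:{h:A.J. ev h p = 0}. mu h) = (PROD H:arr_at A ?V. mu (ph H))"
   unfolding p(3) using inj_on_subset[OF A.inj_ph sub] by (simp add: prod.reindex)
  also have "... = (PROD H:arr_at A ?V. \<Lambda> H)"
   using ph(2) sub by (intro prod.cong) (auto simp: mu_def)
  finally have lam: "(PROD h:{h:A.J. ev h p = 0}. mu h) ~= 1" using V(2) by simp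
  \<comment> \<open>An empty product would be 1.\<close>
  hence "EX h:A.J. ev h p = 0" by (metis (mono_tags, lifting) Collect_empty_eq prod.empty)
  moreover obtain r where "r > 0" "ALL x. x : MM A.J --> x : ball p r -->
   B.tr (%t. p + cis (2 * pi * t) *s (x - p)) = (PROD h:{h:A.J. ev h p = 0}. mu h)"
   using rot[of p] by blast
  ultimately show "EX p:?V. (ALL h:A.J. ALL x:?V. ev h x = 0 --> ev h p = 0) & (EX h:A.J. ev h p = 0) &
    (EX lam r. 0 < r & lam ~= 1 & (ALL x. x : MM A.J --> x : ball p r --> B.tr (%t. p + cis (2 * pi * t) *s (x - p)) = lam))"
   using p(1,2) lam by (intro bexI[OF _ p(1)] conjI exI[of _ "PROD h:{h:A.J. ev h p = 0}. mu h"] exI[of _ r])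
 qed
 have "B.H.thc (MM A.J) (MM A.J Int TT A.J ep) l b" by (rule pair(2)[OF e(1,2) hol])
 \<comment> \<open>The tube part is acyclic, so the pair computes the homology of the complement
   itself.\<close>
 hence hc: "B.H.hc (tch ?X) (tch {}) l b" using B.H.thz_bot[of ?X "MM A.J Int TT A.J ep" "{}" l b] acyclic
  by (simp add: A.complement Int_commute B.H.thc_def)
 have "carrier (local_cohomology cscale ?X L k) = {\<zero>\<^bsub>local_cohomology cscale ?X L k\<^esub>}" if "k ~= l" for k
 proof (rule B.cohomology(3)[OF _ refl])
  show "B.H.qd (B.H.rz (tch ?X) (tch {}) k) (B.H.rb (tch ?X) (tch {}) k) 0"
   using B.H.hcD[OF hc that] by (simp add: B.H.qd_0)
 qed
 thus ?thesis using B.cohomology(1,2)[OF B.H.hc_qd[OF hc]] beta by simp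
qed

end
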